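(* Let $A=B_+(V)$ with $V$ a finite-dimensional unitary right comodule of a coquasitriangular Hopf $*$-algebra of real type. (1) The unique left connection $\nabla_F:F\to\Omega^1\otimes_AF$ on $F=\Omega^{0,1}$ that vanishes on all $\bar\partial v$ for $v\in V$ is a torsion free bimodule connection with $$\sigma_F(\bar\partial v\otimes\mathrm{d}u)=(\mathrm{d}\otimes\bar\partial)\Psi(v\otimes u)\qquad(v,u\in V)$$ and is the Chern connection for any $\eta$ taking values in the complex numbers. (2) The same holds for the unique left connection $\nabla_E:E\to\Omega^1\otimes_AE$ on $E=\Omega^{1,0}$ that vanishes on all $\partial v$ for $v\in V$, now with $$\sigma_E(\partial v\otimes\mathrm{d}u)=(\mathrm{d}\otimes\partial)\Psi^{-1}(v\otimes u).$$ (3) If both (1) and (2) apply then $$\sigma_E\,\dagger\,\sigma_F=\dagger,\qquad \nabla_E=\sigma_E\,\dagger\,\nabla_F\,*$$ and $\nabla=\nabla_E\oplus\nabla_F$ on $\Omega^1=E\oplus F$ is a $*$-preserving bimodule connection.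
   Context: Braiding: right comodules over a coquasitriangular Hopf $*$-algebra $(H,\mathcal R)$ of real type ($\overline{\mathcal R(g,h)}=\mathcal R(h^*,g^* )$) are braided by $\Psi(v\otimes w)=w_0\otimes v_0\,\mathcal R(v_1,w_1)$. Unitary means $V$ has an antilinear involution $*$ with $( *\otimes * )\Delta_Vv=\Delta_V(v^* )$. $\dagger(x\otimes y)=y^*\otimes x^*$. $B=B_+(V)=TV/\oplus_n\ker[n,\Psi]!$, $[n,\Psi]!=\sum_{\sigma\in S_n}\Psi_\sigma$ (reduced expressions), a $*$-algebra and braided Hopf algebra with $V$ primitive; $\varpi:B\to V$ is projection to degree 1; $\Lambda(V)=TV/\langle\mathrm{Im}(\mathrm{id}+\Psi)\rangle$. $\Omega^{p,q}=\Lambda^p\underline\otimes B\underline\otimes\Lambda^q$ with braided super tensor product $(b\otimes c)(b'\otimes c')=(-1)^{|c||b'|}b\Psi(c\otimes b')c'$ ($B$ in degree 0), $\partial=(-1)^p((\wedge\otimes\mathrm{id})(\mathrm{id}\otimes\varpi\otimes\mathrm{id})(\mathrm{id}\otimes\Delta))\otimes\mathrm{id}$, $\bar\partial=(-1)^p\mathrm{id}\otimes((\mathrm{id}\otimes\wedge)(\mathrm{id}\otimes\varpi\otimes\mathrm{id})(\Delta\otimes\mathrm{id}))$, $\mathrm{d}=\partial+\bar\partial$, $(\omega\otimes b\otimes\zeta)^*=(-1)^{|\omega||\zeta|}\zeta^*\otimes b^*\otimes\omega^*$; this is a $*$-DGA. So $\Omega^{1,0}=V\otimes B$, $\Omega^{0,1}=B\otimes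 V$, $\partial v=v\otimes1$, $\bar\partial v=1\otimes v$, and the maps $\wedge:\Omega^{0,q}\otimes_A\Omega^{p,0}\to\Omega^{p,q}$, $\wedge:\Omega^{p,0}\otimes_A\Omega^{0,q}\to\Omega^{p,q}$ are isomorphisms. A left connection on a left module $M$ is $\nabla:M\to\Omega^1\otimes_AM$ with $\nabla(am)=\mathrm{d}a\otimes m+a\nabla m$; torsion on $M\subseteq\Omega^1$ is $\wedge\nabla-\mathrm{d}$. It is a bimodule connection if there is a bimodule map $\sigma_M:M\otimes_A\Omega^1\to\Omega^1\otimes_AM$ with $\nabla(ma)=\nabla(m)a+\sigma_M(m\otimes\mathrm{d}a)$. A bimodule connection on $\Omega^1$ is $*$-preserving if $\sigma\,\dagger\,\sigma=\dagger$ and $\nabla=\sigma\,\dagger\,\nabla\,*$. Chern connections: let $\eta:V\otimes V\to A$ be linear with $*\eta=\eta\dagger$, $v^i$ a basis of $V$. Hermitian metrics: $\phi_-(a\otimes v\otimes w\otimes b)=a\,\eta(v\otimes w)\,b$ on $\Omega^{0,1}\otimes\Omega^{1,0}$, $\phi_+=\phi_-\circ(\Theta^{1,1})^{-1}$ with $\Theta^{1,1}=(\Psi_{B,V}\otimes\Psi_{V,B})(\mathrm{id}\otimes\Psi_{V,V}\otimes\mathrm{id})$; $\langle\xi,\overline\zeta\rangle=\phi_-(\xi\otimes\zeta^* )$ on $F$ and $\phi_+(\xi\otimes\zeta^* )$ on $E$, assumed nondegenerate (matrices $\eta(v^i\otimes v^{j*})$, resp. $\eta(\Psi^{-1}(v^i\otimes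 v^{j*}))$, invertible). Hermitian metric compatibility is $\mathrm{d}\langle m,\overline n\rangle=m_1\langle m_2,\overline n\rangle+\langle m,\overline{n_2}\rangle(n_1)^*$ where $\nabla m=m_1\otimes m_2$. The Chern connection on $E$ is the unique hermitian metric compatible connection $\nabla_E=\bar\partial_E+\partial_E$ with $\bar\partial_E=\wedge^{-1}\bar\partial:\Omega^{1,0}\to\Omega^{0,1}\otimes_A\Omega^{1,0}$ and $\partial_E$ valued in $\Omega^{1,0}\otimes_AE$; on $F$ it is the unique hermitian metric compatible $\nabla_F=\partial_F+\bar\partial_F$ with $\partial_F=\wedge^{-1}\partial:\Omega^{0,1}\to\Omega^{1,0}\otimes_A\Omega^{0,1}$ and $\bar\partial_F$ valued in $\Omega^{0,1}\otimes_AF$. *)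

theory Defs
  imports Complex_Main "HOL-Library.Poly_Mapping" "HOL-Library.FuncSet"
    "HOL-Combinatorics.Permutations"
begin

section \<open>Complex vector spaces and algebras\<close>

class complex_vec = ab_group_add +
  fixes scaleC :: "complex \<Rightarrow> 'a \<Rightarrow> 'a" (infixr \<open>*\<^sub>C\<close> 75)
  assumes scaleC_add_right: "c *\<^sub>C (x + y) = c *\<^sub>C x + c *\<^sub>C y"
    and scaleC_add_left: "(c + d) *\<^sub>C x = c *\<^sub>C x + d *\<^sub>C x"
    and scaleC_scaleC: "c *\<^sub>C d *\<^sub>C x = (c * d) *\<^sub>C x"
    and scaleC_one: "1 *\<^sub>C x = x"

class complex_alg_1 = complex_vec + ring_1 +
  assumes mult_scaleC_left: "(c *\<^sub>C x) * y = c *\<^sub>C (x * y)"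
    and mult_scaleC_right: "x * (c *\<^sub>C y) = c *\<^sub>C (x * y)"

global_interpretation cvec: vector_space "scaleC :: complex \<Rightarrow> 'a \<Rightarrow> 'a::complex_vec"
  by unfold_locales (simp_all add: scaleC_add_right scaleC_add_left scaleC_scaleC scaleC_one)

abbreviation clinear :: "('a::complex_vec \<Rightarrow> 'b::complex_vec) \<Rightarrow> bool"
  where "clinear \<equiv> Vector_Spaces.linear scaleC scaleC"

definition antilinear :: "('a::complex_vec \<Rightarrow> 'b::complex_vec) \<Rightarrow> bool"
  where "antilinear f \<longleftrightarrow> (\<forall>x y. f (x + y) = f x + f y) \<and> (\<forall>c x. f (c *\<^sub>C x) = cnj c *\<^sub>C f x)"

definition antilinear_involution :: "('a::complex_vec \<Rightarrow> 'a) \<Rightarrow> bool"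
  where "antilinear_involution f \<longleftrightarrow> antilinear f \<and> (\<forall>x. f (f x) = x)"

instantiation complex :: complex_alg_1
begin
definition scaleC_complex :: "complex \<Rightarrow> complex \<Rightarrow> complex" where "scaleC_complex c z = c * z"
instance by standard (simp_all add: scaleC_complex_def algebra_simps)
end

instantiation poly_mapping :: (type, complex_vec) complex_vec
begin
definition scaleC_poly_mapping :: "complex \<Rightarrow> ('a \<Rightarrow>\<^sub>0 'b) \<Rightarrow> 'a \<Rightarrow>\<^sub>0 'b"
  where "scaleC_poly_mapping c = Poly_Mapping.map (scaleC c)"
instance
proof -
  have *: "Poly_Mapping.lookup (c *\<^sub>C p) k = c *\<^sub>C Poly_Mapping.lookup p k"
    for c and p :: "'a \<Rightarrow>\<^sub>0 'b" and k
    unfolding scaleC_poly_mapping_def by (transfer) (simp add: when_def)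
  show "OFCLASS('a \<Rightarrow>\<^sub>0 'b, complex_vec_class)"
    by standard (auto intro!: poly_mapping_eqI
      simp: * lookup_add scaleC_add_right scaleC_add_left scaleC_scaleC scaleC_one)
qed
end


section \<open>Tensor products over the complex numbers\<close>

definition tensor_relators :: "('a::complex_vec \<times> 'b::complex_vec \<Rightarrow>\<^sub>0 complex) set" where
  "tensor_relators =
     {Poly_Mapping.single (x + x', y) 1 - Poly_Mapping.single (x, y) 1 - Poly_Mapping.single (x', y) 1 | x x' y. True}
   \<union> {Poly_Mapping.single (x, y + y') 1 - Poly_Mapping.single (x, y) 1 - Poly_Mapping.single (x, y') 1 | x y y'. True}
   \<union> {Poly_Mapping.single (c *\<^sub>C x, y) 1 - Poly_Mapping.single (x, y) c | c x y. True}
   \<union> {Poly_Mapping.single (x, c *\<^sub>C y) 1 - Poly_Mapping.single (x, y) c | c x y. True}"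

definition tensor_rel ::
  "('a::complex_vec \<times> 'b::complex_vec \<Rightarrow>\<^sub>0 complex) \<Rightarrow> ('a \<times> 'b \<Rightarrow>\<^sub>0 complex) \<Rightarrow> bool"
  where "tensor_rel p q \<longleftrightarrow> p - q \<in> cvec.span tensor_relators"

lemma equivp_span: "equivp (\<lambda>p q. p - q \<in> cvec.span S)"
proof (rule equivpI)
  show "reflp (\<lambda>p q. p - q \<in> cvec.span S)"
    by (simp add: reflp_def cvec.span_zero)
  show "symp (\<lambda>p q. p - q \<in> cvec.span S)"
    unfolding symp_def by (metis cvec.span_neg minus_diff_eq)
  show "transp (\<lambda>p q. p - q \<in> cvec.span S)"
    unfolding transp_def by (metis cvec.span_add diff_add_cancel add_diff_eq)
qed

quotient_type (overloaded) ('a, 'b) tensor =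
  "('a::complex_vec \<times> 'b::complex_vec) \<Rightarrow>\<^sub>0 complex" / tensor_rel
  unfolding tensor_rel_def[abs_def] by (rule equivp_span)

instantiation tensor :: (complex_vec, complex_vec) complex_vec
begin

lift_definition zero_tensor :: "('a, 'b) tensor" is 0 .

lift_definition plus_tensor :: "('a, 'b) tensor \<Rightarrow> ('a, 'b) tensor \<Rightarrow> ('a, 'b) tensor" is "(+)"
  unfolding tensor_rel_def using cvec.span_add by (metis add_diff_add)

lift_definition minus_tensor :: "('a, 'b) tensor \<Rightarrow> ('a, 'b) tensor \<Rightarrow> ('a, 'b) tensor" is "(-)"
  unfolding tensor_rel_def
proof -
  fix p p' q q' :: "'a \<times> 'b \<Rightarrow>\<^sub>0 complex"
  assume "p - p' \<in> cvec.span tensor_relators" "q - q' \<in> cvec.span tensor_relators"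
  then have "(p - p') - (q - q') \<in> cvec.span tensor_relators" by (rule cvec.span_diff)
  then show "p - q - (p' - q') \<in> cvec.span tensor_relators" by (simp add: algebra_simps)
qed

lift_definition uminus_tensor :: "('a, 'b) tensor \<Rightarrow> ('a, 'b) tensor" is uminus
  unfolding tensor_rel_def by (metis cvec.span_neg minus_diff_eq minus_diff_minus)

lift_definition scaleC_tensor :: "complex \<Rightarrow> ('a, 'b) tensor \<Rightarrow> ('a, 'b) tensor" is scaleC
  unfolding tensor_rel_def by (metis cvec.span_scale cvec.scale_right_diff_distrib)

instance
proof
  fix x y z :: "('a, 'b) tensor" and c d :: complex
  show "x + y + z = x + (y + z)" by transfer (simp add: tensor_rel_def cvec.span_zero algebra_simps)
  show "x + y = y + x" by transfer (simp add: tensor_rel_def cvec.span_zero algebra_simps)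
  show "0 + x = x" by transfer (simp add: tensor_rel_def cvec.span_zero)
  show "- x + x = 0" by transfer (simp add: tensor_rel_def cvec.span_zero)
  show "x - y = x + - y" by transfer (simp add: tensor_rel_def cvec.span_zero)
  show "c *\<^sub>C (x + y) = c *\<^sub>C x + c *\<^sub>C y"
    by transfer (simp add: tensor_rel_def cvec.span_zero scaleC_add_right)
  show "(c + d) *\<^sub>C x = c *\<^sub>C x + d *\<^sub>C x"
    by transfer (simp add: tensor_rel_def cvec.span_zero scaleC_add_left)
  show "c *\<^sub>C d *\<^sub>C x = (c * d) *\<^sub>C x"
    by transfer (simp add: tensor_rel_def cvec.span_zero scaleC_scaleC)
  show "1 *\<^sub>C x = x" by transfer (simp add: tensor_rel_def cvec.span_zero scaleC_one)
qed

end

lift_definition tensor_pure :: "'a::complex_vec \<Rightarrow> 'b::complex_vec \<Rightarrow> ('a, 'b) tensor"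
    (infixr \<open>\<otimes>\<close> 76)
  is "\<lambda>x y. Poly_Mapping.single (x, y) 1" .

text \<open>
  The linear map induced by a bilinear map \<open>f\<close>, and the antilinear map induced by a map \<open>f\<close> that
  is antilinear in both arguments.  They are computed on a representative; the value is
  independent of it only for such \<open>f\<close>.
\<close>

definition tensor_lift :: "('a::complex_vec \<Rightarrow> 'b::complex_vec \<Rightarrow> 'c::complex_vec) \<Rightarrow> ('a, 'b) tensor \<Rightarrow> 'c"
  where "tensor_lift f t =
    (\<Sum>(x, y) \<in> Poly_Mapping.keys (rep_tensor t). Poly_Mapping.lookup (rep_tensor t) (x, y) *\<^sub>C f x y)"

definition tensor_lift_cnj :: "('a::complex_vec \<Rightarrow> 'b::complex_vec \<Rightarrow> 'c::complex_vec) \<Rightarrow> ('a, 'b) tensor \<Rightarrow> 'c"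
  where "tensor_lift_cnj f t =
    (\<Sum>(x, y) \<in> Poly_Mapping.keys (rep_tensor t). cnj (Poly_Mapping.lookup (rep_tensor t) (x, y)) *\<^sub>C f x y)"

definition tensor_map ::
  "('a::complex_vec \<Rightarrow> 'c::complex_vec) \<Rightarrow> ('b::complex_vec \<Rightarrow> 'd::complex_vec) \<Rightarrow> ('a, 'b) tensor \<Rightarrow> ('c, 'd) tensor"
  where "tensor_map f g = tensor_lift (\<lambda>x y. f x \<otimes> g y)"

definition tensor_map_cnj ::
  "('a::complex_vec \<Rightarrow> 'c::complex_vec) \<Rightarrow> ('b::complex_vec \<Rightarrow> 'd::complex_vec) \<Rightarrow> ('a, 'b) tensor \<Rightarrow> ('c, 'd) tensor"
  where "tensor_map_cnj f g = tensor_lift_cnj (\<lambda>x y. f x \<otimes> g y)"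

definition tensor_assoc ::
  "(('a::complex_vec, 'b::complex_vec) tensor, 'c::complex_vec) tensor \<Rightarrow> ('a, ('b, 'c) tensor) tensor"
  where "tensor_assoc = tensor_lift (\<lambda>t z. tensor_lift (\<lambda>x y. x \<otimes> y \<otimes> z) t)"

definition tensor_mult ::
  "('a::complex_alg_1, 'b::complex_alg_1) tensor \<Rightarrow> ('a, 'b) tensor \<Rightarrow> ('a, 'b) tensor"
  where "tensor_mult s t = tensor_lift (\<lambda>x y. tensor_lift (\<lambda>x' y'. (x * x') \<otimes> (y * y')) t) s"

definition dagger :: "('a::complex_vec \<Rightarrow> 'a) \<Rightarrow> ('a, 'a) tensor \<Rightarrow> ('a, 'a) tensor"
  where "dagger st = tensor_lift_cnj (\<lambda>x y. st y \<otimes> st x)"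


section \<open>The tensor algebra\<close>

text \<open>
  The tensor algebra of \<open>'v\<close> is the free algebra on the set \<open>'v\<close> (the monoid algebra of words over
  \<open>'v\<close> under concatenation) modulo multilinearity of words.
\<close>

instantiation list :: (type) monoid_add
begin
definition zero_list :: "'a list" where "zero_list = []"
definition plus_list :: "'a list \<Rightarrow> 'a list \<Rightarrow> 'a list" where "plus_list = (@)"
instance by standard (simp_all add: zero_list_def plus_list_def)
end

definition talg_relators :: "('v::complex_vec list \<Rightarrow>\<^sub>0 complex) set" where
  "talg_relators =
     {Poly_Mapping.single (xs @ (v + w) # ys) 1 - Poly_Mapping.single (xs @ v # ys) 1
        - Poly_Mapping.single (xs @ w # ys) 1 | xs v w ys. True}
   \<union> {Poly_Mapping.single (xs @ (c *\<^sub>C v) # ys) 1 - Poly_Mapping.single (xs @ v # ys) c | xs c v ys. True}"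

definition talg_rel :: "('v::complex_vec list \<Rightarrow>\<^sub>0 complex) \<Rightarrow> ('v list \<Rightarrow>\<^sub>0 complex) \<Rightarrow> bool"
  where "talg_rel p q \<longleftrightarrow> p - q \<in> cvec.span talg_relators"

lemma scaleC_single: "c *\<^sub>C Poly_Mapping.single k d = Poly_Mapping.single k (c * d :: complex)"
  unfolding scaleC_poly_mapping_def
  by transfer (auto simp: fun_eq_iff when_def scaleC_complex_def)

lemma lookup_scaleC: "Poly_Mapping.lookup (c *\<^sub>C p) k = c *\<^sub>C Poly_Mapping.lookup p k"
  for p :: "'a \<Rightarrow>\<^sub>0 'b::complex_vec"
  unfolding scaleC_poly_mapping_def by (transfer) (simp add: when_def)

lemma talg_relators_mult_single:
  fixes p :: "'v::complex_vec list \<Rightarrow>\<^sub>0 complex"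
  assumes "p \<in> talg_relators"
  shows "Poly_Mapping.single zs 1 * p \<in> talg_relators" "p * Poly_Mapping.single zs 1 \<in> talg_relators"
proof -
  from assms consider
      (add) xs v w ys where "p = Poly_Mapping.single (xs @ (v + w) # ys) 1
        - Poly_Mapping.single (xs @ v # ys) 1 - Poly_Mapping.single (xs @ w # ys) 1"
    | (scale) xs c v ys where
        "p = Poly_Mapping.single (xs @ (c *\<^sub>C v) # ys) 1 - Poly_Mapping.single (xs @ v # ys) c"
    unfolding talg_relators_def by blast
  then have "Poly_Mapping.single zs 1 * p \<in> talg_relators \<and> p * Poly_Mapping.single zs 1 \<in> talg_relators"
  proof cases
    case add
    have "Poly_Mapping.single zs 1 * p = Poly_Mapping.single ((zs @ xs) @ (v + w) # ys) 1
        - Poly_Mapping.single ((zs @ xs) @ v # ys) 1 - Poly_Mapping.single ((zs @ xs) @ w # ys) 1"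
      by (simp add: add right_diff_distrib mult_single plus_list_def)
    moreover have "p * Poly_Mapping.single zs 1 = Poly_Mapping.single (xs @ (v + w) # (ys @ zs)) 1
        - Poly_Mapping.single (xs @ v # (ys @ zs)) 1 - Poly_Mapping.single (xs @ w # (ys @ zs)) 1"
      by (simp add: add left_diff_distrib mult_single plus_list_def)
    ultimately show ?thesis unfolding talg_relators_def by blast
  next
    case scale
    have "Poly_Mapping.single zs 1 * p =
        Poly_Mapping.single ((zs @ xs) @ (c *\<^sub>C v) # ys) 1 - Poly_Mapping.single ((zs @ xs) @ v # ys) c"
      by (simp add: scale right_diff_distrib mult_single plus_list_def)
    moreover have "p * Poly_Mapping.single zs 1 =
        Poly_Mapping.single (xs @ (c *\<^sub>C v) # (ys @ zs)) 1 - Poly_Mapping.single (xs @ v # (ys @ zs)) c"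
      by (simp add: scale left_diff_distrib mult_single plus_list_def)
    ultimately show ?thesis unfolding talg_relators_def by blast
  qed
  then show "Poly_Mapping.single zs 1 * p \<in> talg_relators" "p * Poly_Mapping.single zs 1 \<in> talg_relators"
    by blast+
qed

lemma scaleC_poly_mult:
  fixes p q :: "'v list \<Rightarrow>\<^sub>0 complex"
  shows "(c *\<^sub>C p) * q = c *\<^sub>C (p * q)" "p * (c *\<^sub>C q) = c *\<^sub>C (p * q)"
proof -
  have *: "c *\<^sub>C p = Poly_Mapping.single 0 c * p" "c *\<^sub>C p = p * Poly_Mapping.single 0 c"
    for p :: "'v list \<Rightarrow>\<^sub>0 complex"
  proof -
    have "c *\<^sub>C p = Poly_Mapping.single 0 c * p \<and> c *\<^sub>C p = p * Poly_Mapping.single 0 c"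
    proof (induction p rule: update_induct)
      case const
      then show ?case by simp
    next
      case (update f a b)
      have "Poly_Mapping.update a b f = f + Poly_Mapping.single a b"
        using update(1) by (auto intro!: poly_mapping_eqI
          simp: lookup_add lookup_update lookup_single when_def in_keys_iff)
      then show ?case
        using update(3) by (auto simp: scaleC_add_right distrib_left distrib_right scaleC_single mult_single mult.commute)
    qed
    then show "c *\<^sub>C p = Poly_Mapping.single 0 c * p" "c *\<^sub>C p = p * Poly_Mapping.single 0 c"
      by blast+
  qed
  show "(c *\<^sub>C p) * q = c *\<^sub>C (p * q)" by (simp add: *(1) mult.assoc)
  show "p * (c *\<^sub>C q) = c *\<^sub>C (p * q)"
    using *(2)[of q] *(2)[of "p * q"] by (simp add: mult.assoc)
qed

lemma talg_ideal:
  fixes p q :: "'v::complex_vec list \<Rightarrow>\<^sub>0 complex"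
  assumes "p \<in> cvec.span talg_relators"
  shows "q * p \<in> cvec.span talg_relators" "p * q \<in> cvec.span talg_relators"
proof -
  have 1: "Poly_Mapping.single zs 1 * p \<in> cvec.span talg_relators \<and> p * Poly_Mapping.single zs 1 \<in> cvec.span talg_relators" for zs
    using assms
  proof (induction rule: cvec.span_induct_alt)
    case base
    then show ?case by (simp add: cvec.span_zero)
  next
    case (step c x y)
    then show ?case
      using talg_relators_mult_single[of x zs]
      by (simp add: distrib_left distrib_right scaleC_poly_mult cvec.span_add cvec.span_scale cvec.span_base)
  qed
  have "q * p \<in> cvec.span talg_relators \<and> p * q \<in> cvec.span talg_relators"
  proof (induction q rule: update_induct)
    case const
    then show ?case by (simp add: cvec.span_zero)
  next
    case (update f a b)
    have "Poly_Mapping.update a b f = f + b *\<^sub>C Poly_Mapping.single a 1"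
      using update(1) by (auto intro!: poly_mapping_eqI
        simp: lookup_add lookup_update lookup_single when_def in_keys_iff scaleC_single)
    then show ?case
      using update 1[of a] by (simp add: distrib_left distrib_right scaleC_poly_mult cvec.span_add cvec.span_scale)
  qed
  then show "q * p \<in> cvec.span talg_relators" "p * q \<in> cvec.span talg_relators" by blast+
qed

lemma lookup_Nil_talg_relators:
  "p \<in> cvec.span talg_relators \<Longrightarrow> Poly_Mapping.lookup p [] = 0"
proof (induction rule: cvec.span_induct_alt)
  case base
  then show ?case by simp
next
  case (step c x y)
  then show ?case
    by (auto simp: talg_relators_def lookup_add lookup_minus lookup_scaleC lookup_single
        scaleC_complex_def when_def)
qed

quotient_type (overloaded) 'v talg = "'v::complex_vec list \<Rightarrow>\<^sub>0 complex" / talg_rel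
  unfolding talg_rel_def[abs_def] by (rule equivp_span)

instantiation talg :: (complex_vec) complex_alg_1
begin

lift_definition zero_talg :: "'a talg" is 0 .
lift_definition one_talg :: "'a talg" is 1 .

lift_definition plus_talg :: "'a talg \<Rightarrow> 'a talg \<Rightarrow> 'a talg" is "(+)"
  unfolding talg_rel_def using cvec.span_add by (metis add_diff_add)

lift_definition minus_talg :: "'a talg \<Rightarrow> 'a talg \<Rightarrow> 'a talg" is "(-)"
  unfolding talg_rel_def
proof -
  fix p p' q q' :: "'a list \<Rightarrow>\<^sub>0 complex"
  assume "p - p' \<in> cvec.span talg_relators" "q - q' \<in> cvec.span talg_relators"
  then have "(p - p') - (q - q') \<in> cvec.span talg_relators" by (rule cvec.span_diff)
  then show "p - q - (p' - q') \<in> cvec.span talg_relators" by (simp add: algebra_simps)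
qed

lift_definition uminus_talg :: "'a talg \<Rightarrow> 'a talg" is uminus
  unfolding talg_rel_def by (metis cvec.span_neg minus_diff_eq minus_diff_minus)

lift_definition scaleC_talg :: "complex \<Rightarrow> 'a talg \<Rightarrow> 'a talg" is scaleC
  unfolding talg_rel_def by (metis cvec.span_scale cvec.scale_right_diff_distrib)

lift_definition times_talg :: "'a talg \<Rightarrow> 'a talg \<Rightarrow> 'a talg" is "(*)"
  unfolding talg_rel_def
proof -
  fix p p' q q' :: "'a list \<Rightarrow>\<^sub>0 complex"
  assume "p - p' \<in> cvec.span talg_relators" "q - q' \<in> cvec.span talg_relators"
  then have "(p - p') * q + p' * (q - q') \<in> cvec.span talg_relators"
    by (intro cvec.span_add talg_ideal)
  then show "p * q - p' * q' \<in> cvec.span talg_relators" by (simp add: algebra_simps)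
qed

instance
proof
  fix x y z :: "'a talg" and c d :: complex
  show "x + y + z = x + (y + z)" by transfer (simp add: talg_rel_def cvec.span_zero algebra_simps)
  show "x + y = y + x" by transfer (simp add: talg_rel_def cvec.span_zero algebra_simps)
  show "0 + x = x" by transfer (simp add: talg_rel_def cvec.span_zero)
  show "- x + x = 0" by transfer (simp add: talg_rel_def cvec.span_zero)
  show "x - y = x + - y" by transfer (simp add: talg_rel_def cvec.span_zero)
  show "c *\<^sub>C (x + y) = c *\<^sub>C x + c *\<^sub>C y"
    by transfer (simp add: talg_rel_def cvec.span_zero scaleC_add_right)
  show "(c + d) *\<^sub>C x = c *\<^sub>C x + d *\<^sub>C x"
    by transfer (simp add: talg_rel_def cvec.span_zero scaleC_add_left)
  show "c *\<^sub>C d *\<^sub>C x = (c * d) *\<^sub>C x"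
    by transfer (simp add: talg_rel_def cvec.span_zero scaleC_scaleC)
  show "1 *\<^sub>C x = x" by transfer (simp add: talg_rel_def cvec.span_zero scaleC_one)
  show "x * y * z = x * (y * z)" by transfer (simp add: talg_rel_def cvec.span_zero mult.assoc)
  show "(0 :: 'a talg) \<noteq> 1"
  proof
    assume "(0 :: 'a talg) = 1"
    then have "talg_rel (0 :: 'a list \<Rightarrow>\<^sub>0 complex) 1" by transfer
    then have "Poly_Mapping.lookup (0 - 1 :: 'a list \<Rightarrow>\<^sub>0 complex) [] = 0"
      unfolding talg_rel_def by (rule lookup_Nil_talg_relators)
    then show False
      by (simp add: lookup_minus lookup_one zero_list_def)
  qed
  show "1 * x = x" by transfer (simp add: talg_rel_def cvec.span_zero)
  show "x * 1 = x" by transfer (simp add: talg_rel_def cvec.span_zero)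
  show "(x + y) * z = x * z + y * z"
    by transfer (simp add: talg_rel_def cvec.span_zero distrib_right)
  show "x * (y + z) = x * y + x * z"
    by transfer (simp add: talg_rel_def cvec.span_zero distrib_left)
  show "(c *\<^sub>C x) * y = c *\<^sub>C (x * y)"
    by transfer (simp add: talg_rel_def cvec.span_zero scaleC_poly_mult)
  show "x * (c *\<^sub>C y) = c *\<^sub>C (x * y)"
    by transfer (simp add: talg_rel_def cvec.span_zero scaleC_poly_mult)
qed

end

lift_definition word :: "'v::complex_vec list \<Rightarrow> 'v talg" is "\<lambda>xs. Poly_Mapping.single xs 1" .

text \<open>
  The (anti)linear map on the tensor algebra given on words by a map \<open>f\<close> that is (anti)linear in
  each letter; as for tensors, the value is independent of the representative only for such \<open>f\<close>.
\<close>

definition talg_lift :: "('v::complex_vec list \<Rightarrow> 'a::complex_vec) \<Rightarrow> 'v talg \<Rightarrow> 'a" where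
  "talg_lift f t =
    (\<Sum>xs \<in> Poly_Mapping.keys (rep_talg t). Poly_Mapping.lookup (rep_talg t) xs *\<^sub>C f xs)"

definition talg_lift_cnj :: "('v::complex_vec list \<Rightarrow> 'a::complex_vec) \<Rightarrow> 'v talg \<Rightarrow> 'a" where
  "talg_lift_cnj f t =
    (\<Sum>xs \<in> Poly_Mapping.keys (rep_talg t). cnj (Poly_Mapping.lookup (rep_talg t) xs) *\<^sub>C f xs)"

definition talg_deg :: "nat \<Rightarrow> 'v::complex_vec talg set"
  where "talg_deg n = cvec.span (word ` {xs. length xs = n})"

definition quad :: "('v::complex_vec, 'v) tensor \<Rightarrow> 'v talg"
  where "quad = tensor_lift (\<lambda>v w. word [v, w])"


section \<open>Coquasitriangular Hopf star-algebras and unitary comodules\<close>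

text \<open>
  \<open>proj_B\<close> and \<open>proj_\<Lambda>\<close> present the algebras \<open>B\<^sub>+(V)\<close> and \<open>\<Lambda>(V)\<close> as quotients of the tensor
  algebra of \<open>V\<close>; see \<open>quotient_by\<close>, \<open>nichols_ideal\<close> and \<open>exterior_ideal\<close> below.
\<close>

record (overloaded) ('h, 'v, 'b, 'l) braided_data =
  comult :: "'h::complex_alg_1 \<Rightarrow> ('h, 'h) tensor"
  counit :: "'h \<Rightarrow> complex"
  antipode :: "'h \<Rightarrow> 'h"
  hstar :: "'h \<Rightarrow> 'h"
  Rform :: "'h \<Rightarrow> 'h \<Rightarrow> complex"
  coact :: "'v::complex_vec \<Rightarrow> ('v, 'h) tensor"
  vstar :: "'v \<Rightarrow> 'v"
  proj_B :: "'v talg \<Rightarrow> 'b::complex_alg_1"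
  proj_\<Lambda> :: "'v talg \<Rightarrow> 'l::complex_alg_1"

definition bilinear_form :: "('a::complex_vec \<Rightarrow> 'a \<Rightarrow> complex) \<Rightarrow> bool"
  where "bilinear_form f \<longleftrightarrow> (\<forall>x. clinear (f x)) \<and> (\<forall>y. clinear (\<lambda>x. f x y))"

definition hopf_star_algebra ::
  "('h::complex_alg_1, 'v::complex_vec, 'b::complex_alg_1, 'l::complex_alg_1) braided_data \<Rightarrow> bool" where
  "hopf_star_algebra D \<longleftrightarrow>
     clinear (comult D) \<and> clinear (counit D) \<and> clinear (antipode D) \<and>
     comult D 1 = 1 \<otimes> 1 \<and> (\<forall>g h. comult D (g * h) = tensor_mult (comult D g) (comult D h)) \<and>
     counit D 1 = 1 \<and> (\<forall>g h. counit D (g * h) = counit D g * counit D h) \<and>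
     (\<forall>h. tensor_assoc (tensor_map (comult D) id (comult D h)) = tensor_map id (comult D) (comult D h)) \<and>
     (\<forall>h. tensor_lift (\<lambda>x y. counit D x *\<^sub>C y) (comult D h) = h) \<and>
     (\<forall>h. tensor_lift (\<lambda>x y. counit D y *\<^sub>C x) (comult D h) = h) \<and>
     (\<forall>h. tensor_lift (\<lambda>x y. antipode D x * y) (comult D h) = counit D h *\<^sub>C 1) \<and>
     (\<forall>h. tensor_lift (\<lambda>x y. x * antipode D y) (comult D h) = counit D h *\<^sub>C 1) \<and>
     antilinear_involution (hstar D) \<and>
     (\<forall>g h. hstar D (g * h) = hstar D h * hstar D g) \<and>
     (\<forall>h. comult D (hstar D h) = tensor_map_cnj (hstar D) (hstar D) (comult D h)) \<and>
     (\<forall>h. counit D (hstar D h) = cnj (counit D h)) \<and>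
     (\<forall>h. antipode D (hstar D (antipode D (hstar D h))) = h)"

definition coquasitriangular ::
  "('h::complex_alg_1, 'v::complex_vec, 'b::complex_alg_1, 'l::complex_alg_1) braided_data \<Rightarrow> bool" where
  "coquasitriangular D \<longleftrightarrow>
     bilinear_form (Rform D) \<and>
     (\<exists>Rinv. bilinear_form Rinv \<and> (\<forall>g h.
        tensor_lift (\<lambda>g1 g2. tensor_lift (\<lambda>h1 h2. Rform D g1 h1 * Rinv g2 h2) (comult D h)) (comult D g)
          = counit D g * counit D h \<and>
        tensor_lift (\<lambda>g1 g2. tensor_lift (\<lambda>h1 h2. Rinv g1 h1 * Rform D g2 h2) (comult D h)) (comult D g)
          = counit D g * counit D h)) \<and>
     (\<forall>f g h. Rform D (f * g) h = tensor_lift (\<lambda>h1 h2. Rform D f h1 * Rform D g h2) (comult D h)) \<and>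
     (\<forall>f g h. Rform D f (g * h) = tensor_lift (\<lambda>f1 f2. Rform D f1 h * Rform D f2 g) (comult D f)) \<and>
     (\<forall>g h.
        tensor_lift (\<lambda>g1 g2. tensor_lift (\<lambda>h1 h2. Rform D g2 h2 *\<^sub>C (h1 * g1)) (comult D h)) (comult D g) =
        tensor_lift (\<lambda>g1 g2. tensor_lift (\<lambda>h1 h2. Rform D g1 h1 *\<^sub>C (g2 * h2)) (comult D h)) (comult D g))"

definition real_type ::
  "('h::complex_alg_1, 'v::complex_vec, 'b::complex_alg_1, 'l::complex_alg_1) braided_data \<Rightarrow> bool"
  where "real_type D \<longleftrightarrow> (\<forall>g h. cnj (Rform D g h) = Rform D (hstar D h) (hstar D g))"

definition unitary_comodule ::
  "('h::complex_alg_1, 'v::complex_vec, 'b::complex_alg_1, 'l::complex_alg_1) braided_data \<Rightarrow> bool" where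
  "unitary_comodule D \<longleftrightarrow>
     clinear (coact D) \<and>
     (\<forall>v. tensor_assoc (tensor_map (coact D) id (coact D v)) = tensor_map id (comult D) (coact D v)) \<and>
     (\<forall>v. tensor_lift (\<lambda>w h. counit D h *\<^sub>C w) (coact D v) = v) \<and>
     antilinear_involution (vstar D) \<and>
     (\<forall>v. tensor_map_cnj (vstar D) (hstar D) (coact D v) = coact D (vstar D v))"

definition finite_dim :: "'v::complex_vec itself \<Rightarrow> bool"
  where "finite_dim _ \<longleftrightarrow> (\<exists>S :: 'v set. finite S \<and> cvec.span S = UNIV)"

text \<open>The braiding of two comodules with coactions \<open>\<rho>\<^sub>X\<close> and \<open>\<rho>\<^sub>Y\<close>.\<close>

definition braid ::
  "('h::complex_alg_1, 'v::complex_vec, 'b::complex_alg_1, 'l::complex_alg_1) braided_data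
    \<Rightarrow> ('x::complex_vec \<Rightarrow> ('x, 'h) tensor) \<Rightarrow> ('y::complex_vec \<Rightarrow> ('y, 'h) tensor)
    \<Rightarrow> ('x, 'y) tensor \<Rightarrow> ('y, 'x) tensor" where
  "braid D \<rho>X \<rho>Y = tensor_lift (\<lambda>x y.
     tensor_lift (\<lambda>x0 x1. tensor_lift (\<lambda>y0 y1. Rform D x1 y1 *\<^sub>C (y0 \<otimes> x0)) (\<rho>Y y)) (\<rho>X x))"

definition Psi ::
  "('h::complex_alg_1, 'v::complex_vec, 'b::complex_alg_1, 'l::complex_alg_1) braided_data
    \<Rightarrow> ('v, 'v) tensor \<Rightarrow> ('v, 'v) tensor"
  where "Psi D = braid D (coact D) (coact D)"


section \<open>The algebras \<open>B\<^sub>+(V)\<close> and \<open>\<Lambda>(V)\<close>\<close>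

text \<open>\<open>Psi_at D i\<close> applies the braiding to the letters \<open>i\<close> and \<open>i + 1\<close> (counted from 0) of a word.\<close>

definition Psi_at ::
  "('h::complex_alg_1, 'v::complex_vec, 'b::complex_alg_1, 'l::complex_alg_1) braided_data
    \<Rightarrow> nat \<Rightarrow> 'v talg \<Rightarrow> 'v talg" where
  "Psi_at D i = talg_lift (\<lambda>xs.
     if Suc i < length xs
     then word (take i xs) * quad (Psi D (xs ! i \<otimes> xs ! Suc i)) * word (drop (i + 2) xs)
     else word xs)"

definition expression_of :: "nat \<Rightarrow> (nat \<Rightarrow> nat) \<Rightarrow> nat list \<Rightarrow> bool" where
  "expression_of n \<sigma> is \<longleftrightarrow>
     (\<forall>i \<in> set is. Suc i < n) \<and> foldr (\<lambda>i f. Transposition.transpose i (Suc i) \<circ> f) is id = \<sigma>"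

definition reduced_expression_of :: "nat \<Rightarrow> (nat \<Rightarrow> nat) \<Rightarrow> nat list \<Rightarrow> bool" where
  "reduced_expression_of n \<sigma> is \<longleftrightarrow>
     expression_of n \<sigma> is \<and> (\<forall>js. expression_of n \<sigma> js \<longrightarrow> length is \<le> length js)"

text \<open>By the braid relations the following does not depend on the choice of reduced expression.\<close>

definition Psi_perm ::
  "('h::complex_alg_1, 'v::complex_vec, 'b::complex_alg_1, 'l::complex_alg_1) braided_data
    \<Rightarrow> nat \<Rightarrow> (nat \<Rightarrow> nat) \<Rightarrow> 'v talg \<Rightarrow> 'v talg" where
  "Psi_perm D n \<sigma> = foldr (\<lambda>i f. Psi_at D i \<circ> f) (SOME is. reduced_expression_of n \<sigma> is) id"

definition braided_factorial ::
  "('h::complex_alg_1, 'v::complex_vec, 'b::complex_alg_1, 'l::complex_alg_1) braided_data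
    \<Rightarrow> nat \<Rightarrow> 'v talg \<Rightarrow> 'v talg"
  where "braided_factorial D n t = (\<Sum>\<sigma> | \<sigma> permutes {..<n}. Psi_perm D n \<sigma> t)"

definition nichols_ideal ::
  "('h::complex_alg_1, 'v::complex_vec, 'b::complex_alg_1, 'l::complex_alg_1) braided_data \<Rightarrow> 'v talg set"
  where "nichols_ideal D = cvec.span (\<Union>n. {t \<in> talg_deg n. braided_factorial D n t = 0})"

definition exterior_ideal ::
  "('h::complex_alg_1, 'v::complex_vec, 'b::complex_alg_1, 'l::complex_alg_1) braided_data \<Rightarrow> 'v talg set"
  where "exterior_ideal D = cvec.span {x * quad (t + Psi D t) * y | x t y. True}"

text \<open>The type \<open>'a\<close> is, via \<open>p\<close>, the quotient algebra of the tensor algebra by \<open>K\<close>.\<close>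

definition quotient_by :: "('v::complex_vec talg \<Rightarrow> 'a::complex_alg_1) \<Rightarrow> 'v talg set \<Rightarrow> bool" where
  "quotient_by p K \<longleftrightarrow>
     clinear p \<and> p 1 = 1 \<and> (\<forall>x y. p (x * y) = p x * p y) \<and> surj p \<and> {t. p t = 0} = K"

text \<open>
  The map induced on such a quotient by a map \<open>f\<close> defined on the tensor algebra.  It does not
  depend on the preimage selected by \<open>inv p\<close> if \<open>f\<close> is constant on the fibres of \<open>p\<close>, which is
  the case for all uses below.
\<close>

definition induced :: "('v::complex_vec talg \<Rightarrow> 'a::complex_alg_1) \<Rightarrow> ('v talg \<Rightarrow> 'c) \<Rightarrow> 'a \<Rightarrow> 'c"
  where "induced p f a = f (inv p a)"

text \<open>The (tensor product) coaction on words, followed by the projection \<open>p\<close>.\<close>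

definition coact_quot ::
  "('h::complex_alg_1, 'v::complex_vec, 'b::complex_alg_1, 'l::complex_alg_1) braided_data
    \<Rightarrow> ('v talg \<Rightarrow> 'a::complex_alg_1) \<Rightarrow> 'a \<Rightarrow> ('a, 'h) tensor" where
  "coact_quot D p = induced p (talg_lift (\<lambda>xs.
     foldr (\<lambda>v s. tensor_mult (tensor_map (\<lambda>w. p (word [w])) id (coact D v)) s) xs (1 \<otimes> 1)))"

definition deg1 :: "('v::complex_vec talg \<Rightarrow> 'a::complex_alg_1) \<Rightarrow> 'a \<Rightarrow> 'v"
  where "deg1 p = induced p (talg_lift (\<lambda>xs. if length xs = 1 then hd xs else 0))"

definition deg0 :: "('v::complex_vec talg \<Rightarrow> 'a::complex_alg_1) \<Rightarrow> 'a \<Rightarrow> complex"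
  where "deg0 p = induced p (talg_lift (\<lambda>xs. if xs = [] then 1 else 0))"

definition star_B ::
  "('h::complex_alg_1, 'v::complex_vec, 'b::complex_alg_1, 'l::complex_alg_1) braided_data \<Rightarrow> 'b \<Rightarrow> 'b" where
  "star_B D = induced (proj_B D) (talg_lift_cnj (\<lambda>xs. proj_B D (word (rev (map (vstar D) xs)))))"

text \<open>
  As usual for graded star-algebras, \<open>(\<omega> \<and> \<zeta>)\<^sup>* = (-1)\<^sup>|\<^sup>\<omega>\<^sup>|\<^sup>|\<^sup>\<zeta>\<^sup>| \<zeta>\<^sup>* \<and> \<omega>\<^sup>*\<close> on \<open>\<Lambda>(V)\<close>; reversing \<open>n\<close> factors
  of degree 1 gives the sign below.
\<close>

definition star_\<Lambda> ::
  "('h::complex_alg_1, 'v::complex_vec, 'b::complex_alg_1, 'l::complex_alg_1) braided_data \<Rightarrow> 'l \<Rightarrow> 'l" where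
  "star_\<Lambda> D = induced (proj_\<Lambda> D) (talg_lift_cnj (\<lambda>xs.
     (-1) ^ (length xs choose 2) *\<^sub>C proj_\<Lambda> D (word (rev (map (vstar D) xs)))))"

definition parity_\<Lambda> ::
  "('h::complex_alg_1, 'v::complex_vec, 'b::complex_alg_1, 'l::complex_alg_1) braided_data \<Rightarrow> 'l \<Rightarrow> 'l" where
  "parity_\<Lambda> D = induced (proj_\<Lambda> D) (talg_lift (\<lambda>xs. (-1) ^ length xs *\<^sub>C proj_\<Lambda> D (word xs)))"


section \<open>Braided super tensor products\<close>

text \<open>
  Comodule superalgebras, the grading being recorded by the parity operator \<open>x \<mapsto> (-1)\<^sup>|\<^sup>x\<^sup>| x\<close>.
\<close>

record (overloaded) ('x, 'h) superalg =
  mult :: "'x::complex_vec \<Rightarrow> 'x \<Rightarrow> 'x"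
  unit :: 'x
  coaction :: "'x \<Rightarrow> ('x, 'h::complex_vec) tensor"
  parity :: "'x \<Rightarrow> 'x"

definition even_part :: "('x::complex_vec \<Rightarrow> 'x) \<Rightarrow> 'x \<Rightarrow> 'x"
  where "even_part \<gamma> x = (1 / 2) *\<^sub>C (x + \<gamma> x)"

definition odd_part :: "('x::complex_vec \<Rightarrow> 'x) \<Rightarrow> 'x \<Rightarrow> 'x"
  where "odd_part \<gamma> x = (1 / 2) *\<^sub>C (x - \<gamma> x)"

text \<open>
  The product \<open>(b \<otimes> c)(b' \<otimes> c') = (-1)\<^sup>|\<^sup>c\<^sup>|\<^sup>|\<^sup>b\<^sup>'\<^sup>| b \<Psi>(c \<otimes> b') c'\<close>; the sign is implemented by splitting
  \<open>b'\<close> into its even and odd parts.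
\<close>

definition braided_tensor ::
  "('h::complex_alg_1, 'v::complex_vec, 'b::complex_alg_1, 'l::complex_alg_1) braided_data
    \<Rightarrow> ('x::complex_vec, 'h) superalg \<Rightarrow> ('y::complex_vec, 'h) superalg
    \<Rightarrow> (('x, 'y) tensor, 'h) superalg" where
  "braided_tensor D X Y = \<lparr>
     mult = (\<lambda>s t. tensor_lift (\<lambda>b c. tensor_lift (\<lambda>b' c'.
       tensor_lift (\<lambda>b'' c''. mult X b b'' \<otimes> mult Y c'' c')
         (braid D (coaction Y) (coaction X)
            (c \<otimes> even_part (parity X) b' + parity Y c \<otimes> odd_part (parity X) b'))) t) s),
     unit = unit X \<otimes> unit Y,
     coaction = tensor_lift (\<lambda>x y. tensor_lift (\<lambda>x0 x1. tensor_lift (\<lambda>y0 y1.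
       (x0 \<otimes> y0) \<otimes> (x1 * y1)) (coaction Y y)) (coaction X x)),
     parity = tensor_map (parity X) (parity Y) \<rparr>"

definition B_alg ::
  "('h::complex_alg_1, 'v::complex_vec, 'b::complex_alg_1, 'l::complex_alg_1) braided_data
    \<Rightarrow> ('b, 'h) superalg"
  where "B_alg D = \<lparr>mult = (*), unit = 1, coaction = coact_quot D (proj_B D), parity = id\<rparr>"

definition \<Lambda>_alg ::
  "('h::complex_alg_1, 'v::complex_vec, 'b::complex_alg_1, 'l::complex_alg_1) braided_data
    \<Rightarrow> ('l, 'h) superalg"
  where "\<Lambda>_alg D = \<lparr>mult = (*), unit = 1, coaction = coact_quot D (proj_\<Lambda> D), parity = parity_\<Lambda> D\<rparr>"

definition gen_B ::
  "('h::complex_alg_1, 'v::complex_vec, 'b::complex_alg_1, 'l::complex_alg_1) braided_data \<Rightarrow> 'v \<Rightarrow> 'b"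
  where "gen_B D v = proj_B D (word [v])"

definition gen_\<Lambda> ::
  "('h::complex_alg_1, 'v::complex_vec, 'b::complex_alg_1, 'l::complex_alg_1) braided_data \<Rightarrow> 'v \<Rightarrow> 'l"
  where "gen_\<Lambda> D v = proj_\<Lambda> D (word [v])"

text \<open>
  The braided coproduct: multiplicative for the braided tensor product, with \<open>V\<close> primitive.
\<close>

definition coprod_B ::
  "('h::complex_alg_1, 'v::complex_vec, 'b::complex_alg_1, 'l::complex_alg_1) braided_data
    \<Rightarrow> 'b \<Rightarrow> ('b, 'b) tensor" where
  "coprod_B D = induced (proj_B D) (talg_lift (\<lambda>xs.
     foldr (\<lambda>v s. mult (braided_tensor D (B_alg D) (B_alg D)) (gen_B D v \<otimes> 1 + 1 \<otimes> gen_B D v) s)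
       xs (1 \<otimes> 1)))"


section \<open>The double complex\<close>

type_synonym ('b, 'l) forms = "('l, ('b, 'l) tensor) tensor"
type_synonym ('b, 'l) forms_A = "(('b, 'l) forms, ('b, 'l) forms) tensor set"

definition wedge ::
  "('h::complex_alg_1, 'v::complex_vec, 'b::complex_alg_1, 'l::complex_alg_1) braided_data
    \<Rightarrow> ('b, 'l) forms \<Rightarrow> ('b, 'l) forms \<Rightarrow> ('b, 'l) forms"
  where "wedge D = mult (braided_tensor D (\<Lambda>_alg D) (braided_tensor D (B_alg D) (\<Lambda>_alg D)))"

definition form0 :: "'b::complex_alg_1 \<Rightarrow> ('b, 'l::complex_alg_1) forms"
  where "form0 b = 1 \<otimes> b \<otimes> 1"

definition lmult ::
  "('h::complex_alg_1, 'v::complex_vec, 'b::complex_alg_1, 'l::complex_alg_1) braided_data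
    \<Rightarrow> 'b \<Rightarrow> ('b, 'l) forms \<Rightarrow> ('b, 'l) forms"
  where "lmult D a x = wedge D (form0 a) x"

definition rmult ::
  "('h::complex_alg_1, 'v::complex_vec, 'b::complex_alg_1, 'l::complex_alg_1) braided_data
    \<Rightarrow> ('b, 'l) forms \<Rightarrow> 'b \<Rightarrow> ('b, 'l) forms"
  where "rmult D x a = wedge D x (form0 a)"

definition Omega ::
  "('h::complex_alg_1, 'v::complex_vec, 'b::complex_alg_1, 'l::complex_alg_1) braided_data
    \<Rightarrow> nat \<Rightarrow> nat \<Rightarrow> ('b, 'l) forms set" where
  "Omega D p q = cvec.span {\<omega> \<otimes> b \<otimes> \<zeta> | \<omega> b \<zeta>. \<omega> \<in> proj_\<Lambda> D ` talg_deg p \<and> \<zeta> \<in> proj_\<Lambda> D ` talg_deg q}"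

definition Omega1 ::
  "('h::complex_alg_1, 'v::complex_vec, 'b::complex_alg_1, 'l::complex_alg_1) braided_data
    \<Rightarrow> ('b, 'l) forms set"
  where "Omega1 D = {e + f | e f. e \<in> Omega D 1 0 \<and> f \<in> Omega D 0 1}"

definition del ::
  "('h::complex_alg_1, 'v::complex_vec, 'b::complex_alg_1, 'l::complex_alg_1) braided_data
    \<Rightarrow> ('b, 'l) forms \<Rightarrow> ('b, 'l) forms" where
  "del D = tensor_lift (\<lambda>\<omega>. tensor_lift (\<lambda>b \<zeta>.
     tensor_lift (\<lambda>b1 b2. (parity_\<Lambda> D \<omega> * gen_\<Lambda> D (deg1 (proj_B D) b1)) \<otimes> b2 \<otimes> \<zeta>) (coprod_B D b)))"

definition delbar ::
  "('h::complex_alg_1, 'v::complex_vec, 'b::complex_alg_1, 'l::complex_alg_1) braided_data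
    \<Rightarrow> ('b, 'l) forms \<Rightarrow> ('b, 'l) forms" where
  "delbar D = tensor_lift (\<lambda>\<omega>. tensor_lift (\<lambda>b \<zeta>.
     tensor_lift (\<lambda>b1 b2. parity_\<Lambda> D \<omega> \<otimes> b1 \<otimes> (gen_\<Lambda> D (deg1 (proj_B D) b2) * \<zeta>)) (coprod_B D b)))"

definition ext_d ::
  "('h::complex_alg_1, 'v::complex_vec, 'b::complex_alg_1, 'l::complex_alg_1) braided_data
    \<Rightarrow> ('b, 'l) forms \<Rightarrow> ('b, 'l) forms"
  where "ext_d D x = del D x + delbar D x"

text \<open>\<open>(\<omega> \<otimes> b \<otimes> \<zeta>)\<^sup>* = (-1)\<^sup>|\<^sup>\<omega>\<^sup>|\<^sup>|\<^sup>\<zeta>\<^sup>| \<zeta>\<^sup>* \<otimes> b\<^sup>* \<otimes> \<omega>\<^sup>*\<close>\<close>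

definition form_star ::
  "('h::complex_alg_1, 'v::complex_vec, 'b::complex_alg_1, 'l::complex_alg_1) braided_data
    \<Rightarrow> ('b, 'l) forms \<Rightarrow> ('b, 'l) forms" where
  "form_star D = tensor_lift_cnj (\<lambda>\<omega>. tensor_lift_cnj (\<lambda>b \<zeta>.
     star_\<Lambda> D \<zeta> \<otimes> star_B D b \<otimes> star_\<Lambda> D (even_part (parity_\<Lambda> D) \<omega>) +
     star_\<Lambda> D (parity_\<Lambda> D \<zeta>) \<otimes> star_B D b \<otimes> star_\<Lambda> D (odd_part (parity_\<Lambda> D) \<omega>)))"

definition d_gen ::
  "('h::complex_alg_1, 'v::complex_vec, 'b::complex_alg_1, 'l::complex_alg_1) braided_data
    \<Rightarrow> 'v \<Rightarrow> ('b, 'l) forms"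
  where "d_gen D v = ext_d D (form0 (gen_B D v))"

definition del_gen ::
  "('h::complex_alg_1, 'v::complex_vec, 'b::complex_alg_1, 'l::complex_alg_1) braided_data
    \<Rightarrow> 'v \<Rightarrow> ('b, 'l) forms"
  where "del_gen D v = del D (form0 (gen_B D v))"

definition delbar_gen ::
  "('h::complex_alg_1, 'v::complex_vec, 'b::complex_alg_1, 'l::complex_alg_1) braided_data
    \<Rightarrow> 'v \<Rightarrow> ('b, 'l) forms"
  where "delbar_gen D v = delbar D (form0 (gen_B D v))"


section \<open>Tensor products over \<open>A\<close>\<close>

text \<open>
  With \<open>A = B\<^sub>+(V)\<close>, elements of \<open>\<Omega> \<otimes>\<^sub>A \<Omega>\<close> are cosets in \<open>\<Omega> \<otimes> \<Omega>\<close>; \<open>over_A D t\<close> is the coset of \<open>t\<close>.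
  All modules tensored below are sums of the \<open>\<Omega>\<^sup>p\<^sup>,\<^sup>q\<close>, which are direct summands of \<open>\<Omega>\<close> as
  bimodules, so that \<open>M \<otimes>\<^sub>A N\<close> is the subspace of \<open>\<Omega> \<otimes>\<^sub>A \<Omega>\<close> spanned by the \<open>x \<otimes> y\<close> with \<open>x\<close> in \<open>M\<close>
  and \<open>y\<close> in \<open>N\<close>.
\<close>

definition balancing ::
  "('h::complex_alg_1, 'v::complex_vec, 'b::complex_alg_1, 'l::complex_alg_1) braided_data
    \<Rightarrow> (('b, 'l) forms, ('b, 'l) forms) tensor set"
  where "balancing D = cvec.span {rmult D x a \<otimes> y - x \<otimes> lmult D a y | x a y. True}"

definition over_A ::
  "('h::complex_alg_1, 'v::complex_vec, 'b::complex_alg_1, 'l::complex_alg_1) braided_data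
    \<Rightarrow> (('b, 'l) forms, ('b, 'l) forms) tensor \<Rightarrow> ('b, 'l) forms_A"
  where "over_A D t = {s. s - t \<in> balancing D}"

definition tensor_A ::
  "('h::complex_alg_1, 'v::complex_vec, 'b::complex_alg_1, 'l::complex_alg_1) braided_data
    \<Rightarrow> ('b, 'l) forms set \<Rightarrow> ('b, 'l) forms set
    \<Rightarrow> ('b, 'l) forms_A set"
  where "tensor_A D M N = over_A D ` cvec.span {x \<otimes> y | x y. x \<in> M \<and> y \<in> N}"

definition add_A ::
  "('h::complex_alg_1, 'v::complex_vec, 'b::complex_alg_1, 'l::complex_alg_1) braided_data
    \<Rightarrow> ('b, 'l) forms_A \<Rightarrow> ('b, 'l) forms_A
    \<Rightarrow> ('b, 'l) forms_A"
  where "add_A D X Y = (\<Union>s\<in>X. \<Union>t\<in>Y. over_A D (s + t))"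

text \<open>The endomap of \<open>\<Omega> \<otimes>\<^sub>A \<Omega>\<close> induced by an additive endomap of \<open>\<Omega> \<otimes> \<Omega>\<close> preserving \<open>balancing D\<close>.\<close>

definition map_A ::
  "('h::complex_alg_1, 'v::complex_vec, 'b::complex_alg_1, 'l::complex_alg_1) braided_data
    \<Rightarrow> ((('b, 'l) forms, ('b, 'l) forms) tensor \<Rightarrow> (('b, 'l) forms, ('b, 'l) forms) tensor)
    \<Rightarrow> ('b, 'l) forms_A \<Rightarrow> ('b, 'l) forms_A"
  where "map_A D f X = (\<Union>t\<in>X. over_A D (f t))"

definition lmult_A ::
  "('h::complex_alg_1, 'v::complex_vec, 'b::complex_alg_1, 'l::complex_alg_1) braided_data
    \<Rightarrow> 'b \<Rightarrow> ('b, 'l) forms_A \<Rightarrow> ('b, 'l) forms_A"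
  where "lmult_A D a = map_A D (tensor_map (lmult D a) id)"

definition rmult_A ::
  "('h::complex_alg_1, 'v::complex_vec, 'b::complex_alg_1, 'l::complex_alg_1) braided_data
    \<Rightarrow> ('b, 'l) forms_A \<Rightarrow> 'b \<Rightarrow> ('b, 'l) forms_A"
  where "rmult_A D X a = map_A D (tensor_map id (\<lambda>y. rmult D y a)) X"

definition dagger_A ::
  "('h::complex_alg_1, 'v::complex_vec, 'b::complex_alg_1, 'l::complex_alg_1) braided_data
    \<Rightarrow> ('b, 'l) forms_A \<Rightarrow> ('b, 'l) forms_A"
  where "dagger_A D = map_A D (dagger (form_star D))"

text \<open>
  The map on \<open>\<Omega> \<otimes>\<^sub>A \<Omega>\<close> induced by a map \<open>f\<close> on \<open>\<Omega> \<otimes> \<Omega>\<close> constant on cosets is \<open>X \<mapsto> the_elem (f ` X)\<close>.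
\<close>

definition wedge_A ::
  "('h::complex_alg_1, 'v::complex_vec, 'b::complex_alg_1, 'l::complex_alg_1) braided_data
    \<Rightarrow> ('b, 'l) forms_A \<Rightarrow> ('b, 'l) forms"
  where "wedge_A D X = the_elem (tensor_lift (wedge D) ` X)"


section \<open>Connections\<close>

text \<open>
  Connections are extensional functions, so that they are determined by their values on \<open>M\<close>.
  Homogeneity under scalars is the Leibniz rule for \<open>a = c 1\<close>.
\<close>

definition left_connection ::
  "('h::complex_alg_1, 'v::complex_vec, 'b::complex_alg_1, 'l::complex_alg_1) braided_data
    \<Rightarrow> ('b, 'l) forms set \<Rightarrow> (('b, 'l) forms \<Rightarrow> ('b, 'l) forms_A) \<Rightarrow> bool" where
  "left_connection D M nab \<longleftrightarrow>
     nab \<in> M \<rightarrow>\<^sub>E tensor_A D (Omega1 D) M \<and>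
     (\<forall>m\<in>M. \<forall>n\<in>M. nab (m + n) = add_A D (nab m) (nab n)) \<and>
     (\<forall>a. \<forall>m\<in>M. nab (lmult D a m) =
        add_A D (over_A D (ext_d D (form0 a) \<otimes> m)) (lmult_A D a (nab m)))"

definition torsion_free ::
  "('h::complex_alg_1, 'v::complex_vec, 'b::complex_alg_1, 'l::complex_alg_1) braided_data
    \<Rightarrow> ('b, 'l) forms set \<Rightarrow> (('b, 'l) forms \<Rightarrow> ('b, 'l) forms_A) \<Rightarrow> bool"
  where "torsion_free D M nab \<longleftrightarrow> (\<forall>m\<in>M. wedge_A D (nab m) - ext_d D m = 0)"

definition bimodule_map_A ::
  "('h::complex_alg_1, 'v::complex_vec, 'b::complex_alg_1, 'l::complex_alg_1) braided_data
    \<Rightarrow> ('b, 'l) forms_A set \<Rightarrow> ('b, 'l) forms_A set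
    \<Rightarrow> (('b, 'l) forms_A \<Rightarrow> ('b, 'l) forms_A)
    \<Rightarrow> bool" where
  "bimodule_map_A D P Q s \<longleftrightarrow>
     s \<in> P \<rightarrow> Q \<and>
     (\<forall>X\<in>P. \<forall>Y\<in>P. s (add_A D X Y) = add_A D (s X) (s Y)) \<and>
     (\<forall>a. \<forall>X\<in>P. s (lmult_A D a X) = lmult_A D a (s X)) \<and>
     (\<forall>a. \<forall>X\<in>P. s (rmult_A D X a) = rmult_A D (s X) a)"

definition bimodule_connection ::
  "('h::complex_alg_1, 'v::complex_vec, 'b::complex_alg_1, 'l::complex_alg_1) braided_data
    \<Rightarrow> ('b, 'l) forms set \<Rightarrow> (('b, 'l) forms \<Rightarrow> ('b, 'l) forms_A)
    \<Rightarrow> (('b, 'l) forms_A \<Rightarrow> ('b, 'l) forms_A)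
    \<Rightarrow> bool" where
  "bimodule_connection D M nab s \<longleftrightarrow>
     left_connection D M nab \<and>
     bimodule_map_A D (tensor_A D M (Omega1 D)) (tensor_A D (Omega1 D) M) s \<and>
     (\<forall>a. \<forall>m\<in>M. nab (rmult D m a) =
        add_A D (rmult_A D (nab m) a) (s (over_A D (m \<otimes> ext_d D (form0 a)))))"

definition star_preserving ::
  "('h::complex_alg_1, 'v::complex_vec, 'b::complex_alg_1, 'l::complex_alg_1) braided_data
    \<Rightarrow> (('b, 'l) forms \<Rightarrow> ('b, 'l) forms_A)
    \<Rightarrow> (('b, 'l) forms_A \<Rightarrow> ('b, 'l) forms_A)
    \<Rightarrow> bool" where
  "star_preserving D nab s \<longleftrightarrow>
     (\<forall>X \<in> tensor_A D (Omega1 D) (Omega1 D). s (dagger_A D (s X)) = dagger_A D X) \<and>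
     (\<forall>x \<in> Omega1 D. nab x = s (dagger_A D (nab (form_star D x))))"

text \<open>
  The identifications of \<open>\<Omega>\<^sup>1\<^sup>,\<^sup>0\<close> with \<open>V \<otimes> B\<close> and of \<open>\<Omega>\<^sup>0\<^sup>,\<^sup>1\<close> with \<open>B \<otimes> V\<close>, extended by 0 to
  the other bidegrees.
\<close>

definition coord10 ::
  "('h::complex_alg_1, 'v::complex_vec, 'b::complex_alg_1, 'l::complex_alg_1) braided_data
    \<Rightarrow> ('b, 'l) forms \<Rightarrow> ('v, 'b) tensor" where
  "coord10 D = tensor_lift (\<lambda>\<omega>. tensor_lift (\<lambda>b \<zeta>.
     deg0 (proj_\<Lambda> D) \<zeta> *\<^sub>C (deg1 (proj_\<Lambda> D) \<omega> \<otimes> b)))"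

definition coord01 ::
  "('h::complex_alg_1, 'v::complex_vec, 'b::complex_alg_1, 'l::complex_alg_1) braided_data
    \<Rightarrow> ('b, 'l) forms \<Rightarrow> ('b, 'v) tensor" where
  "coord01 D = tensor_lift (\<lambda>\<omega>. tensor_lift (\<lambda>b \<zeta>.
     deg0 (proj_\<Lambda> D) \<omega> *\<^sub>C (b \<otimes> deg1 (proj_\<Lambda> D) \<zeta>)))"

definition part10 ::
  "('h::complex_alg_1, 'v::complex_vec, 'b::complex_alg_1, 'l::complex_alg_1) braided_data
    \<Rightarrow> ('b, 'l) forms \<Rightarrow> ('b, 'l) forms"
  where "part10 D x = tensor_lift (\<lambda>v b. gen_\<Lambda> D v \<otimes> b \<otimes> 1) (coord10 D x)"

definition part01 ::
  "('h::complex_alg_1, 'v::complex_vec, 'b::complex_alg_1, 'l::complex_alg_1) braided_data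
    \<Rightarrow> ('b, 'l) forms \<Rightarrow> ('b, 'l) forms"
  where "part01 D x = tensor_lift (\<lambda>b v. 1 \<otimes> b \<otimes> gen_\<Lambda> D v) (coord01 D x)"

text \<open>\<open>\<nabla>\<^sub>E \<oplus> \<nabla>\<^sub>F\<close> and its generalised braiding \<open>\<sigma>\<^sub>E \<oplus> \<sigma>\<^sub>F\<close>.\<close>

definition sum_connection ::
  "('h::complex_alg_1, 'v::complex_vec, 'b::complex_alg_1, 'l::complex_alg_1) braided_data
    \<Rightarrow> (('b, 'l) forms \<Rightarrow> ('b, 'l) forms_A)
    \<Rightarrow> (('b, 'l) forms \<Rightarrow> ('b, 'l) forms_A)
    \<Rightarrow> ('b, 'l) forms \<Rightarrow> ('b, 'l) forms_A" where
  "sum_connection D nabE nabF =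
     (\<lambda>x \<in> Omega1 D. add_A D (nabE (part10 D x)) (nabF (part01 D x)))"

definition sum_braiding ::
  "('h::complex_alg_1, 'v::complex_vec, 'b::complex_alg_1, 'l::complex_alg_1) braided_data
    \<Rightarrow> (('b, 'l) forms_A \<Rightarrow> ('b, 'l) forms_A)
    \<Rightarrow> (('b, 'l) forms_A \<Rightarrow> ('b, 'l) forms_A)
    \<Rightarrow> ('b, 'l) forms_A \<Rightarrow> ('b, 'l) forms_A" where
  "sum_braiding D sE sF X =
     add_A D (sE (map_A D (tensor_map (part10 D) id) X)) (sF (map_A D (tensor_map (part01 D) id) X))"


section \<open>Hermitian metrics and Chern connections\<close>

definition phi_minus :: "(('v::complex_vec, 'v) tensor \<Rightarrow> 'b::complex_alg_1)
    \<Rightarrow> (('b, 'v) tensor, ('v, 'b) tensor) tensor \<Rightarrow> 'b" where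
  "phi_minus \<eta> = tensor_lift (\<lambda>s t. tensor_lift (\<lambda>a v. tensor_lift (\<lambda>w b. a * \<eta> (v \<otimes> w) * b) t) s)"

definition Theta ::
  "('h::complex_alg_1, 'v::complex_vec, 'b::complex_alg_1, 'l::complex_alg_1) braided_data
    \<Rightarrow> (('b, 'v) tensor, ('v, 'b) tensor) tensor \<Rightarrow> (('v, 'b) tensor, ('b, 'v) tensor) tensor" where
  "Theta D t =
     tensor_map (braid D (coaction (B_alg D)) (coact D)) (braid D (coact D) (coaction (B_alg D)))
       (tensor_lift (\<lambda>s u. tensor_lift (\<lambda>a v. tensor_lift (\<lambda>w b.
          tensor_lift (\<lambda>w' v'. (a \<otimes> w') \<otimes> (v' \<otimes> b)) (Psi D (v \<otimes> w))) u) s) t)"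

definition phi_plus ::
  "('h::complex_alg_1, 'v::complex_vec, 'b::complex_alg_1, 'l::complex_alg_1) braided_data
    \<Rightarrow> (('v, 'v) tensor \<Rightarrow> 'b) \<Rightarrow> (('v, 'b) tensor, ('b, 'v) tensor) tensor \<Rightarrow> 'b"
  where "phi_plus D \<eta> = phi_minus \<eta> \<circ> inv (Theta D)"

text \<open>\<open>metric_F D \<eta> x z\<close> is the hermitian metric evaluated on \<open>x\<close> and the conjugate of \<open>z\<close>.\<close>

definition metric_F ::
  "('h::complex_alg_1, 'v::complex_vec, 'b::complex_alg_1, 'l::complex_alg_1) braided_data
    \<Rightarrow> (('v, 'v) tensor \<Rightarrow> 'b) \<Rightarrow> ('b, 'l) forms \<Rightarrow> ('b, 'l) forms \<Rightarrow> 'b"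
  where "metric_F D \<eta> x z = phi_minus \<eta> (coord01 D x \<otimes> coord10 D (form_star D z))"

definition metric_E ::
  "('h::complex_alg_1, 'v::complex_vec, 'b::complex_alg_1, 'l::complex_alg_1) braided_data
    \<Rightarrow> (('v, 'v) tensor \<Rightarrow> 'b) \<Rightarrow> ('b, 'l) forms \<Rightarrow> ('b, 'l) forms \<Rightarrow> 'b"
  where "metric_E D \<eta> x z = phi_plus D \<eta> (coord10 D x \<otimes> coord01 D (form_star D z))"

definition hermitian_form ::
  "('h::complex_alg_1, 'v::complex_vec, 'b::complex_alg_1, 'l::complex_alg_1) braided_data
    \<Rightarrow> (('v, 'v) tensor \<Rightarrow> 'b) \<Rightarrow> bool"
  where "hermitian_form D \<eta> \<longleftrightarrow> clinear \<eta> \<and> (\<forall>t. star_B D (\<eta> t) = \<eta> (dagger (vstar D) t))"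

definition complex_valued :: "('x \<Rightarrow> 'b::complex_alg_1) \<Rightarrow> bool"
  where "complex_valued f \<longleftrightarrow> range f \<subseteq> range (\<lambda>c. c *\<^sub>C 1)"

text \<open>Invertibility over \<open>A\<close> of the matrix of \<open>g\<close> in a basis (equivalently, in any basis) of \<open>V\<close>.\<close>

definition invertible_gram :: "('v::complex_vec \<Rightarrow> 'v \<Rightarrow> 'b::complex_alg_1) \<Rightarrow> bool" where
  "invertible_gram g \<longleftrightarrow>
     (\<exists>S. finite S \<and> cvec.independent S \<and> cvec.span S = UNIV \<and>
       (\<exists>h. \<forall>i\<in>S. \<forall>k\<in>S.
          (\<Sum>j\<in>S. g i j * h j k) = (if i = k then 1 else 0) \<and>
          (\<Sum>j\<in>S. h i j * g j k) = (if i = k then 1 else 0)))"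

definition nondegenerate_F ::
  "('h::complex_alg_1, 'v::complex_vec, 'b::complex_alg_1, 'l::complex_alg_1) braided_data
    \<Rightarrow> (('v, 'v) tensor \<Rightarrow> 'b) \<Rightarrow> bool"
  where "nondegenerate_F D \<eta> \<longleftrightarrow> invertible_gram (\<lambda>v w. \<eta> (v \<otimes> vstar D w))"

definition nondegenerate_E ::
  "('h::complex_alg_1, 'v::complex_vec, 'b::complex_alg_1, 'l::complex_alg_1) braided_data
    \<Rightarrow> (('v, 'v) tensor \<Rightarrow> 'b) \<Rightarrow> bool"
  where "nondegenerate_E D \<eta> \<longleftrightarrow> invertible_gram (\<lambda>v w. \<eta> (inv (Psi D) (v \<otimes> vstar D w)))"

definition hermitian_compatible ::
  "('h::complex_alg_1, 'v::complex_vec, 'b::complex_alg_1, 'l::complex_alg_1) braided_data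
    \<Rightarrow> (('b, 'l) forms \<Rightarrow> ('b, 'l) forms \<Rightarrow> 'b) \<Rightarrow> ('b, 'l) forms set
    \<Rightarrow> (('b, 'l) forms \<Rightarrow> ('b, 'l) forms_A) \<Rightarrow> bool" where
  "hermitian_compatible D g M nab \<longleftrightarrow>
     (\<forall>m\<in>M. \<forall>n\<in>M. ext_d D (form0 (g m n)) =
        the_elem (tensor_lift (\<lambda>m1 m2. rmult D m1 (g m2 n)) ` nab m) +
        the_elem (tensor_lift_cnj (\<lambda>n1 n2. lmult D (g m n2) (form_star D n1)) ` nab n))"

definition is_chern_F ::
  "('h::complex_alg_1, 'v::complex_vec, 'b::complex_alg_1, 'l::complex_alg_1) braided_data
    \<Rightarrow> (('v, 'v) tensor \<Rightarrow> 'b) \<Rightarrow> (('b, 'l) forms \<Rightarrow> ('b, 'l) forms_A) \<Rightarrow> bool" where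
  "is_chern_F D \<eta> nab \<longleftrightarrow>
     left_connection D (Omega D 0 1) nab \<and>
     hermitian_compatible D (metric_F D \<eta>) (Omega D 0 1) nab \<and>
     (\<forall>m \<in> Omega D 0 1. \<exists>Y \<in> tensor_A D (Omega D 0 1) (Omega D 0 1).
        nab m = add_A D (inv_into (tensor_A D (Omega D 1 0) (Omega D 0 1)) (wedge_A D) (del D m)) Y)"

definition is_chern_E ::
  "('h::complex_alg_1, 'v::complex_vec, 'b::complex_alg_1, 'l::complex_alg_1) braided_data
    \<Rightarrow> (('v, 'v) tensor \<Rightarrow> 'b) \<Rightarrow> (('b, 'l) forms \<Rightarrow> ('b, 'l) forms_A) \<Rightarrow> bool" where
  "is_chern_E D \<eta> nab \<longleftrightarrow>
     left_connection D (Omega D 1 0) nab \<and>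
     hermitian_compatible D (metric_E D \<eta>) (Omega D 1 0) nab \<and>
     (\<forall>m \<in> Omega D 1 0. \<exists>Y \<in> tensor_A D (Omega D 1 0) (Omega D 1 0).
        nab m = add_A D (inv_into (tensor_A D (Omega D 0 1) (Omega D 1 0)) (wedge_A D) (delbar D m)) Y)"

definition the_only :: "('x \<Rightarrow> bool) \<Rightarrow> 'x \<Rightarrow> bool"
  where "the_only P x \<longleftrightarrow> P x \<and> (\<forall>y. P y \<longrightarrow> y = x)"

end

theory Submission
  imports Defs
begin

text \<open>
  Both \<open>F = \<Omega>\<^sup>0\<^sup>,\<^sup>1\<close> and \<open>E = \<Omega>\<^sup>1\<^sup>,\<^sup>0\<close> are free left modules \<open>B \<otimes> V\<close> on the generators \<open>\<delta>v\<close>, where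
  \<open>\<delta> = \<partial>\<bar>\<close> or \<open>\<delta> = \<partial>\<close>, with right action \<open>\<delta>v . b = (B \<otimes> \<delta>) \<theta>(v \<otimes> b)\<close> for \<open>\<theta> = \<Psi>\<^bsub>V,B\<^esub>\<close> respectively
  \<open>\<theta> = \<Psi>\<^bsub>B,V\<^esub>\<inverse>\<close>.  The connection killing the generators is \<open>\<nabla>(a . \<delta>v) = da \<otimes> \<delta>v\<close>, and
  \<open>\<sigma>(a . \<delta>v \<otimes> du) = a . (d \<otimes> \<delta>) \<Psi>\<^sup>\<plusminus>\<^sup>1(v \<otimes> u)\<close> respects the right actions by the Yang--Baxter equation,
  so that the right Leibniz rule need only be checked on the generators of \<open>B\<close>.  As
  \<open>\<Psi> \<circ> \<dagger> = \<dagger> \<circ> \<Psi>\<close> by the real type condition, the involution exchanges the two constructions.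
  For a metric with scalar values on the generators, \<open>d\<langle>\<delta>v, \<delta>w\<rangle> = 0\<close>, so \<open>\<nabla>\<close> is compatible with it;
  conversely the components of any Chern connection on generators are killed by the Gram matrix.
  That \<open>d\<close> is well defined on \<open>B = TV / \<Oplus> ker [n]!\<close> rests on the factorisation
  \<open>[n+1]! = (id \<otimes> [n]!) (1 + \<Psi>\<^sub>1 + \<Psi>\<^sub>1 \<Psi>\<^sub>2 + \<dots>)\<close>, hence on Matsumoto's theorem.
\<close>

section \<open>Linear and antilinear maps out of tensor products\<close>

text \<open>\<open>Psi_perm\<close> evaluates a reduced word picked by choice, so
  \<open>braided_factorial\<close> becomes tractable only once all reduced words of a permutation
  act equally; the picked words may then be exchanged for words adapted to a coset decomposition, or
  for mirrored ones. The kernel of [n]! on a tensor product is never described: in degree n the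
  projection to B is written as a linear map \<open>G\<close> after [n]!, and identities are pushed
  through [n]!. The factorisation serves only the derivative that splits off a left factor; the
  other derivative is its conjugate under the involution, which preserves the ideal by mirror
  symmetry. Elements of a tensor product over A are cosets, so all maps are given on
  representatives, and coordinates in B \<otimes> V \<otimes> V that are constant on cosets make
  them well defined. Handedness is an obstacle for E: connections are left-handed, whereas d on E is
  simple only for right multiples of generators, so torsion freeness of E is drawn from the right
  Leibniz rule and from wedge after \<sigma> being minus wedge.\<close>

lemma clinearI:
  "(\<And>x y. f (x + y) = f x + f y) \<Longrightarrow> (\<And>c x. f (c *\<^sub>C x) = c *\<^sub>C f x) \<Longrightarrow> clinear f"
  by (simp add: Vector_Spaces.linear_iff cvec.vector_space_axioms)

lemma clinear_iff:
  "clinear f \<longleftrightarrow> (\<forall>x y. f (x + y) = f x + f y) \<and> (\<forall>c x. f (c *\<^sub>C x) = c *\<^sub>C f x)"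
  by (simp add: Vector_Spaces.linear_iff cvec.vector_space_axioms)

lemma clinear_add: "clinear f \<Longrightarrow> f (x + y) = f x + f y"
  and clinear_scale: "clinear f \<Longrightarrow> f (c *\<^sub>C x) = c *\<^sub>C f x"
  by (simp_all add: clinear_iff)

lemma additive_zero: "(\<And>x y. f (x + y) = f x + f y) \<Longrightarrow> f 0 = 0"
  for f :: "'a::ab_group_add \<Rightarrow> 'b::ab_group_add"
  by (metis add_cancel_left_right)

lemma additive_diff: "(\<And>x y. f (x + y) = f x + f y) \<Longrightarrow> f (x - y) = f x - f y"
  for f :: "'a::ab_group_add \<Rightarrow> 'b::ab_group_add"
  by (metis add_diff_cancel_right' diff_add_cancel)

lemma additive_sum: "(\<And>x y. f (x + y) = f x + f y) \<Longrightarrow> f (sum g A) = (\<Sum>i\<in>A. f (g i))"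
  for f :: "'a::ab_group_add \<Rightarrow> 'b::ab_group_add"
  by (induct A rule: infinite_finite_induct) (simp_all add: additive_zero)

lemma clinear_0: "clinear f \<Longrightarrow> f 0 = 0"
  by (rule additive_zero) (rule clinear_add)

lemma clinear_diff: "clinear f \<Longrightarrow> f (x - y) = f x - f y"
  by (rule additive_diff) (rule clinear_add)

lemma clinear_minus: "clinear f \<Longrightarrow> f (- x) = - f x"
  by (metis clinear_diff clinear_0 diff_0)

lemma clinear_sum: "clinear f \<Longrightarrow> f (sum g A) = (\<Sum>i\<in>A. f (g i))"
  by (rule additive_sum) (rule clinear_add)

lemma antilinear_0: "antilinear f \<Longrightarrow> f 0 = 0"
  unfolding antilinear_def by (metis add_cancel_left_right)

lemma scaleC_complex_mult [simp]: "c *\<^sub>C (z :: complex) = c * z"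
  by (simp add: scaleC_complex_def)

lemma scaleC_minus [simp]: "c *\<^sub>C (- x) = - (c *\<^sub>C x)" "(- c) *\<^sub>C x = - (c *\<^sub>C x)"
  for x :: "'a::complex_vec"
  by simp_all

declare scaleC_scaleC [simp] scaleC_one [simp] mult_scaleC_left [simp] mult_scaleC_right [simp]

lemma scaleC_sum: "c *\<^sub>C sum f A = (\<Sum>i\<in>A. c *\<^sub>C f i)" for f :: "_ \<Rightarrow> 'a::complex_vec"
  by (rule cvec.scale_sum_right)

text \<open>The extension of \<open>g\<close> from basis elements to formal sums, with coefficients
  passed through \<tau>. Taking \<tau> to be the identity or conjugation, as in
  \<open>id_or_cnj\<close>, serves the linear and the antilinear lifts at once, for tensors as well
  as for words.\<close>

definition polyext :: "(complex \<Rightarrow> complex) \<Rightarrow> ('k \<Rightarrow> 'a::complex_vec) \<Rightarrow> ('k \<Rightarrow>\<^sub>0 complex) \<Rightarrow> 'a"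
  where "polyext \<tau> g p = (\<Sum>k \<in> Poly_Mapping.keys p. \<tau> (Poly_Mapping.lookup p k) *\<^sub>C g k)"

definition id_or_cnj :: "(complex \<Rightarrow> complex) \<Rightarrow> bool"
  where "id_or_cnj \<tau> \<longleftrightarrow> \<tau> = (\<lambda>c. c) \<or> \<tau> = cnj"

lemma id_or_cnj [simp]: "id_or_cnj (\<lambda>c. c)" "id_or_cnj cnj"
  by (simp_all add: id_or_cnj_def)

lemma id_or_cnj_rules:
  assumes "id_or_cnj \<tau>"
  shows "\<tau> 0 = 0" "\<tau> 1 = 1" "\<tau> (c + d) = \<tau> c + \<tau> d" "\<tau> (c * d) = \<tau> c * \<tau> d"
  using assms by (auto simp: id_or_cnj_def)

lemma polyext_superset:
  assumes "id_or_cnj \<tau>" "finite K" "Poly_Mapping.keys p \<subseteq> K"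
  shows "polyext \<tau> g p = (\<Sum>k \<in> K. \<tau> (Poly_Mapping.lookup p k) *\<^sub>C g k)"
  unfolding polyext_def using assms
  by (intro sum.mono_neutral_left) (auto simp: in_keys_iff id_or_cnj_rules)

lemma polyext_add:
  assumes "id_or_cnj \<tau>"
  shows "polyext \<tau> g (p + q) = polyext \<tau> g p + polyext \<tau> g q"
proof -
  let ?K = "Poly_Mapping.keys p \<union> Poly_Mapping.keys q"
  have "Poly_Mapping.keys (p + q) \<subseteq> ?K" by (rule keys_add)
  then show ?thesis
    using polyext_superset[OF assms, of ?K p g] polyext_superset[OF assms, of ?K q g]
      polyext_superset[OF assms, of ?K "p + q" g]
    by (simp add: lookup_add id_or_cnj_rules[OF assms] scaleC_add_left sum.distrib)
qed

lemma polyext_scale: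
  assumes "id_or_cnj \<tau>"
  shows "polyext \<tau> g (c *\<^sub>C p) = \<tau> c *\<^sub>C polyext \<tau> g p"
proof -
  have "Poly_Mapping.keys (c *\<^sub>C p) \<subseteq> Poly_Mapping.keys p"
    by (auto simp: in_keys_iff lookup_scaleC)
  then show ?thesis
    using polyext_superset[OF assms, of "Poly_Mapping.keys p" "c *\<^sub>C p" g]
      polyext_superset[OF assms, of "Poly_Mapping.keys p" p g]
    by (simp add: lookup_scaleC id_or_cnj_rules[OF assms] scaleC_sum)
qed

lemma polyext_single:
  assumes "id_or_cnj \<tau>"
  shows "polyext \<tau> g (Poly_Mapping.single k c) = \<tau> c *\<^sub>C g k"
  using polyext_superset[OF assms, of "{k}" "Poly_Mapping.single k c" g] by simp

lemma polyext_diff: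
  assumes "id_or_cnj \<tau>"
  shows "polyext \<tau> g (p - q) = polyext \<tau> g p - polyext \<tau> g q"
  by (rule additive_diff) (rule polyext_add[OF assms])

text \<open>The criterion for a lift to be independent of the representative: vanishing on the
  relators gives vanishing on their span, and two representatives differ by an element of that
  span.\<close>

lemma polyext_span:
  assumes "id_or_cnj \<tau>" "\<And>r. r \<in> S \<Longrightarrow> polyext \<tau> g r = 0" "p \<in> cvec.span S"
  shows "polyext \<tau> g p = 0"
  using assms(3)
proof (induct rule: cvec.span_induct_alt)
  case base
  then show ?case by (simp add: polyext_def)
next
  case (step c x y)
  then show ?case by (simp add: polyext_add assms polyext_scale)
qed

lemma poly_mapping_additive_induct [case_names single add]:
  fixes p :: "'k \<Rightarrow>\<^sub>0 complex"
  assumes "\<And>k c. P (Poly_Mapping.single k c)" "\<And>p q. P p \<Longrightarrow> P q \<Longrightarrow> P (p + q)"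
  shows "P p"
proof (induct p rule: update_induct)
  case const
  then show ?case using assms(1)[of _ 0] by simp
next
  case (update f a b)
  have "Poly_Mapping.update a b f = f + Poly_Mapping.single a b"
    using update(1) by (auto intro!: poly_mapping_eqI
      simp: lookup_add lookup_update lookup_single when_def in_keys_iff)
  then show ?case using update assms by simp
qed

section \<open>The universal property of the tensor product\<close>

abbreviation bilin :: "('a::complex_vec \<Rightarrow> 'b::complex_vec \<Rightarrow> 'c::complex_vec) \<Rightarrow> bool"
  where "bilin f \<equiv> (\<forall>x. clinear (f x)) \<and> (\<forall>y. clinear (\<lambda>x. f x y))"

abbreviation biantilin :: "('a::complex_vec \<Rightarrow> 'b::complex_vec \<Rightarrow> 'c::complex_vec) \<Rightarrow> bool"
  where "biantilin f \<equiv> (\<forall>x. antilinear (f x)) \<and> (\<forall>y. antilinear (\<lambda>x. f x y))"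

lemma tensor_lift_polyext: "tensor_lift f t = polyext (\<lambda>c. c) (\<lambda>k. f (fst k) (snd k)) (rep_tensor t)"
  by (simp add: tensor_lift_def polyext_def case_prod_beta)

lemma tensor_lift_cnj_polyext: "tensor_lift_cnj f t = polyext cnj (\<lambda>k. f (fst k) (snd k)) (rep_tensor t)"
  by (simp add: tensor_lift_cnj_def polyext_def case_prod_beta)

lemma rep_abs_tensor: "rep_tensor (abs_tensor p) - p \<in> cvec.span tensor_relators"
  using Quotient_rep_abs[OF Quotient_tensor, of p] by (simp add: tensor_rel_def cvec.span_zero)

lemma tensor_lift_abs:
  assumes "bilin f"
  shows "tensor_lift f (abs_tensor p) = polyext (\<lambda>c. c) (\<lambda>k. f (fst k) (snd k)) p"
proof -
  have "polyext (\<lambda>c. c) (\<lambda>k. f (fst k) (snd k)) (rep_tensor (abs_tensor p) - p) = 0"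
    by (rule polyext_span[OF id_or_cnj(1) _ rep_abs_tensor])
      (use assms in \<open>auto simp: tensor_relators_def polyext_diff polyext_single clinear_iff\<close>)
  then show ?thesis by (simp add: tensor_lift_polyext polyext_diff)
qed

lemma tensor_lift_cnj_abs:
  assumes "biantilin f"
  shows "tensor_lift_cnj f (abs_tensor p) = polyext cnj (\<lambda>k. f (fst k) (snd k)) p"
proof -
  have "polyext cnj (\<lambda>k. f (fst k) (snd k)) (rep_tensor (abs_tensor p) - p) = 0"
    by (rule polyext_span[OF id_or_cnj(2) _ rep_abs_tensor])
      (use assms in \<open>auto simp: tensor_relators_def polyext_diff polyext_single antilinear_def\<close>)
  then show ?thesis by (simp add: tensor_lift_cnj_polyext polyext_diff)
qed

lemma tensor_lift_pure [simp]: "bilin f \<Longrightarrow> tensor_lift f (x \<otimes> y) = f x y"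
  unfolding tensor_pure.abs_eq by (subst tensor_lift_abs) (simp_all add: polyext_single)

lemma tensor_lift_cnj_pure [simp]: "biantilin f \<Longrightarrow> tensor_lift_cnj f (x \<otimes> y) = f x y"
  unfolding tensor_pure.abs_eq by (subst tensor_lift_cnj_abs) (simp_all add: polyext_single)

lemma tensor_lift_add: "bilin f \<Longrightarrow> tensor_lift f (s + t) = tensor_lift f s + tensor_lift f t"
  by (induct s rule: tensor.abs_induct, induct t rule: tensor.abs_induct)
    (simp add: plus_tensor.abs_eq tensor_lift_abs polyext_add)

lemma tensor_lift_scale: "bilin f \<Longrightarrow> tensor_lift f (c *\<^sub>C t) = c *\<^sub>C tensor_lift f t"
  by (induct t rule: tensor.abs_induct)
    (simp add: scaleC_tensor.abs_eq tensor_lift_abs polyext_scale)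

lemma tensor_lift_cnj_add: "biantilin f \<Longrightarrow> tensor_lift_cnj f (s + t) = tensor_lift_cnj f s + tensor_lift_cnj f t"
  by (induct s rule: tensor.abs_induct, induct t rule: tensor.abs_induct)
    (simp add: plus_tensor.abs_eq tensor_lift_cnj_abs polyext_add)

lemma tensor_lift_cnj_scale: "biantilin f \<Longrightarrow> tensor_lift_cnj f (c *\<^sub>C t) = cnj c *\<^sub>C tensor_lift_cnj f t"
  by (induct t rule: tensor.abs_induct)
    (simp add: scaleC_tensor.abs_eq tensor_lift_cnj_abs polyext_scale)

lemma tensor_eqI: "p - q \<in> tensor_relators \<Longrightarrow> abs_tensor p = abs_tensor q"
  by (simp add: tensor.abs_eq_iff tensor_rel_def cvec.span_base)

lemma tensor_pure_add [simp]:
  "(x + x') \<otimes> y = x \<otimes> y + x' \<otimes> y" "x \<otimes> (y + y') = x \<otimes> y + x \<otimes> y'"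
  unfolding tensor_pure.abs_eq plus_tensor.abs_eq
  by (rule tensor_eqI, unfold tensor_relators_def diff_diff_eq[symmetric], blast)+

lemma tensor_pure_scale [simp]: "(c *\<^sub>C x) \<otimes> y = c *\<^sub>C (x \<otimes> y)" "x \<otimes> (c *\<^sub>C y) = c *\<^sub>C (x \<otimes> y)"
  unfolding tensor_pure.abs_eq scaleC_tensor.abs_eq scaleC_single mult_1_right
  by (rule tensor_eqI, unfold tensor_relators_def diff_diff_eq[symmetric], blast)+

text \<open>A scalar multiple of a pure tensor is again pure, which is why there is no case for
  scalars; the rule therefore serves antilinear maps as well as linear ones.\<close>

lemma tensor_induct [case_names pure add]:
  assumes "\<And>x y. P (x \<otimes> y)" "\<And>s t. P s \<Longrightarrow> P t \<Longrightarrow> P (s + t)"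
  shows "P t"
proof (induct t rule: tensor.abs_induct)
  fix p
  show "P (abs_tensor p)"
  proof (induct p rule: poly_mapping_additive_induct)
    case (single k c)
    have "abs_tensor (Poly_Mapping.single k c) = (c *\<^sub>C fst k) \<otimes> snd k"
      unfolding tensor_pure_scale by (simp add: tensor_pure.abs_eq scaleC_tensor.abs_eq scaleC_single)
    then show ?case using assms(1)[of "c *\<^sub>C fst k" "snd k"] by metis
  next
    case (add p q)
    then show ?case using assms(2) by (simp flip: plus_tensor.abs_eq)
  qed
qed

lemma clinear_ident [simp]: "clinear (\<lambda>x. x)" "clinear id"
  and clinear_const_zero [simp]: "clinear (\<lambda>x. 0)"
  and clinear_plus [simp]: "clinear f \<Longrightarrow> clinear g \<Longrightarrow> clinear (\<lambda>x. f x + g x)"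
  and clinear_subtract [simp]: "clinear f \<Longrightarrow> clinear g \<Longrightarrow> clinear (\<lambda>x. f x - g x)"
  and clinear_uminus [simp]: "clinear f \<Longrightarrow> clinear (\<lambda>x. - f x)"
  and clinear_scaleC_right [simp]: "clinear f \<Longrightarrow> clinear (\<lambda>x. c *\<^sub>C f x)"
  by (simp_all add: clinear_iff scaleC_add_right cvec.scale_right_diff_distrib mult.commute)

lemma clinear_scaleC_left [simp]: "clinear h \<Longrightarrow> clinear (\<lambda>x. h x *\<^sub>C y)"
  and clinear_pure_left [simp]: "clinear f \<Longrightarrow> clinear (\<lambda>x. f x \<otimes> z)"
  and clinear_pure_right [simp]: "clinear f \<Longrightarrow> clinear (\<lambda>x. z \<otimes> f x)"
  by (simp_all add: clinear_iff scaleC_add_left)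

lemma clinear_mult_left [simp]: "clinear h \<Longrightarrow> clinear (\<lambda>x. h x * y)"
  and clinear_mult_right [simp]: "clinear h \<Longrightarrow> clinear (\<lambda>x. y * h x)"
  for h :: "_ \<Rightarrow> 'a::complex_alg_1"
  by (simp_all add: clinear_iff distrib_left distrib_right)

lemma clinear_sum_fun [simp]: "(\<And>i. i \<in> A \<Longrightarrow> clinear (f i)) \<Longrightarrow> clinear (\<lambda>x. \<Sum>i\<in>A. f i x)"
  by (simp add: clinear_iff sum.distrib scaleC_sum)

lemma clinear_compose: "clinear g \<Longrightarrow> clinear f \<Longrightarrow> clinear (\<lambda>x. g (f x))"
  by (simp add: clinear_iff)

lemma clinear_tensor_lift [simp]: "bilin f \<Longrightarrow> clinear g \<Longrightarrow> clinear (\<lambda>x. tensor_lift f (g x))"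
  by (intro clinearI) (simp_all add: tensor_lift_add tensor_lift_scale clinear_add clinear_scale)

lemma clinear_tensor_lift' [simp]: "bilin f \<Longrightarrow> clinear (tensor_lift f)"
  by (intro clinearI) (simp_all add: tensor_lift_add tensor_lift_scale)

lemma clinear_tensor_lift_fun [simp]:
  assumes "\<forall>a b. clinear (\<lambda>x. f x a b)"
  shows "clinear (\<lambda>x. tensor_lift (f x) t)"
  using assms by (intro clinearI)
    (simp_all add: tensor_lift_def clinear_iff case_prod_beta sum.distrib scaleC_sum scaleC_add_right mult.commute)

text \<open>\<open>tensor_lift f t\<close> is a finite sum over one fixed representative of
  \<open>t\<close>, so linear maps pass inside for arbitrary \<open>f\<close>. Together with
  \<open>tensor_lift_swap\<close> this gives the usual manipulations of Sweedler sums.\<close>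

lemma clinear_tensor_lift_swap:
  "clinear L \<Longrightarrow> L (tensor_lift f t) = tensor_lift (\<lambda>a b. L (f a b)) t"
  by (simp add: tensor_lift_def clinear_sum case_prod_beta clinear_scale)

lemma tensor_lift_swap:
  "tensor_lift (\<lambda>a b. tensor_lift (\<lambda>c d. f a b c d) s) t = tensor_lift (\<lambda>c d. tensor_lift (\<lambda>a b. f a b c d) t) s"
  unfolding tensor_lift_def case_prod_beta scaleC_sum
  by (subst sum.swap) (simp add: mult.commute)

lemma scaleC_tensor_lift: "c *\<^sub>C tensor_lift f t = tensor_lift (\<lambda>a b. c *\<^sub>C f a b) t"
  by (rule clinear_tensor_lift_swap) simp

lemma tensor_lift_zero [simp]: "tensor_lift (\<lambda>a b. 0) t = 0"
  by (simp add: tensor_lift_def case_prod_beta)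

lemma tensor_lift_plus: "tensor_lift (\<lambda>a b. f a b + g a b) t = tensor_lift f t + tensor_lift g t"
  by (simp add: tensor_lift_def case_prod_beta scaleC_add_right sum.distrib)

lemma tensor_lift_0 [simp]: "bilin f \<Longrightarrow> tensor_lift f 0 = 0"
  by (rule clinear_0) simp

lemma tensor_pure_0 [simp]: "0 \<otimes> y = 0" "x \<otimes> 0 = 0"
  by (rule clinear_0[of "\<lambda>x. x \<otimes> y"], simp) (rule clinear_0[of "\<lambda>y. x \<otimes> y"], simp)

lemma tensor_pure_minus [simp]: "(- x) \<otimes> y = - (x \<otimes> y)" "x \<otimes> (- y) = - (x \<otimes> y)"
  by (rule clinear_minus[of "\<lambda>x. x \<otimes> y"], simp) (rule clinear_minus[of "\<lambda>y. x \<otimes> y"], simp)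

lemma tensor_lift_eqI:
  assumes "bilin f" "clinear g" "\<And>x y. f x y = g (x \<otimes> y)"
  shows "tensor_lift f t = g t"
proof (induct t rule: tensor_induct)
  case (pure x y)
  show ?case by (rule trans[OF tensor_lift_pure[OF assms(1)] assms(3)])
next
  case (add s t)
  then show ?case by (simp only: tensor_lift_add[OF assms(1)] clinear_add[OF assms(2)])
qed

lemma clinear_eqI:
  assumes "clinear f" "clinear g" "\<And>x y. f (x \<otimes> y) = g (x \<otimes> y)"
  shows "f t = g t"
  by (induct t rule: tensor_induct) (use assms in \<open>simp_all add: clinear_add\<close>)

lemma tensor_lift_pure_id [simp]: "tensor_lift (\<lambda>x y. x \<otimes> y) t = t" "tensor_lift (\<otimes>) t = t"
  by (rule tensor_lift_eqI; simp)+

lemma tensor_lift_comp: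
  "bilin f \<Longrightarrow> tensor_lift f (tensor_lift g t) = tensor_lift (\<lambda>a b. tensor_lift f (g a b)) t"
  by (rule clinear_tensor_lift_swap) simp

lemma tensor_map_pure [simp]: "clinear f \<Longrightarrow> clinear g \<Longrightarrow> tensor_map f g (x \<otimes> y) = f x \<otimes> g y"
  by (simp add: tensor_map_def)

lemma clinear_tensor_map' [simp]:
  "clinear f \<Longrightarrow> clinear g \<Longrightarrow> clinear h \<Longrightarrow> clinear (\<lambda>x. tensor_map f g (h x))"
  by (simp add: tensor_map_def)

lemma tensor_lift_tensor_map:
  "bilin f \<Longrightarrow> clinear g \<Longrightarrow> clinear h \<Longrightarrow> tensor_lift f (tensor_map g h t) = tensor_lift (\<lambda>x y. f (g x) (h y)) t"
  by (subst tensor_map_def, subst tensor_lift_comp) (simp_all add: clinear_iff)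

lemma tensor_map_comp:
  "clinear f \<Longrightarrow> clinear g \<Longrightarrow> clinear f' \<Longrightarrow> clinear g' \<Longrightarrow>
    tensor_map f g (tensor_map f' g' t) = tensor_map (\<lambda>x. f (f' x)) (\<lambda>x. g (g' x)) t"
  by (rule clinear_eqI) (simp_all add: clinear_compose)

lemma tensor_map_id [simp]: "tensor_map id id t = t" "tensor_map (\<lambda>x. x) (\<lambda>x. x) t = t"
  by (rule clinear_eqI; simp)+

lemma tensor_assoc_pure [simp]: "tensor_assoc ((x \<otimes> y) \<otimes> z) = x \<otimes> y \<otimes> z"
  by (simp add: tensor_assoc_def)

lemma clinear_tensor_assoc [simp]: "clinear tensor_assoc"
  by (simp add: tensor_assoc_def)

lemma tensor_lift_tensor_assoc:
  assumes "\<forall>a b. clinear (\<lambda>c. f a b c)" "\<forall>a c. clinear (\<lambda>b. f a b c)" "\<forall>b c. clinear (\<lambda>a. f a b c)"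
  shows "tensor_lift (\<lambda>a t. tensor_lift (\<lambda>b c. f a b c) t) (tensor_assoc s) = tensor_lift (\<lambda>t c. tensor_lift (\<lambda>a b. f a b c) t) s"
proof (induct s rule: tensor_induct)
  case (pure t c)
  show ?case
  proof (induct t rule: tensor_induct)
    case (pure a b)
    then show ?case by (simp add: assms)
  next
    case (add s t)
    then show ?case by (simp add: assms tensor_lift_add clinear_add[OF clinear_tensor_assoc])
  qed
next
  case (add s t)
  then show ?case by (simp add: assms tensor_lift_add clinear_add[OF clinear_tensor_assoc])
qed

lemma tensor_mult_pure [simp]: "tensor_mult (x \<otimes> y) (x' \<otimes> y') = (x * x') \<otimes> (y * y')"
  by (simp add: tensor_mult_def)

lemma clinear_tensor_mult [simp]:
  "clinear f \<Longrightarrow> clinear (\<lambda>s. tensor_mult (f s) t)" "clinear f \<Longrightarrow> clinear (\<lambda>t. tensor_mult s (f t))"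
  by (simp_all add: tensor_mult_def)

lemma tensor_mult_assoc: "tensor_mult (tensor_mult r s) t = tensor_mult r (tensor_mult s t)"
proof -
  have *: "tensor_mult ((a * c) \<otimes> (b * d)) t = tensor_mult (a \<otimes> b) (tensor_mult (c \<otimes> d) t)" for a b c d
    by (rule clinear_eqI[where t = t]) (simp_all add: mult.assoc)
  have **: "tensor_mult (tensor_mult (a \<otimes> b) s) t = tensor_mult (a \<otimes> b) (tensor_mult s t)" for a b
    by (rule clinear_eqI[where t = s]) (simp_all add: *)
  show ?thesis
    by (rule clinear_eqI[where t = r]) (simp_all add: **)
qed

lemma tensor_mult_one [simp]: "tensor_mult (1 \<otimes> 1) t = t" "tensor_mult t (1 \<otimes> 1) = t"
  by (rule clinear_eqI; simp)+

lemma tensor_lift_tensor_mult: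
  assumes "bilin f"
  shows "tensor_lift f (tensor_mult s t) = tensor_lift (\<lambda>x y. tensor_lift (\<lambda>x' y'. f (x * x') (y * y')) t) s"
  unfolding tensor_mult_def using assms by (simp add: tensor_lift_comp)

lemma antilinear_comp_linear: "antilinear f \<Longrightarrow> clinear g \<Longrightarrow> antilinear (\<lambda>x. f (g x))"
  and linear_comp_antilinear: "clinear h \<Longrightarrow> antilinear k \<Longrightarrow> antilinear (\<lambda>x. h (k x))"
  and antilinear_comp_antilinear: "antilinear p \<Longrightarrow> antilinear q \<Longrightarrow> clinear (\<lambda>x. p (q x))"
  by (simp_all add: antilinear_def clinear_iff)

lemma antilinear_rules [simp]:
  "antilinear cnj" "antilinear (\<lambda>x. 0)"
  "antilinear f \<Longrightarrow> antilinear (\<lambda>x. f x \<otimes> z)"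
  "antilinear g \<Longrightarrow> antilinear (\<lambda>x. w \<otimes> g x)"
  "antilinear g \<Longrightarrow> antilinear (\<lambda>x. c *\<^sub>C g x)"
  "antilinear h \<Longrightarrow> antilinear k \<Longrightarrow> antilinear (\<lambda>x. h x + k x)"
  "antilinear l \<Longrightarrow> antilinear (\<lambda>x. l x *\<^sub>C y)"
  by (auto simp: antilinear_def scaleC_add_right scaleC_add_left mult.commute)

lemma antilinear_tensor_lift_cnj [simp]: "biantilin f \<Longrightarrow> antilinear (tensor_lift_cnj f)"
  "biantilin f \<Longrightarrow> clinear g \<Longrightarrow> antilinear (\<lambda>x. tensor_lift_cnj f (g x))"
  by (auto simp: antilinear_def tensor_lift_cnj_add tensor_lift_cnj_scale clinear_iff)

lemma antilinear_tensor_lift_cnj_fun [simp]: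
  assumes "\<forall>a b. antilinear (\<lambda>x. f x a b)"
  shows "antilinear (\<lambda>x. tensor_lift_cnj (f x) t)"
  using assms unfolding antilinear_def
  by (simp add: tensor_lift_cnj_def case_prod_beta sum.distrib scaleC_sum scaleC_add_right mult.commute)

lemma antilinear_add: "antilinear f \<Longrightarrow> f (x + y) = f x + f y"
  and antilinear_scale: "antilinear f \<Longrightarrow> f (c *\<^sub>C x) = cnj c *\<^sub>C f x"
  by (simp_all add: antilinear_def)

lemma clinear_span_induct:
  assumes "x \<in> cvec.span S" "clinear f" "clinear g" "\<And>x. x \<in> S \<Longrightarrow> f x = g x"
  shows "f x = g x"
  using assms(1) by (induct rule: cvec.span_induct_alt)
    (simp_all add: clinear_0 clinear_add clinear_scale assms)

text \<open>The map \<open>f\<close> tensored with the identity, on triple tensors nested to the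
  right, so that \<open>apl\<close> and \<open>tensor_map id\<close> together express relations on
  three strands without an associator.\<close>

definition apl :: "(('a::complex_vec, 'b::complex_vec) tensor \<Rightarrow> ('c::complex_vec, 'd::complex_vec) tensor)
    \<Rightarrow> ('a, ('b, 'e::complex_vec) tensor) tensor \<Rightarrow> ('c, ('d, 'e) tensor) tensor"
  where "apl f = tensor_lift (\<lambda>x. tensor_lift (\<lambda>y z. tensor_lift (\<lambda>c d. c \<otimes> d \<otimes> z) (f (x \<otimes> y))))"

lemma apl_pure:
  assumes "clinear f"
  shows "apl f (x \<otimes> y \<otimes> z) = tensor_lift (\<lambda>c d. c \<otimes> d \<otimes> z) (f (x \<otimes> y))"
proof -
  have [simp]: "clinear h \<Longrightarrow> clinear (\<lambda>x. f (h x))" for h by (rule clinear_compose[OF assms])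
  show ?thesis unfolding apl_def by simp
qed

lemma clinear_apl [simp]:
  assumes "clinear f"
  shows "clinear (apl f)"
proof -
  have [simp]: "clinear h \<Longrightarrow> clinear (\<lambda>x. f (h x))" for h by (rule clinear_compose[OF assms])
  show ?thesis unfolding apl_def by simp
qed

lemma tensor3_eqI:
  assumes "clinear f" "clinear g" "\<And>x y z. f (x \<otimes> y \<otimes> z) = g (x \<otimes> y \<otimes> z)"
  shows "f t = g t"
  by (rule clinear_eqI[OF assms(1,2)],
      rule clinear_eqI[where f = "\<lambda>y. f (_ \<otimes> y)" and g = "\<lambda>y. g (_ \<otimes> y)"])
    (simp_all add: clinear_compose assms)

lemma apl_comp:
  assumes "clinear f" "clinear g"
  shows "apl f (apl g t) = apl (\<lambda>s. f (g s)) t"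
proof (rule tensor3_eqI[where t = t])
  fix x y z
  have "apl f (tensor_lift (\<lambda>c d. c \<otimes> d \<otimes> z) s) = tensor_lift (\<lambda>c d. c \<otimes> d \<otimes> z) (f s)" for s
    by (rule clinear_eqI[where t = s])
      (simp_all add: assms clinear_compose[OF clinear_apl] clinear_compose apl_pure)
  then show "apl f (apl g (x \<otimes> y \<otimes> z)) = apl (\<lambda>s. f (g s)) (x \<otimes> y \<otimes> z)"
    by (simp add: apl_pure assms clinear_compose)
qed (simp_all add: assms clinear_compose)

lemma apl_id:
  assumes "\<And>s. f s = s"
  shows "apl f t = t"
proof -
  have [simp]: "f = (\<lambda>s. s)" using assms by auto
  show ?thesis by (rule tensor3_eqI[where t = t]) (simp_all add: apl_pure)
qed

section \<open>Comodules over a coquasitriangular Hopf algebra\<close>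

lemma tensor_lift_push:
  "clinear f \<Longrightarrow> clinear g \<Longrightarrow> tensor_map f g (tensor_lift h' t') = tensor_lift (\<lambda>a b. tensor_map f g (h' a b)) t'"
  "z \<otimes> tensor_lift h t = tensor_lift (\<lambda>a b. z \<otimes> h a b) t"
  "tensor_lift k s \<otimes> w = tensor_lift (\<lambda>a b. k a b \<otimes> w) s"
  "clinear p \<Longrightarrow> apl p (tensor_lift q s') = tensor_lift (\<lambda>a b. apl p (q a b)) s'"
  by (rule clinear_tensor_lift_swap; simp)+

lemma scaleC_tensor_lift_left: "tensor_lift h t *\<^sub>C w = tensor_lift (\<lambda>a b. h a b *\<^sub>C w) t"
  by (rule clinear_tensor_lift_swap; simp)

lemma mult_tensor_lift:
  "tensor_lift h t * w = tensor_lift (\<lambda>a b. h a b * w) t" "w * tensor_lift k s = tensor_lift (\<lambda>a b. w * k a b) s"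
  for w :: "'a::complex_alg_1"
  by (rule clinear_tensor_lift_swap; simp)+

lemma antilinear_tensor_lift_swap:
  "antilinear L \<Longrightarrow> L (tensor_lift f t) = tensor_lift_cnj (\<lambda>a b. L (f a b)) t"
  by (simp add: tensor_lift_def tensor_lift_cnj_def case_prod_beta antilinear_scale additive_sum antilinear_add)

lemma tensor_lift_cnj_swap:
  "tensor_lift_cnj (\<lambda>a b. tensor_lift_cnj (\<lambda>c d. f a b c d) s) t = tensor_lift_cnj (\<lambda>c d. tensor_lift_cnj (\<lambda>a b. f a b c d) t) s"
  unfolding tensor_lift_cnj_def case_prod_beta scaleC_sum
  by (subst sum.swap) (simp add: mult.commute)

lemma tensor_map_cnj_pure [simp]: "antilinear f \<Longrightarrow> antilinear g \<Longrightarrow> tensor_map_cnj f g (x \<otimes> y) = f x \<otimes> g y"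
  by (simp add: tensor_map_cnj_def)

lemma antilinear_tensor_map_cnj [simp]: "antilinear f \<Longrightarrow> antilinear g \<Longrightarrow> antilinear (tensor_map_cnj f g)"
  by (simp add: tensor_map_cnj_def)

lemma tensor_lift_tensor_map_cnj:
  assumes "bilin f" "antilinear g" "antilinear h"
  shows "tensor_lift f (tensor_map_cnj g h t) = tensor_lift_cnj (\<lambda>x y. f (g x) (h y)) t"
proof (induct t rule: tensor_induct)
  have b: "biantilin (\<lambda>x y. f (g x) (h y))"
    using assms by (auto simp: antilinear_def clinear_iff)
  { case (pure x y) show ?case using assms b by simp }
  { case (add s t) then show ?case using assms b
    by (simp add: tensor_lift_add antilinear_add tensor_lift_cnj_add) }
qed

definition trilin :: "('a::complex_vec \<Rightarrow> 'b::complex_vec \<Rightarrow> 'c::complex_vec \<Rightarrow> 'd::complex_vec) \<Rightarrow> bool"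
  where "trilin f \<longleftrightarrow> (\<forall>a b. clinear (\<lambda>c. f a b c)) \<and> (\<forall>a c. clinear (\<lambda>b. f a b c)) \<and> (\<forall>b c. clinear (\<lambda>a. f a b c))"

locale coquasitriangular_hopf =
  fixes D :: "('h::complex_alg_1, 'v::complex_vec, 'b::complex_alg_1, 'l::complex_alg_1) braided_data"
  assumes hopf: "hopf_star_algebra D" and cqt: "coquasitriangular D"
begin

lemma linear_structure [simp]:
  "clinear f \<Longrightarrow> clinear (\<lambda>x. comult D (f x))"
  "clinear f \<Longrightarrow> clinear (\<lambda>x. counit D (f x))"
  "clinear f \<Longrightarrow> clinear (\<lambda>x. Rform D (f x) h)"
  "clinear f \<Longrightarrow> clinear (\<lambda>x. Rform D g (f x))"
  "clinear (comult D)" "clinear (counit D)" "clinear (Rform D g)"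
  using hopf cqt unfolding hopf_star_algebra_def coquasitriangular_def bilinear_form_def
  by (auto intro: clinear_compose clinear_compose[of "\<lambda>x. Rform D x h"])

section \<open>Comodules and Sweedler sums\<close>

definition comodule :: "('x::complex_vec \<Rightarrow> ('x, 'h) tensor) \<Rightarrow> bool" where
  "comodule \<rho> \<longleftrightarrow> clinear \<rho> \<and>
     (\<forall>v. tensor_assoc (tensor_map \<rho> id (\<rho> v)) = tensor_map id (comult D) (\<rho> v)) \<and>
     (\<forall>v. tensor_lift (\<lambda>w h. counit D h *\<^sub>C w) (\<rho> v) = v)"

lemma comodule_linear: "comodule \<rho> \<Longrightarrow> clinear \<rho>"
  by (simp add: comodule_def)

lemma comodule_linear': "comodule \<rho> \<Longrightarrow> clinear f \<Longrightarrow> clinear (\<lambda>x. \<rho> (f x))"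
  by (simp add: comodule_def clinear_compose)

lemmas comodule_lin = comodule_linear comodule_linear'

lemma comodule_counit: "comodule \<rho> \<Longrightarrow> tensor_lift (\<lambda>w h. counit D h *\<^sub>C w) (\<rho> v) = v"
  by (simp add: comodule_def)

text \<open>Coassociativity as a rewrite rule for Sweedler sums: the coaction applied again to x_0
  is traded for the coproduct of x_1. Reshufflings of iterated coactions use the axiom in this
  form.\<close>

lemma coassociative_lift:
  assumes "clinear \<rho>" "tensor_assoc (tensor_map \<rho> id (\<rho> x)) = tensor_map id (comult D) (\<rho> x)" and f: "trilin f"
  shows "tensor_lift (\<lambda>x0 x1. tensor_lift (\<lambda>a b. f a b x1) (\<rho> x0)) (\<rho> x) =
    tensor_lift (\<lambda>x0 x1. tensor_lift (\<lambda>a b. f x0 a b) (comult D x1)) (\<rho> x)"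
proof -
  have [simp]: "clinear g \<Longrightarrow> clinear (\<lambda>x. \<rho> (g x))" for g by (rule clinear_compose[OF assms(1)])
  have f': "\<forall>a b. clinear (\<lambda>c. f a b c)" "\<forall>a c. clinear (\<lambda>b. f a b c)" "\<forall>b c. clinear (\<lambda>a. f a b c)"
    using f by (simp_all add: trilin_def)
  have "tensor_lift (\<lambda>a t. tensor_lift (\<lambda>b c. f a b c) t) (tensor_assoc (tensor_map \<rho> id (\<rho> x)))
      = tensor_lift (\<lambda>a t. tensor_lift (\<lambda>b c. f a b c) t) (tensor_map id (comult D) (\<rho> x))"
    by (simp add: assms(2))
  then show ?thesis
    using f' by (simp add: tensor_lift_tensor_assoc tensor_lift_tensor_map assms(1))
qed

lemma comodule_coassoc:
  "comodule \<rho> \<Longrightarrow> trilin f \<Longrightarrow> tensor_lift (\<lambda>x0 x1. tensor_lift (\<lambda>a b. f a b x1) (\<rho> x0)) (\<rho> x) =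
    tensor_lift (\<lambda>x0 x1. tensor_lift (\<lambda>a b. f x0 a b) (comult D x1)) (\<rho> x)"
  unfolding comodule_def by (intro coassociative_lift) auto

lemma comult_comodule: "comodule (comult D)"
  using hopf unfolding comodule_def hopf_star_algebra_def by blast

lemmas comult_coassoc = comodule_coassoc[OF comult_comodule]

lemma counit_left: "clinear f \<Longrightarrow> tensor_lift (\<lambda>x y. counit D x *\<^sub>C f y) (comult D h) = f h"
  using hopf clinear_tensor_lift_swap[of f "\<lambda>x y. counit D x *\<^sub>C y" "comult D h"]
  unfolding hopf_star_algebra_def by (simp add: clinear_scale)

lemma counit_right: "clinear f \<Longrightarrow> tensor_lift (\<lambda>x y. counit D y *\<^sub>C f x) (comult D h) = f h"
  using hopf clinear_tensor_lift_swap[of f "\<lambda>x y. counit D y *\<^sub>C x" "comult D h"]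
  unfolding hopf_star_algebra_def by (simp add: clinear_scale)

lemma counit_comodule: "comodule \<rho> \<Longrightarrow> clinear f \<Longrightarrow> tensor_lift (\<lambda>x y. counit D y *\<^sub>C f x) (\<rho> h) = f h"
  using comodule_counit[of \<rho> h] clinear_tensor_lift_swap[of f "\<lambda>x y. counit D y *\<^sub>C x" "\<rho> h"]
  by (simp add: clinear_scale)

lemma comult_one: "comult D 1 = 1 \<otimes> 1" and counit_one: "counit D 1 = 1"
  using hopf by (simp_all add: hopf_star_algebra_def)

lemma Rform_mult:
  "Rform D (f * g) h = tensor_lift (\<lambda>h1 h2. Rform D f h1 * Rform D g h2) (comult D h)"
  "Rform D f (g * h) = tensor_lift (\<lambda>f1 f2. Rform D f1 h * Rform D f2 g) (comult D f)"
  using cqt by (simp_all add: coquasitriangular_def)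

lemma Rform_commutation:
  "tensor_lift (\<lambda>g1 g2. tensor_lift (\<lambda>h1 h2. Rform D g2 h2 *\<^sub>C (h1 * g1)) (comult D h)) (comult D g) =
   tensor_lift (\<lambda>g1 g2. tensor_lift (\<lambda>h1 h2. Rform D g1 h1 *\<^sub>C (g2 * h2)) (comult D h)) (comult D g)"
  using cqt by (simp add: coquasitriangular_def)

section \<open>The convolution inverse and the normalisation of the R-form\<close>

definition Rinv :: "'h \<Rightarrow> 'h \<Rightarrow> complex" where
  "Rinv = (SOME Rinv. bilinear_form Rinv \<and> (\<forall>g h.
        tensor_lift (\<lambda>g1 g2. tensor_lift (\<lambda>h1 h2. Rform D g1 h1 * Rinv g2 h2) (comult D h)) (comult D g)
          = counit D g * counit D h \<and>
        tensor_lift (\<lambda>g1 g2. tensor_lift (\<lambda>h1 h2. Rinv g1 h1 * Rform D g2 h2) (comult D h)) (comult D g)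
          = counit D g * counit D h))"

lemma Rinv: "bilinear_form Rinv"
    "tensor_lift (\<lambda>g1 g2. tensor_lift (\<lambda>h1 h2. Rform D g1 h1 * Rinv g2 h2) (comult D h)) (comult D g)
          = counit D g * counit D h"
    "tensor_lift (\<lambda>g1 g2. tensor_lift (\<lambda>h1 h2. Rinv g1 h1 * Rform D g2 h2) (comult D h)) (comult D g)
          = counit D g * counit D h"
proof -
  have "\<exists>Rinv. bilinear_form Rinv \<and> (\<forall>g h.
        tensor_lift (\<lambda>g1 g2. tensor_lift (\<lambda>h1 h2. Rform D g1 h1 * Rinv g2 h2) (comult D h)) (comult D g)
          = counit D g * counit D h \<and>
        tensor_lift (\<lambda>g1 g2. tensor_lift (\<lambda>h1 h2. Rinv g1 h1 * Rform D g2 h2) (comult D h)) (comult D g)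
          = counit D g * counit D h)"
    using cqt by (simp add: coquasitriangular_def)
  from someI_ex[OF this] show "bilinear_form Rinv"
    "tensor_lift (\<lambda>g1 g2. tensor_lift (\<lambda>h1 h2. Rform D g1 h1 * Rinv g2 h2) (comult D h)) (comult D g)
          = counit D g * counit D h"
    "tensor_lift (\<lambda>g1 g2. tensor_lift (\<lambda>h1 h2. Rinv g1 h1 * Rform D g2 h2) (comult D h)) (comult D g)
          = counit D g * counit D h"
    unfolding Rinv_def by blast+
qed

lemma Rinv_linear [simp]:
  "clinear f \<Longrightarrow> clinear (\<lambda>x. Rinv (f x) h)"
  "clinear f \<Longrightarrow> clinear (\<lambda>x. Rinv g (f x))"
  using Rinv(1) unfolding bilinear_form_def
  by (auto intro: clinear_compose clinear_compose[of "\<lambda>x. Rinv x h"])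

text \<open>In the convolution algebra, an idempotent \<open>e\<close> with right inverse
  \<open>e'\<close> is the unit: e = e(ee') = (ee)e' = ee'. Fixing one argument of the R-form to be
  1 gives such idempotents, because 1 is a product of two units; the result is the normalisation
  \<open>Rform_one\<close>.\<close>

lemma convolution_idempotent:
  assumes "clinear e" "clinear e'"
    and "\<And>h. tensor_lift (\<lambda>a b. e a * e b) (comult D h) = (e h :: complex)"
    and "\<And>h. tensor_lift (\<lambda>a b. e a * e' b) (comult D h) = counit D h"
  shows "e h = counit D h"
proof -
  note [simp] = assms(1,2)
  have [simp]: "trilin (\<lambda>a b c. e a * (e b * e' c))" by (simp add: trilin_def)
  have "e h = tensor_lift (\<lambda>a b. counit D b *\<^sub>C e a) (comult D h)"
    by (subst counit_right) simp_all
  also have "\<dots> = tensor_lift (\<lambda>a b. tensor_lift (\<lambda>c d. e a * (e c * e' d)) (comult D b)) (comult D h)"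
    by (subst assms(4)[symmetric]) (simp add: mult_tensor_lift(2)[symmetric] mult.commute)
  also have "\<dots> = tensor_lift (\<lambda>a b. tensor_lift (\<lambda>c d. e c * (e d * e' b)) (comult D a)) (comult D h)"
    by (rule comult_coassoc[symmetric]) simp
  also have "\<dots> = tensor_lift (\<lambda>a b. e a * e' b) (comult D h)"
    by (subst assms(3)[symmetric, of "_ :: 'h"]) (simp add: mult_tensor_lift mult.assoc)
  finally show ?thesis by (simp add: assms(4))
qed

lemma Rform_one: "Rform D h 1 = counit D h" "Rform D 1 h = counit D h"
proof -
  show "Rform D h 1 = counit D h"
  proof (rule convolution_idempotent[of "\<lambda>x. Rform D x 1" "\<lambda>x. Rinv x 1"])
    show "tensor_lift (\<lambda>a b. Rform D a 1 * Rform D b 1) (comult D h) = Rform D h 1" for h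
      using Rform_mult(2)[of h 1 1] by simp
    show "tensor_lift (\<lambda>a b. Rform D a 1 * Rinv b 1) (comult D h) = counit D h" for h
      using Rinv(2)[of 1 h] by (simp add: comult_one counit_one)
  qed simp_all
  show "Rform D 1 h = counit D h"
  proof (rule convolution_idempotent[of "\<lambda>x. Rform D 1 x" "\<lambda>x. Rinv 1 x"])
    show "tensor_lift (\<lambda>a b. Rform D 1 a * Rform D 1 b) (comult D h) = Rform D 1 h" for h
      using Rform_mult(1)[of 1 1 h] by simp
    show "tensor_lift (\<lambda>a b. Rform D 1 a * Rinv 1 b) (comult D h) = counit D h" for h
      using Rinv(2)[of h 1] by (simp add: comult_one counit_one)
  qed simp_all
qed

text \<open>
  The right action \<open>x \<cdot> h = x\<^sub>0 \<R>(x\<^sub>1, h)\<close> turns a comodule into a Yetter-Drinfeld module, with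
  \<open>\<Psi>(x \<otimes> y) = y\<^sub>0 \<otimes> x \<cdot> y\<^sub>1\<close>.
\<close>

definition act :: "('x::complex_vec \<Rightarrow> ('x, 'h) tensor) \<Rightarrow> 'x \<Rightarrow> 'h \<Rightarrow> 'x"
  where "act \<rho> x h = tensor_lift (\<lambda>x0 x1. Rform D x1 h *\<^sub>C x0) (\<rho> x)"

definition act_inv :: "('x::complex_vec \<Rightarrow> ('x, 'h) tensor) \<Rightarrow> 'x \<Rightarrow> 'h \<Rightarrow> 'x"
  where "act_inv \<rho> x h = tensor_lift (\<lambda>x0 x1. Rinv x1 h *\<^sub>C x0) (\<rho> x)"

lemma act_linear [simp]:
  "clinear f \<Longrightarrow> clinear (\<lambda>h. act \<rho> x (f h))"
  "comodule \<rho> \<Longrightarrow> clinear g \<Longrightarrow> clinear (\<lambda>x. act \<rho> (g x) h)"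
  "clinear f \<Longrightarrow> clinear (\<lambda>h. act_inv \<rho> x (f h))"
  "comodule \<rho> \<Longrightarrow> clinear g \<Longrightarrow> clinear (\<lambda>x. act_inv \<rho> (g x) h)"
  by (simp_all add: act_def act_inv_def comodule_lin)

lemma act_push:
  "comodule \<rho> \<Longrightarrow> act \<rho> (tensor_lift g t) h = tensor_lift (\<lambda>a b. act \<rho> (g a b) h) t"
  "act \<rho> x (tensor_lift k s) = tensor_lift (\<lambda>a b. act \<rho> x (k a b)) s"
  "comodule \<rho> \<Longrightarrow> act_inv \<rho> (tensor_lift g t) h = tensor_lift (\<lambda>a b. act_inv \<rho> (g a b) h) t"
  by (rule clinear_tensor_lift_swap; simp)+

lemma act_scale [simp]:
  "comodule \<rho> \<Longrightarrow> act \<rho> (c *\<^sub>C x) h = c *\<^sub>C act \<rho> x h" "act \<rho> x (c *\<^sub>C h) = c *\<^sub>C act \<rho> x h"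
  "comodule \<rho> \<Longrightarrow> act_inv \<rho> (c *\<^sub>C x) h = c *\<^sub>C act_inv \<rho> x h"
  by (rule clinear_scale[of "\<lambda>x. act \<rho> x h"], simp) (rule clinear_scale[of "\<lambda>h. act \<rho> x h"], simp,
    rule clinear_scale[of "\<lambda>x. act_inv \<rho> x h"], simp)

lemma act_mult:
  assumes \<rho>: "comodule \<rho>"
  shows "act \<rho> x (g * h) = act \<rho> (act \<rho> x g) h"
proof -
  have t: "trilin (\<lambda>a b c. (Rform D c g * Rform D b h) *\<^sub>C a)" by (simp add: trilin_def)
  have "act \<rho> (act \<rho> x g) h = tensor_lift (\<lambda>x0 x1. tensor_lift (\<lambda>a b. (Rform D x1 g * Rform D b h) *\<^sub>C a) (\<rho> x0)) (\<rho> x)"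
    unfolding act_def[of \<rho> x g] by (simp add: act_push \<rho>) (simp add: act_def scaleC_tensor_lift)
  also have "\<dots> = tensor_lift (\<lambda>x0 x1. tensor_lift (\<lambda>a b. (Rform D b g * Rform D a h) *\<^sub>C x0) (comult D x1)) (\<rho> x)"
    by (rule comodule_coassoc[OF \<rho> t])
  also have "\<dots> = act \<rho> x (g * h)"
    by (simp add: act_def Rform_mult scaleC_tensor_lift_left mult.commute)
  finally show ?thesis ..
qed

lemma act_one: "comodule \<rho> \<Longrightarrow> act \<rho> x 1 = x"
  by (simp add: act_def Rform_one comodule_counit)

text \<open>For a single h the two operators are in general not inverse to each other; they become
  so after summing over the two legs of the coproduct of h, because \<open>Rinv\<close> is the
  convolution inverse of R. The two statements use the two orders of that inverse.\<close>

lemma act_inv_act: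
  assumes \<rho>: "comodule \<rho>"
  shows "tensor_lift (\<lambda>h1 h2. act \<rho> (act_inv \<rho> x h2) h1) (comult D h) = counit D h *\<^sub>C x" (is "?L = _")
    and "tensor_lift (\<lambda>h1 h2. act_inv \<rho> (act \<rho> x h2) h1) (comult D h) = counit D h *\<^sub>C x" (is "?L' = _")
proof -
  note [simp] = comodule_lin[OF \<rho>]
  have [simp]: "trilin (\<lambda>a b c. (Rinv c h2 * Rform D b h1) *\<^sub>C a)"
    "trilin (\<lambda>a b c. (Rform D c h2 * Rinv b h1) *\<^sub>C a)" for h1 h2 by (simp_all add: trilin_def)
  have "act \<rho> (act_inv \<rho> x h2) h1 = tensor_lift (\<lambda>x0 x1. tensor_lift (\<lambda>a b. (Rinv x1 h2 * Rform D b h1) *\<^sub>C a) (\<rho> x0)) (\<rho> x)" for h1 h2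
    unfolding act_inv_def by (simp add: act_push \<rho>) (simp add: act_def scaleC_tensor_lift)
  then have "act \<rho> (act_inv \<rho> x h2) h1 = tensor_lift (\<lambda>x0 x1. tensor_lift (\<lambda>a b. (Rinv b h2 * Rform D a h1) *\<^sub>C x0) (comult D x1)) (\<rho> x)" for h1 h2
    by (simp add: comodule_coassoc[OF \<rho>])
  then have "?L = tensor_lift (\<lambda>x0 x1. tensor_lift (\<lambda>a b. tensor_lift (\<lambda>h1 h2. (Rform D a h1 * Rinv b h2) *\<^sub>C x0) (comult D h)) (comult D x1)) (\<rho> x)"
    by (simp add: tensor_lift_swap[of _ _ "comult D h"] mult.commute)
  also have "\<dots> = tensor_lift (\<lambda>x0 x1. counit D h *\<^sub>C counit D x1 *\<^sub>C x0) (\<rho> x)"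
    by (simp add: scaleC_tensor_lift_left[symmetric] Rinv(2)) (simp add: mult.commute)
  finally show "?L = counit D h *\<^sub>C x"
    by (simp only: scaleC_tensor_lift[symmetric] comodule_counit[OF \<rho>])
  have "act_inv \<rho> (act \<rho> x h2) h1 = tensor_lift (\<lambda>x0 x1. tensor_lift (\<lambda>a b. (Rform D x1 h2 * Rinv b h1) *\<^sub>C a) (\<rho> x0)) (\<rho> x)" for h1 h2
    unfolding act_def by (simp add: act_push \<rho>) (simp add: act_inv_def scaleC_tensor_lift)
  then have "act_inv \<rho> (act \<rho> x h2) h1 = tensor_lift (\<lambda>x0 x1. tensor_lift (\<lambda>a b. (Rform D b h2 * Rinv a h1) *\<^sub>C x0) (comult D x1)) (\<rho> x)" for h1 h2
    by (simp add: comodule_coassoc[OF \<rho>])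
  then have "?L' = tensor_lift (\<lambda>x0 x1. tensor_lift (\<lambda>a b. tensor_lift (\<lambda>h1 h2. (Rinv a h1 * Rform D b h2) *\<^sub>C x0) (comult D h)) (comult D x1)) (\<rho> x)"
    by (simp add: tensor_lift_swap[of _ _ "comult D h"] mult.commute)
  also have "\<dots> = tensor_lift (\<lambda>x0 x1. counit D h *\<^sub>C counit D x1 *\<^sub>C x0) (\<rho> x)"
    by (simp add: scaleC_tensor_lift_left[symmetric] Rinv(3)) (simp add: mult.commute)
  finally show "?L' = counit D h *\<^sub>C x"
    by (simp only: scaleC_tensor_lift[symmetric] comodule_counit[OF \<rho>])
qed

text \<open>In Sweedler form, (x.h_2)_0 \<otimes> h_1 (x.h_2)_1 = x_0.h_1 \<otimes> x_1 h_2. This is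
  \<open>Rform_commutation\<close> for x_1 and h, and the only place where that axiom enters; the
  Yang-Baxter equation, colinearity of the braiding and balancedness of the wedge product all rest
  on it.\<close>

lemma Yetter_Drinfeld:
  assumes \<rho>: "comodule \<rho>" and f: "bilin f"
  shows "tensor_lift (\<lambda>h1 h2. tensor_lift (\<lambda>a b. f a (h1 * b)) (\<rho> (act \<rho> x h2))) (comult D h) =
    tensor_lift (\<lambda>h1 h2. tensor_lift (\<lambda>x0 x1. f (act \<rho> x0 h1) (x1 * h2)) (\<rho> x)) (comult D h)"
proof -
  note [simp] = \<rho> comodule_lin[OF \<rho>]
  have fl [simp]: "clinear g \<Longrightarrow> clinear (\<lambda>b. f a (g b))" "clinear g' \<Longrightarrow> clinear (\<lambda>a. f (g' a) c)" for g a g' c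
    by (rule clinear_compose[of "f a"], use f in simp_all) (rule clinear_compose[of "\<lambda>a. f a c"], use f in simp_all)
  have t1: "trilin (\<lambda>a b c. Rform D c h2 *\<^sub>C f a (h1 * b))" for h1 h2
    by (simp add: trilin_def)
  have t2: "trilin (\<lambda>a b c. Rform D b h1 *\<^sub>C f a (c * h2))" for h1 h2
    by (simp add: trilin_def)
  have "tensor_lift (\<lambda>h1 h2. tensor_lift (\<lambda>a b. f a (h1 * b)) (\<rho> (act \<rho> x h2))) (comult D h) =
     tensor_lift (\<lambda>h1 h2. tensor_lift (\<lambda>x0 x1. tensor_lift (\<lambda>a b. Rform D x1 h2 *\<^sub>C f a (h1 * b)) (\<rho> x0)) (\<rho> x)) (comult D h)"
    unfolding act_def
    by (simp add: clinear_tensor_lift_swap[of \<rho>] comodule_linear[OF \<rho>] \<rho> clinear_scale tensor_lift_comp tensor_lift_scale)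
      (simp add: scaleC_tensor_lift)
  also have "\<dots> = tensor_lift (\<lambda>h1 h2. tensor_lift (\<lambda>x0 x1. tensor_lift (\<lambda>a b. Rform D b h2 *\<^sub>C f x0 (h1 * a)) (comult D x1)) (\<rho> x)) (comult D h)"
    by (subst comodule_coassoc[OF \<rho> t1]) simp
  also have "\<dots> = tensor_lift (\<lambda>x0 x1. tensor_lift (\<lambda>a b. tensor_lift (\<lambda>h1 h2. f x0 (Rform D b h2 *\<^sub>C (h1 * a))) (comult D h)) (comult D x1)) (\<rho> x)"
    by (simp add: tensor_lift_swap[of _ _ "comult D h"] clinear_scale)
  also have "\<dots> = tensor_lift (\<lambda>x0 x1. f x0 (tensor_lift (\<lambda>a b. tensor_lift (\<lambda>h1 h2. Rform D b h2 *\<^sub>C (h1 * a)) (comult D h)) (comult D x1))) (\<rho> x)"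
    by (simp add: clinear_tensor_lift_swap[of "f _"] f)
  also have "\<dots> = tensor_lift (\<lambda>x0 x1. f x0 (tensor_lift (\<lambda>a b. tensor_lift (\<lambda>h1 h2. Rform D a h1 *\<^sub>C (b * h2)) (comult D h)) (comult D x1))) (\<rho> x)"
    by (simp add: Rform_commutation)
  also have "\<dots> = tensor_lift (\<lambda>x0 x1. tensor_lift (\<lambda>a b. tensor_lift (\<lambda>h1 h2. f x0 (Rform D a h1 *\<^sub>C (b * h2))) (comult D h)) (comult D x1)) (\<rho> x)"
    by (simp add: clinear_tensor_lift_swap[of "f _"] f)
  also have "\<dots> = tensor_lift (\<lambda>h1 h2. tensor_lift (\<lambda>x0 x1. tensor_lift (\<lambda>a b. Rform D a h1 *\<^sub>C f x0 (b * h2)) (comult D x1)) (\<rho> x)) (comult D h)"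
    by (simp add: tensor_lift_swap[of _ _ "comult D h"] clinear_scale)
  also have "\<dots> = tensor_lift (\<lambda>h1 h2. tensor_lift (\<lambda>x0 x1. tensor_lift (\<lambda>a b. Rform D b h1 *\<^sub>C f a (x1 * h2)) (\<rho> x0)) (\<rho> x)) (comult D h)"
    by (subst comodule_coassoc[OF \<rho> t2]) simp
  also have "\<dots> = tensor_lift (\<lambda>h1 h2. tensor_lift (\<lambda>x0 x1. f (act \<rho> x0 h1) (x1 * h2)) (\<rho> x)) (comult D h)"
    by (simp add: act_def clinear_tensor_lift_swap[of "\<lambda>a. f a _"] clinear_scale[of "\<lambda>a. f a _"])
  finally show ?thesis .
qed

section \<open>The braiding, its inverse and the Yang-Baxter equation\<close>

lemma braid_linear [simp]:
  "comodule \<rho>X \<Longrightarrow> comodule \<rho>Y \<Longrightarrow> clinear (braid D \<rho>X \<rho>Y)"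
  "comodule \<rho>X \<Longrightarrow> comodule \<rho>Y \<Longrightarrow> clinear g \<Longrightarrow> clinear (\<lambda>x. braid D \<rho>X \<rho>Y (g x))"
  by (simp_all add: braid_def comodule_lin)

lemma braid_pure:
  "comodule \<rho>X \<Longrightarrow> comodule \<rho>Y \<Longrightarrow> braid D \<rho>X \<rho>Y (x \<otimes> y) = tensor_lift (\<lambda>y0 y1. y0 \<otimes> act \<rho>X x y1) (\<rho>Y y)"
  by (simp add: braid_def comodule_lin act_def tensor_lift_push tensor_lift_swap[of _ "\<rho>Y y"])

text \<open>The inverse of \<open>braid D \<rho>X \<rho>Y\<close>, with the action formed from the
  convolution inverse of R. It also leads from Y \<otimes> X to X \<otimes> Y, but is a different
  map from the braiding of Y with X.\<close>

definition braid_inv ::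
  "('x::complex_vec \<Rightarrow> ('x, 'h) tensor) \<Rightarrow> ('y::complex_vec \<Rightarrow> ('y, 'h) tensor) \<Rightarrow> ('y, 'x) tensor \<Rightarrow> ('x, 'y) tensor"
  where "braid_inv \<rho>X \<rho>Y = tensor_lift (\<lambda>y x. tensor_lift (\<lambda>y0 y1. act_inv \<rho>X x y1 \<otimes> y0) (\<rho>Y y))"

lemma braid_inv_linear [simp]:
  "comodule \<rho>X \<Longrightarrow> comodule \<rho>Y \<Longrightarrow> clinear (braid_inv \<rho>X \<rho>Y)"
  "comodule \<rho>X \<Longrightarrow> comodule \<rho>Y \<Longrightarrow> clinear g \<Longrightarrow> clinear (\<lambda>x. braid_inv \<rho>X \<rho>Y (g x))"
  by (simp_all add: braid_inv_def comodule_lin)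

lemma braid_inv_pure:
  "comodule \<rho>X \<Longrightarrow> comodule \<rho>Y \<Longrightarrow> braid_inv \<rho>X \<rho>Y (y \<otimes> x) = tensor_lift (\<lambda>y0 y1. act_inv \<rho>X x y1 \<otimes> y0) (\<rho>Y y)"
  by (simp add: braid_inv_def comodule_lin)

lemma braid_braid_inv:
  assumes X: "comodule \<rho>X" and Y: "comodule \<rho>Y"
  shows "braid D \<rho>X \<rho>Y (braid_inv \<rho>X \<rho>Y t) = t" "braid_inv \<rho>X \<rho>Y (braid D \<rho>X \<rho>Y s) = s"
proof -
  note [simp] = X Y comodule_lin[OF X] comodule_lin[OF Y]
  have t: "trilin (\<lambda>a b c. a \<otimes> act \<rho>X (act_inv \<rho>X x c) b)" "trilin (\<lambda>a b c. act_inv \<rho>X (act \<rho>X x c) b \<otimes> a)" for x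
    using X by (simp_all add: trilin_def)
  show "braid D \<rho>X \<rho>Y (braid_inv \<rho>X \<rho>Y t) = t"
  proof (rule clinear_eqI[where t = t])
    fix y x
    have "braid D \<rho>X \<rho>Y (braid_inv \<rho>X \<rho>Y (y \<otimes> x)) =
        tensor_lift (\<lambda>y0 y1. tensor_lift (\<lambda>a b. a \<otimes> act \<rho>X (act_inv \<rho>X x y1) b) (\<rho>Y y0)) (\<rho>Y y)"
      by (simp add: braid_inv_pure X Y clinear_tensor_lift_swap[of "braid D \<rho>X \<rho>Y"] braid_pure)
    also have "\<dots> = tensor_lift (\<lambda>y0 y1. tensor_lift (\<lambda>a b. y0 \<otimes> act \<rho>X (act_inv \<rho>X x b) a) (comult D y1)) (\<rho>Y y)"
      by (rule comodule_coassoc[OF Y t(1)])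
    also have "\<dots> = tensor_lift (\<lambda>y0 y1. counit D y1 *\<^sub>C (y0 \<otimes> x)) (\<rho>Y y)"
      by (simp add: tensor_lift_push(2)[symmetric] act_inv_act X)
    also have "\<dots> = y \<otimes> x" by (rule counit_comodule[OF Y]) simp
    finally show "braid D \<rho>X \<rho>Y (braid_inv \<rho>X \<rho>Y (y \<otimes> x)) = y \<otimes> x" .
  qed (simp_all add: X Y)
  show "braid_inv \<rho>X \<rho>Y (braid D \<rho>X \<rho>Y s) = s"
  proof (rule clinear_eqI[where t = s])
    fix x y
    have "braid_inv \<rho>X \<rho>Y (braid D \<rho>X \<rho>Y (x \<otimes> y)) =
        tensor_lift (\<lambda>y0 y1. tensor_lift (\<lambda>a b. act_inv \<rho>X (act \<rho>X x y1) b \<otimes> a) (\<rho>Y y0)) (\<rho>Y y)"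
      by (simp add: braid_inv_pure X Y clinear_tensor_lift_swap[of "braid_inv \<rho>X \<rho>Y"] braid_pure)
    also have "\<dots> = tensor_lift (\<lambda>y0 y1. tensor_lift (\<lambda>a b. act_inv \<rho>X (act \<rho>X x b) a \<otimes> y0) (comult D y1)) (\<rho>Y y)"
      by (rule comodule_coassoc[OF Y t(2)])
    also have "\<dots> = tensor_lift (\<lambda>y0 y1. counit D y1 *\<^sub>C (x \<otimes> y0)) (\<rho>Y y)"
      by (simp add: tensor_lift_push(3)[symmetric] act_inv_act X)
    also have "\<dots> = x \<otimes> y" by (rule counit_comodule[OF Y]) simp
    finally show "braid_inv \<rho>X \<rho>Y (braid D \<rho>X \<rho>Y (x \<otimes> y)) = x \<otimes> y" .
  qed (simp_all add: X Y)
qed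

lemma inv_braid: "comodule \<rho>X \<Longrightarrow> comodule \<rho>Y \<Longrightarrow> inv (braid D \<rho>X \<rho>Y) = braid_inv \<rho>X \<rho>Y"
  by (rule inv_equality) (rule braid_braid_inv; assumption)+

text \<open>With z carried to the front, both sides become a sum over z_0 tensored with y and x
  acted upon, and the two orders of acting and coacting on y agree by the Yetter-Drinfeld condition.
  The three comodules may differ, since V and B occur in various positions later.\<close>

lemma Yang_Baxter:
  assumes X: "comodule \<rho>X" and Y: "comodule \<rho>Y" and Z: "comodule \<rho>Z"
  shows "apl (braid D \<rho>Y \<rho>Z) (tensor_map id (braid D \<rho>X \<rho>Z) (apl (braid D \<rho>X \<rho>Y) t)) =
    tensor_map id (braid D \<rho>X \<rho>Y) (apl (braid D \<rho>X \<rho>Z) (tensor_map id (braid D \<rho>Y \<rho>Z) t))"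
proof (rule tensor3_eqI[where t = t])
  fix x y z
  note [simp] = X Y Z comodule_lin[OF X] comodule_lin[OF Y] comodule_lin[OF Z]
  have t1: "trilin (\<lambda>a b c. a \<otimes> act \<rho>Y y0 b \<otimes> act \<rho>X x (y1 * c))" for y0 y1 by (simp add: trilin_def)
  have t2: "trilin (\<lambda>a b c. a \<otimes> act \<rho>X x b \<otimes> act \<rho>Y y c)" by (simp add: trilin_def)
  have "apl (braid D \<rho>Y \<rho>Z) (tensor_map id (braid D \<rho>X \<rho>Z) (apl (braid D \<rho>X \<rho>Y) (x \<otimes> y \<otimes> z))) =
     tensor_lift (\<lambda>y0 y1. tensor_lift (\<lambda>z0 z1. tensor_lift (\<lambda>a b. a \<otimes> act \<rho>Y y0 b \<otimes> act \<rho>X x (y1 * z1)) (\<rho>Z z0)) (\<rho>Z z)) (\<rho>Y y)"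
    by (simp add: apl_pure braid_pure tensor_lift_comp tensor_lift_push act_mult)
  also have "\<dots> = tensor_lift (\<lambda>y0 y1. tensor_lift (\<lambda>z0 z1. tensor_lift (\<lambda>a b. z0 \<otimes> act \<rho>Y y0 a \<otimes> act \<rho>X x (y1 * b)) (comult D z1)) (\<rho>Z z)) (\<rho>Y y)"
    by (subst comodule_coassoc[OF Z t1]) simp
  also have "\<dots> = tensor_lift (\<lambda>z0 z1. tensor_lift (\<lambda>a b. tensor_lift (\<lambda>y0 y1. z0 \<otimes> act \<rho>Y y0 a \<otimes> act \<rho>X x (y1 * b)) (\<rho>Y y)) (comult D z1)) (\<rho>Z z)"
    by (simp add: tensor_lift_swap[of _ _ "\<rho>Y y"])
  also have "\<dots> = tensor_lift (\<lambda>z0 z1. tensor_lift (\<lambda>a b. tensor_lift (\<lambda>u0 u1. z0 \<otimes> u0 \<otimes> act \<rho>X x (a * u1)) (\<rho>Y (act \<rho>Y y b))) (comult D z1)) (\<rho>Z z)"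
    by (subst Yetter_Drinfeld[OF Y, of "\<lambda>p q. _ \<otimes> p \<otimes> act \<rho>X x q"]) simp_all
  also have "\<dots> = tensor_lift (\<lambda>z0 z1. tensor_lift (\<lambda>a b. tensor_map id (braid D \<rho>X \<rho>Y) (z0 \<otimes> act \<rho>X x a \<otimes> act \<rho>Y y b)) (comult D z1)) (\<rho>Z z)"
    by (simp add: braid_pure tensor_lift_push act_mult)
  also have "\<dots> = tensor_map id (braid D \<rho>X \<rho>Y) (tensor_lift (\<lambda>z0 z1. tensor_lift (\<lambda>a b. z0 \<otimes> act \<rho>X x a \<otimes> act \<rho>Y y b) (comult D z1)) (\<rho>Z z))"
    by (simp add: tensor_lift_push)
  also have "\<dots> = tensor_map id (braid D \<rho>X \<rho>Y) (tensor_lift (\<lambda>z0 z1. tensor_lift (\<lambda>a b. a \<otimes> act \<rho>X x b \<otimes> act \<rho>Y y z1) (\<rho>Z z0)) (\<rho>Z z))"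
    by (subst comodule_coassoc[OF Z t2]) simp
  also have "\<dots> = tensor_map id (braid D \<rho>X \<rho>Y) (apl (braid D \<rho>X \<rho>Z) (tensor_map id (braid D \<rho>Y \<rho>Z) (x \<otimes> y \<otimes> z)))"
    by (simp add: apl_pure braid_pure tensor_lift_comp tensor_lift_push)
  finally show "apl (braid D \<rho>Y \<rho>Z) (tensor_map id (braid D \<rho>X \<rho>Z) (apl (braid D \<rho>X \<rho>Y) (x \<otimes> y \<otimes> z))) =
    tensor_map id (braid D \<rho>X \<rho>Y) (apl (braid D \<rho>X \<rho>Z) (tensor_map id (braid D \<rho>Y \<rho>Z) (x \<otimes> y \<otimes> z)))" .
qed (simp_all add: X Y Z clinear_compose[OF clinear_apl] clinear_compose)

section \<open>Colinearity of the braiding, comodule algebras and involutions\<close>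

definition codiagonal ::
  "('x::complex_vec \<Rightarrow> ('x, 'h) tensor) \<Rightarrow> ('y::complex_vec \<Rightarrow> ('y, 'h) tensor) \<Rightarrow> ('x, 'y) tensor \<Rightarrow> (('x, 'y) tensor, 'h) tensor"
  where "codiagonal \<rho>X \<rho>Y = tensor_lift (\<lambda>x y. tensor_lift (\<lambda>x0 x1. tensor_lift (\<lambda>y0 y1.
       (x0 \<otimes> y0) \<otimes> (x1 * y1)) (\<rho>Y y)) (\<rho>X x))"

lemma codiagonal_pure:
  "comodule \<rho>X \<Longrightarrow> comodule \<rho>Y \<Longrightarrow> codiagonal \<rho>X \<rho>Y (x \<otimes> y) =
    tensor_lift (\<lambda>x0 x1. tensor_lift (\<lambda>y0 y1. (x0 \<otimes> y0) \<otimes> (x1 * y1)) (\<rho>Y y)) (\<rho>X x)"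
  by (simp add: codiagonal_def comodule_lin)

lemma codiagonal_linear [simp]:
  "comodule \<rho>X \<Longrightarrow> comodule \<rho>Y \<Longrightarrow> clinear (codiagonal \<rho>X \<rho>Y)"
  "comodule \<rho>X \<Longrightarrow> comodule \<rho>Y \<Longrightarrow> clinear g \<Longrightarrow> clinear (\<lambda>x. codiagonal \<rho>X \<rho>Y (g x))"
  by (simp_all add: codiagonal_def comodule_lin)

text \<open>The braiding is a comodule map, by the Yetter-Drinfeld condition for X. This is what
  makes the ideals defining B and \<Lambda> stable under the coaction.\<close>

lemma codiagonal_braid:
  assumes X: "comodule \<rho>X" and Y: "comodule \<rho>Y"
  shows "codiagonal \<rho>Y \<rho>X (braid D \<rho>X \<rho>Y t) = tensor_map (braid D \<rho>X \<rho>Y) id (codiagonal \<rho>X \<rho>Y t)"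
proof (rule clinear_eqI[where t = t])
  fix x y
  note [simp] = X Y comodule_lin[OF X] comodule_lin[OF Y]
  have t1: "trilin (\<lambda>a b c. tensor_lift (\<lambda>p q. (a \<otimes> p) \<otimes> (b * q)) (\<rho>X (act \<rho>X x c)))" by (simp add: trilin_def)
  have t2: "trilin (\<lambda>a b c. (a \<otimes> act \<rho>X x0 b) \<otimes> (x1 * c))" for x0 and x1 :: 'h by (simp add: trilin_def)
  have "codiagonal \<rho>Y \<rho>X (braid D \<rho>X \<rho>Y (x \<otimes> y)) =
    tensor_lift (\<lambda>y0 y1. tensor_lift (\<lambda>c d. tensor_lift (\<lambda>p q. (c \<otimes> p) \<otimes> (d * q)) (\<rho>X (act \<rho>X x y1))) (\<rho>Y y0)) (\<rho>Y y)"
    by (simp add: braid_pure clinear_tensor_lift_swap[of "codiagonal \<rho>Y \<rho>X"] codiagonal_pure)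
  also have "\<dots> = tensor_lift (\<lambda>y0 y1. tensor_lift (\<lambda>c d. tensor_lift (\<lambda>p q. (y0 \<otimes> p) \<otimes> (c * q)) (\<rho>X (act \<rho>X x d))) (comult D y1)) (\<rho>Y y)"
    by (rule comodule_coassoc[OF Y t1])
  also have "\<dots> = tensor_lift (\<lambda>y0 y1. tensor_lift (\<lambda>c d. tensor_lift (\<lambda>x0 x1. (y0 \<otimes> act \<rho>X x0 c) \<otimes> (x1 * d)) (\<rho>X x)) (comult D y1)) (\<rho>Y y)"
    by (subst Yetter_Drinfeld[OF X, of "\<lambda>p q. (_ \<otimes> p) \<otimes> q"]) simp_all
  also have "\<dots> = tensor_lift (\<lambda>x0 x1. tensor_lift (\<lambda>y0 y1. tensor_lift (\<lambda>c d. (y0 \<otimes> act \<rho>X x0 c) \<otimes> (x1 * d)) (comult D y1)) (\<rho>Y y)) (\<rho>X x)"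
    by (simp add: tensor_lift_swap[of _ _ "\<rho>X x"])
  also have "\<dots> = tensor_lift (\<lambda>x0 x1. tensor_lift (\<lambda>y0 y1. tensor_lift (\<lambda>c d. (c \<otimes> act \<rho>X x0 d) \<otimes> (x1 * y1)) (\<rho>Y y0)) (\<rho>Y y)) (\<rho>X x)"
    by (subst comodule_coassoc[OF Y t2]) simp
  also have "\<dots> = tensor_map (braid D \<rho>X \<rho>Y) id (codiagonal \<rho>X \<rho>Y (x \<otimes> y))"
    by (simp add: codiagonal_pure tensor_lift_push braid_pure)
  finally show "codiagonal \<rho>Y \<rho>X (braid D \<rho>X \<rho>Y (x \<otimes> y)) = tensor_map (braid D \<rho>X \<rho>Y) id (codiagonal \<rho>X \<rho>Y (x \<otimes> y))" .
qed (simp_all add: X Y)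

definition comodule_algebra :: "('x::complex_alg_1 \<Rightarrow> ('x, 'h) tensor) \<Rightarrow> bool"
  where "comodule_algebra \<rho> \<longleftrightarrow> comodule \<rho> \<and> \<rho> 1 = 1 \<otimes> 1 \<and> (\<forall>x y. \<rho> (x * y) = tensor_mult (\<rho> x) (\<rho> y))"

lemma comodule_algebraD:
  assumes "comodule_algebra \<rho>"
  shows "comodule \<rho>" "\<rho> 1 = 1 \<otimes> 1"
    "bilin f \<Longrightarrow> tensor_lift f (\<rho> (x * y)) = tensor_lift (\<lambda>x0 x1. tensor_lift (\<lambda>y0 y1. f (x0 * y0) (x1 * y1)) (\<rho> y)) (\<rho> x)"
  using assms by (simp_all add: comodule_algebra_def tensor_lift_tensor_mult)

lemma act_one_left: "comodule_algebra \<rho> \<Longrightarrow> act \<rho> 1 h = counit D h *\<^sub>C 1"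
  by (simp add: act_def comodule_algebraD Rform_one comodule_lin)

text \<open>Multiplicativity of R in its first argument makes a comodule algebra a module algebra;
  it is the hexagon identity for a product crossing another comodule.\<close>

lemma act_times:
  assumes \<rho>: "comodule_algebra \<rho>"
  shows "act \<rho> (x * y) h = tensor_lift (\<lambda>h1 h2. act \<rho> x h1 * act \<rho> y h2) (comult D h)"
proof -
  have "act \<rho> (x * y) h = tensor_lift (\<lambda>x0 x1. tensor_lift (\<lambda>y0 y1. tensor_lift (\<lambda>h1 h2. (Rform D x1 h1 * Rform D y1 h2) *\<^sub>C (x0 * y0)) (comult D h)) (\<rho> y)) (\<rho> x)"
    by (simp add: act_def comodule_algebraD[OF \<rho>] Rform_mult scaleC_tensor_lift_left)
  also have "\<dots> = tensor_lift (\<lambda>h1 h2. tensor_lift (\<lambda>x0 x1. tensor_lift (\<lambda>y0 y1. (Rform D x1 h1 * Rform D y1 h2) *\<^sub>C (x0 * y0)) (\<rho> y)) (\<rho> x)) (comult D h)"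
    by (simp add: tensor_lift_swap[of _ _ "comult D h"])
  also have "\<dots> = tensor_lift (\<lambda>h1 h2. act \<rho> x h1 * act \<rho> y h2) (comult D h)"
    unfolding act_def by (simp only: mult_tensor_lift(1)) (simp add: mult_tensor_lift(2) scaleC_tensor_lift mult.commute)
  finally show ?thesis .
qed

definition comodule_star :: "('x::complex_vec \<Rightarrow> ('x, 'h) tensor) \<Rightarrow> ('x \<Rightarrow> 'x) \<Rightarrow> bool"
  where "comodule_star \<rho> st \<longleftrightarrow> antilinear st \<and> (\<forall>x. \<rho> (st x) = tensor_map_cnj st (hstar D) (\<rho> x))"

lemma hstar_antilinear [simp]: "antilinear (hstar D)"
  using hopf by (simp add: hopf_star_algebra_def antilinear_involution_def)

text \<open>The coactions of the starred elements produce R at the stars of y_1 and x_1, which the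
  real type condition turns into the conjugate of R(x_1, y_1). Hence reversal combined with the
  stars commutes with the braiding.\<close>

lemma braid_star:
  assumes X: "comodule \<rho>X" "comodule_star \<rho>X sX" and Y: "comodule \<rho>Y" "comodule_star \<rho>Y sY"
    and real: "real_type D"
  shows "braid D \<rho>Y \<rho>X (sY y \<otimes> sX x) = tensor_lift_cnj (\<lambda>a b. sX b \<otimes> sY a) (braid D \<rho>X \<rho>Y (x \<otimes> y))"
proof -
  note [simp] = comodule_lin[OF X(1)] comodule_lin[OF Y(1)]
  have [simp]: "antilinear sX" "antilinear sY" and s: "\<And>x. \<rho>X (sX x) = tensor_map_cnj sX (hstar D) (\<rho>X x)"
      "\<And>x. \<rho>Y (sY x) = tensor_map_cnj sY (hstar D) (\<rho>Y x)"
    using X Y by (simp_all add: comodule_star_def)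
  have "braid D \<rho>Y \<rho>X (sY y \<otimes> sX x) =
     tensor_lift_cnj (\<lambda>y0 y1. tensor_lift_cnj (\<lambda>x0 x1. Rform D (hstar D y1) (hstar D x1) *\<^sub>C (sX x0 \<otimes> sY y0)) (\<rho>X x)) (\<rho>Y y)"
    by (simp add: braid_def X Y s tensor_lift_tensor_map_cnj)
  also have "\<dots> = tensor_lift_cnj (\<lambda>x0 x1. tensor_lift_cnj (\<lambda>y0 y1. cnj (Rform D x1 y1) *\<^sub>C (sX x0 \<otimes> sY y0)) (\<rho>Y y)) (\<rho>X x)"
    using real by (subst tensor_lift_cnj_swap) (simp add: real_type_def)
  also have "\<dots> = tensor_lift_cnj (\<lambda>a b. sX b \<otimes> sY a) (braid D \<rho>X \<rho>Y (x \<otimes> y))"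
    by (simp add: braid_def X Y antilinear_tensor_lift_swap tensor_lift_cnj_scale tensor_lift_cnj_pure)
  finally show ?thesis .
qed

end

section \<open>Reduced expressions in the symmetric group\<close>

abbreviation adj :: "nat \<Rightarrow> nat \<Rightarrow> nat" where "adj i \<equiv> Transposition.transpose i (Suc i)"

definition word_perm :: "nat list \<Rightarrow> nat \<Rightarrow> nat"
  where "word_perm is = foldr (\<lambda>i f. adj i \<circ> f) is id"

definition word_op :: "(nat \<Rightarrow> 'a \<Rightarrow> 'a) \<Rightarrow> nat list \<Rightarrow> 'a \<Rightarrow> 'a"
  where "word_op P is = foldr (\<lambda>i f. P i \<circ> f) is id"

lemma word_op_simps [simp]: "word_op P [] t = t" "word_op P (i # is) t = P i (word_op P is t)"
  "word_op P (is @ js) t = word_op P is (word_op P js t)"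
  by (simp_all add: word_op_def) (induct "is"; simp)

lemma word_perm_simps [simp]: "word_perm [] = id" "word_perm (i # is) = adj i \<circ> word_perm is"
  "word_perm (is @ js) = word_perm is \<circ> word_perm js"
  by (simp_all add: word_perm_def) (induct "is"; simp add: comp_assoc)

definition valid_word :: "nat \<Rightarrow> nat list \<Rightarrow> bool"
  where "valid_word n is \<longleftrightarrow> (\<forall>i \<in> set is. Suc i < n)"

lemma valid_word_simps [simp]: "valid_word n []" "valid_word n (i # is) \<longleftrightarrow> Suc i < n \<and> valid_word n is"
  "valid_word n (is @ js) \<longleftrightarrow> valid_word n is \<and> valid_word n js"
  by (auto simp: valid_word_def)

section \<open>The number of inversions as length function\<close>

definition inversions :: "nat \<Rightarrow> (nat \<Rightarrow> nat) \<Rightarrow> (nat \<times> nat) set"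
  where "inversions n \<sigma> = {(a, b). a < b \<and> b < n \<and> \<sigma> b < \<sigma> a}"

definition ninv :: "nat \<Rightarrow> (nat \<Rightarrow> nat) \<Rightarrow> nat"
  where "ninv n \<sigma> = card (inversions n \<sigma>)"

lemma finite_inversions [simp]: "finite (inversions n \<sigma>)"
  by (rule finite_subset[of _ "{..<n} \<times> {..<n}"]) (auto simp: inversions_def)

lemma adj_permutes: "Suc i < n \<Longrightarrow> adj i permutes {..<n}"
  by (rule permutes_swap_id) auto

lemma word_perm_permutes: "valid_word n is \<Longrightarrow> word_perm is permutes {..<n}"
proof (induct "is")
  case Nil
  show ?case by (simp only: word_perm_simps permutes_id)
next
  case (Cons i "is")
  then show ?case unfolding word_perm_simps by (intro permutes_compose[OF _ adj_permutes]) simp_all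
qed

lemma adj_adj [simp]: "adj i \<circ> adj i = id" "adj i (adj i a) = a" "\<sigma> \<circ> adj i \<circ> adj i = \<sigma>"
  by (auto simp: fun_eq_iff)

lemma adj_less: "a < b \<Longrightarrow> (a, b) \<noteq> (i, Suc i) \<Longrightarrow> adj i a < adj i b"
  by (auto simp: Transposition.transpose_def)

lemma adj_bound: "Suc i < n \<Longrightarrow> a < n \<Longrightarrow> adj i a < n"
  by (auto simp: Transposition.transpose_def)

text \<open>Relabelling both positions by \<open>adj i\<close> matches the inversions of \<sigma>
  with those of \<sigma> \<circ> adj i other than (i, Suc i), since \<open>adj i\<close> keeps the
  order of every other pair of positions.\<close>

lemma ninv_ascent:
  assumes "Suc i < n" "\<sigma> i < \<sigma> (Suc i)"
  shows "ninv n (\<sigma> \<circ> adj i) = Suc (ninv n \<sigma>)"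
proof -
  have "inversions n (\<sigma> \<circ> adj i) = insert (i, Suc i) (map_prod (adj i) (adj i) ` inversions n \<sigma>)" (is "?A = ?B")
  proof
    show "?A \<subseteq> ?B"
    proof clarify
      fix a b assume ab: "(a, b) \<in> ?A" "(a, b) \<notin> map_prod (adj i) (adj i) ` inversions n \<sigma>"
      have "a = i \<and> b = Suc i"
      proof (rule ccontr)
        assume *: "\<not> ?thesis"
        then have "(adj i a, adj i b) \<in> inversions n \<sigma>"
          using ab(1) assms adj_less[of a b i] by (auto simp: inversions_def adj_bound)
        then have "map_prod (adj i) (adj i) (adj i a, adj i b) \<in> map_prod (adj i) (adj i) ` inversions n \<sigma>"
          by (rule imageI)
        then show False using ab(2) by simp
      qed
      then show "a = i \<and> b = Suc i" .
    qed
    show "?B \<subseteq> ?A"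
      using assms by (auto simp: inversions_def adj_bound intro: adj_less)
  qed
  moreover have "(i, Suc i) \<notin> map_prod (adj i) (adj i) ` inversions n \<sigma>"
  proof
    assume "(i, Suc i) \<in> map_prod (adj i) (adj i) ` inversions n \<sigma>"
    then obtain a b where "i = adj i a" "Suc i = adj i b" "a < b"
      by (auto simp: inversions_def)
    then have "adj i i = a" "adj i (Suc i) = b" by (metis adj_adj(2))+
    with \<open>a < b\<close> show False by simp
  qed
  moreover have "inj_on (map_prod (adj i) (adj i)) (inversions n \<sigma>)"
    by (rule inj_onI) (metis adj_adj(2) map_prod_simp prod.collapse prod.inject)
  ultimately show ?thesis by (simp add: ninv_def card_image)
qed

lemma ninv_descent:
  assumes "Suc i < n" "\<sigma> (Suc i) < \<sigma> i"
  shows "ninv n \<sigma> = Suc (ninv n (\<sigma> \<circ> adj i))"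
  using ninv_ascent[of i n "\<sigma> \<circ> adj i"] assms by simp

lemma ninv_step:
  assumes "Suc i < n" "inj \<sigma>"
  shows "ninv n (\<sigma> \<circ> adj i) \<le> Suc (ninv n \<sigma>)"
    "\<sigma> i < \<sigma> (Suc i) \<or> \<sigma> (Suc i) < \<sigma> i"
proof -
  show *: "\<sigma> i < \<sigma> (Suc i) \<or> \<sigma> (Suc i) < \<sigma> i"
    using injD[OF assms(2), of i "Suc i"] by force
  then show "ninv n (\<sigma> \<circ> adj i) \<le> Suc (ninv n \<sigma>)"
    using ninv_ascent[OF assms(1), of \<sigma>] ninv_descent[OF assms(1), of \<sigma>] by auto
qed

lemma inj_word_perm: "inj (word_perm is)"
proof (induct "is")
  case (Cons i "is")
  then show ?case by (auto simp: inj_def) (metis adj_adj(2))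
qed simp

lemma ninv_word_perm: "valid_word n is \<Longrightarrow> ninv n (word_perm is) \<le> length is"
proof (induct "is" rule: rev_induct)
  case Nil
  have "inversions n id = {}" by (auto simp: inversions_def)
  then show ?case by (simp add: ninv_def id_def)
next
  case (snoc i "is")
  then show ?case using ninv_step(1)[OF _ inj_word_perm, of i n "is"] by (simp add: comp_def)
qed

text \<open>Strict growth from position 0 gives a \<le> \<sigma> a, and strict growth from a up to
  the last position, whose image is below n, gives the opposite inequality.\<close>

lemma no_descent_id:
  assumes \<sigma>: "\<sigma> permutes {..<n}" and nd: "\<And>i. Suc i < n \<Longrightarrow> \<sigma> i < \<sigma> (Suc i)"
  shows "\<sigma> = id"
proof
  fix a
  show "\<sigma> a = id a"
  proof (cases "a < n")
    case True
    have up: "a < n \<Longrightarrow> a \<le> \<sigma> a" for a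
    proof (induct a)
      case (Suc a)
      then show ?case using nd[of a] by simp
    qed simp
    have "k \<le> n - 1 - a \<Longrightarrow> \<sigma> a + k \<le> \<sigma> (a + k)" for k
    proof (induct k)
      case (Suc k)
      then have "Suc (a + k) < n" by linarith
      then show ?case using nd[of "a + k"] Suc by simp
    qed simp
    from this[of "n - 1 - a"] have "\<sigma> a + (n - 1 - a) \<le> \<sigma> (n - 1)" using True by simp
    moreover have "\<sigma> (n - 1) < n" using permutes_in_image[OF \<sigma>, of "n - 1"] True by simp
    ultimately show ?thesis using up[OF True] True by simp
  next
    case False
    then show ?thesis using permutes_not_in[OF \<sigma>, of a] by simp
  qed
qed

text \<open>Undoing a descent on the right lowers the number of inversions by one, and a permutation
  without descents is the identity.\<close>

lemma exists_word:
  assumes "\<sigma> permutes {..<n}"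
  shows "\<exists>is. valid_word n is \<and> word_perm is = \<sigma> \<and> length is = ninv n \<sigma>"
  using assms
proof (induct "ninv n \<sigma>" arbitrary: \<sigma> rule: less_induct)
  case less
  show ?case
  proof (cases "\<exists>i. Suc i < n \<and> \<sigma> (Suc i) < \<sigma> i")
    case True
    then obtain i where i: "Suc i < n" "\<sigma> (Suc i) < \<sigma> i" by blast
    from less(1)[of "\<sigma> \<circ> adj i"] obtain js where
      "valid_word n js" "word_perm js = \<sigma> \<circ> adj i" "length js = ninv n (\<sigma> \<circ> adj i)"
      using ninv_descent[of i n \<sigma>, OF i] permutes_compose[OF adj_permutes[OF i(1)] less(2)] by auto
    then show ?thesis
      using ninv_descent[of i n \<sigma>, OF i] i by (intro exI[of _ "js @ [i]"]) simp
  next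
    case False
    then have "\<sigma> = id"
      using no_descent_id[OF less(2)] ninv_step(2)[OF _ permutes_inj[OF less(2)]] by blast
    then show ?thesis
      using ninv_word_perm[of n "[]"] by (intro exI[of _ "[]"]) simp
  qed
qed

lemma expression_of_iff: "expression_of n \<sigma> is \<longleftrightarrow> valid_word n is \<and> word_perm is = \<sigma>"
  by (simp add: expression_of_def valid_word_def word_perm_def)

lemma reduced_expression_iff:
  assumes "\<sigma> permutes {..<n}"
  shows "reduced_expression_of n \<sigma> is \<longleftrightarrow> valid_word n is \<and> word_perm is = \<sigma> \<and> length is = ninv n \<sigma>"
proof -
  obtain ks where "valid_word n ks \<and> word_perm ks = \<sigma> \<and> length ks = ninv n \<sigma>"
    using exists_word[OF assms] by blast
  then show ?thesis
    using ninv_word_perm[of n] unfolding reduced_expression_of_def expression_of_iff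
    by (metis le_antisym)
qed

definition some_word :: "nat \<Rightarrow> (nat \<Rightarrow> nat) \<Rightarrow> nat list"
  where "some_word n \<sigma> = (SOME is. reduced_expression_of n \<sigma> is)"

lemma some_word:
  assumes "\<sigma> permutes {..<n}"
  shows "valid_word n (some_word n \<sigma>)" "word_perm (some_word n \<sigma>) = \<sigma>" "length (some_word n \<sigma>) = ninv n \<sigma>"
proof -
  have "reduced_expression_of n \<sigma> (some_word n \<sigma>)"
    unfolding some_word_def using exists_word[OF assms] reduced_expression_iff[OF assms] by (metis someI_ex)
  then show "valid_word n (some_word n \<sigma>)" "word_perm (some_word n \<sigma>) = \<sigma>" "length (some_word n \<sigma>) = ninv n \<sigma>"
    using reduced_expression_iff[OF assms] by auto
qed

text \<open>The carrier \<open>A\<close> is part of the data because \<open>Psi_at\<close> is the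
  identity on words too short for it: the cubic relation holds in degree n, where all the letters
  exist, but can fail in smaller degrees.\<close>

locale braid_operators =
  fixes n :: nat and P :: "nat \<Rightarrow> 'a \<Rightarrow> 'a" and A :: "'a set"
  assumes closed: "\<And>i t. Suc i < n \<Longrightarrow> t \<in> A \<Longrightarrow> P i t \<in> A"
    and far: "\<And>i j t. Suc i < j \<Longrightarrow> Suc j < n \<Longrightarrow> t \<in> A \<Longrightarrow> P i (P j t) = P j (P i t)"
    and braid: "\<And>i t. Suc (Suc i) < n \<Longrightarrow> t \<in> A \<Longrightarrow> P i (P (Suc i) (P i t)) = P (Suc i) (P i (P (Suc i) t))"
begin

text \<open>
  Matsumoto's theorem: two reduced words with different last letters are compared through a third
  one ending in the longest element of the dihedral subgroup generated by these letters.
\<close>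

lemma word_op_unique:
  assumes "valid_word n is" "valid_word n js" "word_perm is = word_perm js"
    and "length is = ninv n (word_perm is)" "length js = ninv n (word_perm js)" "t \<in> A"
  shows "word_op P is t = word_op P js t"
  using assms
proof (induct "length is" arbitrary: "is" js t rule: less_induct)
  case less
  define \<sigma> where "\<sigma> = word_perm is"
  have inj: "inj \<sigma>" unfolding \<sigma>_def by (rule inj_word_perm)
  have perm: "\<sigma> permutes {..<n}" unfolding \<sigma>_def by (rule word_perm_permutes[OF less(2)])
  have l: "length is = ninv n \<sigma>" "length js = ninv n \<sigma>" "word_perm js = \<sigma>"
    using less(4-6) by (simp_all only: \<sigma>_def)
  show ?case
  proof (cases "is = []")
    case True
    then show ?thesis using l by simp
  next
    case False
    then obtain is' i where is': "is = is' @ [i]" by (metis rev_exhaust)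
    have "js \<noteq> []" using l False by (metis length_0_conv)
    then obtain js' j where js': "js = js' @ [j]" by (metis rev_exhaust)
    \<comment> \<open>The last letter k of a reduced word is a descent of \<sigma>: otherwise the
      remaining letters would express a permutation with more inversions than \<sigma>, for which
      they are too few.\<close>
    have last_descent: "Suc k < n \<and> valid_word n ks' \<and> word_perm ks' = \<sigma> \<circ> adj k \<and> \<sigma> (Suc k) < \<sigma> k
        \<and> Suc (length ks') = ninv n \<sigma> \<and> length ks' = ninv n (\<sigma> \<circ> adj k)"
      if ks: "ks = ks' @ [k]" "valid_word n ks" "length ks = ninv n \<sigma>" "word_perm ks = \<sigma>" for ks ks' k
    proof -
      have k: "Suc k < n" "valid_word n ks'" using ks by simp_all
      have s: "word_perm ks' = \<sigma> \<circ> adj k" using ks(4) unfolding ks(1) by (auto simp: fun_eq_iff) (metis adj_adj(2))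
      have "\<sigma> (Suc k) < \<sigma> k"
      proof (rule ccontr)
        assume "\<not> ?thesis"
        then have "ninv n (\<sigma> \<circ> adj k) = Suc (length ks)"
          unfolding ks(3) using ninv_ascent[OF k(1), of \<sigma>] ninv_step(2)[OF k(1) inj] by blast
        then show False using ninv_word_perm[OF k(2)] unfolding s ks(1) by simp
      qed
      then show ?thesis using k s ninv_descent[of k n \<sigma>] ks(3) unfolding ks(1) by simp
    qed
    have i: "Suc i < n \<and> valid_word n is' \<and> word_perm is' = \<sigma> \<circ> adj i \<and> \<sigma> (Suc i) < \<sigma> i
        \<and> Suc (length is') = ninv n \<sigma> \<and> length is' = ninv n (\<sigma> \<circ> adj i)"
      by (rule last_descent[OF is' less(2) l(1) \<sigma>_def[symmetric]])
    have j: "Suc j < n \<and> valid_word n js' \<and> word_perm js' = \<sigma> \<circ> adj j \<and> \<sigma> (Suc j) < \<sigma> j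
        \<and> Suc (length js') = ninv n \<sigma> \<and> length js' = ninv n (\<sigma> \<circ> adj j)"
      by (rule last_descent[OF js' less(3) l(2) l(3)])
    have IH: "word_op P us s = word_op P vs s"
      if "Suc (length us) = ninv n \<sigma>" "valid_word n us" "valid_word n vs" "word_perm us = \<rho>" "word_perm vs = \<rho>"
        "length us = ninv n \<rho>" "length vs = ninv n \<rho>" "s \<in> A" for us vs \<rho> s
      using that l(1) by (intro less(1)) simp_all
    have *: "word_op P us (P i t) = word_op P vs (P j t)"
      if ij: "i < j" and i: "Suc i < n \<and> valid_word n us \<and> word_perm us = \<sigma> \<circ> adj i \<and> \<sigma> (Suc i) < \<sigma> i
        \<and> Suc (length us) = ninv n \<sigma> \<and> length us = ninv n (\<sigma> \<circ> adj i)"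
      and j: "Suc j < n \<and> valid_word n vs \<and> word_perm vs = \<sigma> \<circ> adj j \<and> \<sigma> (Suc j) < \<sigma> j
        \<and> Suc (length vs) = ninv n \<sigma> \<and> length vs = ninv n (\<sigma> \<circ> adj j)" for us vs i j
    proof (cases "j = Suc i")
      case False
      then have ij': "Suc i < j" using ij by simp
      \<comment> \<open>The two generators commute, so \<tau> followed by them in either order is
        \<sigma>. A reduced word of \<tau>, extended by i and j in both orders, links the two given
        words.\<close>
      define \<tau> where "\<tau> = \<sigma> \<circ> adj i \<circ> adj j"
      have \<tau>': "\<tau> = \<sigma> \<circ> adj j \<circ> adj i"
        using ij' by (auto simp: \<tau>_def fun_eq_iff Transposition.transpose_def)
      have "\<tau> permutes {..<n}" unfolding \<tau>_def using i j perm
        by (intro permutes_compose adj_permutes) auto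
      then obtain ks where ks: "valid_word n ks" "word_perm ks = \<tau>" "length ks = ninv n \<tau>"
        using exists_word by blast
      have d: "(\<sigma> \<circ> adj i) (Suc j) < (\<sigma> \<circ> adj i) j" "(\<sigma> \<circ> adj j) (Suc i) < (\<sigma> \<circ> adj j) i"
        using ij' i j by (auto simp: Transposition.transpose_def)
      have n: "ninv n (\<sigma> \<circ> adj i) = Suc (ninv n \<tau>)" "ninv n (\<sigma> \<circ> adj j) = Suc (ninv n \<tau>)"
        using ninv_descent[OF _ d(1), of n] ninv_descent[OF _ d(2), of n] i j by (simp_all only: \<tau>_def[symmetric] \<tau>'[symmetric])
      have p: "word_perm (ks @ [j]) = \<sigma> \<circ> adj i" by (simp add: ks(2) \<tau>_def fun_eq_iff)
      have p': "word_perm (ks @ [i]) = \<sigma> \<circ> adj j" by (simp add: ks(2) \<tau>' fun_eq_iff)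
      have "word_op P us (P i t) = word_op P (ks @ [j]) (P i t)"
        by (rule IH) (use i j ks n p p' in \<open>auto simp: closed less(7)\<close>)
      moreover have "word_op P vs (P j t) = word_op P (ks @ [i]) (P j t)"
        by (rule IH) (use i j ks n p p' in \<open>auto simp: closed less(7)\<close>)
      ultimately show ?thesis using far[OF ij' _ less(7)] j by simp
    next
      case True
      \<comment> \<open>Both letters are descents of \<sigma>, so \<sigma> ends in the longest
        element of the copy of S_3 which they generate; removing it lowers the number of inversions
        by three.\<close>
      define \<tau> where "\<tau> = \<sigma> \<circ> adj i \<circ> adj j \<circ> adj i"
      have \<tau>': "\<tau> = \<sigma> \<circ> adj j \<circ> adj i \<circ> adj j"
        using True by (auto simp: \<tau>_def fun_eq_iff Transposition.transpose_def)
      have "\<tau> permutes {..<n}" unfolding \<tau>_def using i j perm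
        by (intro permutes_compose adj_permutes) auto
      then obtain ks where ks: "valid_word n ks" "word_perm ks = \<tau>" "length ks = ninv n \<tau>"
        using exists_word by blast
      have d: "(\<sigma> \<circ> adj i) (Suc j) < (\<sigma> \<circ> adj i) j" "(\<sigma> \<circ> adj j) (Suc i) < (\<sigma> \<circ> adj j) i"
        "(\<sigma> \<circ> adj i \<circ> adj j) (Suc i) < (\<sigma> \<circ> adj i \<circ> adj j) i" "(\<sigma> \<circ> adj j \<circ> adj i) (Suc j) < (\<sigma> \<circ> adj j \<circ> adj i) j"
        using True i j by (auto simp: Transposition.transpose_def)
      have n: "ninv n (\<sigma> \<circ> adj i) = Suc (Suc (ninv n \<tau>))" "ninv n (\<sigma> \<circ> adj j) = Suc (Suc (ninv n \<tau>))"
        using ninv_descent[OF _ d(1), of n] ninv_descent[OF _ d(2), of n]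
          ninv_descent[OF _ d(3), of n] ninv_descent[OF _ d(4), of n] i j
        by (simp_all only: \<tau>_def[symmetric] \<tau>'[symmetric])
      have p: "word_perm (ks @ [i, j]) = \<sigma> \<circ> adj i" by (simp add: ks(2) \<tau>_def fun_eq_iff)
      have p': "word_perm (ks @ [j, i]) = \<sigma> \<circ> adj j" by (simp add: ks(2) \<tau>' fun_eq_iff)
      have "word_op P us (P i t) = word_op P (ks @ [i, j]) (P i t)"
        by (rule IH) (use i j ks n p p' in \<open>auto simp: closed less(7)\<close>)
      moreover have "word_op P vs (P j t) = word_op P (ks @ [j, i]) (P j t)"
        by (rule IH) (use i j ks n p p' in \<open>auto simp: closed less(7)\<close>)
      ultimately show ?thesis using braid[OF _ less(7), of i] j True by simp
    qed
    have "word_op P is' (P i t) = word_op P js' (P j t)"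
    proof (cases i j rule: linorder_cases)
      case equal
      then show ?thesis using i j \<open>t \<in> A\<close> IH[of is' js' "\<sigma> \<circ> adj i" "P i t"] by (auto simp: closed)
    next
      case less
      then show ?thesis using i j by (rule *)
    next
      case greater
      then show ?thesis using j i by (rule *[symmetric])
    qed
    then show ?thesis by (simp add: is' js')
  qed
qed

lemma word_op_some_word:
  assumes "valid_word n is" "length is = ninv n (word_perm is)" "t \<in> A"
  shows "word_op P (some_word n (word_perm is)) t = word_op P is t"
  using assms some_word[OF word_perm_permutes[OF assms(1)]] by (intro word_op_unique) auto

end

section \<open>Coset decomposition of S_{n+1} over the permutations fixing 0\<close>

definition shift_perm :: "(nat \<Rightarrow> nat) \<Rightarrow> nat \<Rightarrow> nat"
  where "shift_perm \<tau> a = (case a of 0 \<Rightarrow> 0 | Suc b \<Rightarrow> Suc (\<tau> b))"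

lemma shift_perm_simps [simp]: "shift_perm \<tau> 0 = 0" "shift_perm \<tau> (Suc b) = Suc (\<tau> b)"
  by (simp_all add: shift_perm_def)

lemma word_perm_map_Suc: "word_perm (map Suc is) = shift_perm (word_perm is)"
proof (induct "is")
  case Nil
  then show ?case by (auto simp: fun_eq_iff shift_perm_def split: nat.split)
next
  case (Cons i "is")
  then show ?case
    by (auto simp: fun_eq_iff shift_perm_def Transposition.transpose_def split: nat.split)
qed

lemma ninv_shift_perm: "ninv (Suc n) (shift_perm \<tau>) = ninv n \<tau>"
proof -
  have "inversions (Suc n) (shift_perm \<tau>) = map_prod Suc Suc ` inversions n \<tau>"
  proof
    show "inversions (Suc n) (shift_perm \<tau>) \<subseteq> map_prod Suc Suc ` inversions n \<tau>"
    proof clarify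
      fix a b assume "(a, b) \<in> inversions (Suc n) (shift_perm \<tau>)"
      then obtain a' b' where "a = Suc a'" "b = Suc b'" "(a', b') \<in> inversions n \<tau>"
        by (cases a; cases b) (auto simp: inversions_def)
      then show "(a, b) \<in> map_prod Suc Suc ` inversions n \<tau>"
        using image_eqI[of "(a, b)" "map_prod Suc Suc" "(a', b')"] by simp
    qed
  qed (auto simp: inversions_def)
  moreover have "inj_on (map_prod Suc Suc) (inversions n \<tau>)" by (auto simp: inj_on_def)
  ultimately show ?thesis by (simp add: ninv_def card_image)
qed

text \<open>This cycle, which sends k to 0 and keeps the order of all other positions, is the
  minimal representative of its coset.\<close>

lemma word_perm_upt: "word_perm [0..<k] a = (if a < k then Suc a else if a = k then 0 else a)"
proof (induct k arbitrary: a)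
  case (Suc k)
  then show ?case by (auto simp: Transposition.transpose_def)
qed simp

text \<open>Each appended letter k meets an ascent: before it, position k carries the value 0 and
  position k + 1 a positive value. Lengths therefore add, and a reduced word stays reduced after
  shifting and appending.\<close>

lemma ninv_shift_upt: "k \<le> n \<Longrightarrow> ninv (Suc n) (word_perm (map Suc is @ [0..<k])) = ninv n (word_perm is) + k"
proof (induct k)
  case 0
  then show ?case by (simp add: word_perm_map_Suc ninv_shift_perm)
next
  case (Suc k)
  have "ninv (Suc n) (word_perm (map Suc is @ [0..<k]) \<circ> adj k) = Suc (ninv (Suc n) (word_perm (map Suc is @ [0..<k])))"
    using Suc.prems by (intro ninv_ascent) (auto simp: word_perm_upt word_perm_map_Suc)
  then show ?case using Suc by (simp add: comp_def)
qed

text \<open>The index k is recovered as the position sent to 0, and \<tau> from the values at the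
  remaining positions, which gives injectivity; surjectivity follows by counting, from (n + 1) n! =
  (n + 1)!.\<close>

lemma permutes_shift_decomposition:
  "bij_betw (\<lambda>(k, \<tau>). word_perm (map Suc (some_word n \<tau>) @ [0..<k]))
    ({..n} \<times> {\<tau>. \<tau> permutes {..<n}}) {\<sigma>. \<sigma> permutes {..<Suc n}}" (is "bij_betw ?f ?A ?B")
proof -
  have val: "?f (k, \<tau>) a = shift_perm \<tau> (word_perm [0..<k] a)" if "\<tau> permutes {..<n}" for k \<tau> a
    using that by (simp add: word_perm_map_Suc some_word)
  have inj: "inj_on ?f ?A"
  proof (rule inj_onI)
    fix x y assume xy: "x \<in> ?A" "y \<in> ?A" "?f x = ?f y"
    obtain k \<tau> k' \<tau>' where x: "x = (k, \<tau>)" and y: "y = (k', \<tau>')" by (metis surj_pair)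
    have \<tau>: "\<tau> permutes {..<n}" "\<tau>' permutes {..<n}"
      and eq: "word_perm (map Suc (some_word n \<tau>) @ [0..<k]) = word_perm (map Suc (some_word n \<tau>') @ [0..<k'])"
      using xy by (simp_all add: x y)
    have e: "shift_perm \<tau> (word_perm [0..<k] a) = shift_perm \<tau>' (word_perm [0..<k'] a)" for a
      using val[OF \<tau>(1), of k a] val[OF \<tau>(2), of k' a] fun_cong[OF eq, of a] by simp
    have "shift_perm \<tau>' (word_perm [0..<k'] k) = 0" using e[of k] by (simp add: word_perm_upt)
    then have k: "k = k'"
      by (auto simp: word_perm_upt shift_perm_def split: if_splits nat.splits)
    have "\<tau> a = \<tau>' a" for a
    proof -
      have "shift_perm \<tau> (Suc a) = shift_perm \<tau>' (Suc a)"
        using e[of "if a < k then a else Suc a"] k by (simp add: word_perm_upt split: if_splits)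
      then show ?thesis by simp
    qed
    then show "x = y" using k x y by auto
  qed
  have sub: "?f ` ?A \<subseteq> ?B"
  proof (rule image_subsetI)
    fix x assume "x \<in> ?A"
    then obtain k \<tau> where x: "x = (k, \<tau>)" and *: "k \<in> {..n}" "\<tau> permutes {..<n}" by auto
    then have "valid_word (Suc n) (map Suc (some_word n \<tau>) @ [0..<k])"
      using some_word(1)[of \<tau> n] by (auto simp: valid_word_def)
    from word_perm_permutes[OF this] show "?f x \<in> ?B" unfolding x by simp
  qed
  have "card ?A = card ?B"
    by (simp add: card_cartesian_product card_permutations[of "{..<n}" n] card_permutations[of "{..<Suc n}" "Suc n"])
  then have "?f ` ?A = ?B"
    using sub inj by (intro card_subset_eq) (auto simp: card_image finite_permutations)
  with inj show ?thesis by (simp add: bij_betw_def)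
qed

definition braid_sum :: "nat \<Rightarrow> (nat \<Rightarrow> 'a \<Rightarrow> 'a) \<Rightarrow> 'a \<Rightarrow> 'a::comm_monoid_add"
  where "braid_sum n P t = (\<Sum>\<sigma> | \<sigma> permutes {..<n}. word_op P (some_word n \<sigma>) t)"

text \<open>Along the coset decomposition the word chosen for each permutation is replaced by a
  shifted word followed by [0..<k]; both are reduced, so they act equally.\<close>

lemma braid_sum_Suc:
  fixes P :: "nat \<Rightarrow> 'a \<Rightarrow> 'a::comm_monoid_add"
  assumes "braid_operators (Suc n) P A" "t \<in> A"
  shows "braid_sum (Suc n) P t = (\<Sum>k\<le>n. \<Sum>\<tau> | \<tau> permutes {..<n}. word_op P (map Suc (some_word n \<tau>)) (word_op P [0..<k] t))"
proof -
  interpret braid_operators "Suc n" P A by fact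
  have "braid_sum (Suc n) P t = (\<Sum>(k, \<tau>) \<in> {..n} \<times> {\<tau>. \<tau> permutes {..<n}}.
      word_op P (some_word (Suc n) (word_perm (map Suc (some_word n \<tau>) @ [0..<k]))) t)"
    unfolding braid_sum_def
    by (subst sum.reindex_bij_betw[OF permutes_shift_decomposition, symmetric]) (simp add: case_prod_beta)
  also have "\<dots> = (\<Sum>(k, \<tau>) \<in> {..n} \<times> {\<tau>. \<tau> permutes {..<n}}. word_op P (map Suc (some_word n \<tau>) @ [0..<k]) t)"
  proof (rule sum.cong[OF refl])
    fix x assume "x \<in> {..n} \<times> {\<tau>. \<tau> permutes {..<n}}"
    then obtain k \<tau> where x: "x = (k, \<tau>)" and *: "k \<in> {..n}" "\<tau> permutes {..<n}" by auto
    let ?w = "map Suc (some_word n \<tau>) @ [0..<k]"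
    have "valid_word (Suc n) ?w"
      using some_word(1)[OF *(2)] *(1) by (auto simp: valid_word_def)
    moreover have "length ?w = ninv (Suc n) (word_perm ?w)"
      using some_word[OF *(2)] *(1) by (subst ninv_shift_upt) auto
    ultimately have "word_op P (some_word (Suc n) (word_perm ?w)) t = word_op P ?w t"
      using assms(2) by (intro word_op_some_word)
    then show "(case x of (k, \<tau>) \<Rightarrow> word_op P (some_word (Suc n) (word_perm (map Suc (some_word n \<tau>) @ [0..<k]))) t) =
        (case x of (k, \<tau>) \<Rightarrow> word_op P (map Suc (some_word n \<tau>) @ [0..<k]) t)"
      unfolding x by (simp only: prod.case)
  qed
  also have "\<dots> = (\<Sum>k\<le>n. \<Sum>\<tau> | \<tau> permutes {..<n}. word_op P (map Suc (some_word n \<tau>)) (word_op P [0..<k] t))"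
    by (simp add: sum.cartesian_product)
  finally show ?thesis .
qed

text \<open>The longest element of S_n. Conjugation by it exchanges the generators i and n - 2 - i,
  which is what reversing words of length n does to the positions of the braiding.\<close>

definition flip :: "nat \<Rightarrow> nat \<Rightarrow> nat"
  where "flip n a = (if a < n then n - 1 - a else a)"

lemma flip_flip [simp]: "flip n (flip n a) = a"
  by (auto simp: flip_def)

lemma flip_permutes: "flip n permutes {..<n}"
  unfolding permutes_def by (metis flip_def flip_flip lessThan_iff)

lemma word_perm_flip:
  "valid_word n is \<Longrightarrow> word_perm (map (\<lambda>i. n - 2 - i) is) = flip n \<circ> word_perm is \<circ> flip n"
proof (induct "is")
  case (Cons i "is")
  have "adj (n - 2 - i) (flip n a) = flip n (adj i a)" for a
  proof -
    consider "a = i" | "a = Suc i" | "a \<noteq> i" "a \<noteq> Suc i" by blast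
    then show ?thesis
      using Cons.prems by cases (auto simp: flip_def Transposition.transpose_def Suc_diff_Suc numeral_2_eq_2)
  qed
  then show ?case using Cons by (auto simp: fun_eq_iff)
qed (auto simp: fun_eq_iff)

lemma valid_word_flip: "valid_word n is \<Longrightarrow> valid_word n (map (\<lambda>i. n - 2 - i) is)"
  by (auto simp: valid_word_def)

text \<open>Conjugating a reduced word letter by letter gives one inequality; the same inequality
  for the conjugate gives the other, because \<open>flip\<close> is an involution.\<close>

lemma ninv_flip:
  assumes "\<sigma> permutes {..<n}"
  shows "ninv n (flip n \<circ> \<sigma> \<circ> flip n) = ninv n \<sigma>"
proof (rule antisym)
  have *: "ninv n (flip n \<circ> \<sigma> \<circ> flip n) \<le> ninv n \<sigma>" if "\<sigma> permutes {..<n}" for \<sigma>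
    using ninv_word_perm[OF valid_word_flip[OF some_word(1)[OF that]]] word_perm_flip[OF some_word(1)[OF that]]
      some_word[OF that] by simp
  show "ninv n (flip n \<circ> \<sigma> \<circ> flip n) \<le> ninv n \<sigma>" by (rule *[OF assms])
  have "flip n \<circ> (flip n \<circ> \<sigma> \<circ> flip n) \<circ> flip n = \<sigma>" by (simp add: fun_eq_iff)
  then show "ninv n \<sigma> \<le> ninv n (flip n \<circ> \<sigma> \<circ> flip n)"
    using *[of "flip n \<circ> \<sigma> \<circ> flip n"] assms by (simp add: permutes_compose flip_permutes)
qed

lemma braid_sum_flip:
  fixes P :: "nat \<Rightarrow> 'a \<Rightarrow> 'a::comm_monoid_add"
  assumes "braid_operators n P A" "t \<in> A"
  shows "braid_sum n P t = (\<Sum>\<sigma> | \<sigma> permutes {..<n}. word_op P (map (\<lambda>i. n - 2 - i) (some_word n \<sigma>)) t)"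
proof -
  interpret braid_operators n P A by fact
  define c where "c \<sigma> = flip n \<circ> \<sigma> \<circ> flip n" for \<sigma>
  have "c (c \<sigma>) = \<sigma>" for \<sigma> by (simp add: c_def fun_eq_iff)
  moreover have "c \<sigma> permutes {..<n}" if "\<sigma> permutes {..<n}" for \<sigma>
    unfolding c_def by (intro permutes_compose flip_permutes that)
  ultimately have bij: "bij_betw c {\<sigma>. \<sigma> permutes {..<n}} {\<sigma>. \<sigma> permutes {..<n}}"
    by (intro bij_betw_byWitness[where f' = c]) auto
  have "braid_sum n P t = (\<Sum>\<sigma> | \<sigma> permutes {..<n}. word_op P (some_word n (c \<sigma>)) t)"
    unfolding braid_sum_def by (rule sum.reindex_bij_betw[OF bij, symmetric])
  also have "\<dots> = (\<Sum>\<sigma> | \<sigma> permutes {..<n}. word_op P (map (\<lambda>i. n - 2 - i) (some_word n \<sigma>)) t)"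
  proof (rule sum.cong[OF refl])
    fix \<sigma> assume "\<sigma> \<in> {\<sigma>. \<sigma> permutes {..<n}}"
    then have \<sigma>: "\<sigma> permutes {..<n}" by simp
    have "word_op P (some_word n (word_perm (map (\<lambda>i. n - 2 - i) (some_word n \<sigma>)))) t =
        word_op P (map (\<lambda>i. n - 2 - i) (some_word n \<sigma>)) t"
      using some_word[OF \<sigma>] assms(2) word_perm_flip[OF some_word(1)[OF \<sigma>]] ninv_flip[OF \<sigma>]
      by (intro word_op_some_word valid_word_flip) auto
    then show "word_op P (some_word n (c \<sigma>)) t = word_op P (map (\<lambda>i. n - 2 - i) (some_word n \<sigma>)) t"
      using some_word[OF \<sigma>] word_perm_flip[OF some_word(1)[OF \<sigma>]] by (simp add: c_def)
  qed
  finally show ?thesis .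
qed

section \<open>The tensor algebra\<close>

abbreviation multilin :: "('v::complex_vec list \<Rightarrow> 'a::complex_vec) \<Rightarrow> bool"
  where "multilin f \<equiv> \<forall>xs ys. clinear (\<lambda>v. f (xs @ v # ys))"

abbreviation antimultilin :: "('v::complex_vec list \<Rightarrow> 'a::complex_vec) \<Rightarrow> bool"
  where "antimultilin f \<equiv> \<forall>xs ys. antilinear (\<lambda>v. f (xs @ v # ys))"

lemma rep_abs_talg: "rep_talg (abs_talg p) - p \<in> cvec.span talg_relators"
  using Quotient_rep_abs[OF Quotient_talg, of p] by (simp add: talg_rel_def cvec.span_zero)

lemma talg_lift_polyext: "talg_lift f t = polyext (\<lambda>c. c) f (rep_talg t)"
  and talg_lift_cnj_polyext: "talg_lift_cnj f t = polyext cnj f (rep_talg t)"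
  by (simp_all add: talg_lift_def talg_lift_cnj_def polyext_def)

lemma talg_lift_abs:
  assumes "multilin f"
  shows "talg_lift f (abs_talg p) = polyext (\<lambda>c. c) f p"
proof -
  have "polyext (\<lambda>c. c) f (rep_talg (abs_talg p) - p) = 0"
    by (rule polyext_span[OF id_or_cnj(1) _ rep_abs_talg])
      (use assms in \<open>auto simp: talg_relators_def polyext_diff polyext_single clinear_iff\<close>)
  then show ?thesis by (simp add: talg_lift_polyext polyext_diff)
qed

lemma talg_lift_cnj_abs:
  assumes "antimultilin f"
  shows "talg_lift_cnj f (abs_talg p) = polyext cnj f p"
proof -
  have "polyext cnj f (rep_talg (abs_talg p) - p) = 0"
    by (rule polyext_span[OF id_or_cnj(2) _ rep_abs_talg])
      (use assms in \<open>auto simp: talg_relators_def polyext_diff polyext_single antilinear_def\<close>)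
  then show ?thesis by (simp add: talg_lift_cnj_polyext polyext_diff)
qed

lemma talg_lift_word [simp]: "multilin f \<Longrightarrow> talg_lift f (word xs) = f xs"
  unfolding word.abs_eq by (subst talg_lift_abs) (simp_all add: polyext_single)

lemma talg_lift_cnj_word [simp]: "antimultilin f \<Longrightarrow> talg_lift_cnj f (word xs) = f xs"
  unfolding word.abs_eq by (subst talg_lift_cnj_abs) (simp_all add: polyext_single)

lemma talg_lift_linear [simp]:
  assumes "multilin f"
  shows "clinear (talg_lift f)"
proof (rule clinearI)
  fix s t c
  show "talg_lift f (s + t) = talg_lift f s + talg_lift f t"
    by (induct s rule: talg.abs_induct, induct t rule: talg.abs_induct)
      (simp add: plus_talg.abs_eq talg_lift_abs[OF assms] polyext_add)
  show "talg_lift f (c *\<^sub>C t) = c *\<^sub>C talg_lift f t"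
    by (induct t rule: talg.abs_induct)
      (simp add: scaleC_talg.abs_eq talg_lift_abs[OF assms] polyext_scale)
qed

lemma talg_lift_cnj_antilinear [simp]:
  assumes "antimultilin f"
  shows "antilinear (talg_lift_cnj f)"
  unfolding antilinear_def
proof (intro conjI allI)
  fix s t c
  show "talg_lift_cnj f (s + t) = talg_lift_cnj f s + talg_lift_cnj f t"
    by (induct s rule: talg.abs_induct, induct t rule: talg.abs_induct)
      (simp add: plus_talg.abs_eq talg_lift_cnj_abs[OF assms] polyext_add)
  show "talg_lift_cnj f (c *\<^sub>C t) = cnj c *\<^sub>C talg_lift_cnj f t"
    by (induct t rule: talg.abs_induct)
      (simp add: scaleC_talg.abs_eq talg_lift_cnj_abs[OF assms] polyext_scale)
qed

text \<open>In contrast to \<open>tensor_induct\<close> there is a case for scalars, because the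
  empty word has no letter to absorb them.\<close>

lemma talg_induct [case_names word scale add]:
  assumes "\<And>xs. P (word xs)" "\<And>c t. P t \<Longrightarrow> P (c *\<^sub>C t)" "\<And>s t. P s \<Longrightarrow> P t \<Longrightarrow> P (s + t)"
  shows "P t"
proof (induct t rule: talg.abs_induct)
  fix p
  show "P (abs_talg p)"
  proof (induct p rule: poly_mapping_additive_induct)
    case (single k c)
    have "abs_talg (Poly_Mapping.single k c) = c *\<^sub>C word k"
      by (simp add: word.abs_eq scaleC_talg.abs_eq scaleC_single)
    then show ?case using assms(1,2) by metis
  next
    case (add p q)
    then show ?case using assms(3) by (simp flip: plus_talg.abs_eq)
  qed
qed

lemma talg_eqI:
  assumes "clinear f" "clinear g" "\<And>xs. f (word xs) = g (word xs)"
  shows "f t = g t"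
  by (induct t rule: talg_induct) (simp_all add: assms clinear_add[of f] clinear_add[of g] clinear_scale[of f] clinear_scale[of g])

lemma word_Nil [simp]: "word [] = 1"
  by (simp add: word.abs_eq one_talg.abs_eq flip: single_one zero_list_def)

lemma word_append: "word (xs @ ys) = word xs * word ys"
  by (simp add: word.abs_eq times_talg.abs_eq mult_single plus_list_def)

lemma word_Cons: "word (v # xs) = word [v] * word xs"
  using word_append[of "[v]" xs] by simp

lemma talg_eqI': "p - q \<in> talg_relators \<Longrightarrow> abs_talg p = abs_talg q"
  by (simp add: talg.abs_eq_iff talg_rel_def cvec.span_base)

lemma word_multilinear: "clinear (\<lambda>v. word (xs @ v # ys))"
proof (rule clinearI)
  fix v w c
  show "word (xs @ (v + w) # ys) = word (xs @ v # ys) + word (xs @ w # ys)"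
    unfolding word.abs_eq plus_talg.abs_eq
    by (rule talg_eqI', unfold talg_relators_def diff_diff_eq[symmetric], blast)
  show "word (xs @ (c *\<^sub>C v) # ys) = c *\<^sub>C word (xs @ v # ys)"
    unfolding word.abs_eq scaleC_talg.abs_eq scaleC_single mult_1_right
    by (rule talg_eqI', unfold talg_relators_def diff_diff_eq[symmetric], blast)
qed

lemma letter_linear [simp]: "clinear (\<lambda>v. word [v])" "clinear f \<Longrightarrow> clinear (\<lambda>v. word [f v])"
  using word_multilinear[of "[]" "[]"] clinear_compose[of "\<lambda>v. word [v]" f] by simp_all

lemma multilin_foldr:
  assumes "bilin G"
  shows "multilin (\<lambda>xs. foldr G xs z)"
proof (intro allI)
  fix xs ys
  show "clinear (\<lambda>v. foldr G (xs @ v # ys) z)"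
  proof (induct xs)
    case Nil
    then show ?case using assms by simp
  next
    case (Cons a xs)
    then show ?case using clinear_compose[of "G a" "\<lambda>v. foldr G (xs @ v # ys) z"] assms by simp
  qed
qed

lemma talg_Cons_eqI:
  assumes "clinear f" "clinear g" "f 1 = g 1"
    and "\<And>v xs. f (word xs) = g (word xs) \<Longrightarrow> f (word [v] * word xs) = g (word [v] * word xs)"
  shows "f t = g t"
proof (rule talg_eqI[OF assms(1,2)])
  fix xs
  show "f (word xs) = g (word xs)"
  proof (induct xs)
    case (Cons v xs)
    then show ?case using assms(4)[of xs v] by (simp only: word_Cons[of v xs])
  qed (simp add: assms(3))
qed

lemma quad_linear [simp]: "clinear quad" "clinear f \<Longrightarrow> clinear (\<lambda>x. quad (f x))"
  and quad_pure [simp]: "quad (v \<otimes> w) = word [v] * word [w]"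
proof -
  have b: "bilin (\<lambda>v w. word [v, w])" by (simp add: word_Cons[of _ "[_]"])
  show "clinear quad" unfolding quad_def by (rule clinear_tensor_lift'[OF b])
  then show "clinear f \<Longrightarrow> clinear (\<lambda>x. quad (f x))" by (rule clinear_compose)
  show "quad (v \<otimes> w) = word [v] * word [w]"
    unfolding quad_def tensor_lift_pure[OF b] by (rule word_Cons)
qed

lemma word_in_talg_deg: "word xs \<in> talg_deg (length xs)"
  unfolding talg_deg_def by (rule cvec.span_base) simp

lemma talg_deg_subspace: "cvec.subspace (talg_deg n)"
  unfolding talg_deg_def by (rule cvec.subspace_span)

lemma talg_deg_induct [consumes 1, case_names word scale add]:
  assumes "t \<in> talg_deg n" "\<And>xs. length xs = n \<Longrightarrow> P (word xs)" "\<And>c t. P t \<Longrightarrow> P (c *\<^sub>C t)"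
    "\<And>s t. P s \<Longrightarrow> P t \<Longrightarrow> P (s + t)"
  shows "P t"
  using assms(1) unfolding talg_deg_def
proof (induct rule: cvec.span_induct_alt)
  case base
  show ?case using assms(3)[of "word (replicate n 0)" 0] assms(2)[of "replicate n 0"] by simp
next
  case (step c x y)
  then show ?case using assms(2-4) by blast
qed

lemma talg_deg_eqI:
  assumes "t \<in> talg_deg n" "clinear f" "clinear g" "\<And>xs. length xs = n \<Longrightarrow> f (word xs) = g (word xs)"
  shows "f t = g t"
  using assms(1) unfolding talg_deg_def by (rule clinear_span_induct) (use assms(2-4) in auto)

lemma clinear_talg_deg:
  assumes "clinear f" "t \<in> talg_deg n" "\<And>xs. length xs = n \<Longrightarrow> f (word xs) \<in> talg_deg m"
  shows "f t \<in> talg_deg m"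
  using assms(2)
proof (induct rule: talg_deg_induct)
  case (scale c t)
  then show ?case by (simp add: clinear_scale[OF assms(1)] talg_deg_def cvec.span_scale)
next
  case (add s t)
  then show ?case by (simp add: clinear_add[OF assms(1)] talg_deg_def cvec.span_add)
qed (rule assms(3))

lemma mult_talg_deg:
  assumes "s \<in> talg_deg m" "t \<in> talg_deg n"
  shows "s * t \<in> talg_deg (m + n)"
proof (rule clinear_talg_deg[OF _ assms(1)])
  fix xs :: "'a list" assume xs: "length xs = m"
  show "word xs * t \<in> talg_deg (m + n)"
  proof (rule clinear_talg_deg[OF _ assms(2)])
    fix ys :: "'a list" assume "length ys = n"
    then show "word xs * word ys \<in> talg_deg (m + n)"
      using word_in_talg_deg[of "xs @ ys"] xs by (simp add: word_append)
  qed simp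
qed simp

lemma talg_deg_0: "t \<in> talg_deg 0 \<Longrightarrow> \<exists>c. t = c *\<^sub>C 1"
proof (induct rule: talg_deg_induct)
  case (word xs)
  then show ?case by (intro exI[of _ 1]) simp
next
  case (scale c t)
  then show ?case by auto
next
  case (add s t)
  then obtain c d where "s = c *\<^sub>C 1" "t = d *\<^sub>C 1" by auto
  then show ?case by (intro exI[of _ "c + d"]) (simp add: scaleC_add_left)
qed

lemma talg_deg_1: "t \<in> talg_deg 1 \<Longrightarrow> \<exists>v. t = word [v]"
proof (induct rule: talg_deg_induct)
  case (word xs)
  then show ?case by (cases xs) auto
next
  case (scale c t)
  then show ?case by (metis clinear_scale[OF letter_linear(1)])
next
  case (add s t)
  then show ?case by (metis clinear_add[OF letter_linear(1)])
qed

section \<open>The braid group action on the tensor algebra\<close>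

locale unitary_comodule_setting = coquasitriangular_hopf D
  for D :: "('h::complex_alg_1, 'v::complex_vec, 'b::complex_alg_1, 'l::complex_alg_1) braided_data" +
  assumes real: "real_type D" and unitary: "unitary_comodule D"
begin

abbreviation "\<rho>V \<equiv> coact D"
abbreviation "\<psi> \<equiv> Psi D"

lemma coact_comodule [simp]: "comodule \<rho>V"
  using unitary by (simp add: unitary_comodule_def comodule_def)

lemma coact_linear [simp]: "clinear \<rho>V" "clinear f \<Longrightarrow> clinear (\<lambda>x. \<rho>V (f x))"
  using comodule_lin[OF coact_comodule] by blast+

lemma Psi_linear [simp]: "clinear \<psi>" "clinear f \<Longrightarrow> clinear (\<lambda>x. \<psi> (f x))"
  by (simp_all add: Psi_def)

lemma vstar_antilinear [simp]: "antilinear (vstar D)"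
  and vstar_vstar [simp]: "vstar D (vstar D v) = v"
  using unitary by (simp_all add: unitary_comodule_def antilinear_involution_def)

lemma vstar_comodule_star: "comodule_star \<rho>V (vstar D)"
  using unitary by (simp add: unitary_comodule_def comodule_star_def)

text \<open>The rule inside \<open>Psi_at\<close>, named so that its multilinearity can be proved by
  recursion on the position through \<open>local_op_simps\<close>.\<close>

definition local_op :: "nat \<Rightarrow> 'v list \<Rightarrow> 'v talg" where
  "local_op i = (\<lambda>xs. if Suc i < length xs
     then word (take i xs) * quad (\<psi> (xs ! i \<otimes> xs ! Suc i)) * word (drop (i + 2) xs)
     else word xs)"

lemma local_op_simps:
  "local_op i [] = 1" "local_op 0 [v] = word [v]"
  "local_op 0 (v # w # xs) = quad (\<psi> (v \<otimes> w)) * word xs"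
  "local_op (Suc i) (v # xs) = word [v] * local_op i xs"
  by (simp_all add: local_op_def word_Cons[of v "take i xs"] word_Cons[of v xs] mult.assoc)

lemma local_op_multilin: "multilin (local_op i)"
proof (intro allI)
  fix xs ys
  show "clinear (\<lambda>v. local_op i (xs @ v # ys))"
  proof (induct i arbitrary: xs)
    case 0
    consider "xs = []" "ys = []" | b zs where "xs = []" "ys = b # zs" | a where "xs = [a]"
      | a b zs where "xs = a # b # zs"
      by (metis neq_Nil_conv)
    then show ?case
      by cases (simp_all add: local_op_simps word_multilinear)
  next
    case (Suc i)
    then show ?case by (cases xs) (simp_all add: local_op_simps)
  qed
qed

lemma Psi_at_word: "Psi_at D i (word xs) = local_op i xs"
  and Psi_at_linear [simp]: "clinear (Psi_at D i)"
  using local_op_multilin[of i] by (simp_all add: Psi_at_def local_op_def)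

lemma Psi_at_linear' [simp]: "clinear f \<Longrightarrow> clinear (\<lambda>x. Psi_at D i (f x))"
  by (rule clinear_compose[OF Psi_at_linear])

lemma Psi_at_one [simp]: "Psi_at D i 1 = 1"
  using Psi_at_word[of i "[]"] by (simp add: local_op_simps)

lemma Psi_at_letter [simp]: "Psi_at D i (word [v]) = word [v]"
  using Psi_at_word[of i "[v]"] by (cases i) (simp_all add: local_op_simps)

lemma Psi_at_Suc [simp]: "Psi_at D (Suc i) (word [v] * t) = word [v] * Psi_at D i t"
  by (rule talg_eqI[where t = t])
    (simp_all add: word_Cons[symmetric] Psi_at_word local_op_simps)

text \<open>Stated for an arbitrary tensor \<open>s\<close>, so that further braidings can act on
  the output, which is in general not a single word.\<close>

lemma Psi_at_0_quad: "Psi_at D 0 (quad s * t) = quad (\<psi> s) * t"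
proof (rule clinear_eqI[where t = s])
  fix v w
  have *: "Psi_at D 0 (quad (v \<otimes> w) * word xs) = quad (\<psi> (v \<otimes> w)) * word xs" for xs
    using Psi_at_word[of 0 "v # w # xs"] by (simp add: local_op_simps word_Cons[of v "w # xs"] word_Cons[of w xs] mult.assoc)
  show "Psi_at D 0 (quad (v \<otimes> w) * t) = quad (\<psi> (v \<otimes> w)) * t"
    by (rule talg_eqI[where t = t]) (simp_all only: *, simp_all)
qed simp_all

lemma Psi_at_0 [simp]: "Psi_at D 0 (word [v] * (word [w] * t)) = quad (\<psi> (v \<otimes> w)) * t"
  using Psi_at_0_quad[of "v \<otimes> w" t] by (simp add: mult.assoc)

lemma Psi_at_Suc_quad: "Psi_at D (Suc (Suc i)) (quad s * t) = quad s * Psi_at D i t"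
  by (rule clinear_eqI[where t = s]) (simp_all add: mult.assoc)

lemma quad_deg: "quad s \<in> talg_deg 2"
proof (induct s rule: tensor_induct)
  case (pure v w)
  then show ?case using word_in_talg_deg[of "[v, w]"] by (simp add: word_Cons[of v "[w]"] numeral_2_eq_2)
next
  case (add s t)
  then show ?case by (simp add: clinear_add[OF quad_linear(1)] talg_deg_def cvec.span_add)
qed

lemma Psi_at_deg:
  assumes "t \<in> talg_deg n"
  shows "Psi_at D i t \<in> talg_deg n"
proof (rule clinear_talg_deg[OF Psi_at_linear assms])
  fix xs :: "'v list"
  have "local_op i xs \<in> talg_deg (length xs)"
  proof (induct i arbitrary: xs)
    case 0
    consider "xs = []" | a where "xs = [a]" | a b zs where "xs = a # b # zs"
      by (metis neq_Nil_conv)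
    then show ?case
    proof cases
      case (3 a b zs)
      then show ?thesis
        using mult_talg_deg[OF quad_deg word_in_talg_deg, of "\<psi> (a \<otimes> b)" zs]
        by (simp add: local_op_simps)
    qed (use word_in_talg_deg[of xs] in \<open>simp_all add: local_op_simps\<close>)
  next
    case (Suc i)
    show ?case
    proof (cases xs)
      case (Cons a ys)
      then show ?thesis
        using mult_talg_deg[OF word_in_talg_deg[of "[a]"] Suc[of ys]] by (simp add: local_op_simps)
    qed (use word_in_talg_deg[of xs] in \<open>simp add: local_op_simps\<close>)
  qed
  then show "length xs = n \<Longrightarrow> Psi_at D i (word xs) \<in> talg_deg n"
    by (auto simp: Psi_at_word)
qed

definition cube :: "('v, ('v, 'v) tensor) tensor \<Rightarrow> 'v talg"
  where "cube = tensor_lift (\<lambda>u s. word [u] * quad s)"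

lemma cube_linear [simp]: "clinear cube" "clinear f \<Longrightarrow> clinear (\<lambda>x. cube (f x))"
  by (simp_all add: cube_def)

lemma cube_pure [simp]: "cube (u \<otimes> s) = word [u] * quad s"
  by (simp add: cube_def)

text \<open>Transports the braidings at the first two positions to triple tensors, where
  \<open>Yang_Baxter\<close> applies.\<close>

lemma Psi_at_cube: "Psi_at D 0 (cube s * t) = cube (apl \<psi> s) * t"
  "Psi_at D (Suc 0) (cube s * t) = cube (tensor_map id \<psi> s) * t"
proof -
  show "Psi_at D 0 (cube s * t) = cube (apl \<psi> s) * t"
  proof (rule tensor3_eqI[where t = s])
    fix u v w
    have "quad s * word [w] = cube (tensor_lift (\<lambda>c d. c \<otimes> d \<otimes> w) s)" for s
      by (rule clinear_eqI[where t = s]) (simp_all add: mult.assoc)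
    then show "Psi_at D 0 (cube (u \<otimes> v \<otimes> w) * t) = cube (apl \<psi> (u \<otimes> v \<otimes> w)) * t"
      by (simp add: mult.assoc apl_pure) (simp add: mult.assoc[symmetric])
  qed (simp_all add: clinear_compose[OF clinear_apl] clinear_compose)
  show "Psi_at D (Suc 0) (cube s * t) = cube (tensor_map id \<psi> s) * t"
    by (rule clinear_eqI[where t = s]) (simp_all add: mult.assoc Psi_at_0_quad)
qed

lemma Psi_braid_relation:
  assumes "t \<in> talg_deg n" "Suc (Suc i) < n"
  shows "Psi_at D i (Psi_at D (Suc i) (Psi_at D i t)) = Psi_at D (Suc i) (Psi_at D i (Psi_at D (Suc i) t))"
proof (rule talg_deg_eqI[OF assms(1)])
  fix xs :: "'v list"
  assume "length xs = n"
  then show "Psi_at D i (Psi_at D (Suc i) (Psi_at D i (word xs))) = Psi_at D (Suc i) (Psi_at D i (Psi_at D (Suc i) (word xs)))"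
    using assms(2)
  proof (induct i arbitrary: n xs)
    case 0
    then obtain u v w ys where xs: "xs = u # v # w # ys"
      by (cases xs; cases "tl xs"; cases "tl (tl xs)"; auto)
    have "word xs = cube (u \<otimes> v \<otimes> w) * word ys"
      by (simp add: xs mult.assoc word_Cons[of u "v # w # ys"] word_Cons[of v "w # ys"] word_Cons[of w ys])
    then show ?case
      using Yang_Baxter[of \<rho>V \<rho>V \<rho>V "u \<otimes> v \<otimes> w"] by (simp only: Psi_at_cube) (simp add: Psi_def)
  next
    case (Suc i)
    then obtain u ys where "xs = u # ys" "length ys = n - 1" by (cases xs) auto
    then show ?case using Suc(1)[of ys "n - 1"] Suc(3) by (simp add: word_Cons[of u ys])
  qed
qed simp_all

lemma Psi_far_relation: "Suc i < j \<Longrightarrow> Psi_at D i (Psi_at D j t) = Psi_at D j (Psi_at D i t)"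
proof (induct i arbitrary: j t)
  case 0
  then have "j = Suc (Suc (j - 2))" by simp
  then obtain k where j: "j = Suc (Suc k)" ..
  show ?case
  proof (rule talg_eqI[where t = t])
    fix xs :: "'v list"
    consider "xs = []" | a where "xs = [a]" | a b zs where "xs = a # b # zs"
      by (metis neq_Nil_conv)
    then show "Psi_at D 0 (Psi_at D j (word xs)) = Psi_at D j (Psi_at D 0 (word xs))"
    proof cases
      case (3 a b zs)
      then show ?thesis by (simp add: word_Cons[of a "b # zs"] word_Cons[of b zs] j Psi_at_Suc_quad)
    qed simp_all
  qed simp_all
next
  case (Suc i)
  then obtain k where j: "j = Suc k" "Suc i < k" by (cases j) auto
  show ?case
  proof (rule talg_eqI[where t = t])
    fix xs :: "'v list"
    show "Psi_at D (Suc i) (Psi_at D j (word xs)) = Psi_at D j (Psi_at D (Suc i) (word xs))"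
    proof (cases xs)
      case (Cons v ys)
      then show ?thesis using Suc(1)[OF j(2)] by (simp add: word_Cons[of v ys] j)
    qed simp
  qed simp_all
qed

lemma Psi_braid_operators: "braid_operators n (Psi_at D) (talg_deg n)"
proof
  show "Psi_at D i t \<in> talg_deg n" if "t \<in> talg_deg n" for i t by (rule Psi_at_deg[OF that])
  show "Psi_at D i (Psi_at D j t) = Psi_at D j (Psi_at D i t)" if "Suc i < j" for i j t
    by (rule Psi_far_relation[OF that])
  show "Psi_at D i (Psi_at D (Suc i) (Psi_at D i t)) = Psi_at D (Suc i) (Psi_at D i (Psi_at D (Suc i) t))"
    if "Suc (Suc i) < n" "t \<in> talg_deg n" for i t by (rule Psi_braid_relation[OF that(2,1)])
qed

lemma word_op_linear [simp]: "clinear (word_op (Psi_at D) is)"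
  "clinear f \<Longrightarrow> clinear (\<lambda>x. word_op (Psi_at D) is (f x))"
proof -
  show "clinear (word_op (Psi_at D) is)"
  proof (induct "is")
    case Nil
    have "word_op (Psi_at D) [] = (\<lambda>t. t)" by auto
    then show ?case by simp
  next
    case (Cons i "is")
    have "word_op (Psi_at D) (i # is) = (\<lambda>t. Psi_at D i (word_op (Psi_at D) is t))" by auto
    with Cons show ?case by simp
  qed
  then show "clinear f \<Longrightarrow> clinear (\<lambda>x. word_op (Psi_at D) is (f x))" by (rule clinear_compose)
qed

lemma braided_factorial_sum: "braided_factorial D n t = braid_sum n (Psi_at D) t"
  by (simp add: braided_factorial_def braid_sum_def Psi_perm_def word_op_def some_word_def)

lemma braided_factorial_linear [simp]: "clinear (braided_factorial D n)"
proof -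
  have "braided_factorial D n = (\<lambda>t. \<Sum>\<sigma> | \<sigma> permutes {..<n}. word_op (Psi_at D) (some_word n \<sigma>) t)"
    by (auto simp: braided_factorial_sum braid_sum_def)
  then show ?thesis by simp
qed

lemma word_op_shift: "word_op (Psi_at D) (map Suc is) (word [v] * t) = word [v] * word_op (Psi_at D) is t"
  by (induct "is") simp_all

text \<open>The sum 1 + \<Psi>_1 + \<Psi>_1 \<Psi>_2 + ... of the overview. Its summand k carries
  the letter at position k, counted from 0, over all letters before it to the front.\<close>

definition braided_integer :: "nat \<Rightarrow> 'v talg \<Rightarrow> 'v talg"
  where "braided_integer n t = (\<Sum>k<n. word_op (Psi_at D) [0..<k] t)"

definition shifted_factorial :: "nat \<Rightarrow> 'v talg \<Rightarrow> 'v talg"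
  where "shifted_factorial n t = (\<Sum>\<tau> | \<tau> permutes {..<n}. word_op (Psi_at D) (map Suc (some_word n \<tau>)) t)"

lemma braided_integer_linear [simp]: "clinear (braided_integer n)"
  and shifted_factorial_linear [simp]: "clinear (shifted_factorial n)"
  unfolding braided_integer_def[abs_def] shifted_factorial_def[abs_def] by simp_all

lemma shifted_factorial_letter: "shifted_factorial n (word [v] * t) = word [v] * braided_factorial D n t"
  by (simp add: shifted_factorial_def word_op_shift braided_factorial_sum braid_sum_def sum_distrib_left)

text \<open>\<open>shifted_factorial\<close> is the operator id \<otimes> [n]!, by
  \<open>shifted_factorial_letter\<close>, and the sum over cosets in \<open>braid_sum_Suc\<close>
  is the braided integer.\<close>

lemma braided_factorial_Suc:
  assumes "t \<in> talg_deg (Suc n)"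
  shows "braided_factorial D (Suc n) t = shifted_factorial n (braided_integer (Suc n) t)"
  unfolding braided_factorial_sum braid_sum_Suc[OF Psi_braid_operators assms] shifted_factorial_def braided_integer_def
  by (subst sum.swap) (simp add: clinear_sum[OF word_op_linear(1)] lessThan_Suc_atMost)

text \<open>The word [0..<Suc k] is 0 followed by the shift of [0..<k], so all terms but the leading
  one share the outer factor \<open>Psi_at D 0\<close>. The derivative \<open>D1\<close> will obey
  the same recursion.\<close>

lemma braided_integer_letter:
  "braided_integer (Suc n) (word [v] * t) = word [v] * t + Psi_at D 0 (word [v] * braided_integer n t)"
proof -
  have *: "word_op (Psi_at D) [0..<Suc k] (word [v] * t) = Psi_at D 0 (word [v] * word_op (Psi_at D) [0..<k] t)" for k
  proof -
    have "[0..<Suc k] = 0 # map Suc [0..<k]" by (simp add: map_Suc_upt upt_conv_Cons del: upt_Suc)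
    then show ?thesis by (simp only: word_op_simps word_op_shift)
  qed
  show ?thesis
    unfolding braided_integer_def sum.lessThan_Suc_shift *
    by (simp add: sum_distrib_left clinear_sum[OF Psi_at_linear])
qed

section \<open>The involution of the tensor algebra and mirror symmetry of the braided
  factorial\<close>

definition star_T :: "'v talg \<Rightarrow> 'v talg"
  where "star_T = talg_lift_cnj (\<lambda>xs. word (rev (map (vstar D) xs)))"

lemma rev_antimultilin: "antimultilin (\<lambda>xs. word (rev (map (vstar D) xs)))"
  using linear_comp_antilinear[OF word_multilinear vstar_antilinear] by simp

lemma star_T_word: "star_T (word xs) = word (rev (map (vstar D) xs))"
  and star_T_antilinear [simp]: "antilinear star_T"
  using rev_antimultilin by (simp_all add: star_T_def)

lemma star_T_add: "star_T (s + t) = star_T s + star_T t"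
  and star_T_scale: "star_T (c *\<^sub>C t) = cnj c *\<^sub>C star_T t"
  by (simp_all add: antilinear_add antilinear_scale)

lemma star_T_mult: "star_T (s * t) = star_T t * star_T s"
proof (induct s rule: talg_induct)
  case (word xs)
  show ?case
  proof (induct t rule: talg_induct)
    case (word ys)
    then show ?case by (simp add: star_T_word flip: word_append)
  qed (simp_all add: star_T_add star_T_scale distrib_left distrib_right)
qed (simp_all add: star_T_add star_T_scale distrib_left distrib_right)

lemma star_T_one [simp]: "star_T 1 = 1"
  using star_T_word[of "[]"] by simp

lemma star_T_star_T [simp]: "star_T (star_T t) = t"
  by (induct t rule: talg_induct) (simp_all add: star_T_word star_T_add star_T_scale rev_map comp_def)

lemma dagger_pure: "dagger (vstar D) (v \<otimes> w) = vstar D w \<otimes> vstar D v"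
  by (simp add: dagger_def)

lemma Psi_dagger: "\<psi> (dagger (vstar D) s) = dagger (vstar D) (\<psi> s)"
proof (induct s rule: tensor_induct)
  case (pure v w)
  then show ?case
    using braid_star[OF coact_comodule vstar_comodule_star coact_comodule vstar_comodule_star real, of w v]
    by (simp add: Psi_def dagger_pure) (simp add: dagger_def)
next
  case (add s t)
  then show ?case by (simp add: dagger_def tensor_lift_cnj_add clinear_add[OF Psi_linear(1)])
qed

lemma star_T_quad: "star_T (quad s) = quad (dagger (vstar D) s)"
proof (induct s rule: tensor_induct)
  case (pure v w)
  then show ?case using star_T_word[of "[v]"] star_T_word[of "[w]"] by (simp add: star_T_mult dagger_pure)
next
  case (add s t)
  then show ?case by (simp add: dagger_def tensor_lift_cnj_add clinear_add[OF quad_linear(1)] star_T_add)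
qed

lemma star_T_deg: "t \<in> talg_deg n \<Longrightarrow> star_T t \<in> talg_deg n"
proof (induct rule: talg_deg_induct)
  case (word xs)
  then show ?case using word_in_talg_deg[of "rev (map (vstar D) xs)"] by (simp add: star_T_word)
qed (simp_all add: star_T_add star_T_scale talg_deg_def cvec.span_add cvec.span_scale)

lemma Psi_at_sandwich: "Psi_at D (length xs) (word xs * (quad s * t)) = word xs * (quad (\<psi> s) * t)"
proof (induct xs)
  case Nil
  then show ?case by (simp add: Psi_at_0_quad)
next
  case (Cons a xs)
  then show ?case by (simp add: word_Cons[of a xs] mult.assoc)
qed

text \<open>Reversing a word of length n moves the pair of letters i, i + 1 to the positions n - 2 -
  i, n - 1 - i, and by \<open>Psi_dagger\<close> the braiding of the pair may act after its
  reversal.\<close>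

lemma star_T_Psi_at:
  assumes "t \<in> talg_deg n" "Suc i < n"
  shows "star_T (Psi_at D i t) = Psi_at D (n - 2 - i) (star_T t)"
  using assms(1)
proof (induct rule: talg_deg_induct)
  case (word xs)
  define a b ys zs where "a = xs ! i" and "b = xs ! Suc i" and "ys = take i xs" and "zs = drop (i + 2) xs"
  have xs: "xs = ys @ a # b # zs"
    unfolding a_def b_def ys_def zs_def using word assms(2)
    by (metis Cons_nth_drop_Suc Suc_lessD add_2_eq_Suc' append_take_drop_id)
  have len: "length ys = i" "length zs = n - 2 - i" using word assms(2) by (auto simp: ys_def zs_def)
  have w: "word xs = word ys * (quad (a \<otimes> b) * word zs)"
    unfolding xs word_append by (simp add: word_Cons[of a "b # zs"] word_Cons[of b zs] mult.assoc)
  have "star_T (Psi_at D i (word xs)) = word (rev (map (vstar D) zs)) * (quad (\<psi> (dagger (vstar D) (a \<otimes> b))) * word (rev (map (vstar D) ys)))"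
    unfolding w using Psi_at_sandwich[of ys] by (simp only: len star_T_mult star_T_quad Psi_dagger star_T_word mult.assoc)
  also have "\<dots> = Psi_at D (n - 2 - i) (star_T (word xs))"
    unfolding w using Psi_at_sandwich[of "rev (map (vstar D) zs)"]
    by (simp only: star_T_mult star_T_quad star_T_word mult.assoc length_rev length_map len)
  finally show ?case .
qed (simp_all add: star_T_add star_T_scale clinear_add[OF Psi_at_linear] clinear_scale[OF Psi_at_linear])

lemma word_op_deg: "t \<in> talg_deg n \<Longrightarrow> word_op (Psi_at D) is t \<in> talg_deg n"
  by (induct "is") (simp_all add: Psi_at_deg)

lemma star_T_word_op:
  "valid_word n is \<Longrightarrow> t \<in> talg_deg n \<Longrightarrow>
    star_T (word_op (Psi_at D) is t) = word_op (Psi_at D) (map (\<lambda>i. n - 2 - i) is) (star_T t)"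
  by (induct "is") (simp_all add: star_T_Psi_at[OF word_op_deg])

text \<open>Reversal mirrors every chosen word, and by \<open>braid_sum_flip\<close> the sum over
  the mirrored words is again the braided factorial.\<close>

lemma star_T_factorial:
  assumes "t \<in> talg_deg n"
  shows "star_T (braided_factorial D n t) = braided_factorial D n (star_T t)"
proof -
  have "braided_factorial D n (star_T t) =
      (\<Sum>\<sigma> | \<sigma> permutes {..<n}. word_op (Psi_at D) (map (\<lambda>i. n - 2 - i) (some_word n \<sigma>)) (star_T t))"
    unfolding braided_factorial_sum by (rule braid_sum_flip[OF Psi_braid_operators star_T_deg[OF assms]])
  also have "\<dots> = (\<Sum>\<sigma> | \<sigma> permutes {..<n}. star_T (word_op (Psi_at D) (some_word n \<sigma>) t))"
    by (rule sum.cong[OF refl], rule star_T_word_op[symmetric]) (simp_all add: some_word assms)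
  also have "\<dots> = star_T (braided_factorial D n t)"
    unfolding braided_factorial_sum braid_sum_def by (rule additive_sum[symmetric]) (rule star_T_add)
  finally show ?thesis ..
qed

section \<open>The coaction on the tensor algebra\<close>

definition coact_T :: "'v talg \<Rightarrow> ('v talg, 'h) tensor" where
  "coact_T = talg_lift (\<lambda>xs. foldr (\<lambda>v s. tensor_mult (tensor_map (\<lambda>w. word [w]) (\<lambda>h. h) (\<rho>V v)) s) xs (1 \<otimes> 1))"

lemma coact_T_linear [simp]: "clinear coact_T" "clinear f \<Longrightarrow> clinear (\<lambda>x. coact_T (f x))"
  and coact_T_one: "coact_T 1 = 1 \<otimes> 1"
  and coact_T_letter: "coact_T (word [v] * t) = tensor_mult (tensor_map (\<lambda>w. word [w]) (\<lambda>h. h) (\<rho>V v)) (coact_T t)"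
proof -
  have m: "multilin (\<lambda>xs. foldr (\<lambda>v s. tensor_mult (tensor_map (\<lambda>w. word [w]) (\<lambda>h. h) (\<rho>V v)) s) xs (1 \<otimes> 1 :: ('v talg, 'h) tensor))"
    by (rule multilin_foldr) simp
  show l: "clinear coact_T" unfolding coact_T_def by (rule talg_lift_linear[OF m])
  show "clinear f \<Longrightarrow> clinear (\<lambda>x. coact_T (f x))" by (rule clinear_compose[OF l])
  note l' = clinear_compose[OF l]
  show "coact_T 1 = 1 \<otimes> 1" using talg_lift_word[OF m, of "[]"] unfolding coact_T_def by simp
  show "coact_T (word [v] * t) = tensor_mult (tensor_map (\<lambda>w. word [w]) (\<lambda>h. h) (\<rho>V v)) (coact_T t)"
    by (rule talg_eqI[where t = t])
      (simp_all add: l l' flip: word_Cons, simp add: coact_T_def talg_lift_word[OF m])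
qed

lemma coact_T_gen: "coact_T (word [v]) = tensor_map (\<lambda>w. word [w]) (\<lambda>h. h) (\<rho>V v)"
  using coact_T_letter[of v 1] by (simp add: coact_T_one)

lemma coact_T_mult: "coact_T (s * t) = tensor_mult (coact_T s) (coact_T t)"
  by (rule talg_Cons_eqI[where t = s]) (simp_all add: coact_T_one coact_T_letter mult.assoc tensor_mult_assoc)

lemma coact_T_quad: "coact_T (quad s) = tensor_map quad (\<lambda>h. h) (codiagonal \<rho>V \<rho>V s)"
proof (rule clinear_eqI[where t = s])
  fix v w
  show "coact_T (quad (v \<otimes> w)) = tensor_map quad (\<lambda>h. h) (codiagonal \<rho>V \<rho>V (v \<otimes> w))"
    by (simp add: coact_T_mult coact_T_gen codiagonal_pure tensor_lift_push tensor_mult_def tensor_lift_tensor_map)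
qed simp_all

lemma coact_T_Psi_at: "coact_T (Psi_at D i t) = tensor_map (Psi_at D i) (\<lambda>h. h) (coact_T t)"
proof (induct i arbitrary: t)
  case 0
  show ?case
  proof (rule talg_eqI[where t = t])
    fix xs :: "'v list"
    have l: "coact_T (word [v]) = tensor_map (Psi_at D 0) (\<lambda>h. h) (coact_T (word [v]))" for v
      by (simp add: coact_T_gen tensor_map_comp)
    have q: "tensor_mult (tensor_map quad (\<lambda>h. h) (tensor_map \<psi> (\<lambda>h. h) s)) t = tensor_map (Psi_at D 0) (\<lambda>h. h) (tensor_mult (tensor_map quad (\<lambda>h. h) s) t)" for s t
      by (rule clinear_eqI[where t = s], simp, simp, rule clinear_eqI[where t = t]) (simp_all add: Psi_at_0_quad)
    consider "xs = []" | a where "xs = [a]" | a b zs where "xs = a # b # zs"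
      by (metis neq_Nil_conv)
    then show "coact_T (Psi_at D 0 (word xs)) = tensor_map (Psi_at D 0) (\<lambda>h. h) (coact_T (word xs))"
    proof cases
      case 1
      then show ?thesis by (simp add: coact_T_one)
    next
      case (2 a)
      then show ?thesis using l by simp
    next
      case (3 a b zs)
      have w: "word xs = quad (a \<otimes> b) * word zs"
        unfolding 3 by (simp add: word_Cons[of a "b # zs"] word_Cons[of b zs] mult.assoc)
      show ?thesis
        unfolding w Psi_at_0_quad coact_T_mult coact_T_quad
        using q codiagonal_braid[of \<rho>V \<rho>V "a \<otimes> b", unfolded id_def] by (simp add: Psi_def[symmetric])
    qed
  qed simp_all
next
  case (Suc i)
  show ?case
  proof (rule talg_eqI[where t = t])
    fix xs :: "'v list"
    have q: "tensor_mult (tensor_map (\<lambda>w. word [w]) (\<lambda>h. h) s) (tensor_map (Psi_at D i) (\<lambda>h. h) t) =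
        tensor_map (Psi_at D (Suc i)) (\<lambda>h. h) (tensor_mult (tensor_map (\<lambda>w. word [w]) (\<lambda>h. h) s) t)" for s t
      by (rule clinear_eqI[where t = s], simp, simp, rule clinear_eqI[where t = t]) simp_all
    show "coact_T (Psi_at D (Suc i) (word xs)) = tensor_map (Psi_at D (Suc i)) (\<lambda>h. h) (coact_T (word xs))"
    proof (cases xs)
      case Nil
      then show ?thesis by (simp add: coact_T_one)
    next
      case (Cons v ys)
      then show ?thesis by (simp add: word_Cons[of v ys] coact_T_letter Suc q)
    qed
  qed simp_all
qed

lemma coact_T_factorial: "coact_T (braided_factorial D n t) = tensor_map (braided_factorial D n) (\<lambda>h. h) (coact_T t)"
proof -
  have w: "coact_T (word_op (Psi_at D) is t) = tensor_map (word_op (Psi_at D) is) (\<lambda>h. h) (coact_T t)" for "is" t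
  proof (induct "is")
    case Nil
    have "word_op (Psi_at D) [] = (\<lambda>t. t)" by auto
    then show ?case by simp
  next
    case (Cons i "is")
    have "word_op (Psi_at D) (i # is) = (\<lambda>t. Psi_at D i (word_op (Psi_at D) is t))" by auto
    with Cons show ?case by (simp add: coact_T_Psi_at tensor_map_comp)
  qed
  have "(\<Sum>\<sigma> | \<sigma> permutes {..<n}. tensor_map (word_op (Psi_at D) (some_word n \<sigma>)) (\<lambda>h. h) s) = tensor_map (braided_factorial D n) (\<lambda>h. h) s" for s :: "('v talg, 'h) tensor"
  proof (rule clinear_eqI[where t = s])
    fix x and h :: 'h
    show "(\<Sum>\<sigma> | \<sigma> permutes {..<n}. tensor_map (word_op (Psi_at D) (some_word n \<sigma>)) (\<lambda>h. h) (x \<otimes> h)) = tensor_map (braided_factorial D n) (\<lambda>h. h) (x \<otimes> h)"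
      by (simp add: braided_factorial_sum braid_sum_def clinear_sum[of "\<lambda>x. x \<otimes> h"])
  qed simp_all
  then show ?thesis
    by (simp add: braided_factorial_sum[of n t] braid_sum_def clinear_sum[of coact_T] w)
qed

end

section \<open>Comodule algebra quotients of the tensor algebra\<close>

text \<open>\<open>G\<close> is \<open>p\<close> after a linear right inverse of \<open>f\<close> on
  the image of \<open>S\<close>. With [n]! for \<open>f\<close> and the projection to B for
  \<open>p\<close>, the fact that elements killed by [n]! project to 0 becomes an identity of maps,
  which survives tensoring with another space.\<close>

lemma linear_factor:
  fixes f :: "'a::complex_vec \<Rightarrow> 'b::complex_vec" and p :: "'a \<Rightarrow> 'c::complex_vec"
  assumes f: "clinear f" and p: "clinear p" and S: "cvec.subspace S"
    and ker: "\<And>t. t \<in> S \<Longrightarrow> f t = 0 \<Longrightarrow> p t = 0"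
  obtains G where "clinear G" "\<And>t. t \<in> S \<Longrightarrow> p t = G (f t)"
proof -
  interpret vector_space_pair "scaleC :: complex \<Rightarrow> 'a \<Rightarrow> 'a" "scaleC :: complex \<Rightarrow> 'b \<Rightarrow> 'b" ..
  obtain r where r: "range r \<subseteq> S" "clinear r" "\<And>v. v \<in> f ` S \<Longrightarrow> f (r v) = v"
    using linear_exists_right_inverse_on[OF f S] by auto
  show ?thesis
  proof
    show "clinear (\<lambda>w. p (r w))" using r(2) p by (rule clinear_compose[rotated])
    fix t assume t: "t \<in> S"
    have "t - r (f t) \<in> S" using t r(1) by (intro cvec.subspace_diff[OF S]) auto
    moreover have "f (t - r (f t)) = 0" using r(3)[of "f t"] t by (simp add: clinear_diff[OF f])
    ultimately have "p (t - r (f t)) = 0" by (rule ker)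
    then show "p t = p (r (f t))" by (simp add: clinear_diff[OF p])
  qed
qed

lemma clinear_eqI_span:
  assumes "s \<in> cvec.span {x \<otimes> h | x h. x \<in> S}" "clinear f" "clinear g" "\<And>x h. x \<in> S \<Longrightarrow> f (x \<otimes> h) = g (x \<otimes> h)"
  shows "f s = g s"
  using assms(1) by (rule clinear_span_induct) (use assms(2-4) in auto)

context unitary_comodule_setting
begin

text \<open>Keeps the left leg of the coaction in degree n, the only degree in which the projection
  to B is known to factor through [n]!.\<close>

lemma coact_T_deg: "t \<in> talg_deg n \<Longrightarrow> coact_T t \<in> cvec.span {x \<otimes> h | x h. x \<in> talg_deg n}"
proof (induct rule: talg_deg_induct)
  case (word xs)
  then show ?case
  proof (induct xs arbitrary: n)
    case Nil
    have "1 \<in> talg_deg 0" using word_in_talg_deg[of "[]"] by simp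
    then show ?case using Nil by (auto simp: coact_T_one intro!: cvec.span_base)
  next
    case (Cons v xs)
    then obtain m where n: "n = Suc m" and m: "length xs = m" by auto
    have "tensor_mult (tensor_map (\<lambda>w. word [w]) (\<lambda>h. h) s) t \<in> cvec.span {x \<otimes> h | x h. x \<in> talg_deg n}"
      if t: "t \<in> cvec.span {x \<otimes> h | x h. x \<in> talg_deg m}" for s :: "('v, 'h) tensor" and t
      using t
    proof (induct rule: cvec.span_induct_alt)
      case base
      have "tensor_mult u (0 :: ('v talg, 'h) tensor) = 0" for u by (rule clinear_0) simp
      then show ?case by (simp add: cvec.span_zero)
    next
      case (step c y z)
      from step(1) obtain x h where y: "y = x \<otimes> h" "x \<in> talg_deg m" by auto
      have "tensor_mult (tensor_map (\<lambda>w. word [w]) (\<lambda>h. h) s) y \<in> cvec.span {x \<otimes> h | x h. x \<in> talg_deg n}"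
      proof (induct s rule: tensor_induct)
        case (pure v g)
        have "word [v] * x \<in> talg_deg n" using mult_talg_deg[OF word_in_talg_deg[of "[v]"] y(2)] n by simp
        then show ?case unfolding y(1) by (auto intro!: cvec.span_base)
      next
        case (add s t)
        then show ?case by (simp add: clinear_add[of "tensor_map (\<lambda>w. word [w]) (\<lambda>h. h)"] clinear_add[of "\<lambda>u. tensor_mult u y"] cvec.span_add)
      qed
      moreover have "tensor_mult u (c *\<^sub>C y + z) = c *\<^sub>C tensor_mult u y + tensor_mult u z" for u
        by (simp add: clinear_add[of "tensor_mult u"] clinear_scale[of "tensor_mult u"])
      ultimately show ?case using step(2) by (simp add: cvec.span_add cvec.span_scale)
    qed
    then show ?case using Cons(1)[OF m] by (simp add: word_Cons[of v xs] coact_T_letter)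
  qed
next
  case (scale c t)
  then show ?case by (simp add: clinear_scale[OF coact_T_linear(1)] cvec.span_scale)
next
  case (add s t)
  then show ?case by (simp add: clinear_add[OF coact_T_linear(1)] cvec.span_add)
qed

definition deg0_T :: "'v talg \<Rightarrow> complex" where "deg0_T = talg_lift (\<lambda>xs. if xs = [] then 1 else 0)"

definition deg1_T :: "'v talg \<Rightarrow> 'v" where "deg1_T = talg_lift (\<lambda>xs. if length xs = 1 then hd xs else 0)"

lemma deg0_T: "clinear deg0_T" "deg0_T (word xs) = (if xs = [] then 1 else 0)"
  by (simp_all add: deg0_T_def)

lemma deg1_T: "clinear deg1_T" "deg1_T (word xs) = (if length xs = 1 then hd xs else 0)"
proof -
  have m: "multilin (\<lambda>xs. if length xs = 1 then hd xs else 0 :: 'v)"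
  proof (intro allI)
    fix xs ys :: "'v list"
    show "clinear (\<lambda>v. if length (xs @ v # ys) = 1 then hd (xs @ v # ys) else 0)"
      by (cases "xs = [] \<and> ys = []") auto
  qed
  show "clinear deg1_T" "deg1_T (word xs) = (if length xs = 1 then hd xs else 0)"
    unfolding deg1_T_def using talg_lift_linear[OF m] talg_lift_word[OF m] by auto
qed

end

text \<open>The conditions under which the coaction and the projections to degrees 0 and 1 descend
  to a quotient of the tensor algebra; they are verified for both B and \<Lambda>.\<close>

locale quotient_comodule = unitary_comodule_setting D
  for D :: "('h::complex_alg_1, 'v::complex_vec, 'b::complex_alg_1, 'l::complex_alg_1) braided_data" +
  fixes p :: "'v talg \<Rightarrow> 'q::complex_alg_1" and K :: "'v talg set"
  assumes quot: "quotient_by p K"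
    and K_coact: "t \<in> K \<Longrightarrow> tensor_map p (\<lambda>h. h) (coact_T t) = 0"
    and K_deg: "t \<in> K \<Longrightarrow> deg0_T t = 0" "t \<in> K \<Longrightarrow> deg1_T t = 0"
begin

lemma p_linear [simp]: "clinear p" "clinear f \<Longrightarrow> clinear (\<lambda>x. p (f x))"
  using quot clinear_compose by (auto simp: quotient_by_def)

lemma p_one [simp]: "p 1 = 1" and p_mult: "p (s * t) = p s * p t" and p_eq_0: "p t = 0 \<longleftrightarrow> t \<in> K"
  using quot by (auto simp: quotient_by_def)

lemma p_surj: "\<exists>t. a = p t"
  using quot unfolding quotient_by_def by (metis surjD)

abbreviation gen :: "'v \<Rightarrow> 'q" where "gen v \<equiv> p (word [v])"

lemma induced_apply:
  fixes f :: "'v talg \<Rightarrow> 'x::ab_group_add"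
  assumes "\<And>s t. f (s + t) = f s + f t" "\<And>t. t \<in> K \<Longrightarrow> f t = 0"
  shows "induced p f (p t) = f t"
proof -
  have "p (inv p (p t)) = p t" by (metis f_inv_into_f rangeI)
  then have "p (inv p (p t) - t) = 0" by (simp add: clinear_diff[OF p_linear(1)])
  then have "f (inv p (p t) - t) = 0" using assms(2) p_eq_0 by blast
  then show ?thesis by (simp add: induced_def additive_diff[OF assms(1)])
qed

lemma clinear_quotI:
  assumes "clinear g" "\<And>t. f (p t) = g t"
  shows "clinear f"
proof (rule clinearI)
  fix x y c
  obtain s t where x: "x = p s" and y: "y = p t" using p_surj by metis
  have "f (p (s + t)) = f (p s) + f (p t)" "f (p (c *\<^sub>C s)) = c *\<^sub>C f (p s)"
    unfolding assms(2) by (rule clinear_add[OF assms(1)], rule clinear_scale[OF assms(1)])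
  then show "f (x + y) = f x + f y" "f (c *\<^sub>C x) = c *\<^sub>C f x"
    unfolding x y clinear_add[OF p_linear(1)] clinear_scale[OF p_linear(1)] .
qed

lemma antilinear_quotI:
  assumes "antilinear g" "\<And>t. f (p t) = g t"
  shows "antilinear f"
  unfolding antilinear_def
proof (intro allI conjI)
  fix x y c
  obtain s t where x: "x = p s" and y: "y = p t" using p_surj by metis
  have "f (p (s + t)) = f (p s) + f (p t)" "f (p (c *\<^sub>C s)) = cnj c *\<^sub>C f (p s)"
    unfolding assms(2) by (rule antilinear_add[OF assms(1)], rule antilinear_scale[OF assms(1)])
  then show "f (x + y) = f x + f y" "f (c *\<^sub>C x) = cnj c *\<^sub>C f x"
    unfolding x y clinear_add[OF p_linear(1)] clinear_scale[OF p_linear(1)] .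
qed

lemma gen_induct:
  assumes "clinear f" "clinear g" "f 1 = g 1" "\<And>v a. f a = g a \<Longrightarrow> f (gen v * a) = g (gen v * a)"
  shows "f a = g a"
proof -
  obtain t where "a = p t" using p_surj by blast
  moreover have "f (p t) = g (p t)"
  proof (rule talg_Cons_eqI[where t = t])
    show "clinear (\<lambda>t. f (p t))" "clinear (\<lambda>t. g (p t))" using assms(1,2) by (simp_all add: clinear_compose)
  qed (use assms(3,4) in \<open>simp_all add: p_mult\<close>)
  ultimately show ?thesis by simp
qed

abbreviation "\<rho> \<equiv> coact_quot D p"

lemma coact_p: "\<rho> (p t) = tensor_map p (\<lambda>h. h) (coact_T t)"
proof -
  let ?G = "\<lambda>v s. tensor_mult (tensor_map (\<lambda>w. gen w) (\<lambda>h. h) (\<rho>V v)) s"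
  let ?f = "\<lambda>xs. foldr ?G xs (1 \<otimes> 1)"
  have "bilin ?G" by simp
  then have m: "multilin ?f" by (rule multilin_foldr)
  have w: "talg_lift ?f (word xs) = tensor_map p (\<lambda>h. h) (coact_T (word xs))" for xs
  proof (induct xs)
    case Nil
    have "tensor_map p (\<lambda>h. h) (coact_T (word [])) = 1 \<otimes> 1" by (simp add: coact_T_one)
    then show ?case by (simp only: talg_lift_word[OF m]) simp
  next
    case (Cons v xs)
    have q: "tensor_mult (tensor_map (\<lambda>w. gen w) (\<lambda>h. h) s) (tensor_map p (\<lambda>h. h) u) =
       tensor_map p (\<lambda>h. h) (tensor_mult (tensor_map (\<lambda>w. word [w]) (\<lambda>h. h) s) u)" for s :: "('v, 'h) tensor" and u
      by (rule clinear_eqI[where t = s], simp, simp, rule clinear_eqI[where t = u]) (simp_all add: p_mult)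
    have "talg_lift ?f (word (v # xs)) = ?G v (talg_lift ?f (word xs))"
      by (simp only: talg_lift_word[OF m] foldr.simps o_apply)
    also have "\<dots> = tensor_map p (\<lambda>h. h) (coact_T (word (v # xs)))"
      by (simp only: Cons q word_Cons[of v xs] coact_T_letter)
    finally show ?case .
  qed
  have eq: "talg_lift ?f t = tensor_map p (\<lambda>h. h) (coact_T t)" for t
    by (rule talg_eqI[where t = t, OF talg_lift_linear[OF m] _ w]) simp
  have "coact_quot D p (p t) = induced p (\<lambda>t. tensor_map p (\<lambda>h. h) (coact_T t)) (p t)"
    unfolding coact_quot_def id_def using eq by (metis (no_types, lifting) ext)
  also have "\<dots> = tensor_map p (\<lambda>h. h) (coact_T t)"
    by (rule induced_apply) (simp_all add: K_coact clinear_add[OF coact_T_linear(1)] clinear_add[of "tensor_map p (\<lambda>h. h)"])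
  finally show ?thesis .
qed

lemma coact_q_linear [simp]: "clinear \<rho>" "clinear f \<Longrightarrow> clinear (\<lambda>x. \<rho> (f x))"
proof -
  show "clinear \<rho>"
    by (rule clinear_quotI[where f = \<rho> and g = "\<lambda>t. tensor_map p (\<lambda>h. h) (coact_T t)"]) (simp_all add: coact_p)
  then show "clinear f \<Longrightarrow> clinear (\<lambda>x. \<rho> (f x))" by (rule clinear_compose)
qed

lemma coact_q_one: "\<rho> 1 = 1 \<otimes> 1"
  using coact_p[of 1] by (simp add: coact_T_one)

lemma coact_gen: "\<rho> (gen v) = tensor_map (\<lambda>v. gen v) (\<lambda>h. h) (\<rho>V v)"
  by (simp add: coact_p coact_T_gen tensor_map_comp)

lemma coact_q_mult: "\<rho> (a * b) = tensor_mult (\<rho> a) (\<rho> b)"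
proof -
  obtain s t where "a = p s" "b = p t" using p_surj by metis
  moreover have "tensor_map p (\<lambda>h. h) (tensor_mult x y) = tensor_mult (tensor_map p (\<lambda>h. h) x) (tensor_map p (\<lambda>h. h) y)"
    for x y :: "('v talg, 'h) tensor"
    by (rule clinear_eqI[where t = x], simp, simp, rule clinear_eqI[where t = y]) (simp_all add: p_mult)
  ultimately show ?thesis by (simp add: coact_p coact_T_mult flip: p_mult)
qed

definition mult3 :: "('q, ('h, 'h) tensor) tensor \<Rightarrow> ('q, ('h, 'h) tensor) tensor \<Rightarrow> ('q, ('h, 'h) tensor) tensor"
  where "mult3 s t = tensor_lift (\<lambda>x u. tensor_lift (\<lambda>x' u'. (x * x') \<otimes> tensor_mult u u') t) s"

lemma mult3_linear [simp]: "clinear f \<Longrightarrow> clinear (\<lambda>s. mult3 (f s) t)" "clinear f \<Longrightarrow> clinear (\<lambda>t. mult3 s (f t))"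
  by (simp_all add: mult3_def)

lemma mult3_pure [simp]: "mult3 (x \<otimes> u) (x' \<otimes> u') = (x * x') \<otimes> tensor_mult u u'"
  by (simp add: mult3_def)

text \<open>Both sides of coassociativity are multiplicative for \<open>mult3\<close>, and the
  contraction with the counit is multiplicative as well. So the axioms need checking on generators
  only, where they are those of the comodule V.\<close>

lemma comodule_algebra_q [simp]: "comodule_algebra \<rho>"
proof -
  let ?L = "\<lambda>s. tensor_assoc (tensor_map \<rho> (\<lambda>h. h) s)" and ?R = "tensor_map (\<lambda>x. x) (comult D)"
  have comult_mult: "comult D (g * h) = tensor_mult (comult D g) (comult D h)" for g h
    using hopf by (simp add: hopf_star_algebra_def)
  have ll [simp]: "clinear ?L" by (rule clinear_compose[OF clinear_tensor_assoc]) simp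
  have a: "tensor_assoc (tensor_mult c d \<otimes> (g * h)) = mult3 (tensor_assoc (c \<otimes> g)) (tensor_assoc (d \<otimes> h))"
    for c d :: "('q, 'h) tensor" and g h
    by (rule clinear_eqI[where t = c]; (rule clinear_eqI[where t = d])?)
      (simp_all add: clinear_compose[OF clinear_tensor_assoc])
  have L: "?L (tensor_mult s t) = mult3 (?L s) (?L t)" for s t
    by (rule clinear_eqI[where t = s]; (rule clinear_eqI[where t = t])?)
      (simp_all add: clinear_compose[OF ll] coact_q_mult a)
  have R: "?R (tensor_mult s t) = mult3 (?R s) (?R t)" for s t
    by (rule clinear_eqI[where t = s]; (rule clinear_eqI[where t = t])?) (simp_all add: comult_mult)
  have coassoc: "?L (\<rho> a) = ?R (\<rho> a)" for a
  proof (rule gen_induct[where a = a])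
    show "clinear (\<lambda>a. ?L (\<rho> a))" by (rule clinear_compose[OF ll]) simp
    show "?L (\<rho> 1) = ?R (\<rho> 1)" by (simp add: coact_q_one comult_one)
    fix v a assume *: "?L (\<rho> a) = ?R (\<rho> a)"
    have V: "tensor_assoc (tensor_map \<rho>V (\<lambda>h. h) (\<rho>V v)) = tensor_map (\<lambda>x. x) (comult D) (\<rho>V v)"
      using coact_comodule unfolding comodule_def id_def by blast
    have 1: "?L (\<rho> (gen v)) = tensor_map (\<lambda>v. gen v) (\<lambda>h. h) (tensor_assoc (tensor_map \<rho>V (\<lambda>h. h) (\<rho>V v)))"
    proof -
      have *: "tensor_assoc (tensor_map (\<lambda>v. gen v) (\<lambda>h. h) s \<otimes> h) = tensor_map (\<lambda>v. gen v) (\<lambda>h. h) (tensor_assoc (s \<otimes> h))"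
        for s :: "('v, 'h) tensor" and h :: 'h
        by (rule clinear_eqI[where t = s]) (simp_all add: clinear_compose[OF clinear_tensor_assoc])
      have "?L (tensor_map (\<lambda>v. gen v) (\<lambda>h. h) s) = tensor_map (\<lambda>v. gen v) (\<lambda>h. h) (tensor_assoc (tensor_map \<rho>V (\<lambda>h. h) s))"
        for s :: "('v, 'h) tensor"
        by (rule clinear_eqI[where t = s]) (simp_all add: clinear_compose[OF ll] clinear_compose[OF clinear_tensor_assoc] coact_gen *)
      then show ?thesis by (simp add: coact_gen)
    qed
    have 2: "?R (\<rho> (gen v)) = tensor_map (\<lambda>v. gen v) (\<lambda>h. h) (tensor_map (\<lambda>x. x) (comult D) (\<rho>V v))"
      by (simp add: coact_gen tensor_map_comp)
    show "?L (\<rho> (gen v * a)) = ?R (\<rho> (gen v * a))"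
      unfolding coact_q_mult L R using 1 2 V * by simp
  qed simp
  have counit: "tensor_lift (\<lambda>w h. counit D h *\<^sub>C w) (\<rho> a) = a" for a
  proof (rule gen_induct[where a = a])
    show "tensor_lift (\<lambda>w h. counit D h *\<^sub>C w) (\<rho> 1) = 1" by (simp add: coact_q_one counit_one)
    fix v a assume *: "tensor_lift (\<lambda>w h. counit D h *\<^sub>C w) (\<rho> a) = a"
    have counit_mult: "counit D (g * h) = counit D g * counit D h" for g h
      using hopf by (simp add: hopf_star_algebra_def)
    have "tensor_lift (\<lambda>w h. counit D h *\<^sub>C w) (tensor_mult s t) = tensor_lift (\<lambda>w h. counit D h *\<^sub>C w) s * tensor_lift (\<lambda>w h. counit D h *\<^sub>C w) t"
      for s t :: "('q, 'h) tensor"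
      by (rule clinear_eqI[where t = s]; (rule clinear_eqI[where t = t])?) (simp_all add: counit_mult mult.commute)
    moreover have "tensor_lift (\<lambda>w h. counit D h *\<^sub>C w) (\<rho> (gen v)) = gen v"
      by (simp add: coact_gen tensor_lift_tensor_map counit_comodule[OF coact_comodule])
    ultimately show "tensor_lift (\<lambda>w h. counit D h *\<^sub>C w) (\<rho> (gen v * a)) = gen v * a"
      using * by (simp add: coact_q_mult)
  qed simp_all
  show ?thesis
    unfolding comodule_algebra_def comodule_def id_def
    using coassoc counit by (simp add: coact_q_one coact_q_mult)
qed

lemma comodule_q [simp]: "comodule \<rho>"
  using comodule_algebraD(1)[OF comodule_algebra_q] .

lemma act_gen: "act \<rho> (gen v) h = gen (act \<rho>V v h)"
  unfolding act_def by (simp add: coact_gen tensor_lift_tensor_map clinear_tensor_lift_swap[of "\<lambda>v. gen v"]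
    clinear_scale[of "\<lambda>v. gen v"])

lemma deg0_p: "deg0 p (p t) = deg0_T t" and deg1_p: "deg1 p (p t) = deg1_T t"
  unfolding deg0_def deg1_def deg0_T_def[symmetric] deg1_T_def[symmetric]
  by (rule induced_apply, simp_all add: K_deg clinear_add[OF deg0_T(1)] clinear_add[OF deg1_T(1)])+

lemma deg0_linear [simp]: "clinear (deg0 p)" "clinear f \<Longrightarrow> clinear (\<lambda>x. deg0 p (f x))"
  and deg1_linear [simp]: "clinear (deg1 p)" "clinear g \<Longrightarrow> clinear (\<lambda>x. deg1 p (g x))"
proof -
  show l: "clinear (deg0 p)" "clinear (deg1 p)"
    by (rule clinear_quotI[OF deg0_T(1) deg0_p], rule clinear_quotI[OF deg1_T(1) deg1_p])
  show "clinear f \<Longrightarrow> clinear (\<lambda>x. deg0 p (f x))" "clinear g \<Longrightarrow> clinear (\<lambda>x. deg1 p (g x))"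
    by (rule clinear_compose[OF l(1)], assumption, rule clinear_compose[OF l(2)], assumption)
qed

lemma deg0_one [simp]: "deg0 p 1 = 1" and deg1_one [simp]: "deg1 p 1 = 0"
  and deg0_gen_mult [simp]: "deg0 p (gen v * a) = 0" and deg0_gen [simp]: "deg0 p (gen v) = 0"
  and deg1_gen [simp]: "deg1 p (gen v) = v" and deg1_gen_mult [simp]: "deg1 p (gen v * a) = deg0 p a *\<^sub>C v"
proof -
  show "deg0 p 1 = 1" "deg1 p 1 = 0" "deg0 p (gen v) = 0" "deg1 p (gen v) = v"
    using deg0_p[of 1] deg1_p[of 1] deg0_T(2)[of "[]"] deg1_T(2)[of "[]"] deg0_p[of "word [v]"] deg1_p[of "word [v]"]
    by (simp_all add: deg0_T deg1_T)
  obtain t where a: "a = p t" using p_surj by blast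
  have "deg0_T (word [v] * t) = 0"
    by (rule talg_eqI[where t = t]) (simp_all add: deg0_T clinear_compose[OF deg0_T(1)] flip: word_Cons)
  then show "deg0 p (gen v * a) = 0" by (simp add: a deg0_p flip: p_mult)
  have "deg1_T (word [v] * t) = deg0_T t *\<^sub>C v"
    by (rule talg_eqI[where t = t]) (simp_all add: deg0_T deg1_T clinear_compose[OF deg1_T(1)] flip: word_Cons)
  then show "deg1 p (gen v * a) = deg0 p a *\<^sub>C v" by (simp add: a deg0_p deg1_p flip: p_mult)
qed

text \<open>Projection to degree 0 is a comodule map to the trivial comodule, so the Hopf algebra
  leg of the coaction contributes 1.\<close>

lemma deg0_coact: "bilin f \<Longrightarrow> tensor_lift (\<lambda>a0 a1. f (deg0 p a0) a1) (\<rho> a) = f (deg0 p a) 1"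
proof -
  assume f: "bilin f"
  have fl [simp]: "clinear k \<Longrightarrow> clinear (\<lambda>x. f (k x) y)" "clinear g' \<Longrightarrow> clinear (\<lambda>x. f z (g' x))" for k y g' z
    using clinear_compose[of "\<lambda>x. f x y" k] clinear_compose[of "f z" g'] f by auto
  have f0: "f 0 h = 0" for h by (rule clinear_0[of "\<lambda>x. f x h"]) simp
  show ?thesis
  proof (rule gen_induct[where a = a])
    show "tensor_lift (\<lambda>a0. f (deg0 p a0)) (\<rho> 1) = f (deg0 p 1) 1" by (simp add: coact_q_one)
    fix v a
    show "tensor_lift (\<lambda>a0. f (deg0 p a0)) (\<rho> (gen v * a)) = f (deg0 p (gen v * a)) 1"
      by (simp add: comodule_algebraD(3)[OF comodule_algebra_q] coact_gen tensor_lift_tensor_map f0)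
  qed simp_all
qed

lemma deg1_coact: "\<rho>V (deg1 p a) = tensor_map (deg1 p) (\<lambda>h. h) (\<rho> a)"
proof (rule gen_induct[where a = a])
  show "\<rho>V (deg1 p 1) = tensor_map (deg1 p) (\<lambda>h. h) (\<rho> 1)"
    by (simp add: coact_q_one clinear_0[OF coact_linear(1)])
  fix v a
  have "tensor_map (deg1 p) (\<lambda>h. h) (\<rho> (gen v * a)) =
      tensor_lift (\<lambda>v0 v1. tensor_lift (\<lambda>a0 a1. deg0 p a0 *\<^sub>C v0 \<otimes> (v1 * a1)) (\<rho> a)) (\<rho>V v)"
    unfolding tensor_map_def[of "deg1 p"]
    by (simp add: comodule_algebraD(3)[OF comodule_algebra_q] coact_gen tensor_lift_tensor_map)
  also have "\<dots> = tensor_lift (\<lambda>v0 v1. deg0 p a *\<^sub>C v0 \<otimes> v1) (\<rho>V v)"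
    by (subst deg0_coact[of "\<lambda>c h. c *\<^sub>C (_ \<otimes> (_ * h))"]) simp_all
  also have "\<dots> = deg0 p a *\<^sub>C \<rho>V v"
    by (simp add: scaleC_tensor_lift[symmetric])
  finally show "\<rho>V (deg1 p (gen v * a)) = tensor_map (deg1 p) (\<lambda>h. h) (\<rho> (gen v * a))"
    by (simp add: clinear_scale[OF coact_linear(1)])
qed simp_all

lemma deg1_act: "deg1 p (act \<rho> a h) = act \<rho>V (deg1 p a) h"
  unfolding act_def deg1_coact
  by (simp add: tensor_lift_tensor_map clinear_tensor_lift_swap[of "deg1 p"] clinear_scale[of "deg1 p"])

lemma deg0_act: "deg0 p (act \<rho> a h) = counit D h * deg0 p a"
  unfolding act_def
  using deg0_coact[of "\<lambda>x y. Rform D y h * x" a]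
  by (simp add: clinear_tensor_lift_swap[of "deg0 p"] clinear_scale[of "deg0 p"] Rform_one)

end

section \<open>The Nichols algebra and the exterior algebra\<close>

locale calculus = unitary_comodule_setting D
  for D :: "('h::complex_alg_1, 'v::complex_vec, 'b::complex_alg_1, 'l::complex_alg_1) braided_data" +
  assumes quot_B: "quotient_by (proj_B D) (nichols_ideal D)"
    and quot_L: "quotient_by (proj_\<Lambda> D) (exterior_ideal D)"
begin

abbreviation "\<pi>B \<equiv> proj_B D"
abbreviation "\<pi>L \<equiv> proj_\<Lambda> D"

lemma pi_linear: "clinear \<pi>B" "clinear \<pi>L"
  using quot_B quot_L by (auto simp: quotient_by_def)

lemma span_vanish:
  assumes "t \<in> cvec.span S" "\<And>x y. f (x + y) = f x + f y" "\<And>c x. f x = 0 \<Longrightarrow> f (c *\<^sub>C x) = 0" "\<And>t. t \<in> S \<Longrightarrow> f t = 0"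
  shows "f t = (0 :: 'x::ab_group_add)"
  using assms(1) by (induct rule: cvec.span_induct_alt) (simp_all add: additive_zero[OF assms(2)] assms(2-4))

text \<open>Homogeneity is asked only in the form that zeros of \<open>f\<close> are stable under
  scaling, so that the rule also applies to antilinear maps such as the projection of a reversed
  word.\<close>

lemma nichols_vanish:
  assumes "t \<in> nichols_ideal D" "\<And>x y. f (x + y) = f x + f y" "\<And>c x. f x = 0 \<Longrightarrow> f (c *\<^sub>C x) = 0"
    "\<And>n t. t \<in> talg_deg n \<Longrightarrow> braided_factorial D n t = 0 \<Longrightarrow> f t = 0"
  shows "f t = (0 :: 'x::ab_group_add)"
  using assms(1) unfolding nichols_ideal_def by (rule span_vanish) (use assms(2-4) in auto)

lemma exterior_vanish:
  assumes "t \<in> exterior_ideal D" "\<And>x y. f (x + y) = f x + f y" "\<And>c x. f x = 0 \<Longrightarrow> f (c *\<^sub>C x) = 0"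
    "\<And>x s y. f (x * quad (s + \<psi> s) * y) = 0"
  shows "f t = (0 :: 'x::ab_group_add)"
  using assms(1) unfolding exterior_ideal_def by (rule span_vanish) (use assms(2-4) in auto)

lemma pi_eq_0: "\<pi>B t = 0 \<longleftrightarrow> t \<in> nichols_ideal D" "\<pi>L t = 0 \<longleftrightarrow> t \<in> exterior_ideal D"
  using quot_B quot_L by (auto simp: quotient_by_def)

lemma nichols_mem: "t \<in> talg_deg n \<Longrightarrow> braided_factorial D n t = 0 \<Longrightarrow> t \<in> nichols_ideal D"
  unfolding nichols_ideal_def by (rule cvec.span_base) auto

lemma exterior_mem: "x * quad (s + \<psi> s) * y \<in> exterior_ideal D"
  unfolding exterior_ideal_def by (rule cvec.span_base) auto

lemma braided_factorial_small: "n \<le> 1 \<Longrightarrow> braided_factorial D n t = t"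
proof -
  assume n: "n \<le> 1"
  have p: "{\<sigma>. \<sigma> permutes {..<n}} = {id}"
    using n by (cases n) (auto simp: lessThan_Suc)
  have "valid_word n (some_word n id)" by (rule some_word) (rule permutes_id)
  then have "some_word n id = []" using n by (cases "some_word n id") auto
  then show ?thesis by (simp add: braided_factorial_sum braid_sum_def p)
qed

lemma nichols_factor:
  obtains G where "clinear G" "\<And>t. t \<in> talg_deg n \<Longrightarrow> \<pi>B t = G (braided_factorial D n t)"
  using linear_factor[OF braided_factorial_linear pi_linear(1) talg_deg_subspace]
  by (metis nichols_mem pi_eq_0(1))

sublocale B: quotient_comodule D \<pi>B "nichols_ideal D"
proof
  show "quotient_by \<pi>B (nichols_ideal D)" by (rule quot_B)
  note [simp] = pi_linear clinear_compose[OF pi_linear(1)]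
  fix t assume t: "t \<in> nichols_ideal D"
  from t show "tensor_map \<pi>B (\<lambda>h. h) (coact_T t) = 0"
  proof (rule nichols_vanish)
    fix n t assume t: "t \<in> talg_deg n" "braided_factorial D n t = 0"
    obtain G where G: "clinear G" "\<And>t. t \<in> talg_deg n \<Longrightarrow> \<pi>B t = G (braided_factorial D n t)"
      using nichols_factor by blast
    \<comment> \<open>With \<open>\<pi>B\<close> equal to \<open>G\<close> after [n]! in degree n,
      colinearity of [n]! moves the factorial onto \<open>t\<close> itself, where it
      vanishes.\<close>
    have "tensor_map \<pi>B (\<lambda>h. h) (coact_T t) = tensor_map (\<lambda>t. G (braided_factorial D n t)) (\<lambda>h. h) (coact_T t)"
      using coact_T_deg[OF t(1)] by (rule clinear_eqI_span) (simp_all add: G clinear_compose)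
    also have "\<dots> = tensor_map G (\<lambda>h. h) (coact_T (braided_factorial D n t))"
      by (simp add: coact_T_factorial tensor_map_comp G)
    finally show "tensor_map \<pi>B (\<lambda>h. h) (coact_T t) = 0"
      by (simp add: t clinear_0[of coact_T] clinear_0[of "tensor_map G _"] G)
  qed (simp_all add: clinear_add[of coact_T] clinear_add[of "tensor_map \<pi>B _"]
      clinear_scale[of coact_T] clinear_scale[of "tensor_map \<pi>B _"])
  \<comment> \<open>In degrees 0 and 1 the factorial is the identity and kills nothing but 0, which
    is why the projections to these degrees descend.\<close>
  have small: "t = 0" if "braided_factorial D n t = 0" "n \<le> 1" for n t
    using braided_factorial_small[OF that(2)] that(1) by simp
  have d0: "deg0_T t = 0" if "t \<in> talg_deg n" "n \<noteq> 0" for t n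
    using that by (intro talg_deg_eqI[where t = t and n = n and f = deg0_T and g = "\<lambda>t. 0"]) (auto simp: deg0_T)
  have d1: "deg1_T t = 0" if "t \<in> talg_deg n" "n \<noteq> 1" for t n
    using that by (intro talg_deg_eqI[where t = t and n = n and f = deg1_T and g = "\<lambda>t. 0"]) (auto simp: deg1_T)
  from t show "deg0_T t = 0"
  proof (rule nichols_vanish)
    fix n t assume t: "t \<in> talg_deg n" "braided_factorial D n t = 0"
    show "deg0_T t = 0"
    proof (cases "n = 0")
      case True
      then show ?thesis using small[OF t(2)] by (simp add: clinear_0[OF deg0_T(1)])
    qed (rule d0[OF t(1)])
  qed (simp_all add: clinear_add[OF deg0_T(1)] clinear_scale[OF deg0_T(1)])
  from t show "deg1_T t = 0"
  proof (rule nichols_vanish)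
    fix n t assume t: "t \<in> talg_deg n" "braided_factorial D n t = 0"
    show "deg1_T t = 0"
    proof (cases "n = 1")
      case True
      then show ?thesis using small[OF t(2)] by (simp add: clinear_0[OF deg1_T(1)])
    qed (rule d1[OF t(1)])
  qed (simp_all add: clinear_add[OF deg1_T(1)] clinear_scale[OF deg1_T(1)])
qed

lemma quad_word: "word xs * quad (v \<otimes> w) * word ys = word (xs @ v # w # ys)"
  by (simp add: word_append word_Cons[of v "w # ys"] word_Cons[of w ys] mult.assoc)

lemma sandwich_zero:
  assumes f: "\<And>x y. f (x + y) = f x + f y" "\<And>c x. f x = 0 \<Longrightarrow> f (c *\<^sub>C x) = 0"
    and w: "\<And>xs ys s. f (word xs * quad s * word ys) = (0 :: 'x::ab_group_add)"
  shows "f (x * quad s * y) = 0"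
proof (induct x rule: talg_induct)
  case (word xs)
  show ?case by (induct y rule: talg_induct) (simp_all add: w f distrib_left)
qed (simp_all add: f distrib_right)

text \<open>Since the braiding is a comodule map, the coaction of a relation s + \<Psi> s is the
  same relation applied to the coaction of s, and so projects to 0.\<close>

sublocale L: quotient_comodule D \<pi>L "exterior_ideal D"
proof
  show "quotient_by \<pi>L (exterior_ideal D)" by (rule quot_L)
  note [simp] = pi_linear clinear_compose[OF pi_linear(2)]
  have pm: "\<pi>L (x * y) = \<pi>L x * \<pi>L y" for x y using quot_L by (simp add: quotient_by_def)
  have m: "tensor_map \<pi>L (\<lambda>h. h) (tensor_mult x y) = tensor_mult (tensor_map \<pi>L (\<lambda>h. h) x) (tensor_map \<pi>L (\<lambda>h. h) y)"
    for x y :: "('v talg, 'h) tensor"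
    by (rule clinear_eqI[where t = x], simp, simp, rule clinear_eqI[where t = y]) (simp_all add: pm)
  fix t assume t: "t \<in> exterior_ideal D"
  from t show "tensor_map \<pi>L (\<lambda>h. h) (coact_T t) = 0"
  proof (rule exterior_vanish)
    fix x s y
    have z: "\<pi>L (quad (s + \<psi> s)) = 0" for s
      using exterior_mem[of 1 s 1] pi_eq_0(2) by simp
    have "codiagonal \<rho>V \<rho>V (\<psi> s) = tensor_map \<psi> (\<lambda>h. h) (codiagonal \<rho>V \<rho>V s)"
      using codiagonal_braid[of \<rho>V \<rho>V s] by (simp add: Psi_def id_def)
    then have "tensor_map \<pi>L (\<lambda>h. h) (coact_T (quad (s + \<psi> s))) =
        tensor_map (\<lambda>s. \<pi>L (quad s)) (\<lambda>h. h) (codiagonal \<rho>V \<rho>V s) + tensor_map (\<lambda>s. \<pi>L (quad (\<psi> s))) (\<lambda>h. h) (codiagonal \<rho>V \<rho>V s)"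
      by (simp add: coact_T_quad clinear_add[of "codiagonal \<rho>V \<rho>V"] clinear_add[of "tensor_map _ _"] tensor_map_comp id_def)
    also have "\<dots> = tensor_map (\<lambda>s. \<pi>L (quad (s + \<psi> s))) (\<lambda>h. h) (codiagonal \<rho>V \<rho>V s)"
      by (rule clinear_eqI[where t = "codiagonal \<rho>V \<rho>V s"])
        (simp_all add: clinear_add[of quad] clinear_add[of \<pi>L])
    also have "\<dots> = 0" by (simp add: z tensor_map_def)
    finally show "tensor_map \<pi>L (\<lambda>h. h) (coact_T (x * quad (s + \<psi> s) * y)) = 0"
      by (simp add: coact_T_mult m clinear_0[of "\<lambda>u. tensor_mult u _"] clinear_0[of "tensor_mult _"])
  qed (simp_all add: clinear_add[of coact_T] clinear_add[of "tensor_map \<pi>L _"]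
      clinear_scale[of coact_T] clinear_scale[of "tensor_map \<pi>L _"])
  have d: "deg0_T (word xs * quad s * word ys) = 0" "deg1_T (word xs * quad s * word ys) = 0" for xs s ys
  proof -
    show "deg0_T (word xs * quad s * word ys) = 0"
      by (rule clinear_eqI[where t = s and g = "\<lambda>s. 0"]) (simp_all add: clinear_compose[OF deg0_T(1)] quad_word deg0_T del: quad_pure)
    show "deg1_T (word xs * quad s * word ys) = 0"
      by (rule clinear_eqI[where t = s and g = "\<lambda>s. 0"]) (simp_all add: clinear_compose[OF deg1_T(1)] quad_word deg1_T del: quad_pure)
  qed
  from t show "deg0_T t = 0"
    by (rule exterior_vanish, simp_all add: clinear_add[OF deg0_T(1)] clinear_scale[OF deg0_T(1)])
      (rule sandwich_zero, simp_all add: clinear_add[OF deg0_T(1)] clinear_scale[OF deg0_T(1)] d)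
  from t show "deg1_T t = 0"
    by (rule exterior_vanish, simp_all add: clinear_add[OF deg1_T(1)] clinear_scale[OF deg1_T(1)])
      (rule sandwich_zero, simp_all add: clinear_add[OF deg1_T(1)] clinear_scale[OF deg1_T(1)] d)
qed

abbreviation "\<rho>B \<equiv> coact_quot D \<pi>B"
abbreviation "\<rho>L \<equiv> coact_quot D \<pi>L"

lemma gen_defs: "gen_B D v = B.gen v" "gen_\<Lambda> D v = L.gen v"
  by (simp_all add: gen_B_def gen_\<Lambda>_def)

lemma L_gen_relation: "L.gen v * L.gen w = - \<pi>L (quad (\<psi> (v \<otimes> w)))"
proof -
  have "\<pi>L (quad (v \<otimes> w + \<psi> (v \<otimes> w))) = 0"
    using exterior_mem[of 1 "v \<otimes> w" 1] pi_eq_0(2) by simp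
  then show ?thesis
    by (simp add: clinear_add[OF quad_linear(1)] clinear_add[OF L.p_linear(1)] L.p_mult eq_neg_iff_add_eq_0)
qed

section \<open>The involutions\<close>

lemma nichols_star: "t \<in> nichols_ideal D \<Longrightarrow> star_T t \<in> nichols_ideal D"
proof -
  assume "t \<in> nichols_ideal D"
  then have "\<pi>B (star_T t) = 0"
  proof (rule nichols_vanish)
    fix n t assume "t \<in> talg_deg n" "braided_factorial D n t = 0"
    then show "\<pi>B (star_T t) = 0"
      unfolding pi_eq_0 using star_T_factorial[of t n] antilinear_0[OF star_T_antilinear]
      by (intro nichols_mem[of _ n]) (simp_all add: star_T_deg)
  qed (simp_all add: star_T_add star_T_scale clinear_add[OF B.p_linear(1)] clinear_scale[OF B.p_linear(1)])
  then show ?thesis by (simp add: pi_eq_0)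
qed

lemma star_B_p: "star_B D (\<pi>B t) = \<pi>B (star_T t)"
proof -
  have m: "antimultilin (\<lambda>xs. \<pi>B (word (rev (map (vstar D) xs))))"
    using rev_antimultilin linear_comp_antilinear[OF B.p_linear(1)] by blast
  have "talg_lift_cnj (\<lambda>xs. \<pi>B (word (rev (map (vstar D) xs)))) t = \<pi>B (star_T t)" for t
    by (induct t rule: talg_induct)
      (simp_all add: talg_lift_cnj_word[OF m] star_T_word antilinear_add[OF talg_lift_cnj_antilinear[OF m]]
        antilinear_scale[OF talg_lift_cnj_antilinear[OF m]] star_T_add star_T_scale
        clinear_add[OF B.p_linear(1)] clinear_scale[OF B.p_linear(1)])
  then have "star_B D = induced \<pi>B (\<lambda>t. \<pi>B (star_T t))"
    unfolding star_B_def by presburger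
  then show ?thesis
    using nichols_star pi_eq_0(1)
    by (simp add: B.induced_apply star_T_add clinear_add[OF B.p_linear(1)])
qed

lemma star_B_antilinear [simp]: "antilinear (star_B D)"
  by (rule B.antilinear_quotI[where f = "star_B D" and g = "\<lambda>t. \<pi>B (star_T t)"])
    (simp_all add: star_B_p linear_comp_antilinear[OF B.p_linear(1)])

lemma star_B_one [simp]: "star_B D 1 = 1" and star_B_gen [simp]: "star_B D (B.gen v) = B.gen (vstar D v)"
  using star_B_p[of 1] star_B_p[of "word [v]"] star_T_word[of "[v]"] by simp_all

lemma star_B_mult: "star_B D (a * b) = star_B D b * star_B D a"
proof -
  obtain s t where "a = \<pi>B s" "b = \<pi>B t" using B.p_surj by metis
  then show ?thesis by (simp add: star_B_p star_T_mult flip: B.p_mult)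
qed

lemma star_B_star_B [simp]: "star_B D (star_B D a) = a"
  using B.p_surj[of a] by (auto simp: star_B_p)

lemma tensor_map_cnj_mult:
  assumes "antilinear f" "antilinear g" "antilinear k" "\<And>x y. f (x * y) = g y * f x" "\<And>x y. f (x * y) = f y * f x"
    and "\<And>h h'. k (h * h') = k h' * k h"
  shows "tensor_map_cnj f k (tensor_mult s t) = tensor_mult (tensor_map_cnj f k t) (tensor_map_cnj f k s)"
proof (induct s rule: tensor_induct)
  case (pure x y)
  show ?case
  proof (induct t rule: tensor_induct)
    case (pure x' y')
    then show ?case using assms by simp
  next
    case (add s t)
    then show ?case using assms(1-3)
      by (simp add: clinear_add[of "tensor_mult _"] clinear_add[of "\<lambda>u. tensor_mult u _"] antilinear_add[of "tensor_map_cnj f k"])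
  qed
next
  case (add s t')
  then show ?case using assms(1-3)
    by (simp add: clinear_add[of "tensor_mult _"] clinear_add[of "\<lambda>u. tensor_mult u _"] antilinear_add[of "tensor_map_cnj f k"])
qed

lemma hstar_mult: "hstar D (g * h) = hstar D h * hstar D g" and hstar_one: "hstar D 1 = 1"
proof -
  show m: "hstar D (g * h) = hstar D h * hstar D g" for g h using hopf by (simp add: hopf_star_algebra_def)
  have i: "hstar D (hstar D h) = h" for h using hopf by (simp add: hopf_star_algebra_def antilinear_involution_def)
  show "hstar D 1 = 1" using m[of "hstar D 1" 1] i by (metis mult_1_right)
qed

lemma coact_T_star: "coact_T (star_T t) = tensor_map_cnj star_T (hstar D) (coact_T t)"
proof (induct t rule: talg_induct)
  case (word xs)
  show ?case
  proof (induct xs)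
    case Nil
    then show ?case by (simp add: coact_T_one hstar_one)
  next
    case (Cons v xs)
    have *: "coact_T (star_T (word [v])) = tensor_map_cnj star_T (hstar D) (coact_T (word [v]))"
    proof -
      have st: "star_T (word [w]) = word [vstar D w]" for w using star_T_word[of "[w]"] by simp
      have "tensor_map_cnj star_T (hstar D) (tensor_map (\<lambda>w. word [w]) (\<lambda>h. h) s) =
          tensor_map (\<lambda>w. word [w]) (\<lambda>h. h) (tensor_map_cnj (vstar D) (hstar D) s)" for s :: "('v, 'h) tensor"
        by (induct s rule: tensor_induct)
          (simp_all add: st clinear_add[of "tensor_map _ _"] antilinear_add[of "tensor_map_cnj _ _"])
      then show ?thesis
        using vstar_comodule_star by (simp add: st coact_T_gen comodule_star_def)
    qed
    show ?case
      unfolding word_Cons[of v xs] star_T_mult coact_T_mult * Cons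
      by (rule tensor_map_cnj_mult[symmetric]) (simp_all add: star_T_mult hstar_mult)
  qed
next
  case (scale c t)
  then show ?case by (simp add: star_T_scale clinear_scale[of coact_T] antilinear_scale[of "tensor_map_cnj _ _"])
next
  case (add s t)
  then show ?case by (simp add: star_T_add clinear_add[of coact_T] antilinear_add[of "tensor_map_cnj _ _"])
qed

lemma star_B_comodule_star [simp]: "comodule_star \<rho>B (star_B D)"
  unfolding comodule_star_def
proof (intro conjI allI)
  fix a
  obtain t where a: "a = \<pi>B t" using B.p_surj by blast
  have "tensor_map \<pi>B (\<lambda>h. h) (tensor_map_cnj star_T (hstar D) s) = tensor_map_cnj (star_B D) (hstar D) (tensor_map \<pi>B (\<lambda>h. h) s)" for s
    by (induct s rule: tensor_induct)
      (simp_all add: star_B_p clinear_add[of "tensor_map _ _"] antilinear_add[of "tensor_map_cnj _ _"])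
  then show "\<rho>B (star_B D a) = tensor_map_cnj (star_B D) (hstar D) (\<rho>B a)"
    by (simp add: a star_B_p B.coact_p coact_T_star)
qed simp

section \<open>The graded involution of the exterior algebra\<close>

definition sign :: "nat \<Rightarrow> complex" where "sign n = (-1) ^ (n choose 2)"

lemma sign_cnj [simp]: "cnj (sign n) = sign n" and sign_sq [simp]: "sign n * sign n = 1"
  by (simp_all add: sign_def flip: power_mult_distrib)

lemma sign_star_antimultilin: "antimultilin (\<lambda>xs. (-1) ^ (length xs choose 2) *\<^sub>C word (rev (map (vstar D) xs)))"
  using rev_antimultilin by simp

definition sstar_T :: "'v talg \<Rightarrow> 'v talg"
  where "sstar_T = talg_lift_cnj (\<lambda>xs. (-1) ^ (length xs choose 2) *\<^sub>C word (rev (map (vstar D) xs)))"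

lemma sstar_T_antilinear [simp]: "antilinear sstar_T"
  unfolding sstar_T_def by (rule talg_lift_cnj_antilinear[OF sign_star_antimultilin])

lemma sstar_T_word: "sstar_T (word xs) = sign (length xs) *\<^sub>C star_T (word xs)"
  unfolding sstar_T_def talg_lift_cnj_word[OF sign_star_antimultilin] by (simp add: sign_def star_T_word)

lemma sstar_T_deg: "t \<in> talg_deg n \<Longrightarrow> sstar_T t = sign n *\<^sub>C star_T t"
  by (induct rule: talg_deg_induct)
    (simp_all add: sstar_T_word star_T_add star_T_scale antilinear_add[OF sstar_T_antilinear]
      antilinear_scale[OF sstar_T_antilinear] scaleC_add_right mult.commute)

lemma sstar_T_sstar_T: "sstar_T (sstar_T t) = t"
proof (induct t rule: talg_induct)
  case (word xs)
  have "star_T (word xs) \<in> talg_deg (length xs)" by (rule star_T_deg[OF word_in_talg_deg])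
  then show ?case by (simp add: sstar_T_word antilinear_scale[OF sstar_T_antilinear] sstar_T_deg)
qed (simp_all add: antilinear_add[OF sstar_T_antilinear] antilinear_scale[OF sstar_T_antilinear])

text \<open>On a homogeneous element the graded involution is plain reversal up to a scalar sign,
  and reversal sends the relation for s to the relation for its dagger.\<close>

lemma exterior_sstar: "t \<in> exterior_ideal D \<Longrightarrow> sstar_T t \<in> exterior_ideal D"
proof -
  assume "t \<in> exterior_ideal D"
  then have "\<pi>L (sstar_T t) = 0"
  proof (rule exterior_vanish)
    fix x s y
    let ?u = "s + \<psi> s"
    have "\<pi>L (sstar_T (word xs * quad ?u * word ys)) = 0" for xs ys
    proof -
      have d: "word xs * quad ?u * word ys \<in> talg_deg (length xs + 2 + length ys)"
        by (intro mult_talg_deg word_in_talg_deg quad_deg)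
      have "dagger (vstar D) ?u = dagger (vstar D) s + \<psi> (dagger (vstar D) s)"
        unfolding Psi_dagger by (simp add: dagger_def tensor_lift_cnj_add)
      then have "star_T (word xs * quad ?u * word ys) \<in> exterior_ideal D"
        using exterior_mem[of "star_T (word ys)" "dagger (vstar D) s" "star_T (word xs)"]
        by (simp add: star_T_mult star_T_quad mult.assoc)
      then show ?thesis
        by (simp add: sstar_T_deg[OF d] clinear_scale[OF L.p_linear(1)] L.p_eq_0)
    qed
    note w = this
    have a: "\<pi>L (sstar_T (p + q)) = \<pi>L (sstar_T p) + \<pi>L (sstar_T q)" "\<pi>L (sstar_T (c *\<^sub>C p)) = cnj c *\<^sub>C \<pi>L (sstar_T p)" for p q c
      by (simp_all add: antilinear_add[OF sstar_T_antilinear] antilinear_scale[OF sstar_T_antilinear]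
          clinear_add[OF L.p_linear(1)] clinear_scale[OF L.p_linear(1)])
    show "\<pi>L (sstar_T (x * quad ?u * y)) = 0"
    proof (induct x rule: talg_induct)
      case (word xs)
      show ?case by (induct y rule: talg_induct) (simp_all add: w a distrib_left)
    qed (simp_all add: a distrib_right)
  qed (simp_all add: antilinear_add[OF sstar_T_antilinear] antilinear_scale[OF sstar_T_antilinear]
          clinear_add[OF L.p_linear(1)] clinear_scale[OF L.p_linear(1)])
  then show ?thesis by (simp add: pi_eq_0)
qed

lemma star_L_p: "star_\<Lambda> D (\<pi>L t) = \<pi>L (sstar_T t)"
proof -
  have m: "antimultilin (\<lambda>xs. (-1) ^ (length xs choose 2) *\<^sub>C \<pi>L (word (rev (map (vstar D) xs))))"
  proof -
    have "antimultilin (\<lambda>xs. \<pi>L (word (rev (map (vstar D) xs))))"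
      using rev_antimultilin linear_comp_antilinear[OF L.p_linear(1)] by blast
    then show ?thesis by simp
  qed
  have "talg_lift_cnj (\<lambda>xs. (-1) ^ (length xs choose 2) *\<^sub>C \<pi>L (word (rev (map (vstar D) xs)))) t = \<pi>L (sstar_T t)" for t
    by (induct t rule: talg_induct)
      (simp_all add: talg_lift_cnj_word[OF m] sstar_T_word sign_def star_T_word antilinear_add[OF talg_lift_cnj_antilinear[OF m]]
        antilinear_scale[OF talg_lift_cnj_antilinear[OF m]] antilinear_add[OF sstar_T_antilinear] antilinear_scale[OF sstar_T_antilinear]
        clinear_add[OF L.p_linear(1)] clinear_scale[OF L.p_linear(1)])
  then have "star_\<Lambda> D = induced \<pi>L (\<lambda>t. \<pi>L (sstar_T t))"
    unfolding star_\<Lambda>_def by presburger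
  then show ?thesis
    using exterior_sstar pi_eq_0(2)
    by (simp add: L.induced_apply antilinear_add[OF sstar_T_antilinear] clinear_add[OF L.p_linear(1)])
qed

lemma star_L_antilinear [simp]: "antilinear (star_\<Lambda> D)"
  by (rule L.antilinear_quotI[where f = "star_\<Lambda> D" and g = "\<lambda>t. \<pi>L (sstar_T t)"])
    (simp_all add: star_L_p linear_comp_antilinear[OF L.p_linear(1)])

lemma star_L_one [simp]: "star_\<Lambda> D 1 = 1" and star_L_gen [simp]: "star_\<Lambda> D (L.gen v) = L.gen (vstar D v)"
  using star_L_p[of "word []"] star_L_p[of "word [v]"] sstar_T_word[of "[]"] sstar_T_word[of "[v]"] star_T_word[of "[v]"]
  by (simp_all add: sign_def numeral_2_eq_2)

lemma star_L_comodule_star [simp]: "comodule_star \<rho>L (star_\<Lambda> D)"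
  unfolding comodule_star_def
proof (intro conjI allI)
  have T: "coact_T (sstar_T t) = tensor_map_cnj sstar_T (hstar D) (coact_T t)" for t
  proof (induct t rule: talg_induct)
    case (word xs)
    have "tensor_map_cnj sstar_T (hstar D) s = sign n *\<^sub>C tensor_map_cnj star_T (hstar D) s"
      if "s \<in> cvec.span {x \<otimes> h | x h. x \<in> talg_deg n}" for s n
      using that
    proof (induct rule: cvec.span_induct_alt)
      case base
      then show ?case by (simp add: antilinear_0[OF antilinear_tensor_map_cnj])
    next
      case (step c x y)
      then show ?case
        by (auto simp: antilinear_add[OF antilinear_tensor_map_cnj] antilinear_scale[OF antilinear_tensor_map_cnj]
            sstar_T_deg scaleC_add_right mult.commute)
    qed
    from this[OF coact_T_deg[OF word_in_talg_deg]] show ?case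
      by (simp add: sstar_T_word clinear_scale[OF coact_T_linear(1)] coact_T_star)
  qed (simp_all add: antilinear_add[OF sstar_T_antilinear] antilinear_scale[OF sstar_T_antilinear]
      antilinear_add[OF antilinear_tensor_map_cnj] antilinear_scale[OF antilinear_tensor_map_cnj]
      clinear_scale[OF coact_T_linear(1)] clinear_add[OF coact_T_linear(1)])
  fix a
  obtain t where a: "a = \<pi>L t" using L.p_surj by blast
  have "tensor_map \<pi>L (\<lambda>h. h) (tensor_map_cnj sstar_T (hstar D) s) = tensor_map_cnj (star_\<Lambda> D) (hstar D) (tensor_map \<pi>L (\<lambda>h. h) s)" for s
    by (induct s rule: tensor_induct)
      (simp_all add: star_L_p clinear_add[of "tensor_map _ _"] antilinear_add[of "tensor_map_cnj _ _"])
  then show "\<rho>L (star_\<Lambda> D a) = tensor_map_cnj (star_\<Lambda> D) (hstar D) (\<rho>L a)"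
    by (simp add: a star_L_p L.coact_p T)
qed simp

section \<open>The parity operator\<close>

definition par_T :: "'v talg \<Rightarrow> 'v talg"
  where "par_T = talg_lift (\<lambda>xs. (-1) ^ length xs *\<^sub>C word xs)"

lemma par_multilin: "multilin (\<lambda>xs. (-1) ^ length xs *\<^sub>C word xs :: 'v talg)"
  by (simp add: word_multilinear)

lemma par_T_linear [simp]: "clinear par_T" "clinear f \<Longrightarrow> clinear (\<lambda>x. par_T (f x))"
  unfolding par_T_def using talg_lift_linear[OF par_multilin] clinear_compose by blast+

lemma par_T_word: "par_T (word xs) = (-1) ^ length xs *\<^sub>C word xs"
  unfolding par_T_def by (rule talg_lift_word[OF par_multilin])

lemma par_T_one: "par_T 1 = 1" and par_T_letter: "par_T (word [v]) = - word [v]"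
  using par_T_word[of "[]"] par_T_word[of "[v]"] by simp_all

lemma par_T_letter_mult: "par_T (word [v] * t) = - (word [v] * par_T t)"
proof (rule talg_eqI[where t = t])
  fix xs
  show "par_T (word [v] * word xs) = - (word [v] * par_T (word xs))"
    unfolding word_Cons[symmetric, of v xs] par_T_word by (simp add: word_Cons[of v xs])
qed simp_all

lemma par_T_mult: "par_T (s * t) = par_T s * par_T t"
  by (rule talg_Cons_eqI[where t = s]) (simp_all add: par_T_one par_T_letter_mult mult.assoc)

lemma par_T_quad: "par_T (quad s) = quad s"
  by (rule clinear_eqI[where t = s]) (simp_all add: par_T_mult par_T_letter)

lemma parity_p: "parity_\<Lambda> D (\<pi>L t) = \<pi>L (par_T t)"
proof -
  have m: "multilin (\<lambda>xs. (-1) ^ length xs *\<^sub>C \<pi>L (word xs))"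
    by (simp add: word_multilinear)
  have e: "talg_lift (\<lambda>xs. (-1) ^ length xs *\<^sub>C \<pi>L (word xs)) t = \<pi>L (par_T t)" for t
    by (rule talg_eqI[where t = t, OF talg_lift_linear[OF m]])
      (simp_all add: talg_lift_word[OF m] par_T_word clinear_scale[OF L.p_linear(1)])
  have "\<pi>L (par_T t) = 0" if "t \<in> exterior_ideal D" for t
    using that
  proof (rule exterior_vanish)
    fix x s y
    show "\<pi>L (par_T (x * quad (s + \<psi> s) * y)) = 0"
      using exterior_mem[of "par_T x" s "par_T y"] by (simp add: par_T_mult par_T_quad L.p_eq_0)
  qed (simp_all add: clinear_add[OF par_T_linear(1)] clinear_add[OF L.p_linear(1)]
      clinear_scale[OF par_T_linear(1)] clinear_scale[OF L.p_linear(1)])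
  then show ?thesis
    unfolding parity_\<Lambda>_def e[abs_def]
    by (subst L.induced_apply) (simp_all add: e clinear_add[OF par_T_linear(1)] clinear_add[OF L.p_linear(1)])
qed

lemma parity_linear [simp]: "clinear (parity_\<Lambda> D)" "clinear f \<Longrightarrow> clinear (\<lambda>x. parity_\<Lambda> D (f x))"
proof -
  show "clinear (parity_\<Lambda> D)"
    by (rule L.clinear_quotI[where f = "parity_\<Lambda> D" and g = "\<lambda>t. \<pi>L (par_T t)"]) (simp_all add: parity_p)
  then show "clinear f \<Longrightarrow> clinear (\<lambda>x. parity_\<Lambda> D (f x))" by (rule clinear_compose)
qed

lemma parity_one [simp]: "parity_\<Lambda> D 1 = 1" and parity_gen [simp]: "parity_\<Lambda> D (L.gen v) = - L.gen v"
  using parity_p[of 1] parity_p[of "word [v]"] by (simp_all add: par_T_one par_T_letter clinear_minus[OF L.p_linear(1)])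

lemma parity_mult: "parity_\<Lambda> D (x * y) = parity_\<Lambda> D x * parity_\<Lambda> D y"
proof -
  obtain s t where "x = \<pi>L s" "y = \<pi>L t" using L.p_surj by metis
  then show ?thesis by (simp add: parity_p par_T_mult flip: L.p_mult)
qed

lemma parity_parity [simp]: "parity_\<Lambda> D (parity_\<Lambda> D x) = x"
  by (rule L.gen_induct[where a = x]) (simp_all add: parity_mult clinear_minus[OF parity_linear(1)])

lemma parity_coact: "\<rho>L (parity_\<Lambda> D x) = tensor_map (parity_\<Lambda> D) (\<lambda>h. h) (\<rho>L x)"
proof (rule L.gen_induct[where a = x])
  show "\<rho>L (parity_\<Lambda> D 1) = tensor_map (parity_\<Lambda> D) (\<lambda>h. h) (\<rho>L 1)" by (simp add: L.coact_q_one)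
  fix v a assume *: "\<rho>L (parity_\<Lambda> D a) = tensor_map (parity_\<Lambda> D) (\<lambda>h. h) (\<rho>L a)"
  have m: "tensor_map (parity_\<Lambda> D) (\<lambda>h. h) (tensor_mult s t) = tensor_mult (tensor_map (parity_\<Lambda> D) (\<lambda>h. h) s) (tensor_map (parity_\<Lambda> D) (\<lambda>h. h) t)"
    for s t :: "('l, 'h) tensor"
    by (rule clinear_eqI[where t = s], simp, simp, rule clinear_eqI[where t = t]) (simp_all add: parity_mult)
  have "tensor_map (\<lambda>v. - L.gen v) (\<lambda>h. h) (\<rho>V v) = - tensor_map (\<lambda>v. L.gen v) (\<lambda>h. h) (\<rho>V v)"
    by (rule clinear_eqI[where t = "\<rho>V v"]) simp_all
  then show "\<rho>L (parity_\<Lambda> D (L.gen v * a)) = tensor_map (parity_\<Lambda> D) (\<lambda>h. h) (\<rho>L (L.gen v * a))"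
    by (simp add: parity_mult L.coact_q_mult m * L.coact_gen tensor_map_comp clinear_minus[of \<rho>L]
        flip: clinear_minus[of "\<lambda>u. tensor_mult u _"])
qed simp_all

lemma parity_star: "parity_\<Lambda> D (star_\<Lambda> D x) = star_\<Lambda> D (parity_\<Lambda> D x)"
proof -
  obtain t where x: "x = \<pi>L t" using L.p_surj by blast
  have "par_T (sstar_T t) = sstar_T (par_T t)"
  proof (induct t rule: talg_induct)
    case (word xs)
    then show ?case
      by (simp add: sstar_T_word star_T_word par_T_word clinear_scale[OF par_T_linear(1)]
          antilinear_scale[OF sstar_T_antilinear] mult.commute)
  qed (simp_all add: clinear_scale[OF par_T_linear(1)] clinear_add[OF par_T_linear(1)]
      antilinear_scale[OF sstar_T_antilinear] antilinear_add[OF sstar_T_antilinear])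
  then show ?thesis by (simp add: x star_L_p parity_p)
qed

end

section \<open>The two braided derivations of the Nichols algebra\<close>

lemma even_part_id [simp]: "even_part id x = x" and odd_part_id [simp]: "odd_part id x = 0"
proof -
  have "x + x = (1 + 1) *\<^sub>C x" by (simp only: scaleC_add_left scaleC_one)
  then show "even_part id x = x" by (simp add: even_part_def)
  show "odd_part id x = 0" by (simp add: odd_part_def)
qed

context calculus
begin

text \<open>The left action of B on V \<otimes> B that moves \<open>a\<close> past \<open>v\<close>
  by the braiding. It is the left module structure of the forms of degree (1,0), as
  \<open>ract\<close> is the right module structure of those of degree (0,1).\<close>

definition lact :: "'b \<Rightarrow> ('v, 'b) tensor \<Rightarrow> ('v, 'b) tensor" where
  "lact a = tensor_lift (\<lambda>v b. tensor_lift (\<lambda>v0 v1. v0 \<otimes> (act \<rho>B a v1 * b)) (\<rho>V v))"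

definition ract :: "('b, 'v) tensor \<Rightarrow> 'b \<Rightarrow> ('b, 'v) tensor" where
  "ract t a = tensor_lift (\<lambda>b v. tensor_lift (\<lambda>a0 a1. (b * a0) \<otimes> act \<rho>V v a1) (\<rho>B a)) t"

abbreviation rmul :: "('v, 'b) tensor \<Rightarrow> 'b \<Rightarrow> ('v, 'b) tensor"
  where "rmul t a \<equiv> tensor_map (\<lambda>v. v) (\<lambda>b. b * a) t"

abbreviation lmul :: "'b \<Rightarrow> ('b, 'v) tensor \<Rightarrow> ('b, 'v) tensor"
  where "lmul a \<equiv> tensor_map (\<lambda>b. a * b) (\<lambda>v. v)"

lemma lact_linear [simp]: "clinear (lact a)" "clinear f \<Longrightarrow> clinear (\<lambda>x. lact a (f x))"
  "clinear g \<Longrightarrow> clinear (\<lambda>x. lact (g x) t)"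
  by (simp_all add: lact_def)

lemma ract_linear [simp]: "clinear f \<Longrightarrow> clinear (\<lambda>x. ract (f x) a)" "clinear g \<Longrightarrow> clinear (\<lambda>x. ract t (g x))"
  by (simp_all add: ract_def)

lemma rmul_linear [simp]: "clinear g \<Longrightarrow> clinear (\<lambda>a. rmul t (g a))"
  by (simp add: tensor_map_def)

lemma lact_pure: "lact a (v \<otimes> b) = tensor_lift (\<lambda>v0 v1. v0 \<otimes> (act \<rho>B a v1 * b)) (\<rho>V v)"
  by (simp add: lact_def)

lemma ract_pure: "ract (b \<otimes> v) a = tensor_lift (\<lambda>a0 a1. (b * a0) \<otimes> act \<rho>V v a1) (\<rho>B a)"
  by (simp add: ract_def)

lemma lact_mult: "lact (a * b) t = lact a (lact b t)"
proof (rule clinear_eqI[where t = t])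
  fix v c
  have t: "trilin (\<lambda>x y z. x \<otimes> (act \<rho>B a y * (act \<rho>B b z * c)))" by (simp add: trilin_def)
  have "lact (a * b) (v \<otimes> c) = tensor_lift (\<lambda>v0 v1. tensor_lift (\<lambda>y z. v0 \<otimes> (act \<rho>B a y * (act \<rho>B b z * c))) (comult D v1)) (\<rho>V v)"
    by (simp add: lact_pure act_times mult_tensor_lift tensor_lift_push mult.assoc)
  also have "\<dots> = tensor_lift (\<lambda>v0 v1. tensor_lift (\<lambda>x y. x \<otimes> (act \<rho>B a y * (act \<rho>B b v1 * c))) (\<rho>V v0)) (\<rho>V v)"
    by (rule comodule_coassoc[OF coact_comodule t, symmetric])
  also have "\<dots> = lact a (lact b (v \<otimes> c))"
    by (simp add: lact_pure clinear_tensor_lift_swap[of "lact a"])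
  finally show "lact (a * b) (v \<otimes> c) = lact a (lact b (v \<otimes> c))" .
qed simp_all

lemma lact_one [simp]: "lact 1 t = t"
  by (rule clinear_eqI[where t = t]) (simp_all add: lact_pure act_one_left counit_comodule[OF coact_comodule])

lemma lact_rmul: "lact a (rmul t b) = rmul (lact a t) b"
  by (rule clinear_eqI[where t = t]) (simp_all add: lact_pure tensor_lift_push mult.assoc)

lemma braid_BV: "braid D \<rho>B \<rho>V (a \<otimes> v) = lact a (v \<otimes> 1)"
  by (simp add: braid_pure lact_pure)

lemma braid_VB: "braid D \<rho>V \<rho>B (v \<otimes> a) = ract (1 \<otimes> v) a"
  by (simp add: braid_pure ract_pure)

lemma ract_mult: "ract t (a * b) = ract (ract t a) b"
  by (rule clinear_eqI[where t = t])
    (simp_all add: ract_pure comodule_algebraD(3)[OF B.comodule_algebra_q] clinear_tensor_lift_swap[of "\<lambda>t. ract t b"]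
      act_mult mult.assoc)

lemma ract_one [simp]: "ract t 1 = t"
  by (rule clinear_eqI[where t = t]) (simp_all add: ract_pure B.coact_q_one act_one)

lemma ract_lmul: "ract (lmul c t) a = lmul c (ract t a)"
  by (rule clinear_eqI[where t = t]) (simp_all add: ract_pure tensor_lift_push mult.assoc)

section \<open>The degree one components of the braided coproduct\<close>

definition Bstep :: "'v \<Rightarrow> ('b, 'b) tensor \<Rightarrow> ('b, 'b) tensor"
  where "Bstep v s = mult (braided_tensor D (B_alg D) (B_alg D)) (gen_B D v \<otimes> 1 + 1 \<otimes> gen_B D v) s"

lemma Bstep_expand: "Bstep v s = tensor_lift (\<lambda>b c. tensor_lift (\<lambda>b' c'. tensor_lift (\<lambda>b'' c''. (b * b'') \<otimes> (c'' * c'))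
    (braid D \<rho>B \<rho>B (c \<otimes> b'))) s) (B.gen v \<otimes> 1 + 1 \<otimes> B.gen v)"
  by (simp add: Bstep_def braided_tensor_def B_alg_def gen_defs)

lemma Bstep_linear [simp]: "clinear f \<Longrightarrow> clinear (\<lambda>v. Bstep (f v) s)" "clinear g \<Longrightarrow> clinear (\<lambda>x. Bstep v (g x))" "clinear (Bstep v)"
  unfolding Bstep_expand[abs_def] by simp_all

lemma Bstep_pure: "Bstep v (b \<otimes> c) = (B.gen v * b) \<otimes> c + tensor_lift (\<lambda>b0 b1. b0 \<otimes> (B.gen (act \<rho>V v b1) * c)) (\<rho>B b)"
  by (simp add: Bstep_expand tensor_lift_add braid_pure tensor_lift_comp act_one_left B.act_gen
      counit_comodule[OF B.comodule_q])

text \<open>The coproduct as a map on the tensor algebra. Its components with one leg of degree 1,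
  \<open>D1\<close> and \<open>D2\<close>, are those that enter the differentials, and for these
  independence of the preimage chosen in \<open>coprod_B\<close> is established.\<close>

definition Cop :: "'v talg \<Rightarrow> ('b, 'b) tensor"
  where "Cop = talg_lift (\<lambda>xs. foldr Bstep xs (1 \<otimes> 1))"

lemma Bstep_multilin: "multilin (\<lambda>xs. foldr Bstep xs (1 \<otimes> 1))"
  by (rule multilin_foldr) simp

lemma Cop_linear [simp]: "clinear Cop" "clinear f \<Longrightarrow> clinear (\<lambda>x. Cop (f x))"
  unfolding Cop_def using talg_lift_linear[OF Bstep_multilin] clinear_compose by blast+

lemma Cop_one [simp]: "Cop 1 = 1 \<otimes> 1" and Cop_letter: "Cop (word [v] * t) = Bstep v (Cop t)"
proof -
  have w: "Cop (word xs) = foldr Bstep xs (1 \<otimes> 1)" for xs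
    unfolding Cop_def by (rule talg_lift_word[OF Bstep_multilin])
  show "Cop 1 = 1 \<otimes> 1" using w[of "[]"] by simp
  show "Cop (word [v] * t) = Bstep v (Cop t)"
  proof (rule talg_eqI[where t = t])
    fix xs
    show "Cop (word [v] * word xs) = Bstep v (Cop (word xs))"
      unfolding word_Cons[symmetric, of v xs] w by simp
  qed simp_all
qed

lemma coprod_Cop: "coprod_B D a = Cop (inv \<pi>B a)"
  by (simp add: coprod_B_def induced_def Cop_def Bstep_def[abs_def])

definition D1 :: "'v talg \<Rightarrow> ('v, 'b) tensor" where "D1 t = tensor_map (deg1 \<pi>B) (\<lambda>b. b) (Cop t)"

definition D2 :: "'v talg \<Rightarrow> ('b, 'v) tensor" where "D2 t = tensor_map (\<lambda>b. b) (deg1 \<pi>B) (Cop t)"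

lemma D_linear [simp]: "clinear D1" "clinear D2" "clinear f \<Longrightarrow> clinear (\<lambda>x. D1 (f x))" "clinear g \<Longrightarrow> clinear (\<lambda>x. D2 (g x))"
  unfolding D1_def[abs_def] D2_def[abs_def] by simp_all

lemma Cop_counit: "tensor_lift (\<lambda>b c. deg0 \<pi>B b *\<^sub>C c) (Cop t) = \<pi>B t" "tensor_lift (\<lambda>b c. deg0 \<pi>B c *\<^sub>C b) (Cop t) = \<pi>B t"
proof -
  have 1: "tensor_lift (\<lambda>b c. deg0 \<pi>B b *\<^sub>C c) (Bstep v s) = B.gen v * tensor_lift (\<lambda>b c. deg0 \<pi>B b *\<^sub>C c) s" for v s
  proof (rule clinear_eqI[where t = s])
    fix b c
    have "tensor_lift (\<lambda>b0 b1. deg0 \<pi>B b0 *\<^sub>C (B.gen (act \<rho>V v b1) * c)) (\<rho>B b) = deg0 \<pi>B b *\<^sub>C (B.gen v * c)"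
      by (subst B.deg0_coact[of "\<lambda>x h. x *\<^sub>C (B.gen (act \<rho>V v h) * c)"]) (simp_all add: act_one)
    then show "tensor_lift (\<lambda>b c. deg0 \<pi>B b *\<^sub>C c) (Bstep v (b \<otimes> c)) = B.gen v * tensor_lift (\<lambda>b c. deg0 \<pi>B b *\<^sub>C c) (b \<otimes> c)"
      by (simp add: Bstep_pure tensor_lift_add tensor_lift_comp)
  qed simp_all
  show "tensor_lift (\<lambda>b c. deg0 \<pi>B b *\<^sub>C c) (Cop t) = \<pi>B t"
    by (rule talg_Cons_eqI[where t = t]) (simp_all add: Cop_letter 1 B.p_mult)
  have 2: "tensor_lift (\<lambda>b c. deg0 \<pi>B c *\<^sub>C b) (Bstep v s) = B.gen v * tensor_lift (\<lambda>b c. deg0 \<pi>B c *\<^sub>C b) s" for v s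
    by (rule clinear_eqI[where t = s]) (simp_all add: Bstep_pure tensor_lift_add tensor_lift_comp)
  show "tensor_lift (\<lambda>b c. deg0 \<pi>B c *\<^sub>C b) (Cop t) = \<pi>B t"
    by (rule talg_Cons_eqI[where t = t]) (simp_all add: Cop_letter 2 B.p_mult)
qed

lemma D1_one [simp]: "D1 1 = 0" and D2_one [simp]: "D2 1 = 0"
  by (simp_all add: D1_def D2_def)

text \<open>In the coproduct of a product with the letter v, either v is itself the left leg of
  degree 1, while \<open>t\<close> contributes degree 0 there, or v crosses the left leg of the
  coproduct of \<open>t\<close> by the braiding.\<close>

lemma D1_letter: "D1 (word [v] * t) = v \<otimes> \<pi>B t + lact (B.gen v) (D1 t)"
proof -
  have "tensor_map (deg1 \<pi>B) (\<lambda>b. b) (Bstep v s) =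
      v \<otimes> tensor_lift (\<lambda>b c. deg0 \<pi>B b *\<^sub>C c) s + lact (B.gen v) (tensor_map (deg1 \<pi>B) (\<lambda>b. b) s)" for s
  proof (rule clinear_eqI[where t = s])
    fix b c
    have "lact (B.gen v) (deg1 \<pi>B b \<otimes> c) = tensor_lift (\<lambda>b0 b1. deg1 \<pi>B b0 \<otimes> (B.gen (act \<rho>V v b1) * c)) (\<rho>B b)"
      by (simp add: lact_pure B.deg1_coact tensor_lift_tensor_map B.act_gen)
    then show "tensor_map (deg1 \<pi>B) (\<lambda>b. b) (Bstep v (b \<otimes> c)) =
      v \<otimes> tensor_lift (\<lambda>b c. deg0 \<pi>B b *\<^sub>C c) (b \<otimes> c) + lact (B.gen v) (tensor_map (deg1 \<pi>B) (\<lambda>b. b) (b \<otimes> c))"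
      by (simp add: Bstep_pure clinear_add[of "tensor_map _ _"] tensor_lift_push)
  qed simp_all
  then show ?thesis by (simp add: D1_def Cop_letter Cop_counit)
qed

lemma D2_letter: "D2 (word [v] * t) = ract (1 \<otimes> v) (\<pi>B t) + lmul (B.gen v) (D2 t)"
proof -
  have "tensor_map (\<lambda>b. b) (deg1 \<pi>B) (Bstep v s) =
      ract (1 \<otimes> v) (tensor_lift (\<lambda>b c. deg0 \<pi>B c *\<^sub>C b) s) + lmul (B.gen v) (tensor_map (\<lambda>b. b) (deg1 \<pi>B) s)" for s
  proof (rule clinear_eqI[where t = s])
    fix b c
    have "ract (1 \<otimes> v) (deg0 \<pi>B c *\<^sub>C b) = tensor_lift (\<lambda>b0 b1. deg0 \<pi>B c *\<^sub>C b0 \<otimes> act \<rho>V v b1) (\<rho>B b)"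
      by (simp add: ract_pure clinear_scale[of \<rho>B] tensor_lift_scale) (simp add: scaleC_tensor_lift)
    then show "tensor_map (\<lambda>b. b) (deg1 \<pi>B) (Bstep v (b \<otimes> c)) =
      ract (1 \<otimes> v) (tensor_lift (\<lambda>b c. deg0 \<pi>B c *\<^sub>C b) (b \<otimes> c)) + lmul (B.gen v) (tensor_map (\<lambda>b. b) (deg1 \<pi>B) (b \<otimes> c))"
      by (simp add: Bstep_pure clinear_add[of "tensor_map _ _"] tensor_lift_push add.commute)
  qed simp_all
  then show ?thesis by (simp add: D2_def Cop_letter Cop_counit)
qed

definition head_map :: "('v talg \<Rightarrow> 'b) \<Rightarrow> 'v talg \<Rightarrow> ('v, 'b) tensor"
  where "head_map G = talg_lift (\<lambda>xs. case xs of [] \<Rightarrow> 0 | v # ys \<Rightarrow> v \<otimes> G (word ys))"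

lemma head_map:
  assumes G: "clinear G"
  shows "clinear (head_map G)" "clinear f \<Longrightarrow> clinear (\<lambda>x. head_map G (f x))" "head_map G (word [v] * t) = v \<otimes> G t"
proof -
  have m: "multilin (\<lambda>xs. case xs of [] \<Rightarrow> 0 | v # ys \<Rightarrow> v \<otimes> G (word ys))"
  proof (intro allI)
    fix xs ys :: "'v list"
    show "clinear (\<lambda>v. case xs @ v # ys of [] \<Rightarrow> 0 | v # ys \<Rightarrow> v \<otimes> G (word ys))"
      by (cases xs) (simp_all add: clinear_compose[OF G word_multilinear])
  qed
  show l: "clinear (head_map G)" unfolding head_map_def by (rule talg_lift_linear[OF m])
  then show "clinear f \<Longrightarrow> clinear (\<lambda>x. head_map G (f x))" by (rule clinear_compose)
  show "head_map G (word [v] * t) = v \<otimes> G t"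
  proof (rule talg_eqI[where t = t])
    fix xs
    show "head_map G (word [v] * word xs) = v \<otimes> G (word xs)"
      unfolding word_Cons[symmetric, of v xs] head_map_def talg_lift_word[OF m] by simp
  qed (simp_all add: G clinear_compose[OF l])
qed

lemma braided_integer_deg: "t \<in> talg_deg n \<Longrightarrow> braided_integer n t \<in> talg_deg n"
  unfolding braided_integer_def by (rule cvec.subspace_sum[OF talg_deg_subspace]) (rule word_op_deg)

text \<open>Both sides satisfy the same recursion in the leading letter, by \<open>D1_letter\<close>
  and \<open>braided_integer_letter\<close>: the derivative is the braided integer followed by the
  projection of all letters but the leading one.\<close>

lemma D1_braided_integer: "D1 (word xs) = head_map \<pi>B (braided_integer (length xs) (word xs))"
proof (induct xs)
  case Nil
  then show ?case by (simp add: braided_integer_def clinear_0[OF head_map(1)])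
next
  case (Cons v xs)
  note [simp] = head_map[OF B.p_linear(1)]
  have q: "head_map \<pi>B (quad s * r) = tensor_lift (\<lambda>a b. a \<otimes> (B.gen b * \<pi>B r)) s" for s r
    by (rule clinear_eqI[where t = s]) (simp_all add: mult.assoc B.p_mult)
  have *: "head_map \<pi>B (Psi_at D 0 (word [v] * s)) = lact (B.gen v) (head_map \<pi>B s)" if "s \<in> talg_deg (Suc m)" for s m
  proof (rule talg_deg_eqI[OF that])
    fix ys :: "'v list" assume "length ys = Suc m"
    then obtain w zs where ys: "ys = w # zs" by (cases ys) auto
    show "head_map \<pi>B (Psi_at D 0 (word [v] * word ys)) = lact (B.gen v) (head_map \<pi>B (word ys))"
      by (simp add: ys word_Cons[of w zs] q Psi_def braid_pure lact_pure tensor_lift_comp B.act_gen)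
  qed simp_all
  have "head_map \<pi>B (Psi_at D 0 (word [v] * braided_integer (length xs) (word xs))) = lact (B.gen v) (D1 (word xs))"
  proof (cases xs)
    case Nil
    then show ?thesis by (simp add: braided_integer_def clinear_0[OF Psi_at_linear] clinear_0[OF head_map(1)] clinear_0[OF lact_linear(1)])
  next
    case (Cons w ys)
    then show ?thesis
      using *[of "braided_integer (length xs) (word xs)" "length ys"] braided_integer_deg[OF word_in_talg_deg[of xs]]
        \<open>D1 (word xs) = _\<close> by simp
  qed
  then show ?case
    by (simp add: word_Cons[of v xs] D1_letter braided_integer_letter clinear_add[of "head_map \<pi>B"])
qed

text \<open>In degree m + 1 the projection of the last m letters is \<open>G\<close> after [m]!.
  Hence \<open>D1\<close> is id \<otimes> G after id \<otimes> [m]! after the braided integer, which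
  is id \<otimes> G applied to [m + 1]!.\<close>

lemma D1_nichols: "t \<in> nichols_ideal D \<Longrightarrow> D1 t = 0"
proof (erule nichols_vanish)
  fix n t assume t: "t \<in> talg_deg n" "braided_factorial D n t = 0"
  show "D1 t = 0"
  proof (cases n)
    case 0
    then show ?thesis using braided_factorial_small[of 0 t] t(2) by (simp add: clinear_0[OF D_linear(1)])
  next
    case (Suc m)
    obtain G where G: "clinear G" "\<And>t. t \<in> talg_deg m \<Longrightarrow> \<pi>B t = G (braided_factorial D m t)"
      using nichols_factor by blast
    note [simp] = head_map[OF B.p_linear(1)] head_map[OF G(1)]
    have sh: "head_map \<pi>B s = head_map G (shifted_factorial m s)" if "s \<in> talg_deg n" for s
    proof (rule talg_deg_eqI[OF that])
      fix xs :: "'v list" assume "length xs = n"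
      then obtain v ys where xs: "xs = v # ys" "length ys = m" using Suc by (cases xs) auto
      have "word ys \<in> talg_deg m" using word_in_talg_deg[of ys] xs(2) by simp
      then show "head_map \<pi>B (word xs) = head_map G (shifted_factorial m (word xs))"
        by (simp add: xs word_Cons[of v ys] shifted_factorial_letter G(2))
    qed (simp_all add: clinear_compose)
    have "D1 t = head_map \<pi>B (braided_integer n t)"
      using t(1) by (rule talg_deg_eqI) (simp_all add: D1_braided_integer clinear_compose)
    also have "\<dots> = head_map G (braided_factorial D n t)"
      using sh[OF braided_integer_deg[OF t(1)]] braided_factorial_Suc[of t m] t(1) Suc by simp
    finally show ?thesis by (simp add: t(2) clinear_0[of "head_map G"])
  qed
qed (simp_all add: clinear_add[OF D_linear(1)] clinear_scale[OF D_linear(1)])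

definition dB :: "'b \<Rightarrow> ('v, 'b) tensor" where "dB a = tensor_map (deg1 \<pi>B) (\<lambda>b. b) (coprod_B D a)"

definition dbarB :: "'b \<Rightarrow> ('b, 'v) tensor" where "dbarB a = tensor_map (\<lambda>b. b) (deg1 \<pi>B) (coprod_B D a)"

lemma dB_p: "dB (\<pi>B t) = D1 t"
  using B.induced_apply[of D1 t] D1_nichols
  by (simp add: dB_def coprod_Cop induced_def D1_def[symmetric] clinear_add[OF D_linear(1)])

lemma dB_linear [simp]: "clinear dB" "clinear f \<Longrightarrow> clinear (\<lambda>x. dB (f x))"
proof -
  show "clinear dB" by (rule B.clinear_quotI[where f = dB and g = D1]) (simp_all add: dB_p)
  then show "clinear f \<Longrightarrow> clinear (\<lambda>x. dB (f x))" by (rule clinear_compose)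
qed

lemma dB_one [simp]: "dB 1 = 0" and dB_gen_mult: "dB (B.gen v * a) = v \<otimes> a + lact (B.gen v) (dB a)"
  and dB_gen: "dB (B.gen v) = v \<otimes> 1"
proof -
  show 1: "dB 1 = 0" using dB_p[of 1] by simp
  show 2: "dB (B.gen v * a) = v \<otimes> a + lact (B.gen v) (dB a)" for a
  proof -
    obtain t where a: "a = \<pi>B t" using B.p_surj by blast
    show ?thesis using dB_p[of "word [v] * t"] by (simp add: a B.p_mult dB_p D1_letter)
  qed
  show "dB (B.gen v) = v \<otimes> 1" using 2[of 1] 1 by (simp add: clinear_0[OF lact_linear(1)])
qed

lemma dB_mult: "dB (a * b) = rmul (dB a) b + lact a (dB b)"
proof (rule B.gen_induct[where a = a])
  fix v a assume "dB (a * b) = rmul (dB a) b + lact a (dB b)"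
  then show "dB (B.gen v * a * b) = rmul (dB (B.gen v * a)) b + lact (B.gen v * a) (dB b)"
    by (simp add: mult.assoc dB_gen_mult clinear_add[of "lact _"] clinear_add[of "tensor_map _ _"] lact_mult lact_rmul)
qed (simp_all add: clinear_0[of "tensor_map _ _"])

section \<open>The second derivation as a conjugate of the first\<close>

definition swap_star :: "('v, 'b) tensor \<Rightarrow> ('b, 'v) tensor"
  where "swap_star = tensor_lift_cnj (\<lambda>v b. star_B D b \<otimes> vstar D v)"

lemma swap_star_pure [simp]: "swap_star (v \<otimes> b) = star_B D b \<otimes> vstar D v"
  and swap_star_antilinear [simp]: "antilinear swap_star"
  and swap_star_add: "swap_star (s + t) = swap_star s + swap_star t"
  by (simp_all add: swap_star_def tensor_lift_cnj_add)

lemma swap_star_rmul: "swap_star (rmul t a) = lmul (star_B D a) (swap_star t)"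
  by (induct t rule: tensor_induct)
    (simp_all add: star_B_mult swap_star_add clinear_add[of "tensor_map _ _"])

lemma swap_star_lact: "swap_star (lact a t) = ract (swap_star t) (star_B D a)"
proof (induct t rule: tensor_induct)
  case (pure v b)
  have "lact a (v \<otimes> b) = rmul (braid D \<rho>B \<rho>V (a \<otimes> v)) b"
    by (simp add: braid_BV flip: lact_rmul)
  then have "swap_star (lact a (v \<otimes> b)) = lmul (star_B D b) (swap_star (braid D \<rho>B \<rho>V (a \<otimes> v)))"
    by (simp add: swap_star_rmul)
  also have "swap_star (braid D \<rho>B \<rho>V (a \<otimes> v)) = braid D \<rho>V \<rho>B (vstar D v \<otimes> star_B D a)"
    unfolding swap_star_def
    by (rule braid_star[OF B.comodule_q star_B_comodule_star coact_comodule vstar_comodule_star real, symmetric])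
  also have "\<dots> = ract (1 \<otimes> vstar D v) (star_B D a)" by (rule braid_VB)
  finally show ?case by (simp flip: ract_lmul)
next
  case (add s t)
  then show ?case by (simp add: clinear_add[of "lact a"] swap_star_add clinear_add[of "\<lambda>t. ract t _"])
qed

text \<open>The involution exchanges the left and the right Leibniz rule, so both sides obey the
  recursion \<open>D2_letter\<close>. The right-hand side depends on \<open>t\<close> only through
  its class in B, which makes the second derivation well defined.\<close>

lemma D2_star: "D2 t = swap_star (dB (star_B D (\<pi>B t)))"
proof (rule talg_Cons_eqI[where t = t])
  have "antilinear (\<lambda>t. dB (star_B D (\<pi>B t)))"
    by (rule linear_comp_antilinear[OF dB_linear(1)]) (rule antilinear_comp_linear[OF star_B_antilinear B.p_linear(1)])
  then show "clinear (\<lambda>t. swap_star (dB (star_B D (\<pi>B t))))"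
    by (rule antilinear_comp_antilinear[OF swap_star_antilinear])
  show "D2 1 = swap_star (dB (star_B D (\<pi>B 1)))" by (simp add: antilinear_0)
  fix v xs assume "D2 (word xs) = swap_star (dB (star_B D (\<pi>B (word xs))))"
  then show "D2 (word [v] * word xs) = swap_star (dB (star_B D (\<pi>B (word [v] * word xs))))"
    by (simp add: D2_letter B.p_mult star_B_mult dB_mult dB_gen swap_star_add swap_star_rmul swap_star_lact add.commute)
qed simp

lemma dbarB_p: "dbarB (\<pi>B t) = D2 t"
proof -
  have "\<pi>B (inv \<pi>B (\<pi>B t)) = \<pi>B t" by (metis f_inv_into_f rangeI)
  then show ?thesis by (simp add: dbarB_def coprod_Cop D2_def[symmetric] D2_star)
qed

lemma dbarB_star: "dbarB a = swap_star (dB (star_B D a))"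
  using B.p_surj[of a] by (auto simp: dbarB_p D2_star)

lemma dbarB_linear [simp]: "clinear dbarB" "clinear f \<Longrightarrow> clinear (\<lambda>x. dbarB (f x))"
proof -
  show "clinear dbarB" by (rule B.clinear_quotI[where f = dbarB and g = D2]) (simp_all add: dbarB_p)
  then show "clinear f \<Longrightarrow> clinear (\<lambda>x. dbarB (f x))" by (rule clinear_compose)
qed

lemma dbarB_mult: "dbarB (a * b) = ract (dbarB a) b + lmul a (dbarB b)"
  by (simp add: dbarB_star star_B_mult dB_mult swap_star_add swap_star_rmul swap_star_lact)

lemma dbarB_one [simp]: "dbarB 1 = 0" and dbarB_gen: "dbarB (B.gen v) = 1 \<otimes> v"
  by (simp_all add: dbarB_star antilinear_0 dB_gen)

end

section \<open>The double complex\<close>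

lemma even_odd_sum: "even_part \<gamma> x + odd_part \<gamma> x = x"
proof -
  have "even_part \<gamma> x + odd_part \<gamma> x = (1/2) *\<^sub>C ((1 + 1) *\<^sub>C x)"
    unfolding even_part_def odd_part_def scaleC_add_right[symmetric] scaleC_add_left scaleC_one by (simp add: algebra_simps)
  then show ?thesis by simp
qed

context calculus
begin

abbreviation "evn \<equiv> even_part (parity_\<Lambda> D)"
abbreviation "od \<equiv> odd_part (parity_\<Lambda> D)"

lemma even_odd_linear [simp]: "clinear f \<Longrightarrow> clinear (\<lambda>x. evn (f x))" "clinear f \<Longrightarrow> clinear (\<lambda>x. od (f x))" "clinear evn" "clinear od"
  unfolding even_part_def[abs_def] odd_part_def[abs_def] by simp_all

lemma even_one [simp]: "evn 1 = 1" and odd_one [simp]: "od 1 = 0"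
  and even_gen [simp]: "evn (L.gen v) = 0" and odd_gen [simp]: "od (L.gen v) = L.gen v"
proof -
  show e: "od 1 = 0" "evn (L.gen v) = 0" by (simp_all add: even_part_def odd_part_def)
  show "evn 1 = 1" using even_odd_sum[of "parity_\<Lambda> D" 1] e by simp
  show "od (L.gen v) = L.gen v" using even_odd_sum[of "parity_\<Lambda> D" "L.gen v"] e by simp
qed

lemma parity_even [simp]: "parity_\<Lambda> D (evn x) = evn x" and parity_odd [simp]: "parity_\<Lambda> D (od x) = - od x"
  by (simp_all add: even_part_def odd_part_def clinear_scale[OF parity_linear(1)] clinear_add[OF parity_linear(1)]
    clinear_diff[OF parity_linear(1)] add.commute flip: scaleC_minus(1))

text \<open>Parity is colinear, hence so are the projections to the even and odd parts; the signs of
  the super tensor product can thus be separated from the braiding.\<close>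

lemma even_odd_coact:
  assumes "bilin f"
  shows "tensor_lift (\<lambda>x0 x1. f (evn x0) x1) (\<rho>L x) = tensor_lift f (\<rho>L (evn x))"
    "tensor_lift (\<lambda>x0 x1. f (od x0) x1) (\<rho>L x) = tensor_lift f (\<rho>L (od x))"
proof -
  have fl [simp]: "clinear k \<Longrightarrow> clinear (\<lambda>x. f (k x) y)" for k :: "'l \<Rightarrow> 'l" and y
    using clinear_compose[of "\<lambda>x. f x y" k] assms by auto
  have 1: "\<rho>L (evn x) = tensor_map evn (\<lambda>h. h) (\<rho>L x)"
    by (simp add: even_part_def clinear_scale[OF L.coact_q_linear(1)] clinear_add[OF L.coact_q_linear(1)] parity_coact)
      (rule clinear_eqI[where t = "\<rho>L x"]; simp add: even_part_def[abs_def])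
  have 2: "\<rho>L (od x) = tensor_map od (\<lambda>h. h) (\<rho>L x)"
    by (simp add: odd_part_def clinear_scale[OF L.coact_q_linear(1)] clinear_diff[OF L.coact_q_linear(1)] parity_coact)
      (rule clinear_eqI[where t = "\<rho>L x"]; simp add: odd_part_def[abs_def] clinear_diff[of "\<lambda>u. u \<otimes> _"])
  show "tensor_lift (\<lambda>x0 x1. f (evn x0) x1) (\<rho>L x) = tensor_lift f (\<rho>L (evn x))"
    "tensor_lift (\<lambda>x0 x1. f (od x0) x1) (\<rho>L x) = tensor_lift f (\<rho>L (od x))"
    unfolding 1 2 using assms by (simp_all add: tensor_lift_tensor_map)
qed

lemma parity_act: "parity_\<Lambda> D (act \<rho>L x h) = act \<rho>L (parity_\<Lambda> D x) h"
  unfolding act_def parity_coact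
  by (simp add: tensor_lift_tensor_map clinear_tensor_lift_swap[of "parity_\<Lambda> D"] clinear_scale[of "parity_\<Lambda> D"])

text \<open>Asks the coactions to be linear only, so that it can be used with
  \<open>codiagonal \<rho>B \<rho>L\<close> directly.\<close>

lemma braid_pure_linear:
  "clinear \<rho>X \<Longrightarrow> clinear \<rho>Y \<Longrightarrow> braid D \<rho>X \<rho>Y (x \<otimes> y) = tensor_lift (\<lambda>y0 y1. y0 \<otimes> act \<rho>X x y1) (\<rho>Y y)"
proof -
  assume l: "clinear \<rho>X" "clinear \<rho>Y"
  have "bilin (\<lambda>x y. tensor_lift (\<lambda>x0 x1. tensor_lift (\<lambda>y0 y1. Rform D x1 y1 *\<^sub>C y0 \<otimes> x0) (\<rho>Y y)) (\<rho>X x))"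
    by (simp add: l)
  then show ?thesis
    by (simp add: braid_def act_def tensor_lift_push tensor_lift_swap[of _ _ "\<rho>X x"])
qed

lemma act_codiagonal: "act (codiagonal \<rho>B \<rho>L) (b \<otimes> z) h = tensor_lift (\<lambda>h1 h2. act \<rho>B b h1 \<otimes> act \<rho>L z h2) (comult D h)"
proof -
  have "act (codiagonal \<rho>B \<rho>L) (b \<otimes> z) h =
     tensor_lift (\<lambda>x0 x1. tensor_lift (\<lambda>y0 y1. tensor_lift (\<lambda>h1 h2. (Rform D x1 h1 * Rform D y1 h2) *\<^sub>C (x0 \<otimes> y0)) (comult D h)) (\<rho>L z)) (\<rho>B b)"
    by (simp add: act_def codiagonal_pure tensor_lift_comp Rform_mult scaleC_tensor_lift_left)
  also have "\<dots> = tensor_lift (\<lambda>h1 h2. tensor_lift (\<lambda>x0 x1. tensor_lift (\<lambda>y0 y1. (Rform D x1 h1 * Rform D y1 h2) *\<^sub>C (x0 \<otimes> y0)) (\<rho>L z)) (\<rho>B b)) (comult D h)"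
    by (simp add: tensor_lift_swap[of _ _ "comult D h"])
  also have "\<dots> = tensor_lift (\<lambda>h1 h2. act \<rho>B b h1 \<otimes> act \<rho>L z h2) (comult D h)"
    unfolding act_def by (simp only: tensor_lift_push(3)) (simp add: tensor_lift_push(2) scaleC_tensor_lift mult.commute)
  finally show ?thesis .
qed

text \<open>The product of two homogeneous forms without the Koszul sign.\<close>

definition W :: "'l \<Rightarrow> 'b \<Rightarrow> 'l \<Rightarrow> 'l \<Rightarrow> 'b \<Rightarrow> 'l \<Rightarrow> ('b, 'l) forms" where
  "W w b z w' b' z' = tensor_lift (\<lambda>w0 w1. tensor_lift (\<lambda>h1 h2. tensor_lift (\<lambda>b0 b1.
     (w * w0) \<otimes> (act \<rho>B b h1 * b0) \<otimes> (act \<rho>L (act \<rho>L z h2) b1 * z')) (\<rho>B b')) (comult D w1)) (\<rho>L w')"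

lemma W_linear [simp]:
  "clinear f1 \<Longrightarrow> clinear (\<lambda>x. W (f1 x) b z w' b' z')" "clinear f2 \<Longrightarrow> clinear (\<lambda>x. W w (f2 x) z w' b' z')"
  "clinear f3 \<Longrightarrow> clinear (\<lambda>x. W w b (f3 x) w' b' z')" "clinear f4 \<Longrightarrow> clinear (\<lambda>x. W w b z (f4 x) b' z')"
  "clinear f5 \<Longrightarrow> clinear (\<lambda>x. W w b z w' (f5 x) z')" "clinear f6 \<Longrightarrow> clinear (\<lambda>x. W w b z w' b' (f6 x))"
  by (simp_all add: W_def)

text \<open>The Koszul sign of z passing w' appears as the parity operator on z in the term with the
  odd part of w'. The factor b has degree 0 and contributes no sign.\<close>

lemma wedge_pure: "wedge D (w \<otimes> b \<otimes> z) (w' \<otimes> b' \<otimes> z') = W w b z (evn w') b' z' + W w b (parity_\<Lambda> D z) (od w') b' z'"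
proof -
  let ?Y = "braided_tensor D (B_alg D) (\<Lambda>_alg D)"
  have co: "coaction ?Y = codiagonal \<rho>B \<rho>L"
    by (simp add: braided_tensor_def B_alg_def \<Lambda>_alg_def codiagonal_def)
  have par: "parity ?Y = tensor_map (\<lambda>b. b) (parity_\<Lambda> D)"
    by (simp add: braided_tensor_def B_alg_def \<Lambda>_alg_def id_def)
  define mY where "mY = mult ?Y"
  have mY: "mY s t = tensor_lift (\<lambda>b c. tensor_lift (\<lambda>b' c'. tensor_lift (\<lambda>b'' c''. (b * b'') \<otimes> (c'' * c')) (braid D \<rho>L \<rho>B (c \<otimes> b'))) t) s" for s t
    by (simp add: mY_def braided_tensor_def B_alg_def \<Lambda>_alg_def)
  have mYl [simp]: "clinear f \<Longrightarrow> clinear (\<lambda>x. mY (f x) t)" "clinear g \<Longrightarrow> clinear (\<lambda>x. mY s (g x))" for f :: "'x::complex_vec \<Rightarrow> _" and g :: "'y::complex_vec \<Rightarrow> _" and s t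
    by (simp_all add: mY)
  have mYl' [simp]: "clinear f \<Longrightarrow> clinear (\<lambda>x. mY (f x) t)" for f :: "'l \<Rightarrow> _" and t
    by (simp add: mY)
  have mYl'' [simp]: "clinear f \<Longrightarrow> clinear (\<lambda>x. mY (f x) t)" for f :: "('b, 'l) tensor \<Rightarrow> _" and t
    by (simp add: mY)
  have mYl3 [simp]: "clinear f \<Longrightarrow> clinear (\<lambda>x. mY t (f x))" for f :: "('b, 'l) tensor \<Rightarrow> _" and t
    by (simp add: mY)
  have mYp: "mY (b \<otimes> z) (b' \<otimes> z') = tensor_lift (\<lambda>b0 b1. (b * b0) \<otimes> (act \<rho>L z b1 * z')) (\<rho>B b')" for b z b' z'
    by (simp add: mY braid_pure tensor_lift_comp)
  have cl: "clinear (codiagonal \<rho>B \<rho>L)" "\<And>x. clinear (\<lambda>h. act (codiagonal \<rho>B \<rho>L) x h)" "clinear f \<Longrightarrow> clinear (\<lambda>x. codiagonal \<rho>B \<rho>L (f x))" for f :: "('b, 'l) tensor \<Rightarrow> _"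
    by (simp_all add: act_def)
  have bl [simp]: "clinear (braid D (codiagonal \<rho>B \<rho>L) \<rho>L)" "clinear f \<Longrightarrow> clinear (\<lambda>x. braid D (codiagonal \<rho>B \<rho>L) \<rho>L (f x))" for f :: "'l \<Rightarrow> _"
    by (simp_all add: braid_def)
  have bl' [simp]: "clinear f \<Longrightarrow> clinear (\<lambda>x. braid D (codiagonal \<rho>B \<rho>L) \<rho>L (f x))" for f :: "('b, 'l) tensor \<Rightarrow> _"
    by (simp add: braid_def)
  have "wedge D s t = tensor_lift (\<lambda>b c. tensor_lift (\<lambda>b' c'.
       tensor_lift (\<lambda>b'' c''. (b * b'') \<otimes> mY c'' c')
         (braid D (codiagonal \<rho>B \<rho>L) \<rho>L (c \<otimes> evn b' + tensor_map (\<lambda>b. b) (parity_\<Lambda> D) c \<otimes> od b'))) t) s" for s t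
    unfolding wedge_def co[symmetric] par[symmetric] mY_def
    by (simp add: braided_tensor_def[of D "\<Lambda>_alg D"]) (simp add: \<Lambda>_alg_def)
  then have "wedge D (w \<otimes> b \<otimes> z) (w' \<otimes> b' \<otimes> z') = tensor_lift (\<lambda>b'' c''. (w * b'') \<otimes> mY c'' (b' \<otimes> z'))
         (braid D (codiagonal \<rho>B \<rho>L) \<rho>L ((b \<otimes> z) \<otimes> evn w' + (b \<otimes> parity_\<Lambda> D z) \<otimes> od w'))"
    by simp
  also have "\<dots> = tensor_lift (\<lambda>b'' c''. (w * b'') \<otimes> mY c'' (b' \<otimes> z')) (braid D (codiagonal \<rho>B \<rho>L) \<rho>L ((b \<otimes> z) \<otimes> evn w'))
     + tensor_lift (\<lambda>b'' c''. (w * b'') \<otimes> mY c'' (b' \<otimes> z')) (braid D (codiagonal \<rho>B \<rho>L) \<rho>L ((b \<otimes> parity_\<Lambda> D z) \<otimes> od w'))"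
    by (simp add: clinear_add[OF bl(1)] tensor_lift_add)
  finally have "wedge D (w \<otimes> b \<otimes> z) (w' \<otimes> b' \<otimes> z') = \<dots>" .
  moreover have "\<And>z w'. tensor_lift (\<lambda>b'' c''. (w * b'') \<otimes> mY c'' (b' \<otimes> z')) (braid D (codiagonal \<rho>B \<rho>L) \<rho>L ((b \<otimes> z) \<otimes> w')) = W w b z w' b' z'"
    by (simp add: braid_pure_linear cl tensor_lift_comp act_codiagonal clinear_tensor_lift_swap[of "\<lambda>s. mY s _"] tensor_lift_push mYp W_def)
  ultimately show ?thesis by simp
qed

lemma wedge_linear [simp]: "clinear f \<Longrightarrow> clinear (\<lambda>x. wedge D (f x) t)" "clinear g \<Longrightarrow> clinear (\<lambda>x. wedge D s (g x))"
proof -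
  have "wedge D s t = tensor_lift (\<lambda>w. tensor_lift (\<lambda>b z. tensor_lift (\<lambda>w'. tensor_lift (\<lambda>b' z'. W w b z (evn w') b' z' + W w b (parity_\<Lambda> D z) (od w') b' z')) t)) s" for s t
  proof -
    have b1: "bilin (wedge D)"
      unfolding wedge_def braided_tensor_def B_alg_def \<Lambda>_alg_def
      by (simp add: even_part_def odd_part_def braid_def)
    show ?thesis
    proof (rule tensor3_eqI[where t = s])
      fix w b z
      show "wedge D (w \<otimes> b \<otimes> z) t = tensor_lift (\<lambda>w. tensor_lift (\<lambda>b z. tensor_lift (\<lambda>w'. tensor_lift (\<lambda>b' z'. W w b z (evn w') b' z' + W w b (parity_\<Lambda> D z) (od w') b' z')) t)) (w \<otimes> b \<otimes> z)"
        by (rule tensor3_eqI[where t = t]) (use b1 in \<open>simp_all add: wedge_pure\<close>)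
    qed (use b1 in simp_all)
  qed
  then show "clinear f \<Longrightarrow> clinear (\<lambda>x. wedge D (f x) t)" "clinear g \<Longrightarrow> clinear (\<lambda>x. wedge D s (g x))"
    by simp_all
qed

lemma lmult_linear [simp]: "clinear f \<Longrightarrow> clinear (\<lambda>x. lmult D (f x) t)" "clinear g \<Longrightarrow> clinear (\<lambda>x. lmult D a (g x))" "clinear (lmult D a)"
  and rmult_linear [simp]: "clinear h \<Longrightarrow> clinear (\<lambda>x. rmult D (h x) a)" "clinear k \<Longrightarrow> clinear (\<lambda>x. rmult D t (k x))" "clinear (rmult D t)"
  by (simp_all add: lmult_def[abs_def] rmult_def[abs_def] form0_def)

lemma W_one_left: "W 1 a 1 w b z = tensor_lift (\<lambda>w0 w1. w0 \<otimes> (act \<rho>B a w1 * b) \<otimes> z) (\<rho>L w)"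
proof -
  have *: "tensor_lift (\<lambda>b0 b1. (c * counit D b1) *\<^sub>C (w0 \<otimes> (act \<rho>B a h1 * b0) \<otimes> z)) (\<rho>B b) = c *\<^sub>C (w0 \<otimes> (act \<rho>B a h1 * b) \<otimes> z)" for c h1 and w0 :: 'l
    unfolding scaleC_scaleC[symmetric] scaleC_tensor_lift[symmetric]
    using counit_comodule[OF B.comodule_q, of "\<lambda>b. w0 \<otimes> (act \<rho>B a h1 * b) \<otimes> z" b] by simp
  have "tensor_lift (\<lambda>h1 h2. counit D h2 *\<^sub>C (w0 \<otimes> (act \<rho>B a h1 * b) \<otimes> z)) (comult D h) = w0 \<otimes> (act \<rho>B a h * b) \<otimes> z" for h and w0 :: 'l
    by (rule counit_right) simp
  then show ?thesis
    using * by (simp add: W_def act_one_left)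
qed

lemma lmult_pure: "lmult D a (w \<otimes> b \<otimes> z) = tensor_lift (\<lambda>w0 w1. w0 \<otimes> (act \<rho>B a w1 * b) \<otimes> z) (\<rho>L w)"
proof -
  have "lmult D a (w \<otimes> b \<otimes> z) = W 1 a 1 (evn w) b z + W 1 a 1 (od w) b z"
    by (simp add: lmult_def form0_def wedge_pure)
  also have "\<dots> = W 1 a 1 (evn w + od w) b z" by (rule clinear_add[symmetric]) simp
  finally show ?thesis by (simp add: even_odd_sum W_one_left)
qed

lemma W_one_right: "W w b z 1 b' z' = tensor_lift (\<lambda>b0 b1. w \<otimes> (b * b0) \<otimes> (act \<rho>L z b1 * z')) (\<rho>B b')"
  by (simp add: W_def L.coact_q_one comult_one act_one)

lemma wedge_one: "wedge D (w \<otimes> b \<otimes> z) (1 \<otimes> b' \<otimes> z') = tensor_lift (\<lambda>b0 b1. w \<otimes> (b * b0) \<otimes> (act \<rho>L z b1 * z')) (\<rho>B b')"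
  by (simp add: wedge_pure W_one_right clinear_0[of "\<lambda>x. W _ _ _ x _ _"])

lemma rmult_pure: "rmult D (w \<otimes> b \<otimes> z) a = tensor_lift (\<lambda>a0 a1. w \<otimes> (b * a0) \<otimes> act \<rho>L z a1) (\<rho>B a)"
  by (simp add: rmult_def form0_def wedge_one)

text \<open>The two sides act on \<open>a\<close> and coact on it in opposite orders, so the
  identity is the Yetter-Drinfeld condition for B, surrounded by renamings of Sweedler
  indices.\<close>

lemma W_balanced:
  "tensor_lift (\<lambda>a0 a1. W w (b * a0) (act \<rho>L z a1) w' b' z') (\<rho>B a) =
   tensor_lift (\<lambda>w0 w1. W w b z w0 (act \<rho>B a w1 * b') z') (\<rho>L w')"
proof -
  define T where "T w0 g1 p q = tensor_lift (\<lambda>b0 b1. (w * w0) \<otimes> (act \<rho>B b g1 * (p * b0)) \<otimes> (act \<rho>L z (q * b1) * z')) (\<rho>B b')" for w0 g1 p q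
  have Tl [simp]: "clinear f1 \<Longrightarrow> clinear (\<lambda>x. T (f1 x) g1 p q)" "clinear f2 \<Longrightarrow> clinear (\<lambda>x. T w0 (f2 x) p q)"
    "clinear f3 \<Longrightarrow> clinear (\<lambda>x. T w0 g1 (f3 x) q)" "clinear f4 \<Longrightarrow> clinear (\<lambda>x. T w0 g1 p (f4 x))"
    for f1 :: "'l \<Rightarrow> _" and f2 :: "'h \<Rightarrow> _" and f3 :: "'b \<Rightarrow> _" and f4 :: "'h \<Rightarrow> _" and w0 g1 p q
    by (simp_all add: T_def)
  have Tl' [simp]: "clinear f3 \<Longrightarrow> clinear (\<lambda>x. T w0 g1 (f3 x) q)" for f3 :: "'h \<Rightarrow> _" and w0 g1 q
    by (simp add: T_def)
  have t: "trilin (\<lambda>g1 g2 h2. tensor_lift (\<lambda>a0 a1. T w0 g1 (act \<rho>B a0 g2) (a1 * h2)) (\<rho>B a))" for w0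
    by (simp add: trilin_def)
  have t': "trilin (\<lambda>g1 g2 u. tensor_lift (\<lambda>p q. T w0 g1 p (g2 * q)) (\<rho>B (act \<rho>B a u)))" for w0
    by (simp add: trilin_def)
  have t'': "trilin (\<lambda>w0 k u. tensor_lift (\<lambda>g1 g2. tensor_lift (\<lambda>p q. T w0 g1 p (g2 * q)) (\<rho>B (act \<rho>B a u))) (comult D k))"
    by (simp add: trilin_def)
  have "tensor_lift (\<lambda>a0 a1. W w (b * a0) (act \<rho>L z a1) w' b' z') (\<rho>B a) =
    tensor_lift (\<lambda>w0 w1. tensor_lift (\<lambda>h1 h2. tensor_lift (\<lambda>g1 g2. tensor_lift (\<lambda>a0 a1. T w0 g1 (act \<rho>B a0 g2) (a1 * h2)) (\<rho>B a)) (comult D h1)) (comult D w1)) (\<rho>L w')"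
    by (simp add: W_def act_times mult_tensor_lift tensor_lift_push T_def act_mult mult.assoc
        tensor_lift_swap[of _ _ "\<rho>B a"] tensor_lift_swap[of _ "\<rho>B b'" "comult D _"])
  also have "\<dots> = tensor_lift (\<lambda>w0 w1. tensor_lift (\<lambda>g1 k. tensor_lift (\<lambda>g2 h2. tensor_lift (\<lambda>a0 a1. T w0 g1 (act \<rho>B a0 g2) (a1 * h2)) (\<rho>B a)) (comult D k)) (comult D w1)) (\<rho>L w')"
    by (subst comult_coassoc[OF t]) simp
  also have "\<dots> = tensor_lift (\<lambda>w0 w1. tensor_lift (\<lambda>g1 k. tensor_lift (\<lambda>g2 u. tensor_lift (\<lambda>p q. T w0 g1 p (g2 * q)) (\<rho>B (act \<rho>B a u))) (comult D k)) (comult D w1)) (\<rho>L w')"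
    by (subst Yetter_Drinfeld[OF B.comodule_q]) simp_all
  also have "\<dots> = tensor_lift (\<lambda>w0 w1. tensor_lift (\<lambda>k u. tensor_lift (\<lambda>g1 g2. tensor_lift (\<lambda>p q. T w0 g1 p (g2 * q)) (\<rho>B (act \<rho>B a u))) (comult D k)) (comult D w1)) (\<rho>L w')"
    by (subst comult_coassoc[OF t', symmetric]) simp
  also have "\<dots> = tensor_lift (\<lambda>w0 u. tensor_lift (\<lambda>v0 k. tensor_lift (\<lambda>g1 g2. tensor_lift (\<lambda>p q. T v0 g1 p (g2 * q)) (\<rho>B (act \<rho>B a u))) (comult D k)) (\<rho>L w0)) (\<rho>L w')"
    by (rule comodule_coassoc[OF L.comodule_q t'', symmetric])
  also have "\<dots> = tensor_lift (\<lambda>w0 w1. W w b z w0 (act \<rho>B a w1 * b') z') (\<rho>L w')"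
    by (simp add: W_def T_def comodule_algebraD(3)[OF B.comodule_algebra_q] act_mult)
  finally show ?thesis .
qed

text \<open>Together with \<open>wedge_lmult\<close> this is the part of associativity that involves
  functions. The bimodule laws, and the descent of the wedge product to the tensor product over A,
  are derived from these two.\<close>

lemma wedge_balanced: "wedge D (rmult D x a) y = wedge D x (lmult D a y)"
proof (rule tensor3_eqI[where t = x])
  fix w b z
  show "wedge D (rmult D (w \<otimes> b \<otimes> z) a) y = wedge D (w \<otimes> b \<otimes> z) (lmult D a y)"
  proof (rule tensor3_eqI[where t = y])
    fix w' b' z'
    have "wedge D (rmult D (w \<otimes> b \<otimes> z) a) (w' \<otimes> b' \<otimes> z') =
        tensor_lift (\<lambda>a0 a1. W w (b * a0) (act \<rho>L z a1) (evn w') b' z') (\<rho>B a) +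
        tensor_lift (\<lambda>a0 a1. W w (b * a0) (act \<rho>L (parity_\<Lambda> D z) a1) (od w') b' z') (\<rho>B a)"
      by (simp add: rmult_pure clinear_tensor_lift_swap[of "\<lambda>s. wedge D s _"] wedge_pure tensor_lift_plus parity_act)
    also have "\<dots> = tensor_lift (\<lambda>w0 w1. W w b z (evn w0) (act \<rho>B a w1 * b') z') (\<rho>L w') +
        tensor_lift (\<lambda>w0 w1. W w b (parity_\<Lambda> D z) (od w0) (act \<rho>B a w1 * b') z') (\<rho>L w')"
      unfolding W_balanced
      using even_odd_coact(1)[where f = "\<lambda>w0 w1. W w b z w0 (act \<rho>B a w1 * b') z'" and x = w']
        even_odd_coact(2)[where f = "\<lambda>w0 w1. W w b (parity_\<Lambda> D z) w0 (act \<rho>B a w1 * b') z'" and x = w']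
      by simp
    also have "\<dots> = wedge D (w \<otimes> b \<otimes> z) (lmult D a (w' \<otimes> b' \<otimes> z'))"
      by (simp add: lmult_pure clinear_tensor_lift_swap[of "wedge D _"] wedge_pure tensor_lift_plus)
    finally show "wedge D (rmult D (w \<otimes> b \<otimes> z) a) (w' \<otimes> b' \<otimes> z') = wedge D (w \<otimes> b \<otimes> z) (lmult D a (w' \<otimes> b' \<otimes> z'))" .
  qed simp_all
qed simp_all

lemma W_lmult: "tensor_lift (\<lambda>w0 w1. W w0 (act \<rho>B a w1 * b) z w' b' z') (\<rho>L w) = lmult D a (W w b z w' b' z')"
proof -
  define T where "T w0 w1 u0 g k h2 = tensor_lift (\<lambda>b0 b1. ((w0 :: 'l) * u0) \<otimes> (act \<rho>B a (w1 * g) * (act \<rho>B b k * b0)) \<otimes> (act \<rho>L (act \<rho>L z h2) b1 * z')) (\<rho>B b')" for w0 w1 u0 g k h2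
  have Tl [simp]: "clinear f3 \<Longrightarrow> clinear (\<lambda>x. T w0 w1 (f3 x) g k h2)"
    "clinear f4 \<Longrightarrow> clinear (\<lambda>x. T w0 w1 u0 (f4 x) k h2)" "clinear f5 \<Longrightarrow> clinear (\<lambda>x. T w0 w1 u0 g (f5 x) h2)" "clinear f6 \<Longrightarrow> clinear (\<lambda>x. T w0 w1 u0 g k (f6 x))"
    for f3 :: "'l \<Rightarrow> _" and f4 :: "'h \<Rightarrow> _" and f5 :: "'h \<Rightarrow> _" and f6 :: "'h \<Rightarrow> _" and w0 w1 u0 g k h2
    by (simp_all add: T_def)
  have t: "trilin (\<lambda>g k h2. T w0 w1 u0 g k h2)" for w0 w1 u0 by (simp add: trilin_def)
  have t': "trilin (\<lambda>u0 g h. tensor_lift (\<lambda>k h2. T w0 w1 u0 g k h2) (comult D h))" for w0 w1 by (simp add: trilin_def)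
  have "tensor_lift (\<lambda>w0 w1. W w0 (act \<rho>B a w1 * b) z w' b' z') (\<rho>L w) =
    tensor_lift (\<lambda>w0 w1. tensor_lift (\<lambda>u0 u1. tensor_lift (\<lambda>h1 h2. tensor_lift (\<lambda>g k. T w0 w1 u0 g k h2) (comult D h1)) (comult D u1)) (\<rho>L w')) (\<rho>L w)"
    by (simp add: W_def act_times mult_tensor_lift tensor_lift_push T_def act_mult mult.assoc
        tensor_lift_swap[of _ "\<rho>B b'" "comult D _"])
  also have "\<dots> = tensor_lift (\<lambda>w0 w1. tensor_lift (\<lambda>u0 u1. tensor_lift (\<lambda>g h. tensor_lift (\<lambda>k h2. T w0 w1 u0 g k h2) (comult D h)) (comult D u1)) (\<rho>L w')) (\<rho>L w)"
    by (subst comult_coassoc[OF t]) simp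
  also have "\<dots> = tensor_lift (\<lambda>w0 w1. tensor_lift (\<lambda>u0 h. tensor_lift (\<lambda>v0 g. tensor_lift (\<lambda>k h2. T w0 w1 v0 g k h2) (comult D h)) (\<rho>L u0)) (\<rho>L w')) (\<rho>L w)"
    by (subst comodule_coassoc[OF L.comodule_q t']) simp
  also have "\<dots> = lmult D a (W w b z w' b' z')"
    by (simp add: W_def clinear_tensor_lift_swap[of "lmult D a"] lmult_pure comodule_algebraD(3)[OF L.comodule_algebra_q] T_def
        tensor_lift_swap[of _ _ "\<rho>L w"] tensor_lift_swap[of _ "\<rho>B b'" "\<rho>L _"] tensor_lift_swap[of _ "comult D _" "\<rho>L _"])
  finally show ?thesis .
qed

lemma wedge_lmult: "wedge D (lmult D a x) y = lmult D a (wedge D x y)"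
proof (rule tensor3_eqI[where t = x])
  fix w b z
  show "wedge D (lmult D a (w \<otimes> b \<otimes> z)) y = lmult D a (wedge D (w \<otimes> b \<otimes> z) y)"
    by (rule tensor3_eqI[where t = y])
      (simp_all add: lmult_pure clinear_tensor_lift_swap[of "\<lambda>s. wedge D s _"] wedge_pure tensor_lift_plus W_lmult clinear_add[of "lmult D a"])
qed simp_all

end

section \<open>Coordinates on forms of degree one\<close>

context calculus
begin

text \<open>The involution of a pure form without its sign, in the role that \<open>W\<close> has
  for the wedge product.\<close>

definition S_star :: "'l \<Rightarrow> 'b \<Rightarrow> 'l \<Rightarrow> ('b, 'l) forms"
  where "S_star w b z = star_\<Lambda> D z \<otimes> star_B D b \<otimes> star_\<Lambda> D w"

lemma antilinear_comp_lin [simp]: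
  "clinear f \<Longrightarrow> antilinear (\<lambda>x. star_\<Lambda> D (f x))" "clinear g \<Longrightarrow> antilinear (\<lambda>x. star_B D (g x))"
  by (rule antilinear_comp_linear[OF star_L_antilinear], assumption) (rule antilinear_comp_linear[OF star_B_antilinear], assumption)

lemma form_star_pure: "form_star D (w \<otimes> b \<otimes> z) = S_star (evn w) b z + S_star (od w) b (parity_\<Lambda> D z)"
  by (simp add: form_star_def S_star_def antilinear_add[OF star_L_antilinear])

lemma form_star_antilinear [simp]: "antilinear (form_star D)"
  by (simp add: form_star_def)

lemma form_star_add: "form_star D (x + y) = form_star D x + form_star D y"
  and form_star_scale: "form_star D (c *\<^sub>C x) = cnj c *\<^sub>C form_star D x"
  by (simp_all add: antilinear_add antilinear_scale)

lemma star_L_star_L: "star_\<Lambda> D (star_\<Lambda> D z) = z"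
  using L.p_surj[of z] by (auto simp: star_L_p sstar_T_sstar_T)

lemma star_L_even_odd: "evn (star_\<Lambda> D z) = star_\<Lambda> D (evn z)" "od (star_\<Lambda> D z) = star_\<Lambda> D (od z)"
  by (simp_all add: even_part_def odd_part_def antilinear_scale[OF star_L_antilinear] antilinear_add[OF star_L_antilinear]
    additive_diff[of "star_\<Lambda> D", OF antilinear_add[OF star_L_antilinear]] parity_star)

lemma even_odd_simps [simp]: "evn (evn x) = evn x" "od (od x) = od x" "evn (od x) = 0" "od (evn x) = 0"
proof -
  show "evn (od x) = 0" "od (evn x) = 0" by (simp_all add: even_part_def[of _ "od x"] odd_part_def[of _ "evn x"])
  then show "evn (evn x) = evn x" "od (od x) = od x"
    using even_odd_sum[of "parity_\<Lambda> D" "evn x"] even_odd_sum[of "parity_\<Lambda> D" "od x"] by simp_all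
qed

lemma even_odd_parity: "evn (parity_\<Lambda> D x) = evn x" "od (parity_\<Lambda> D x) = - od x"
proof -
  have p: "parity_\<Lambda> D x = evn x - od x"
    using clinear_add[OF parity_linear(1), of "evn x" "od x"] by (simp add: even_odd_sum)
  show "evn (parity_\<Lambda> D x) = evn x" "od (parity_\<Lambda> D x) = - od x"
    unfolding p by (simp_all add: clinear_diff[of evn] clinear_diff[of od])
qed

lemma forms_induct [case_names pure add]:
  assumes "\<And>w b z. P (w \<otimes> b \<otimes> z)" "\<And>x y. P x \<Longrightarrow> P y \<Longrightarrow> P (x + y)"
  shows "P (x :: ('b, 'l) forms)"
proof (induct x rule: tensor_induct)
  case (pure w y)
  show ?case by (induct y rule: tensor_induct) (use assms in simp_all)
qed (rule assms(2))

lemma form_star_form_star [simp]: "form_star D (form_star D x) = x"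
proof (induct x rule: forms_induct)
  case (pure w b z)
  have z: "star_\<Lambda> D 0 = 0" "S_star 0 b' z' = 0" "S_star w' b' 0 = 0" for w' b' z'
    by (simp_all add: S_star_def antilinear_0)
  have s: "S_star (- w') b' z' = - S_star w' b' z'" for w' b' z'
    using antilinear_scale[OF star_L_antilinear, of "-1" w'] by (simp add: S_star_def)
  have "form_star D (S_star (evn w) b z) = evn w \<otimes> b \<otimes> z"
    unfolding S_star_def form_star_pure
    by (simp add: S_star_def star_L_even_odd star_L_star_L parity_star) (simp add: even_odd_sum flip: tensor_pure_add)
  moreover have "form_star D (S_star (od w) b (parity_\<Lambda> D z)) = od w \<otimes> b \<otimes> z"
  proof -
    have "star_\<Lambda> D (- x) = - star_\<Lambda> D x" for x using antilinear_scale[OF star_L_antilinear, of "-1" x] by simp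
    then show ?thesis
      unfolding S_star_def form_star_pure
      by (simp add: S_star_def star_L_even_odd star_L_star_L parity_star even_odd_parity) (simp add: even_odd_sum flip: tensor_pure_add)
  qed
  ultimately show ?case by (simp add: form_star_pure form_star_add even_odd_sum flip: tensor_pure_add)
qed (simp add: form_star_add)

text \<open>The right action braids z with a, the left action braids the star of a with the star of
  z, and \<open>braid_star\<close> matches the two.\<close>

lemma S_star_rmult:
  "tensor_lift_cnj (\<lambda>a0 a1. S_star w (b * a0) (act \<rho>L z a1)) (\<rho>B a) = lmult D (star_B D a) (S_star w b z)"
proof -
  have "lmult D (star_B D a) (S_star w b z) =
    tensor_lift (\<lambda>p q. p \<otimes> (q * star_B D b) \<otimes> star_\<Lambda> D w) (braid D \<rho>B \<rho>L (star_B D a \<otimes> star_\<Lambda> D z))"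
    by (simp add: S_star_def lmult_pure braid_pure tensor_lift_comp)
  also have "\<dots> = tensor_lift (\<lambda>p q. p \<otimes> (q * star_B D b) \<otimes> star_\<Lambda> D w)
      (tensor_lift_cnj (\<lambda>p q. star_\<Lambda> D q \<otimes> star_B D p) (braid D \<rho>L \<rho>B (z \<otimes> a)))"
    by (subst braid_star[OF L.comodule_q star_L_comodule_star B.comodule_q star_B_comodule_star real]) simp
  also have "\<dots> = tensor_lift (\<lambda>p q. p \<otimes> (q * star_B D b) \<otimes> star_\<Lambda> D w)
      (tensor_lift_cnj (\<lambda>a0 a1. star_\<Lambda> D (act \<rho>L z a1) \<otimes> star_B D a0) (\<rho>B a))"
    by (simp add: braid_pure antilinear_tensor_lift_swap[of "tensor_lift_cnj _"])
  also have "\<dots> = tensor_lift_cnj (\<lambda>a0 a1. S_star w (b * a0) (act \<rho>L z a1)) (\<rho>B a)"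
  proof -
    have sw: "L (tensor_lift_cnj f t) = tensor_lift_cnj (\<lambda>a b. L (f a b)) t" if "clinear L"
      for L :: "('l, 'b) tensor \<Rightarrow> ('b, 'l) forms" and f :: "'b \<Rightarrow> 'h \<Rightarrow> _" and t
      by (simp add: tensor_lift_cnj_def case_prod_beta clinear_sum[OF that] clinear_scale[OF that])
    show ?thesis by (simp add: S_star_def star_B_mult sw[of "tensor_lift _"])
  qed
  finally show ?thesis ..
qed

lemma form_star_rmult: "form_star D (rmult D x a) = lmult D (star_B D a) (form_star D x)"
proof (induct x rule: forms_induct)
  case (pure w b z)
  have S: "tensor_lift_cnj (\<lambda>a b. f a b + g a b) t = tensor_lift_cnj f t + tensor_lift_cnj g t"
    for f g :: "'b \<Rightarrow> 'h \<Rightarrow> ('b, 'l) forms" and t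
    by (simp add: tensor_lift_cnj_def case_prod_beta scaleC_add_right sum.distrib)
  show ?case
    by (simp add: rmult_pure antilinear_tensor_lift_swap[OF form_star_antilinear] form_star_pure S parity_act S_star_rmult
      clinear_add[of "lmult D _"])
next
  case (add x y)
  then show ?case by (simp add: clinear_add[of "\<lambda>x. rmult D x _"] clinear_add[of "lmult D _"] form_star_add)
qed

lemma form_star_lmult: "form_star D (lmult D a x) = rmult D (form_star D x) (star_B D a)"
  using form_star_rmult[of "form_star D x" "star_B D a"] by (metis form_star_form_star star_B_star_B)

section \<open>The bimodules of forms of degree (1,0) and (0,1)\<close>

definition iota10 :: "('v, 'b) tensor \<Rightarrow> ('b, 'l) forms" where "iota10 = tensor_lift (\<lambda>v b. L.gen v \<otimes> b \<otimes> 1)"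

definition iota01 :: "('b, 'v) tensor \<Rightarrow> ('b, 'l) forms" where "iota01 = tensor_lift (\<lambda>b v. 1 \<otimes> b \<otimes> L.gen v)"

lemma iota_linear [simp]: "clinear iota10" "clinear iota01" "clinear f \<Longrightarrow> clinear (\<lambda>x. iota10 (f x))" "clinear g \<Longrightarrow> clinear (\<lambda>x. iota01 (g x))"
  by (simp_all add: iota10_def iota01_def)

lemma iota_pure [simp]: "iota10 (v \<otimes> b) = L.gen v \<otimes> b \<otimes> 1" "iota01 (b \<otimes> v) = 1 \<otimes> b \<otimes> L.gen v"
  by (simp_all add: iota10_def iota01_def)

lemma part_iota: "part10 D x = iota10 (coord10 D x)" "part01 D x = iota01 (coord01 D x)"
  by (simp_all add: part10_def part01_def iota10_def iota01_def gen_defs)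

lemma coord_linear [simp]: "clinear (coord10 D)" "clinear (coord01 D)"
  "clinear f \<Longrightarrow> clinear (\<lambda>x. coord10 D (f x))" "clinear g \<Longrightarrow> clinear (\<lambda>x. coord01 D (g x))"
  by (simp_all add: coord10_def coord01_def)

lemma coord_pure: "coord10 D (w \<otimes> b \<otimes> z) = deg0 \<pi>L z *\<^sub>C (deg1 \<pi>L w \<otimes> b)" "coord01 D (w \<otimes> b \<otimes> z) = deg0 \<pi>L w *\<^sub>C (b \<otimes> deg1 \<pi>L z)"
  by (simp_all add: coord10_def coord01_def)

lemma coord_iota [simp]: "coord10 D (iota10 t) = t" "coord01 D (iota01 s) = s" "coord10 D (iota01 s) = 0" "coord01 D (iota10 t) = 0"
proof -
  show "coord10 D (iota10 t) = t" by (rule clinear_eqI[where t = t]) (simp_all add: coord_pure)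
  show "coord01 D (iota01 s) = s" by (rule clinear_eqI[where t = s]) (simp_all add: coord_pure)
  show "coord10 D (iota01 s) = 0" by (rule clinear_eqI[where t = s and g = "\<lambda>_. 0"]) (simp_all add: coord_pure)
  show "coord01 D (iota10 t) = 0" by (rule clinear_eqI[where t = t and g = "\<lambda>_. 0"]) (simp_all add: coord_pure)
qed

lemma coord10_lmult: "coord10 D (lmult D a x) = lact a (coord10 D x)"
proof (rule tensor3_eqI[where t = x])
  fix w b z
  show "coord10 D (lmult D a (w \<otimes> b \<otimes> z)) = lact a (coord10 D (w \<otimes> b \<otimes> z))"
    by (simp add: lmult_pure clinear_tensor_lift_swap[of "coord10 D"] coord_pure clinear_scale[of "lact a"] lact_pure L.deg1_coact
      tensor_lift_tensor_map scaleC_tensor_lift)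
qed simp_all

lemma coord10_rmult: "coord10 D (rmult D x a) = rmul (coord10 D x) a"
proof (rule tensor3_eqI[where t = x])
  fix w b z
  have "tensor_lift (\<lambda>a0 a1. counit D a1 *\<^sub>C (deg0 \<pi>L z *\<^sub>C (deg1 \<pi>L w \<otimes> (b * a0)))) (\<rho>B a) = deg0 \<pi>L z *\<^sub>C (deg1 \<pi>L w \<otimes> (b * a))"
    by (rule counit_comodule[OF B.comodule_q]) simp
  then show "coord10 D (rmult D (w \<otimes> b \<otimes> z) a) = rmul (coord10 D (w \<otimes> b \<otimes> z)) a"
    by (simp add: rmult_pure clinear_tensor_lift_swap[of "coord10 D"] coord_pure L.deg0_act clinear_scale[of "tensor_map _ _"])
qed simp_all

lemma coord01_lmult: "coord01 D (lmult D a x) = lmul a (coord01 D x)"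
proof (rule tensor3_eqI[where t = x])
  fix w b z
  have "tensor_lift (\<lambda>w0 w1. deg0 \<pi>L w0 *\<^sub>C ((act \<rho>B a w1 * b) \<otimes> deg1 \<pi>L z)) (\<rho>L w) = deg0 \<pi>L w *\<^sub>C ((act \<rho>B a 1 * b) \<otimes> deg1 \<pi>L z)"
    by (rule L.deg0_coact) simp
  then show "coord01 D (lmult D a (w \<otimes> b \<otimes> z)) = lmul a (coord01 D (w \<otimes> b \<otimes> z))"
    by (simp add: lmult_pure clinear_tensor_lift_swap[of "coord01 D"] coord_pure clinear_scale[of "tensor_map _ _"] act_one)
qed simp_all

lemma coord01_rmult: "coord01 D (rmult D x a) = ract (coord01 D x) a"
proof (rule tensor3_eqI[where t = x])
  fix w b z
  show "coord01 D (rmult D (w \<otimes> b \<otimes> z) a) = ract (coord01 D (w \<otimes> b \<otimes> z)) a"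
    by (simp add: rmult_pure clinear_tensor_lift_swap[of "coord01 D"] coord_pure clinear_scale[of "\<lambda>t. ract t a"] ract_pure L.deg1_act
      scaleC_tensor_lift)
qed simp_all

lemma lmult_iota10: "lmult D a (iota10 t) = iota10 (lact a t)"
  by (rule clinear_eqI[where t = t])
    (simp_all add: lmult_pure lact_pure L.coact_gen tensor_lift_tensor_map clinear_tensor_lift_swap[of iota10])

lemma rmult_iota10: "rmult D (iota10 t) a = iota10 (rmul t a)"
proof (rule clinear_eqI[where t = t])
  fix v b
  have "tensor_lift (\<lambda>a0 a1. counit D a1 *\<^sub>C (L.gen v \<otimes> (b * a0) \<otimes> 1)) (\<rho>B a) = L.gen v \<otimes> (b * a) \<otimes> 1"
    by (rule counit_comodule[OF B.comodule_q]) simp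
  then show "rmult D (iota10 (v \<otimes> b)) a = iota10 (rmul (v \<otimes> b) a)"
    by (simp add: rmult_pure act_one_left)
qed simp_all

lemma lmult_iota01: "lmult D a (iota01 t) = iota01 (lmul a t)"
  by (rule clinear_eqI[where t = t]) (simp_all add: lmult_pure L.coact_q_one act_one)

lemma rmult_iota01: "rmult D (iota01 t) a = iota01 (ract t a)"
  by (rule clinear_eqI[where t = t])
    (simp_all add: rmult_pure ract_pure L.act_gen clinear_tensor_lift_swap[of iota01])

lemma Omega_pq:
  "\<pi>L ` talg_deg 0 = range (\<lambda>c. c *\<^sub>C 1)" "\<pi>L ` talg_deg 1 = range (\<lambda>v. L.gen v)"
proof -
  have 1: "c *\<^sub>C (1 :: 'v talg) \<in> talg_deg 0" for c
    using word_in_talg_deg[of "[] :: 'v list"] by (simp add: talg_deg_def cvec.span_scale)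
  have 2: "\<pi>L (c *\<^sub>C 1) = c *\<^sub>C 1" for c by (simp add: clinear_scale[OF L.p_linear(1)])
  show "\<pi>L ` talg_deg 0 = range (\<lambda>c. c *\<^sub>C 1)"
  proof
    show "\<pi>L ` talg_deg 0 \<subseteq> range (\<lambda>c. c *\<^sub>C 1)"
    proof
      fix x assume "x \<in> \<pi>L ` talg_deg 0"
      then obtain t where "x = \<pi>L t" "t \<in> talg_deg 0" by auto
      then obtain c where "x = \<pi>L (c *\<^sub>C 1)" using talg_deg_0 by blast
      then show "x \<in> range (\<lambda>c. c *\<^sub>C 1)" unfolding 2 by blast
    qed
    show "range (\<lambda>c. c *\<^sub>C 1) \<subseteq> \<pi>L ` talg_deg 0" using 1 unfolding 2[symmetric] by blast
  qed
  have 3: "word [v] \<in> talg_deg 1" for v :: 'v using word_in_talg_deg[of "[v]"] by simp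
  then show "\<pi>L ` talg_deg 1 = range (\<lambda>v. L.gen v)" using talg_deg_1 by blast
qed

lemma span_range:
  assumes f: "clinear f" and S: "\<And>s. s \<in> S \<Longrightarrow> s \<in> range f" "\<And>x y. f (x \<otimes> y) \<in> S"
  shows "cvec.span S = range f"
proof
  show "cvec.span S \<subseteq> range f"
  proof (rule cvec.span_minimal)
    show "S \<subseteq> range f" using S by auto
    show "cvec.subspace (range f)"
      unfolding cvec.subspace_def
    proof (intro conjI ballI allI)
      show "0 \<in> range f" using clinear_0[OF f] by (metis rangeI)
      fix x y c assume "x \<in> range f" "y \<in> range f"
      then obtain s t where "x = f s" "y = f t" by auto
      then have "x + y = f (s + t)" "c *\<^sub>C x = f (c *\<^sub>C s)" by (simp_all add: clinear_add[OF f] clinear_scale[OF f])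
      then show "x + y \<in> range f" "c *\<^sub>C x \<in> range f" by simp_all
    qed
  qed
  have "f t \<in> cvec.span S" for t
    by (induct t rule: tensor_induct) (simp_all add: S cvec.span_base clinear_add[OF f] cvec.span_add)
  then show "range f \<subseteq> cvec.span S" by auto
qed

lemma Omega10: "Omega D 1 0 = range iota10" and Omega01: "Omega D 0 1 = range iota01"
proof -
  show "Omega D 1 0 = range iota10"
    unfolding Omega_def Omega_pq
  proof (rule span_range)
    fix s assume "s \<in> {w \<otimes> (b::'b) \<otimes> z |w b z. w \<in> range (\<lambda>v. L.gen v) \<and> z \<in> range (\<lambda>c. c *\<^sub>C (1::'l))}"
    then obtain v b c where "s = L.gen v \<otimes> b \<otimes> (c *\<^sub>C 1)" by auto
    then have "s = iota10 (v \<otimes> (c *\<^sub>C b))" by (simp add: clinear_scale[OF iota_linear(1)])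
    then show "s \<in> range iota10" by blast
  next
    fix v b
    have "iota10 (v \<otimes> b) = L.gen v \<otimes> b \<otimes> (1 *\<^sub>C 1)" by simp
    then show "iota10 (v \<otimes> b) \<in> {w \<otimes> (b::'b) \<otimes> z |w b z. w \<in> range (\<lambda>v. L.gen v) \<and> z \<in> range (\<lambda>c. c *\<^sub>C (1::'l))}"
      by blast
  qed simp
  show "Omega D 0 1 = range iota01"
    unfolding Omega_def Omega_pq
  proof (rule span_range)
    fix s assume "s \<in> {w \<otimes> (b::'b) \<otimes> z |w b z. w \<in> range (\<lambda>c. c *\<^sub>C (1::'l)) \<and> z \<in> range (\<lambda>v. L.gen v)}"
    then obtain v b c where "s = (c *\<^sub>C 1) \<otimes> b \<otimes> L.gen v" by auto
    then have "s = iota01 ((c *\<^sub>C b) \<otimes> v)" by (simp add: clinear_scale[OF iota_linear(2)])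
    then show "s \<in> range iota01" by blast
  next
    fix b v
    have "iota01 (b \<otimes> v) = (1 *\<^sub>C 1) \<otimes> b \<otimes> L.gen v" by simp
    then show "iota01 (b \<otimes> v) \<in> {w \<otimes> (b::'b) \<otimes> z |w b z. w \<in> range (\<lambda>c. c *\<^sub>C (1::'l)) \<and> z \<in> range (\<lambda>v. L.gen v)}"
      by blast
  qed simp
qed

lemma del_pure: "del D (w \<otimes> b \<otimes> z) = tensor_lift (\<lambda>v c. (parity_\<Lambda> D w * L.gen v) \<otimes> c \<otimes> z) (dB b)"
proof -
  have "tensor_lift (\<lambda>b1 b2. (parity_\<Lambda> D w * gen_\<Lambda> D (deg1 \<pi>B b1)) \<otimes> b2 \<otimes> z) (coprod_B D b)
      = tensor_lift (\<lambda>v c. (parity_\<Lambda> D w * L.gen v) \<otimes> c \<otimes> z) (dB b)" for w z :: 'l and b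
    by (simp add: dB_def tensor_lift_tensor_map gen_defs)
  then show ?thesis by (simp add: del_def)
qed

lemma delbar_pure: "delbar D (w \<otimes> b \<otimes> z) = tensor_lift (\<lambda>c v. parity_\<Lambda> D w \<otimes> c \<otimes> (L.gen v * z)) (dbarB b)"
proof -
  have "tensor_lift (\<lambda>b1 b2. parity_\<Lambda> D w \<otimes> b1 \<otimes> (gen_\<Lambda> D (deg1 \<pi>B b2) * z)) (coprod_B D b)
      = tensor_lift (\<lambda>c v. parity_\<Lambda> D w \<otimes> c \<otimes> (L.gen v * z)) (dbarB b)" for w z :: 'l and b
    by (simp add: dbarB_def tensor_lift_tensor_map gen_defs)
  then show ?thesis by (simp add: delbar_def)
qed

lemma del_linear [simp]: "clinear (del D)" "clinear (delbar D)"
proof -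
  have d: "tensor_lift (\<lambda>b1 b2. (parity_\<Lambda> D w * gen_\<Lambda> D (deg1 \<pi>B b1)) \<otimes> b2 \<otimes> z) (coprod_B D b)
      = tensor_lift (\<lambda>v c. (parity_\<Lambda> D w * L.gen v) \<otimes> c \<otimes> z) (dB b)" for w z :: 'l and b
    by (simp add: dB_def tensor_lift_tensor_map gen_defs)
  show "clinear (del D)" unfolding del_def d by simp
  have d: "tensor_lift (\<lambda>b1 b2. parity_\<Lambda> D w \<otimes> b1 \<otimes> (gen_\<Lambda> D (deg1 \<pi>B b2) * z)) (coprod_B D b)
      = tensor_lift (\<lambda>c v. parity_\<Lambda> D w \<otimes> c \<otimes> (L.gen v * z)) (dbarB b)" for w z :: 'l and b
    by (simp add: dbarB_def tensor_lift_tensor_map gen_defs)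
  show "clinear (delbar D)" unfolding delbar_def d by simp
qed

lemma ext_d_linear [simp]: "clinear (ext_d D)" "clinear f \<Longrightarrow> clinear (\<lambda>x. ext_d D (f x))"
proof -
  show "clinear (ext_d D)" unfolding ext_d_def[abs_def] by simp
  then show "clinear f \<Longrightarrow> clinear (\<lambda>x. ext_d D (f x))" by (rule clinear_compose)
qed

lemma form0_linear [simp]: "clinear f \<Longrightarrow> clinear (\<lambda>x. form0 (f x))"
  by (simp add: form0_def)

lemma del_form0: "del D (form0 a) = iota10 (dB a)" and delbar_form0: "delbar D (form0 a) = iota01 (dbarB a)"
  by (simp_all add: form0_def del_pure delbar_pure iota10_def iota01_def)

lemma ext_d_form0: "ext_d D (form0 a) = iota10 (dB a) + iota01 (dbarB a)"
  by (simp add: ext_d_def del_form0 delbar_form0)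

lemma form_star_iota: "form_star D (iota10 t) = iota01 (swap_star t)" "form_star D (iota01 (swap_star t)) = iota10 t"
proof -
  show "form_star D (iota10 t) = iota01 (swap_star t)"
  proof (induct t rule: tensor_induct)
    case (pure v b)
    then show ?case by (simp add: form_star_pure S_star_def antilinear_0)
  next
    case (add s t)
    then show ?case by (simp add: clinear_add[OF iota_linear(1)] clinear_add[OF iota_linear(2)] form_star_add swap_star_add)
  qed
  then show "form_star D (iota01 (swap_star t)) = iota10 t" by (metis form_star_form_star)
qed

lemma form_star_ext_d: "form_star D (ext_d D (form0 a)) = ext_d D (form0 (star_B D a))"
proof -
  have "form_star D (iota01 (dbarB a)) = iota10 (dB (star_B D a))"
    using form_star_iota(2)[of "dB (star_B D a)"] by (simp add: dbarB_star)
  moreover have "form_star D (iota10 (dB a)) = iota01 (dbarB (star_B D a))"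
    by (simp add: form_star_iota dbarB_star)
  ultimately show ?thesis by (simp add: ext_d_form0 form_star_add add.commute)
qed

text \<open>
  From here on \<open>\<epsilon> = True\<close> stands for \<open>F = \<Omega>\<^sup>0\<^sup>,\<^sup>1\<close> and \<open>\<epsilon> = False\<close> for \<open>E = \<Omega>\<^sup>1\<^sup>,\<^sup>0\<close>.  Both are free left modules on
  a basis of \<open>V\<close>, so they are identified with \<open>B \<otimes> V\<close>; only the right actions differ.
\<close>

abbreviation "\<beta> \<equiv> braid D \<rho>B \<rho>V"
abbreviation "\<beta>' \<equiv> braid_inv \<rho>B \<rho>V"

lemma beta_inv [simp]: "\<beta> (\<beta>' t) = t" "\<beta>' (\<beta> s) = s"
  by (rule braid_braid_inv[OF B.comodule_q coact_comodule])+

lemma beta_lmul: "\<beta> (lmul a t) = lact a (\<beta> t)"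
  by (rule clinear_eqI[where t = t]) (simp_all add: braid_BV lact_mult)

lemma beta_inv_lact: "\<beta>' (lact a t) = lmul a (\<beta>' t)"
  by (metis beta_inv beta_lmul)

text \<open>For E, whose forms V \<otimes> B carry the coefficient on the right, \<beta> moves it to
  the left. In both cases left multiplication by functions becomes multiplication on the factor
  B.\<close>

definition inn :: "bool \<Rightarrow> ('b, 'v) tensor \<Rightarrow> ('b, 'l) forms"
  where "inn \<epsilon> t = (if \<epsilon> then iota01 t else iota10 (\<beta> t))"

definition cc :: "bool \<Rightarrow> ('b, 'l) forms \<Rightarrow> ('b, 'v) tensor"
  where "cc \<epsilon> x = (if \<epsilon> then coord01 D x else \<beta>' (coord10 D x))"

definition rgt :: "bool \<Rightarrow> ('b, 'v) tensor \<Rightarrow> 'b \<Rightarrow> ('b, 'v) tensor"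
  where "rgt \<epsilon> t a = (if \<epsilon> then ract t a else \<beta>' (rmul (\<beta> t) a))"

definition dd :: "bool \<Rightarrow> 'b \<Rightarrow> ('b, 'v) tensor"
  where "dd \<epsilon> a = (if \<epsilon> then dbarB a else \<beta>' (dB a))"

definition sg :: "bool \<Rightarrow> ('v, 'v) tensor \<Rightarrow> ('v, 'v) tensor"
  where "sg \<epsilon> = (if \<epsilon> then \<psi> else inv \<psi>)"

definition MM :: "bool \<Rightarrow> ('b, 'l) forms set" where "MM \<epsilon> = (if \<epsilon> then Omega D 0 1 else Omega D 1 0)"

abbreviation ee :: "bool \<Rightarrow> 'v \<Rightarrow> ('b, 'l) forms" where "ee \<epsilon> v \<equiv> inn \<epsilon> (1 \<otimes> v)"

lemma inv_Psi: "inv \<psi> = braid_inv \<rho>V \<rho>V"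
  unfolding Psi_def by (rule inv_braid) simp_all

lemma inn_linear [simp]: "clinear (inn \<epsilon>)" "clinear f \<Longrightarrow> clinear (\<lambda>x. inn \<epsilon> (f x))"
  and cc_linear [simp]: "clinear (cc \<epsilon>)" "clinear g \<Longrightarrow> clinear (\<lambda>x. cc \<epsilon> (g x))"
  and dd_linear [simp]: "clinear (dd \<epsilon>)" "clinear h \<Longrightarrow> clinear (\<lambda>x. dd \<epsilon> (h x))"
  and sg_linear [simp]: "clinear (sg \<epsilon>)" "clinear k \<Longrightarrow> clinear (\<lambda>x. sg \<epsilon> (k x))"
  by (cases \<epsilon>; simp add: inn_def[abs_def] cc_def[abs_def] dd_def[abs_def] sg_def inv_Psi)+

lemma rgt_linear [simp]: "clinear f \<Longrightarrow> clinear (\<lambda>x. rgt \<epsilon> (f x) a)" "clinear g \<Longrightarrow> clinear (\<lambda>x. rgt \<epsilon> t (g x))"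
  by (cases \<epsilon>; simp add: rgt_def)+

lemma cc_inn: "cc \<epsilon> (inn \<delta> t) = (if \<epsilon> = \<delta> then t else 0)"
  by (cases \<epsilon>; cases \<delta>) (simp_all add: cc_def inn_def clinear_0[of \<beta>'])

lemma cc_lmult: "cc \<epsilon> (lmult D a x) = lmul a (cc \<epsilon> x)"
  by (simp add: cc_def coord01_lmult coord10_lmult beta_inv_lact)

lemma cc_rmult: "cc \<epsilon> (rmult D x a) = rgt \<epsilon> (cc \<epsilon> x) a"
  by (simp add: cc_def rgt_def coord01_rmult coord10_rmult)

lemma lmult_inn: "lmult D a (inn \<epsilon> t) = inn \<epsilon> (lmul a t)"
  by (simp add: inn_def lmult_iota01 lmult_iota10 beta_lmul)

lemma rmult_inn: "rmult D (inn \<epsilon> t) a = inn \<epsilon> (rgt \<epsilon> t a)"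
  by (simp add: inn_def rgt_def rmult_iota01 rmult_iota10)

lemma rgt_lmul: "rgt \<epsilon> (lmul c t) a = lmul c (rgt \<epsilon> t a)"
  by (simp add: rgt_def ract_lmul beta_lmul beta_inv_lact flip: lact_rmul)

lemma rmul_mult: "rmul t (a * b) = rmul (rmul t a) b" and rmul_one: "rmul t 1 = t"
  by (simp_all add: tensor_map_comp mult.assoc)

lemma rgt_mult: "rgt \<epsilon> t (a * b) = rgt \<epsilon> (rgt \<epsilon> t a) b" and rgt_one [simp]: "rgt \<epsilon> t 1 = t"
  by (simp_all add: rgt_def ract_mult rmul_mult rmul_one)

lemma dd_mult: "dd \<epsilon> (a * b) = rgt \<epsilon> (dd \<epsilon> a) b + lmul a (dd \<epsilon> b)"
  by (simp add: dd_def rgt_def dbarB_mult dB_mult clinear_add[of \<beta>'] beta_inv_lact)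

lemma dd_one [simp]: "dd \<epsilon> 1 = 0" and dd_gen: "dd \<epsilon> (B.gen v) = 1 \<otimes> v"
proof -
  show "dd \<epsilon> 1 = 0" by (simp add: dd_def clinear_0[of \<beta>'])
  have "\<beta> (1 \<otimes> v) = v \<otimes> 1" by (simp add: braid_BV)
  then show "dd \<epsilon> (B.gen v) = 1 \<otimes> v" by (simp add: dd_def dbarB_gen dB_gen) (metis beta_inv(2))
qed

lemma ext_d_inn: "ext_d D (form0 a) = inn True (dd True a) + inn False (dd False a)"
  by (simp add: ext_d_form0 inn_def dd_def add.commute)

lemma MM_range: "MM \<epsilon> = range (inn \<epsilon>)"
proof -
  have "surj \<beta>" by (metis beta_inv(1) surjI)
  then have "range (\<lambda>t. iota10 (\<beta> t)) = range iota10" by (metis fun.set_map image_image)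
  then show ?thesis by (cases \<epsilon>) (simp_all add: MM_def Omega01[unfolded One_nat_def] Omega10[unfolded One_nat_def] inn_def[abs_def])
qed

lemma gen_ee: "delbar_gen D v = ee True v" "del_gen D v = ee False v" "d_gen D u = ee True u + ee False u"
proof -
  show "delbar_gen D v = ee True v" "d_gen D u = ee True u + ee False u"
    by (simp_all add: delbar_gen_def d_gen_def gen_defs delbar_form0 dbarB_gen ext_d_inn dd_gen) (simp add: inn_def)
  show "del_gen D v = ee False v"
    by (simp add: del_gen_def gen_defs del_form0 dB_gen inn_def braid_BV)
qed

lemma form_star_ee: "form_star D (ee \<epsilon> v) = ee (\<not> \<epsilon>) (vstar D v)"
  by (cases \<epsilon>) (simp_all add: inn_def braid_BV form_star_pure S_star_def antilinear_0)

lemma part_inn: "part10 D x = inn False (cc False x)" "part01 D x = inn True (cc True x)"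
  by (simp_all add: part_iota inn_def cc_def)

section \<open>Crossings of functions with generators\<close>

definition th :: "bool \<Rightarrow> ('v, 'b) tensor \<Rightarrow> ('b, 'v) tensor"
  where "th \<epsilon> = (if \<epsilon> then braid D \<rho>V \<rho>B else \<beta>')"

lemma th_linear [simp]: "clinear (th \<epsilon>)" "clinear f \<Longrightarrow> clinear (\<lambda>x. th \<epsilon> (f x))"
  by (cases \<epsilon>; simp add: th_def)+

lemma rgt_th: "rgt \<epsilon> (1 \<otimes> v) a = th \<epsilon> (v \<otimes> a)"
  by (simp add: rgt_def th_def braid_VB braid_BV)

text \<open>The origin of \<Psi> and of its inverse in the two formulas for \<sigma>: for E the
  crossing inverts the braiding of B with V, and that braiding is \<Psi> on the generators of
  B.\<close>

lemma th_gen: "th \<epsilon> (v \<otimes> B.gen u) = tensor_map (\<lambda>v. B.gen v) (\<lambda>v. v) (sg \<epsilon> (v \<otimes> u))"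
proof -
  have F: "braid D \<rho>V \<rho>B (v \<otimes> B.gen u) = tensor_map (\<lambda>v. B.gen v) (\<lambda>v. v) (\<psi> (v \<otimes> u))" for v u
    by (simp add: Psi_def braid_pure B.coact_gen tensor_lift_tensor_map tensor_lift_push)
  have G: "\<beta> (tensor_map (\<lambda>v. B.gen v) (\<lambda>v. v) s) = tensor_map (\<lambda>v. v) (\<lambda>v. B.gen v) (\<psi> s)" for s
    by (rule clinear_eqI[where t = s]) (simp_all add: Psi_def braid_pure B.act_gen tensor_lift_push)
  have "\<psi> (inv \<psi> s) = s" for s unfolding inv_Psi by (simp add: Psi_def braid_braid_inv)
  then have "\<beta> (tensor_map (\<lambda>v. B.gen v) (\<lambda>v. v) (inv \<psi> (v \<otimes> u))) = v \<otimes> B.gen u" unfolding G by simp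
  then have "\<beta>' (v \<otimes> B.gen u) = tensor_map (\<lambda>v. B.gen v) (\<lambda>v. v) (inv \<psi> (v \<otimes> u))" by (metis beta_inv(2))
  then show ?thesis using F by (simp add: th_def sg_def)
qed

lemma Psi_inv [simp]: "\<psi> (inv \<psi> s) = s" "inv \<psi> (\<psi> s) = s"
  unfolding inv_Psi by (simp_all add: Psi_def braid_braid_inv)

lemma tensor_map_inverse:
  assumes "clinear f" "clinear g" "\<And>s. f (g s) = s"
  shows "tensor_map (\<lambda>x. x) f (tensor_map (\<lambda>x. x) g t) = t" "apl f (apl g u) = u"
proof -
  have "(\<lambda>x. f (g x)) = (\<lambda>x. x)" using assms(3) by auto
  then show "tensor_map (\<lambda>x. x) f (tensor_map (\<lambda>x. x) g t) = t" using assms(1,2) by (simp add: tensor_map_comp)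
  show "apl f (apl g u) = u" using assms by (subst apl_comp) (auto intro: apl_id)
qed

text \<open>One case of the Yang-Baxter equation for each pair of types, with B in the third, the
  middle or the leading position. Inverse crossings are obtained by cancelling braidings from the
  plain equation, and the case of E followed by F is the inverse of that of F followed by E.\<close>

lemma sg_th_braid:
  "tensor_map (\<lambda>x. x) (sg \<epsilon>) (apl (th \<epsilon>) (tensor_map (\<lambda>x. x) (th \<delta>) t)) =
   apl (th \<delta>) (tensor_map (\<lambda>x. x) (th \<epsilon>) (apl (sg \<epsilon>) t))"
proof -
  let ?VB = "braid D \<rho>V \<rho>B" and ?m = "tensor_map (\<lambda>x. x)"
  have lin: "clinear (inv \<psi>)" by (simp add: inv_Psi)
  note inv1 = tensor_map_inverse[of \<beta> \<beta>'] tensor_map_inverse[of \<beta>' \<beta>] tensor_map_inverse[of \<psi> "inv \<psi>"] tensor_map_inverse[of "inv \<psi>" \<psi>]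
  have FF: "?m \<psi> (apl ?VB (?m ?VB t)) = apl ?VB (?m ?VB (apl \<psi> t))" for t
    using Yang_Baxter[of \<rho>V \<rho>V \<rho>B t] by (simp add: Psi_def id_def)
  have FE: "?m \<psi> (apl ?VB (?m \<beta>' t)) = apl \<beta>' (?m ?VB (apl \<psi> t))" for t
  proof -
    have "apl \<beta> (?m \<psi> (apl ?VB (?m \<beta>' t))) = ?m ?VB (apl \<psi> (?m \<beta> (?m \<beta>' t)))"
      using Yang_Baxter[of \<rho>V \<rho>B \<rho>V "?m \<beta>' t"] by (simp add: Psi_def id_def)
    then have "apl \<beta>' (apl \<beta> (?m \<psi> (apl ?VB (?m \<beta>' t)))) = apl \<beta>' (?m ?VB (apl \<psi> t))"
      by (simp add: inv1)
    then show ?thesis by (simp add: inv1)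
  qed
  have EF: "?m (inv \<psi>) (apl \<beta>' (?m ?VB t)) = apl ?VB (?m \<beta>' (apl (inv \<psi>) t))" for t
  proof -
    have "?m (inv \<psi>) (?m \<psi> (apl ?VB (?m \<beta>' (apl (inv \<psi>) t)))) = ?m (inv \<psi>) (apl \<beta>' (?m ?VB (apl \<psi> (apl (inv \<psi>) t))))"
      by (simp only: FE)
    then show ?thesis by (simp add: inv1 lin)
  qed
  have EE: "?m (inv \<psi>) (apl \<beta>' (?m \<beta>' t)) = apl \<beta>' (?m \<beta>' (apl (inv \<psi>) t))" for t
  proof -
    let ?u = "?m (inv \<psi>) (apl \<beta>' (?m \<beta>' t))"
    have "apl \<psi> (?m \<beta> (apl \<beta> ?u)) = ?m \<beta> (apl \<beta> (?m \<psi> ?u))"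
      using Yang_Baxter[of \<rho>B \<rho>V \<rho>V ?u] by (simp add: Psi_def id_def)
    also have "\<dots> = t" by (simp add: inv1 lin)
    finally have "apl (inv \<psi>) (apl \<psi> (?m \<beta> (apl \<beta> ?u))) = apl (inv \<psi>) t" by simp
    then have "?m \<beta> (apl \<beta> ?u) = apl (inv \<psi>) t" by (simp add: inv1 lin)
    then have "apl \<beta>' (?m \<beta>' (?m \<beta> (apl \<beta> ?u))) = apl \<beta>' (?m \<beta>' (apl (inv \<psi>) t))" by simp
    then show ?thesis by (simp add: inv1 lin)
  qed
  show ?thesis using FF FE EF EE by (cases \<epsilon>; cases \<delta>) (simp_all add: sg_def th_def)
qed

end

section \<open>Tensor products over the Nichols algebra\<close>

context calculus
begin

abbreviation "ov \<equiv> over_A D"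
abbreviation "bal \<equiv> balancing D"
abbreviation lm :: "'b \<Rightarrow> (('b, 'l) forms, ('b, 'l) forms) tensor \<Rightarrow> (('b, 'l) forms, ('b, 'l) forms) tensor"
  where "lm a \<equiv> tensor_map (lmult D a) (\<lambda>y. y)"
abbreviation rm :: "'b \<Rightarrow> (('b, 'l) forms, ('b, 'l) forms) tensor \<Rightarrow> (('b, 'l) forms, ('b, 'l) forms) tensor"
  where "rm a \<equiv> tensor_map (\<lambda>x. x) (\<lambda>y. rmult D y a)"
abbreviation "dg \<equiv> dagger (form_star D)"

lemma form0_lmult: "lmult D a (form0 b) = form0 (a * b)"
  by (simp add: form0_def lmult_pure L.coact_q_one act_one)

lemma lmult_lmult: "lmult D a (lmult D b x) = lmult D (a * b) x"
  using wedge_lmult[of a "form0 b" x] by (simp add: form0_lmult flip: lmult_def)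

lemma lmult_rmult: "lmult D a (rmult D x b) = rmult D (lmult D a x) b"
  by (simp add: rmult_def wedge_lmult)

lemma rmult_rmult: "rmult D (rmult D x a) b = rmult D x (a * b)"
  using wedge_balanced[of x a "form0 b"] by (simp add: rmult_def form0_lmult)

section \<open>Computing with cosets modulo the balancing relations\<close>

lemma bal_subspace: "cvec.subspace bal"
  unfolding balancing_def by (rule cvec.subspace_span)

lemma bal_gen: "rmult D x a \<otimes> y - x \<otimes> lmult D a y \<in> bal"
  unfolding balancing_def by (rule cvec.span_base) blast

lemma ov_eq_iff: "ov s = ov t \<longleftrightarrow> s - t \<in> bal"
proof
  assume "ov s = ov t"
  moreover have "s \<in> ov s" unfolding over_A_def using cvec.subspace_0[OF bal_subspace] by simp
  ultimately show "s - t \<in> bal" unfolding over_A_def by blast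
next
  assume d: "s - t \<in> bal"
  have "r - s \<in> bal \<longleftrightarrow> r - t \<in> bal" for r
  proof -
    have "r - t = (r - s) + (s - t)" "r - s = (r - t) - (s - t)" by simp_all
    then show ?thesis using d cvec.subspace_add[OF bal_subspace] cvec.subspace_diff[OF bal_subspace] by metis
  qed
  then show "ov s = ov t" by (simp add: over_A_def)
qed

lemma ov_mem: "r \<in> ov t \<longleftrightarrow> ov r = ov t"
  unfolding ov_eq_iff by (simp add: over_A_def)

lemma ov_add: "ov s = ov s' \<Longrightarrow> ov t = ov t' \<Longrightarrow> ov (s + t) = ov (s' + t')"
  unfolding ov_eq_iff using cvec.subspace_add[OF bal_subspace] by (metis add_diff_add)

lemma ov_scale: "ov s = ov s' \<Longrightarrow> ov (c *\<^sub>C s) = ov (c *\<^sub>C s')"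
  unfolding ov_eq_iff using cvec.subspace_scale[OF bal_subspace, of "s - s'" c] by (simp add: cvec.scale_right_diff_distrib)

lemma ov_sum: "(\<And>i. i \<in> I \<Longrightarrow> ov (f i) = ov (g i)) \<Longrightarrow> ov (sum f I) = ov (sum g I)"
proof (induct I rule: infinite_finite_induct)
  case (insert i I)
  have "ov (f i + sum f I) = ov (g i + sum g I)"
    by (rule ov_add; rule insert) (simp_all add: insert)
  then show ?case using insert(1,2) by simp
qed simp_all

lemma add_A_ov [simp]: "add_A D (ov s) (ov t) = ov (s + t)"
proof -
  have 1: "ov (s' + t') = ov (s + t)" if "s' \<in> ov s" "t' \<in> ov t" for s' t'
    using that unfolding ov_mem by (rule ov_add)
  have 2: "s \<in> ov s" "t \<in> ov t" unfolding ov_mem by (rule refl)+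
  show ?thesis unfolding add_A_def
  proof (intro equalityI subsetI)
    fix x assume "x \<in> (\<Union>s\<in>ov s. \<Union>t\<in>ov t. ov (s + t))"
    then obtain s' t' where "s' \<in> ov s" "t' \<in> ov t" "x \<in> ov (s' + t')" by blast
    then show "x \<in> ov (s + t)" using 1 by simp
  next
    fix x assume "x \<in> ov (s + t)"
    then show "x \<in> (\<Union>s\<in>ov s. \<Union>t\<in>ov t. ov (s + t))" using 2 by blast
  qed
qed

lemma map_A_ov:
  assumes "\<And>s t. ov s = ov t \<Longrightarrow> ov (f s) = ov (f t)"
  shows "map_A D f (ov t) = ov (f t)"
proof -
  have 1: "ov (f t') = ov (f t)" if "t' \<in> ov t" for t' using that unfolding ov_mem by (rule assms)
  have 2: "t \<in> ov t" unfolding ov_mem ..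
  show ?thesis unfolding map_A_def
  proof (intro equalityI subsetI)
    fix x assume "x \<in> (\<Union>t\<in>ov t. ov (f t))"
    then obtain t' where "t' \<in> ov t" "x \<in> ov (f t')" by blast
    then show "x \<in> ov (f t)" using 1 by simp
  next
    fix x assume "x \<in> ov (f t)"
    then show "x \<in> (\<Union>t\<in>ov t. ov (f t))" using 2 by blast
  qed
qed

lemma the_elem_ov:
  assumes "\<And>s t. ov s = ov t \<Longrightarrow> L s = L t"
  shows "the_elem (L ` ov t) = L t"
proof -
  have 1: "L t' = L t" if "t' \<in> ov t" for t' using that unfolding ov_mem by (rule assms)
  have 2: "t \<in> ov t" unfolding ov_mem ..
  have "L ` ov t = {L t}" using 1 2 by blast
  then show ?thesis by simp
qed

lemma bal_kill:
  assumes "\<And>x y. f (x + y) = f x + f y" "\<And>c x. f x = 0 \<Longrightarrow> f (c *\<^sub>C x) = 0"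
    and "\<And>x a y. f (rmult D x a \<otimes> y) = f (x \<otimes> lmult D a y)" and "ov s = ov t"
  shows "f s = (f t :: 'x::ab_group_add)"
proof -
  have "f (s - t) = 0"
    using assms(4) unfolding ov_eq_iff balancing_def
    by (rule span_vanish) (use assms(1-3) additive_diff[of f] in auto)
  then show ?thesis using additive_diff[of f] assms(1) by simp
qed

lemma clinear_kill:
  assumes "clinear f" "\<And>x a y. f (rmult D x a \<otimes> y) = f (x \<otimes> lmult D a y)" "ov s = ov t"
  shows "f s = f t"
  using assms(3) by (rule bal_kill[rotated -1]) (simp_all add: clinear_add[OF assms(1)] clinear_scale[OF assms(1)] assms(2))

text \<open>The second condition admits any scalar \<open>d\<close>, so that the antilinear dagger
  is covered along with linear maps.\<close>

lemma bal_preserve: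
  assumes "\<And>x y. f (x + y) = f x + f y" "\<And>c x. \<exists>d. f (c *\<^sub>C x) = d *\<^sub>C f x"
    and "\<And>x a y. ov (f (rmult D x a \<otimes> y)) = ov (f (x \<otimes> lmult D a y))" and "ov s = ov t"
  shows "ov (f s) = ov (f t)"
proof -
  have "f b \<in> bal" if "b \<in> bal" for b
    using that unfolding balancing_def[of D]
  proof (induct rule: cvec.span_induct_alt)
    case base
    then show ?case using additive_zero[of f] assms(1) by (simp add: cvec.span_zero)
  next
    case (step c x y)
    then obtain x' a y' where x: "x = rmult D x' a \<otimes> y' - x' \<otimes> lmult D a y'" by blast
    have "f x \<in> bal" unfolding x additive_diff[of f, OF assms(1)] using assms(3) ov_eq_iff by blast
    moreover obtain d where "f (c *\<^sub>C x) = d *\<^sub>C f x" using assms(2) by blast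
    ultimately have "f (c *\<^sub>C x) \<in> bal" using cvec.subspace_scale[OF bal_subspace] by simp
    then show ?case using step(2) assms(1) by (simp add: balancing_def cvec.span_add)
  qed
  then show ?thesis using assms(4) unfolding ov_eq_iff additive_diff[of f, OF assms(1), symmetric] by blast
qed

lemma clinear_preserve:
  assumes "clinear f" "\<And>x a y. ov (f (rmult D x a \<otimes> y)) = ov (f (x \<otimes> lmult D a y))" "ov s = ov t"
  shows "ov (f s) = ov (f t)"
  using assms(3) by (rule bal_preserve[rotated -1]) (use clinear_add[OF assms(1)] clinear_scale[OF assms(1)] assms(2) in auto)

lemma ov_gen: "ov (rmult D x a \<otimes> y) = ov (x \<otimes> lmult D a y)"
  unfolding ov_eq_iff by (rule bal_gen)

lemma lm_preserve: "ov s = ov t \<Longrightarrow> ov (lm a s) = ov (lm a t)"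
  by (erule clinear_preserve[rotated -1]) (simp_all add: lmult_rmult ov_gen)

lemma rm_preserve: "ov s = ov t \<Longrightarrow> ov (rm a s) = ov (rm a t)"
  by (erule clinear_preserve[rotated -1]) (simp_all add: lmult_rmult[symmetric] ov_gen)

lemma dg_pure: "dg (x \<otimes> y) = form_star D y \<otimes> form_star D x"
  and dg_add: "dg (s + t) = dg s + dg t" and dg_scale: "dg (c *\<^sub>C s) = cnj c *\<^sub>C dg s"
  by (simp_all add: dagger_def tensor_lift_cnj_add tensor_lift_cnj_scale)

lemma dg_preserve: "ov s = ov t \<Longrightarrow> ov (dg s) = ov (dg t)"
  by (erule bal_preserve[rotated -1]) (auto simp: dg_pure dg_add dg_scale form_star_lmult form_star_rmult ov_gen)

lemma lmult_A_ov [simp]: "lmult_A D a (ov t) = ov (lm a t)"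
  unfolding lmult_A_def id_def by (rule map_A_ov) (rule lm_preserve)

lemma rmult_A_ov [simp]: "rmult_A D (ov t) a = ov (rm a t)"
  unfolding rmult_A_def id_def by (rule map_A_ov) (rule rm_preserve)

lemma dagger_A_ov [simp]: "dagger_A D (ov t) = ov (dg t)"
  unfolding dagger_A_def by (rule map_A_ov) (rule dg_preserve)

lemma wedge_lift_linear [simp]: "clinear (tensor_lift (wedge D))"
  by (rule clinear_tensor_lift') (use wedge_linear[OF clinear_ident(1)] in auto)

lemma wedge_lift_pure [simp]: "tensor_lift (wedge D) (x \<otimes> y) = wedge D x y"
  by (rule tensor_lift_pure) (use wedge_linear[OF clinear_ident(1)] in auto)

lemma wedge_A_ov [simp]: "wedge_A D (ov t) = tensor_lift (wedge D) t"
  unfolding wedge_A_def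
  by (rule the_elem_ov) (erule clinear_kill[rotated -1], simp_all add: wedge_balanced)

subsection \<open>Coordinates\<close>

text \<open>The coordinates of a product of two forms over A: the coefficient of \<open>t\<close> is
  carried to the left through \<open>s\<close> by the right action of type \<epsilon>, leaving one
  coefficient and the two generators in order.\<close>

definition mr :: "bool \<Rightarrow> ('b, 'v) tensor \<Rightarrow> ('b, 'v) tensor \<Rightarrow> ('b, ('v, 'v) tensor) tensor"
  where "mr \<epsilon> s t = tensor_lift (\<lambda>b w. tensor_lift (\<lambda>a v. a \<otimes> v \<otimes> w) (rgt \<epsilon> s b)) t"

lemma mr_linear [simp]: "clinear f \<Longrightarrow> clinear (\<lambda>x. mr \<epsilon> (f x) t)" "clinear g \<Longrightarrow> clinear (\<lambda>x. mr \<epsilon> s (g x))"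
  by (simp_all add: mr_def)

lemma mr_pure: "mr \<epsilon> s (b \<otimes> w) = tensor_lift (\<lambda>a v. a \<otimes> v \<otimes> w) (rgt \<epsilon> s b)"
  by (simp add: mr_def)

text \<open>
  \<open>kap \<epsilon> \<delta>\<close> and \<open>lam \<epsilon> \<delta>\<close> identify the summand \<open>OM {\<epsilon>} \<otimes>\<^sub>A OM {\<delta>}\<close> of \<open>\<Omega>\<^sup>1 \<otimes>\<^sub>A \<Omega>\<^sup>1\<close> (with \<open>OM\<close> as below) with
  \<open>B \<otimes> V \<otimes> V\<close>; the braidings and connections are defined on representatives through them.
\<close>

definition kap :: "bool \<Rightarrow> bool \<Rightarrow> (('b, 'l) forms, ('b, 'l) forms) tensor \<Rightarrow> ('b, ('v, 'v) tensor) tensor"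
  where "kap \<epsilon> \<delta> = tensor_lift (\<lambda>x y. mr \<epsilon> (cc \<epsilon> x) (cc \<delta> y))"

definition lam :: "bool \<Rightarrow> bool \<Rightarrow> ('b, ('v, 'v) tensor) tensor \<Rightarrow> (('b, 'l) forms, ('b, 'l) forms) tensor"
  where "lam \<epsilon> \<delta> = tensor_lift (\<lambda>a. tensor_lift (\<lambda>v w. inn \<epsilon> (a \<otimes> v) \<otimes> ee \<delta> w))"

lemma kap_linear [simp]: "clinear (kap \<epsilon> \<delta>)" "clinear f \<Longrightarrow> clinear (\<lambda>x. kap \<epsilon> \<delta> (f x))"
  and lam_linear [simp]: "clinear (lam \<epsilon> \<delta>)" "clinear g \<Longrightarrow> clinear (\<lambda>x. lam \<epsilon> \<delta> (g x))"
  by (simp_all add: kap_def lam_def)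

lemma kap_pure: "kap \<epsilon> \<delta> (x \<otimes> y) = mr \<epsilon> (cc \<epsilon> x) (cc \<delta> y)"
  and lam_pure: "lam \<epsilon> \<delta> (a \<otimes> v \<otimes> w) = inn \<epsilon> (a \<otimes> v) \<otimes> ee \<delta> w"
  by (simp_all add: kap_def lam_def)

lemma mr_lmul: "mr \<epsilon> (rgt \<epsilon> s a) t = mr \<epsilon> s (lmul a t)"
  by (rule clinear_eqI[where t = t]) (simp_all add: mr_pure rgt_mult)

lemma kap_kill: "ov s = ov t \<Longrightarrow> kap \<epsilon> \<delta> s = kap \<epsilon> \<delta> t"
  by (erule clinear_kill[rotated -1]) (simp_all add: kap_pure cc_rmult cc_lmult mr_lmul)

lemma mr_one: "mr \<epsilon> s (1 \<otimes> w) = tensor_lift (\<lambda>a v. a \<otimes> v \<otimes> w) s"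
  by (simp add: mr_pure)

text \<open>A representative built by \<open>lam\<close> has its own coordinates and none in the
  other three summands, so \<open>kap\<close> separates the summands.\<close>

lemma kap_lam: "kap \<epsilon> \<delta> (lam \<epsilon>' \<delta>' s) = (if \<epsilon> = \<epsilon>' \<and> \<delta> = \<delta>' then s else 0)"
proof (rule tensor3_eqI[where t = s])
  show "clinear (\<lambda>a. if \<epsilon> = \<epsilon>' \<and> \<delta> = \<delta>' then a else (0 :: ('b, ('v, 'v) tensor) tensor))"
    by (cases "\<epsilon> = \<epsilon>' \<and> \<delta> = \<delta>'") (simp_all only: simp_thms if_True if_False clinear_ident clinear_const_zero)
  fix a v w
  show "kap \<epsilon> \<delta> (lam \<epsilon>' \<delta>' (a \<otimes> v \<otimes> w)) = (if \<epsilon> = \<epsilon>' \<and> \<delta> = \<delta>' then a \<otimes> v \<otimes> w else 0)"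
    by (simp add: lam_pure kap_pure cc_inn mr_one clinear_0[of "mr _ _"] clinear_0[of "\<lambda>s. mr \<epsilon> s _"])
qed simp_all

lemma inn_pure: "inn \<epsilon> (a \<otimes> v) = lmult D a (ee \<epsilon> v)"
  by (simp add: lmult_inn)

text \<open>The left coefficient of the second factor is a right coefficient of the first modulo
  balancing; moving it there gives the normal form of the coset.\<close>

lemma ov_inn_inn: "ov (inn \<epsilon> s \<otimes> inn \<delta> t) = ov (lam \<epsilon> \<delta> (mr \<epsilon> s t))"
proof (induct t rule: tensor_induct)
  case (pure b w)
  have "lam \<epsilon> \<delta> (tensor_lift (\<lambda>a v. a \<otimes> v \<otimes> w) u) = inn \<epsilon> u \<otimes> ee \<delta> w" for u
    by (rule clinear_eqI[where t = u]) (simp_all add: lam_pure)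
  then show ?case
    unfolding mr_pure inn_pure[of \<delta> b w] ov_gen[symmetric] rmult_inn by simp
next
  case (add t t')
  from ov_add[OF add] show ?case
    by (simp add: clinear_add[OF inn_linear(1)] clinear_add[of "mr \<epsilon> s"] clinear_add[OF lam_linear(1)])
qed

section \<open>Sums of the two types of forms\<close>

definition pr :: "bool \<Rightarrow> ('b, 'l) forms \<Rightarrow> ('b, 'l) forms" where "pr \<epsilon> x = inn \<epsilon> (cc \<epsilon> x)"

lemma pr_linear [simp]: "clinear (pr \<epsilon>)" "clinear f \<Longrightarrow> clinear (\<lambda>x. pr \<epsilon> (f x))"
  by (simp_all add: pr_def[abs_def])

lemma part_pr: "part10 D = pr False" "part01 D = pr True"
  by (auto simp: part_inn pr_def)

text \<open>\<open>OM {True} = F\<close>, \<open>OM {False} = E\<close> and \<open>OM UNIV = \<Omega>\<^sup>1\<close>.\<close>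

definition OM :: "bool set \<Rightarrow> ('b, 'l) forms set" where "OM P = {x. x = (\<Sum>\<epsilon>\<in>P. pr \<epsilon> x)}"

lemma pr_inn: "pr \<epsilon> (inn \<delta> t) = (if \<epsilon> = \<delta> then inn \<epsilon> t else 0)"
  by (simp add: pr_def cc_inn clinear_0[OF inn_linear(1)])

lemma MM_OM: "MM \<epsilon> = OM {\<epsilon>}"
  unfolding MM_range by (auto simp: OM_def pr_inn) (metis pr_def rangeI)

lemma Omega1_OM: "Omega1 D = OM UNIV"
proof -
  have u: "(\<Sum>\<epsilon>\<in>UNIV. f \<epsilon>) = f True + (f False :: ('b, 'l) forms)" for f by (simp add: UNIV_bool)
  have r: "Omega D 1 0 = range (inn False)" "Omega D 0 1 = range (inn True)"
    using MM_range[of False] MM_range[of True] by (simp_all add: MM_def)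
  show ?thesis
    unfolding Omega1_def r OM_def u
  proof (intro equalityI subsetI; clarsimp)
    fix s t
    show "inn False s + inn True t = pr True (inn False s + inn True t) + pr False (inn False s + inn True t)"
      by (simp add: clinear_add[OF pr_linear(1)] pr_inn)
  next
    fix x assume "x = pr True x + pr False x"
    then show "\<exists>e f. x = e + f \<and> e \<in> range (inn False) \<and> f \<in> range (inn True)"
      by (metis add.commute pr_def rangeI)
  qed
qed

lemma OM_add: "x \<in> OM P \<Longrightarrow> y \<in> OM P \<Longrightarrow> x + y \<in> OM P"
  and OM_inn: "\<epsilon> \<in> P \<Longrightarrow> inn \<epsilon> t \<in> OM P"
proof -
  show "x \<in> OM P \<Longrightarrow> y \<in> OM P \<Longrightarrow> x + y \<in> OM P"
    by (simp add: OM_def clinear_add[OF pr_linear(1)] sum.distrib)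
  show "\<epsilon> \<in> P \<Longrightarrow> inn \<epsilon> t \<in> OM P"
    by (simp add: OM_def pr_inn sum.delta)
qed

lemma OM_sum: "x \<in> OM P \<Longrightarrow> x = (\<Sum>\<epsilon>\<in>P. pr \<epsilon> x)"
  by (simp add: OM_def)

lemma OM_0: "0 \<in> OM P"
  by (simp add: OM_def clinear_0[OF pr_linear(1)])

lemma OM_lmult: "x \<in> OM P \<Longrightarrow> lmult D a x \<in> OM P" and OM_rmult: "x \<in> OM P \<Longrightarrow> rmult D x a \<in> OM P"
proof -
  have p: "pr \<epsilon> (lmult D a x) = lmult D a (pr \<epsilon> x)" "pr \<epsilon> (rmult D x a) = rmult D (pr \<epsilon> x) a" for \<epsilon> x
    by (simp_all add: pr_def cc_lmult cc_rmult lmult_inn rmult_inn)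
  show "x \<in> OM P \<Longrightarrow> lmult D a x \<in> OM P" "x \<in> OM P \<Longrightarrow> rmult D x a \<in> OM P"
    by (simp_all add: OM_def p clinear_sum[of "lmult D a", symmetric] clinear_sum[of "\<lambda>x. rmult D x a", symmetric])
qed

lemma OM_induct [consumes 1, case_names pure zero add]:
  assumes "x \<in> OM P" "\<And>\<epsilon> a v. \<epsilon> \<in> P \<Longrightarrow> Q (lmult D a (ee \<epsilon> v))" "Q 0"
    "\<And>x y. x \<in> OM P \<Longrightarrow> y \<in> OM P \<Longrightarrow> Q x \<Longrightarrow> Q y \<Longrightarrow> Q (x + y)"
  shows "Q x"
proof -
  have fin: "finite P" by (rule finite_subset[OF subset_UNIV]) simp
  have p: "Q (inn \<epsilon> t)" if "\<epsilon> \<in> P" for \<epsilon> t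
  proof (induct t rule: tensor_induct)
    case (pure a v)
    then show ?case using assms(2)[OF that] by (simp add: inn_pure[symmetric])
  next
    case (add s t)
    then show ?case using assms(4) OM_inn[OF that] by (simp add: clinear_add[OF inn_linear(1)])
  qed
  have "Q (\<Sum>\<epsilon>\<in>R. pr \<epsilon> x) \<and> (\<Sum>\<epsilon>\<in>R. pr \<epsilon> x) \<in> OM P" if "R \<subseteq> P" for R
    using finite_subset[OF that fin] that
  proof (induct R rule: finite_induct)
    case empty
    then show ?case using assms(3) OM_0 by simp
  next
    case (insert \<epsilon> R)
    then show ?case using assms(4) p OM_inn OM_add by (simp add: pr_def)
  qed
  then have "Q (\<Sum>\<epsilon>\<in>P. pr \<epsilon> x)" by blast
  then show ?thesis by (simp only: OM_sum[OF assms(1), symmetric])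
qed

definition SP :: "bool set \<Rightarrow> bool set \<Rightarrow> (('b, 'l) forms, ('b, 'l) forms) tensor set"
  where "SP P Q = cvec.span {x \<otimes> y | x y. x \<in> OM P \<and> y \<in> OM Q}"

lemma tensor_A_SP: "tensor_A D (OM P) (OM Q) = ov ` SP P Q"
  by (simp add: tensor_A_def SP_def)

lemma SP_pure: "x \<in> OM P \<Longrightarrow> y \<in> OM Q \<Longrightarrow> x \<otimes> y \<in> SP P Q"
  unfolding SP_def by (rule cvec.span_base) blast

lemma SP_add: "s \<in> SP P Q \<Longrightarrow> t \<in> SP P Q \<Longrightarrow> s + t \<in> SP P Q" and SP_0: "0 \<in> SP P Q"
  unfolding SP_def by (simp_all add: cvec.span_add cvec.span_zero)

lemma SP_sum: "(\<And>i. i \<in> I \<Longrightarrow> f i \<in> SP P Q) \<Longrightarrow> sum f I \<in> SP P Q"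
  unfolding SP_def by (rule cvec.span_sum)

lemma SP_lam: "\<epsilon> \<in> P \<Longrightarrow> \<delta> \<in> Q \<Longrightarrow> lam \<epsilon> \<delta> s \<in> SP P Q"
proof (induct s rule: tensor_induct)
  case (pure a u)
  then show ?case
    by (induct u rule: tensor_induct)
      (simp_all add: lam_pure SP_pure OM_inn clinear_add[OF lam_linear(1)] SP_add)
next
  case (add s t)
  then show ?case by (simp add: clinear_add[OF lam_linear(1)] SP_add)
qed

text \<open>Each pure tensor decomposes along the types of its two factors, and each piece has the
  normal form of \<open>ov_inn_inn\<close>. Statements about cosets can therefore be checked on
  representatives from \<open>lam\<close>.\<close>

lemma SP_normal: "t \<in> SP P Q \<Longrightarrow> ov t = ov (\<Sum>\<epsilon>\<in>P. \<Sum>\<delta>\<in>Q. lam \<epsilon> \<delta> (kap \<epsilon> \<delta> t))"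
  unfolding SP_def
proof (induct rule: cvec.span_induct_alt)
  case base
  then show ?case by (simp add: clinear_0[OF kap_linear(1)] clinear_0[OF lam_linear(1)])
next
  case (step c z t)
  note sum = ov_sum
  obtain x y where z: "z = x \<otimes> y" "x \<in> OM P" "y \<in> OM Q" using step(1) by blast
  have "x \<otimes> y = (\<Sum>\<epsilon>\<in>P. pr \<epsilon> x) \<otimes> (\<Sum>\<delta>\<in>Q. pr \<delta> y)"
    by (simp only: OM_sum[OF z(2), symmetric] OM_sum[OF z(3), symmetric])
  also have "\<dots> = (\<Sum>\<epsilon>\<in>P. \<Sum>\<delta>\<in>Q. pr \<epsilon> x \<otimes> pr \<delta> y)"
    by (subst sum.swap) (simp add: clinear_sum[of "\<lambda>x. x \<otimes> _"] clinear_sum[of "\<lambda>y. _ \<otimes> y"])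
  finally have "ov z = ov (\<Sum>\<epsilon>\<in>P. \<Sum>\<delta>\<in>Q. pr \<epsilon> x \<otimes> pr \<delta> y)" by (simp add: z)
  also have "\<dots> = ov (\<Sum>\<epsilon>\<in>P. \<Sum>\<delta>\<in>Q. lam \<epsilon> \<delta> (kap \<epsilon> \<delta> z))"
    unfolding pr_def z(1) kap_pure by (intro sum ov_inn_inn)
  finally have "ov z = ov (\<Sum>\<epsilon>\<in>P. \<Sum>\<delta>\<in>Q. lam \<epsilon> \<delta> (kap \<epsilon> \<delta> z))" .
  from ov_add[OF ov_scale[OF this, of c] step(2)] show ?case
    by (simp add: clinear_add[OF kap_linear(1)] clinear_scale[OF kap_linear(1)] clinear_add[OF lam_linear(1)]
        clinear_scale[OF lam_linear(1)] sum.distrib scaleC_sum)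
qed

section \<open>The generalised braidings\<close>

abbreviation lm3 :: "'b \<Rightarrow> ('b, ('v, 'v) tensor) tensor \<Rightarrow> ('b, ('v, 'v) tensor) tensor"
  where "lm3 a \<equiv> tensor_map (\<lambda>b. a * b) (\<lambda>u. u)"

text \<open>The right action in coordinates: \<open>a\<close> crosses the second generator by the
  rule for \<delta>, and what emerges crosses the first by the rule for \<epsilon>.\<close>

definition rr :: "bool \<Rightarrow> bool \<Rightarrow> ('b, ('v, 'v) tensor) tensor \<Rightarrow> 'b \<Rightarrow> ('b, ('v, 'v) tensor) tensor"
  where "rr \<epsilon> \<delta> s a = tensor_lift (\<lambda>b. tensor_lift (\<lambda>v w. mr \<epsilon> (b \<otimes> v) (rgt \<delta> (1 \<otimes> w) a))) s"

lemma rr_linear [simp]: "clinear f \<Longrightarrow> clinear (\<lambda>x. rr \<epsilon> \<delta> (f x) a)" "clinear (\<lambda>s. rr \<epsilon> \<delta> s a)"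
  by (simp_all add: rr_def)

lemma rr_pure: "rr \<epsilon> \<delta> (b \<otimes> v \<otimes> w) a = mr \<epsilon> (b \<otimes> v) (rgt \<delta> (1 \<otimes> w) a)"
  by (simp add: rr_def)

lemma mr_lmul_left: "mr \<epsilon> (lmul b s) t = lm3 b (mr \<epsilon> s t)"
proof (rule clinear_eqI[where t = t])
  fix c w
  have "tensor_lift (\<lambda>a v. a \<otimes> v \<otimes> w) (lmul b u) = lm3 b (tensor_lift (\<lambda>a v. a \<otimes> v \<otimes> w) u)" for u
    by (rule clinear_eqI[where t = u]) simp_all
  then show "mr \<epsilon> (lmul b s) (c \<otimes> w) = lm3 b (mr \<epsilon> s (c \<otimes> w))"
    by (simp add: mr_pure rgt_lmul)
qed simp_all

lemma kap_lm: "kap \<epsilon> \<delta> (lm a t) = lm3 a (kap \<epsilon> \<delta> t)"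
  by (rule clinear_eqI[where t = t]) (simp_all add: kap_pure cc_lmult mr_lmul_left)

lemma lam_lm3: "lam \<epsilon> \<delta> (lm3 a s) = lm a (lam \<epsilon> \<delta> s)"
  by (rule tensor3_eqI[where t = s]) (simp_all add: lam_pure lmult_inn)

lemma mr_rgt: "mr \<epsilon> s (rgt \<delta> t a) = rr \<epsilon> \<delta> (mr \<epsilon> s t) a"
proof (rule clinear_eqI[where t = t])
  fix b w
  have "rgt \<delta> (b \<otimes> w) a = lmul b (rgt \<delta> (1 \<otimes> w) a)"
    using rgt_lmul[of \<delta> b "1 \<otimes> w" a] by simp
  then have "mr \<epsilon> s (rgt \<delta> (b \<otimes> w) a) = mr \<epsilon> (rgt \<epsilon> s b) (rgt \<delta> (1 \<otimes> w) a)"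
    by (simp add: mr_lmul)
  also have "\<And>u. mr \<epsilon> u (rgt \<delta> (1 \<otimes> w) a) = rr \<epsilon> \<delta> (tensor_lift (\<lambda>a v. a \<otimes> v \<otimes> w) u) a"
  proof -
    fix u show "mr \<epsilon> u (rgt \<delta> (1 \<otimes> w) a) = rr \<epsilon> \<delta> (tensor_lift (\<lambda>a v. a \<otimes> v \<otimes> w) u) a"
      by (rule clinear_eqI[where t = u]) (simp_all add: rr_pure)
  qed
  then have "mr \<epsilon> (rgt \<epsilon> s b) (rgt \<delta> (1 \<otimes> w) a) = rr \<epsilon> \<delta> (mr \<epsilon> s (b \<otimes> w)) a"
    by (simp add: mr_pure)
  finally show "mr \<epsilon> s (rgt \<delta> (b \<otimes> w) a) = rr \<epsilon> \<delta> (mr \<epsilon> s (b \<otimes> w)) a" .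
qed simp_all

lemma kap_rm: "kap \<epsilon> \<delta> (rm a t) = rr \<epsilon> \<delta> (kap \<epsilon> \<delta> t) a"
  by (rule clinear_eqI[where t = t]) (simp_all add: kap_pure cc_rmult mr_rgt)

lemma lam_rr: "ov (lam \<epsilon> \<delta> (rr \<epsilon> \<delta> s a)) = ov (rm a (lam \<epsilon> \<delta> s))"
proof (induct s rule: tensor_induct)
  case (pure b u)
  then show ?case
  proof (induct u rule: tensor_induct)
    case (pure v w)
    show ?case by (simp add: rr_pure lam_pure rmult_inn ov_inn_inn)
  next
    case (add u u')
    from ov_add[OF add] show ?case
      by (simp add: clinear_add[OF lam_linear(1)] clinear_add[OF rr_linear(2)] clinear_add[of "tensor_map _ _"])
  qed
next
  case (add s t)
  from ov_add[OF add] show ?case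
    by (simp add: clinear_add[OF lam_linear(1)] clinear_add[OF rr_linear(2)] clinear_add[of "tensor_map _ _"])
qed

lemma rr_apl: "rr \<epsilon> \<delta> (b \<otimes> u) a = lm3 b (apl (th \<epsilon>) (tensor_map (\<lambda>x. x) (th \<delta>) (tensor_lift (\<lambda>v w. v \<otimes> w \<otimes> a) u)))"
proof (rule clinear_eqI[where t = u])
  fix v w
  have m: "mr \<epsilon> (1 \<otimes> v) t = apl (th \<epsilon>) (v \<otimes> t)" for t
    by (rule clinear_eqI[where t = t]) (simp_all add: mr_pure apl_pure rgt_th clinear_compose[OF clinear_apl])
  have "mr \<epsilon> (b \<otimes> v) t = lm3 b (mr \<epsilon> (1 \<otimes> v) t)" for t
    using mr_lmul_left[of \<epsilon> b "1 \<otimes> v" t] by simp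
  then show "rr \<epsilon> \<delta> (b \<otimes> v \<otimes> w) a = lm3 b (apl (th \<epsilon>) (tensor_map (\<lambda>x. x) (th \<delta>) (tensor_lift (\<lambda>v w. v \<otimes> w \<otimes> a) (v \<otimes> w))))"
    by (simp add: rr_pure m rgt_th)
qed (simp_all add: clinear_compose[OF clinear_apl])

abbreviation sg3 :: "bool \<Rightarrow> ('b, ('v, 'v) tensor) tensor \<Rightarrow> ('b, ('v, 'v) tensor) tensor"
  where "sg3 \<epsilon> \<equiv> tensor_map (\<lambda>b. b) (sg \<epsilon>)"

lemma sg3_lm3: "sg3 \<epsilon> (lm3 b s) = lm3 b (sg3 \<epsilon> s)"
  by (simp add: tensor_map_comp)

text \<open>By \<open>rr_apl\<close> the right action consists of two crossings, and
  \<open>sg_th_braid\<close> slides \<open>sg\<close> through them. The labels are exchanged because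
  \<sigma> swaps the two generators.\<close>

lemma sg3_rr: "sg3 \<epsilon> (rr \<epsilon> \<delta> s a) = rr \<delta> \<epsilon> (sg3 \<epsilon> s) a"
proof (rule clinear_eqI[where t = s])
  fix b u
  have "apl (sg \<epsilon>) (tensor_lift (\<lambda>v w. v \<otimes> w \<otimes> a) u) = tensor_lift (\<lambda>v w. v \<otimes> w \<otimes> a) (sg \<epsilon> u)"
    by (rule clinear_eqI[where t = u]) (simp_all add: apl_pure clinear_compose[OF clinear_apl])
  then show "sg3 \<epsilon> (rr \<epsilon> \<delta> (b \<otimes> u) a) = rr \<delta> \<epsilon> (sg3 \<epsilon> (b \<otimes> u)) a"
    by (simp add: rr_apl sg3_lm3 sg_th_braid)
qed simp_all

text \<open>The generalised braiding on representatives. It is zero on the summands whose first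
  factor has the other type; the sum over \<delta> covers both types of the second factor.\<close>

definition sgm :: "bool \<Rightarrow> (('b, 'l) forms, ('b, 'l) forms) tensor \<Rightarrow> (('b, 'l) forms, ('b, 'l) forms) tensor"
  where "sgm \<epsilon> t = (\<Sum>\<delta>\<in>UNIV. lam \<delta> \<epsilon> (sg3 \<epsilon> (kap \<epsilon> \<delta> t)))"

lemma sgm_linear [simp]: "clinear (sgm \<epsilon>)" "clinear f \<Longrightarrow> clinear (\<lambda>x. sgm \<epsilon> (f x))"
  by (simp_all add: sgm_def[abs_def])

lemma sgm_kill: "ov s = ov t \<Longrightarrow> sgm \<epsilon> s = sgm \<epsilon> t"
  by (simp add: sgm_def kap_kill[of s t])

lemma sgm_lm: "sgm \<epsilon> (lm a t) = lm a (sgm \<epsilon> t)"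
  by (simp add: sgm_def kap_lm sg3_lm3 lam_lm3 clinear_sum[of "tensor_map _ _"])


text \<open>\<open>sgm\<close> takes values in normal form, and right multiplication leaves the
  normal form; so this is an equality of cosets, in contrast to \<open>sgm_lm\<close>.\<close>

lemma sgm_rm: "ov (sgm \<epsilon> (rm a t)) = ov (rm a (sgm \<epsilon> t))"
  unfolding sgm_def kap_rm sg3_rr clinear_sum[of "tensor_map (\<lambda>x. x) (\<lambda>y. rmult D y a)", simplified]
  by (rule ov_sum) (rule lam_rr)

lemma sgm_SP: "\<epsilon> \<in> P \<Longrightarrow> sgm \<epsilon> t \<in> SP UNIV P"
  unfolding sgm_def by (rule SP_sum) (simp add: SP_lam)

lemma sgm_lam: "sgm \<epsilon> (lam \<epsilon>' \<delta> s) = (if \<epsilon> = \<epsilon>' then lam \<delta> \<epsilon> (sg3 \<epsilon> s) else 0)"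
  by (cases \<delta>) (simp_all add: sgm_def kap_lam UNIV_bool clinear_0[of "tensor_map _ _"] clinear_0[OF lam_linear(1)])

text \<open>Defined on all forms through the coordinate \<open>cc\<close>, so that it vanishes on
  the other type and may be summed over types without inserting projections.\<close>

definition N :: "bool \<Rightarrow> ('b, 'l) forms \<Rightarrow> (('b, 'l) forms, ('b, 'l) forms) tensor"
  where "N \<epsilon> x = tensor_lift (\<lambda>a v. ext_d D (form0 a) \<otimes> ee \<epsilon> v) (cc \<epsilon> x)"

lemma N_linear [simp]: "clinear (N \<epsilon>)" "clinear f \<Longrightarrow> clinear (\<lambda>x. N \<epsilon> (f x))"
  by (simp_all add: N_def[abs_def])

lemma N_inn: "N \<epsilon> (inn \<delta> (a \<otimes> v)) = (if \<epsilon> = \<delta> then ext_d D (form0 a) \<otimes> ee \<epsilon> v else 0)"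
  by (simp add: N_def cc_inn)

lemma ext_d_mult: "ext_d D (form0 (a * b)) = rmult D (ext_d D (form0 a)) b + lmult D a (ext_d D (form0 b))"
  by (simp add: ext_d_inn dd_mult clinear_add[of "inn _"] clinear_add[of "\<lambda>x. rmult D x b"] clinear_add[of "lmult D a"]
    rmult_inn lmult_inn)

lemma ext_d_one: "ext_d D (form0 1) = 0"
  by (simp add: ext_d_inn clinear_0[of "inn _"])

lemma ext_d_OM: "ext_d D (form0 a) \<in> OM UNIV"
  unfolding ext_d_inn by (rule OM_add; rule OM_inn) simp_all

lemma cc_pr: "cc \<epsilon> (pr \<epsilon> x) = cc \<epsilon> x"
  by (simp add: pr_def cc_inn)

lemma N_left_Leibniz: "ov (N \<epsilon> (lmult D a m)) = ov (ext_d D (form0 a) \<otimes> pr \<epsilon> m + lm a (N \<epsilon> m))"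
proof -
  have "ov (tensor_lift (\<lambda>a v. ext_d D (form0 a) \<otimes> ee \<epsilon> v) (lmul a s)) =
    ov (ext_d D (form0 a) \<otimes> inn \<epsilon> s + lm a (tensor_lift (\<lambda>a v. ext_d D (form0 a) \<otimes> ee \<epsilon> v) s))" for s
  proof (induct s rule: tensor_induct)
    case (pure b v)
    have "ov (rmult D (ext_d D (form0 a)) b \<otimes> ee \<epsilon> v + lmult D a (ext_d D (form0 b)) \<otimes> ee \<epsilon> v)
        = ov (ext_d D (form0 a) \<otimes> lmult D b (ee \<epsilon> v) + lmult D a (ext_d D (form0 b)) \<otimes> ee \<epsilon> v)"
      by (rule ov_add[OF ov_gen refl])
    then show ?case by (simp add: ext_d_mult inn_pure[symmetric])
  next
    case (add s t)
    from ov_add[OF add] show ?case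
      by (simp add: clinear_add[of "tensor_map _ _"] tensor_lift_add clinear_add[OF inn_linear(1)] ac_simps)
  qed
  from this[of "cc \<epsilon> m"] show ?thesis by (simp add: N_def cc_lmult pr_def)
qed

lemma sgm_gen: "sgm \<epsilon> (inn \<epsilon> (b \<otimes> v) \<otimes> ee \<delta> u) = lam \<delta> \<epsilon> (b \<otimes> sg \<epsilon> (v \<otimes> u))"
proof -
  have "sgm \<epsilon> (lam \<epsilon> \<delta> (b \<otimes> v \<otimes> u)) = lam \<delta> \<epsilon> (b \<otimes> sg \<epsilon> (v \<otimes> u))" by (simp add: sgm_lam)
  then show ?thesis by (simp add: lam_pure)
qed

lemma B_induct [case_names one gen scale add]:
  assumes "P 1" "\<And>v a. P a \<Longrightarrow> P (B.gen v * a)" "\<And>c a. P a \<Longrightarrow> P (c *\<^sub>C a)" "\<And>a b. P a \<Longrightarrow> P b \<Longrightarrow> P (a + b)"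
  shows "P a"
proof -
  obtain t where a: "a = \<pi>B t" using B.p_surj by blast
  have "P (\<pi>B t)"
  proof (induct t rule: talg_induct)
    case (word xs)
    show ?case
    proof (induct xs)
      case (Cons v xs)
      then show ?case using assms(2) by (simp add: word_Cons[of v xs] B.p_mult)
    qed (simp add: assms(1))
  qed (simp_all add: clinear_scale[OF B.p_linear(1)] clinear_add[OF B.p_linear(1)] assms(3,4))
  then show ?thesis by (simp add: a)
qed

text \<open>Crossing u turns b . \<delta>v . u into b p . \<delta>q with p \<otimes> q the image of
  v \<otimes> u under \<Psi> or its inverse. In d(b p) = db . p + b . dp the first part is
  \<nabla>(b . \<delta>v) . u and the second is the value of \<sigma>.\<close>

lemma N_right_gen: "ov (N \<epsilon> (rmult D m (B.gen u))) = ov (rm (B.gen u) (N \<epsilon> m) + sgm \<epsilon> (m \<otimes> ext_d D (form0 (B.gen u))))"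
proof -
  let ?T = "tensor_lift (\<lambda>a v. ext_d D (form0 a) \<otimes> ee \<epsilon> v)"
  have sgpr: "sgm \<epsilon> (m \<otimes> y) = sgm \<epsilon> (pr \<epsilon> m \<otimes> y)" for m y
    by (simp add: sgm_def kap_pure cc_pr)
  have "ov (?T (rgt \<epsilon> s (B.gen u))) = ov (rm (B.gen u) (?T s) + sgm \<epsilon> (inn \<epsilon> s \<otimes> ext_d D (form0 (B.gen u))))" for s
  proof (induct s rule: tensor_induct)
    case (pure b v)
    have 1: "ov (?T (lmul b (tensor_map (\<lambda>v. B.gen v) (\<lambda>v. v) z))) =
      ov (tensor_lift (\<lambda>p q. ext_d D (form0 b) \<otimes> inn \<epsilon> (B.gen p \<otimes> q)) z
        + tensor_lift (\<lambda>p q. lmult D b (ext_d D (form0 (B.gen p))) \<otimes> ee \<epsilon> q) z)" for z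
    proof (induct z rule: tensor_induct)
      case (pure p q)
      have "ov (rmult D (ext_d D (form0 b)) (B.gen p) \<otimes> ee \<epsilon> q + lmult D b (ext_d D (form0 (B.gen p))) \<otimes> ee \<epsilon> q)
        = ov (ext_d D (form0 b) \<otimes> lmult D (B.gen p) (ee \<epsilon> q) + lmult D b (ext_d D (form0 (B.gen p))) \<otimes> ee \<epsilon> q)"
        by (rule ov_add[OF ov_gen refl])
      then show ?case by (simp add: ext_d_mult inn_pure[symmetric])
    next
      case (add s t)
      from ov_add[OF add] show ?case
        by (simp add: clinear_add[of "tensor_map _ _"] tensor_lift_add ac_simps)
    qed
    have 2: "rgt \<epsilon> (b \<otimes> v) (B.gen u) = lmul b (tensor_map (\<lambda>v. B.gen v) (\<lambda>v. v) (sg \<epsilon> (v \<otimes> u)))"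
      using rgt_lmul[of \<epsilon> b "1 \<otimes> v" "B.gen u"] by (simp add: rgt_th th_gen)
    have 3: "rm (B.gen u) (?T (b \<otimes> v)) = tensor_lift (\<lambda>p q. ext_d D (form0 b) \<otimes> inn \<epsilon> (B.gen p \<otimes> q)) (sg \<epsilon> (v \<otimes> u))"
    proof -
      have "ext_d D (form0 b) \<otimes> inn \<epsilon> (tensor_map (\<lambda>v. B.gen v) (\<lambda>v. v) z) = tensor_lift (\<lambda>p q. ext_d D (form0 b) \<otimes> inn \<epsilon> (B.gen p \<otimes> q)) z" for z
        by (rule clinear_eqI[where t = z]) simp_all
      then show ?thesis by (simp add: rmult_inn rgt_th th_gen)
    qed
    have 4: "sgm \<epsilon> (inn \<epsilon> (b \<otimes> v) \<otimes> ext_d D (form0 (B.gen u))) = tensor_lift (\<lambda>p q. lmult D b (ext_d D (form0 (B.gen p))) \<otimes> ee \<epsilon> q) (sg \<epsilon> (v \<otimes> u))"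
    proof -
      have l: "lam True \<epsilon> (b \<otimes> z) + lam False \<epsilon> (b \<otimes> z) = tensor_lift (\<lambda>p q. lmult D b (ext_d D (form0 (B.gen p))) \<otimes> ee \<epsilon> q) z" for z
        by (rule clinear_eqI[where t = z])
          (simp_all add: lam_pure ext_d_inn dd_gen clinear_add[of "lmult D b"] lmult_inn)
      show ?thesis unfolding ext_d_inn dd_gen tensor_pure_add clinear_add[OF sgm_linear(1)] sgm_gen l
        by (simp add: ext_d_inn dd_gen)
    qed
    show ?case unfolding 2 3 4 1 ..
  next
    case (add s t)
    from ov_add[OF add] show ?case
      by (simp add: clinear_add[of "tensor_map _ _"] tensor_lift_add clinear_add[of "\<lambda>s. rgt \<epsilon> s _"] clinear_add[OF inn_linear(1)]
        clinear_add[OF sgm_linear(1)] ac_simps)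
  qed
  from this[of "cc \<epsilon> m"] show ?thesis by (simp add: N_def cc_rmult sgpr[of m] pr_def)
qed

lemma rm_mult: "rm b (rm a t) = rm (a * b) t"
  by (simp add: tensor_map_comp rmult_rmult)

text \<open>The rule passes from a generator and a function to their product because \<sigma> is
  balanced and right linear on cosets and d is a derivation, so \<open>N_right_gen\<close> settles
  it by induction over products of generators.\<close>

lemma N_right_Leibniz: "ov (N \<epsilon> (rmult D m a)) = ov (rm a (N \<epsilon> m) + sgm \<epsilon> (m \<otimes> ext_d D (form0 a)))"
proof (induct a arbitrary: m rule: B_induct)
  case one
  have "rmult D x 1 = x" for x
    using rmult_pure by (intro tensor3_eqI[where t = x and f = "\<lambda>x. rmult D x 1" and g = "\<lambda>x. x"]) (simp_all add: B.coact_q_one act_one)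
  then show ?case by (simp add: ext_d_one clinear_0[OF sgm_linear(1)])
next
  case (gen u a)
  have "ov (N \<epsilon> (rmult D m (B.gen u * a))) = ov (N \<epsilon> (rmult D (rmult D m (B.gen u)) a))"
    by (simp add: rmult_rmult)
  also have "\<dots> = ov (rm a (N \<epsilon> (rmult D m (B.gen u))) + sgm \<epsilon> (rmult D m (B.gen u) \<otimes> ext_d D (form0 a)))"
    by (rule gen)
  also have "\<dots> = ov (rm a (rm (B.gen u) (N \<epsilon> m) + sgm \<epsilon> (m \<otimes> ext_d D (form0 (B.gen u)))) + sgm \<epsilon> (m \<otimes> lmult D (B.gen u) (ext_d D (form0 a))))"
    by (intro ov_add rm_preserve N_right_gen) (simp add: sgm_kill[OF ov_gen])
  also have "\<dots> = ov (rm (B.gen u * a) (N \<epsilon> m) + rm a (sgm \<epsilon> (m \<otimes> ext_d D (form0 (B.gen u)))) + sgm \<epsilon> (m \<otimes> lmult D (B.gen u) (ext_d D (form0 a))))"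
    by (simp add: clinear_add[of "tensor_map _ _"] rm_mult)
  also have "\<dots> = ov (rm (B.gen u * a) (N \<epsilon> m) + sgm \<epsilon> (m \<otimes> rmult D (ext_d D (form0 (B.gen u))) a) + sgm \<epsilon> (m \<otimes> lmult D (B.gen u) (ext_d D (form0 a))))"
    using sgm_rm[of \<epsilon> a "m \<otimes> ext_d D (form0 (B.gen u))"] by (intro ov_add refl) simp
  also have "\<dots> = ov (rm (B.gen u * a) (N \<epsilon> m) + sgm \<epsilon> (m \<otimes> ext_d D (form0 (B.gen u * a))))"
    by (simp add: ext_d_mult clinear_add[OF sgm_linear(1)] add.assoc)
  finally show ?case .
next
  case (scale c a)
  have r: "rm (c *\<^sub>C a) t = c *\<^sub>C rm a t" for t
    by (rule clinear_eqI[where t = t]) (simp_all add: clinear_scale[of "rmult D _"])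
  from ov_scale[OF scale, of c m] show ?case
    by (simp add: clinear_scale[of "rmult D m"] clinear_scale[OF N_linear(1)] r clinear_scale[OF sgm_linear(1)]
        clinear_scale[of "\<lambda>a. ext_d D (form0 a)"] scaleC_add_right)
next
  case (add a b)
  have r: "rm (a + b) t = rm a t + rm b t" for t
    by (rule clinear_eqI[where t = t]) (simp_all add: clinear_add[of "rmult D _"])
  from ov_add[OF add] show ?case
    by (simp add: clinear_add[of "rmult D m"] clinear_add[OF N_linear(1)] r clinear_add[OF sgm_linear(1)]
        clinear_add[of "\<lambda>a. ext_d D (form0 a)"] ac_simps)
qed

end

section \<open>The connections\<close>

context calculus
begin

text \<open>Indexing by a set of types lets one construction cover F, E and \<Omega>^1, with {True},
  {False} and the full set.\<close>

definition NP :: "bool set \<Rightarrow> ('b, 'l) forms \<Rightarrow> (('b, 'l) forms, ('b, 'l) forms) tensor"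
  where "NP P x = (\<Sum>\<epsilon>\<in>P. N \<epsilon> x)"

definition SG :: "bool set \<Rightarrow> (('b, 'l) forms, ('b, 'l) forms) tensor \<Rightarrow> (('b, 'l) forms, ('b, 'l) forms) tensor"
  where "SG P t = (\<Sum>\<epsilon>\<in>P. sgm \<epsilon> t)"

definition nabla :: "bool set \<Rightarrow> ('b, 'l) forms \<Rightarrow> ('b, 'l) forms_A"
  where "nabla P = (\<lambda>x\<in>OM P. ov (NP P x))"

definition sigma :: "bool set \<Rightarrow> ('b, 'l) forms_A \<Rightarrow> ('b, 'l) forms_A"
  where "sigma P = map_A D (SG P)"

lemma NP_linear [simp]: "clinear (NP P)" and SG_linear [simp]: "clinear (SG P)"
  by (simp_all add: NP_def[abs_def] SG_def[abs_def])

lemma NP_single [simp]: "NP {\<epsilon>} x = N \<epsilon> x" and SG_single [simp]: "SG {\<epsilon>} t = sgm \<epsilon> t"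
  by (simp_all add: NP_def SG_def)

lemma sigma_ov: "sigma P (ov t) = ov (SG P t)"
proof -
  have "SG P s = SG P u" if "ov s = ov u" for s u
    unfolding SG_def by (rule sum.cong[OF refl]) (rule sgm_kill[OF that])
  then show ?thesis unfolding sigma_def by (intro map_A_ov) (rule arg_cong[where f = ov])
qed

lemma nabla_ov: "x \<in> OM P \<Longrightarrow> nabla P x = ov (NP P x)"
  by (simp add: nabla_def)

lemma N_SP: "\<epsilon> \<in> P \<Longrightarrow> N \<epsilon> x \<in> SP UNIV P"
proof -
  assume e: "\<epsilon> \<in> P"
  have "tensor_lift (\<lambda>a v. ext_d D (form0 a) \<otimes> ee \<epsilon> v) s \<in> SP UNIV P" for s
  proof (induct s rule: tensor_induct)
    case (pure a v)
    show ?case using SP_pure[OF ext_d_OM OM_inn[OF e]] by simp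
  next
    case (add s t)
    then show ?case by (simp add: tensor_lift_add SP_add)
  qed
  then show ?thesis by (simp add: N_def)
qed

lemma left_connection_nabla: "left_connection D (OM P) (nabla P)"
  unfolding left_connection_def
proof (intro conjI ballI allI)
  show "nabla P \<in> OM P \<rightarrow>\<^sub>E tensor_A D (Omega1 D) (OM P)"
    unfolding nabla_def Omega1_OM tensor_A_SP
    by (intro restrict_PiE_iff[THEN iffD2] ballI imageI) (simp add: NP_def SP_sum N_SP)
next
  fix x y assume "x \<in> OM P" "y \<in> OM P"
  then show "nabla P (x + y) = add_A D (nabla P x) (nabla P y)"
    by (simp add: nabla_ov OM_add clinear_add[OF NP_linear])
next
  fix a x assume x: "x \<in> OM P"
  have "ov (NP P (lmult D a x)) = ov (\<Sum>\<epsilon>\<in>P. ext_d D (form0 a) \<otimes> pr \<epsilon> x + lm a (N \<epsilon> x))"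
    unfolding NP_def by (rule ov_sum) (rule N_left_Leibniz)
  also have "(\<Sum>\<epsilon>\<in>P. ext_d D (form0 a) \<otimes> pr \<epsilon> x + lm a (N \<epsilon> x)) = ext_d D (form0 a) \<otimes> (\<Sum>\<epsilon>\<in>P. pr \<epsilon> x) + lm a (NP P x)"
    by (simp add: sum.distrib NP_def clinear_sum[of "\<lambda>y. _ \<otimes> y"] clinear_sum[of "tensor_map _ _"])
  finally show "nabla P (lmult D a x) = add_A D (ov (ext_d D (form0 a) \<otimes> x)) (lmult_A D a (nabla P x))"
    using x by (simp add: nabla_ov OM_lmult flip: OM_sum)
qed

text \<open>The map \<open>s\<close> enters through its values on cosets, so the lemma applies both
  to \<open>sigma P\<close> and, for the full set of types, to \<open>sum_braiding\<close>.\<close>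

lemma bimodule_connection_nabla:
  assumes s: "\<And>t. s (ov t) = ov (SG P t)"
  shows "bimodule_connection D (OM P) (nabla P) s"
  unfolding bimodule_connection_def bimodule_map_A_def
proof (intro conjI ballI allI left_connection_nabla)
  show "s \<in> tensor_A D (OM P) (Omega1 D) \<rightarrow> tensor_A D (Omega1 D) (OM P)"
  proof
    fix X assume "X \<in> tensor_A D (OM P) (Omega1 D)"
    then obtain t where X: "X = ov t" unfolding tensor_A_def by blast
    show "s X \<in> tensor_A D (Omega1 D) (OM P)"
      unfolding X s Omega1_OM tensor_A_SP by (rule imageI) (simp add: SG_def SP_sum sgm_SP)
  qed
next
  fix X Y assume "X \<in> tensor_A D (OM P) (Omega1 D)" "Y \<in> tensor_A D (OM P) (Omega1 D)"
  then obtain t u where X: "X = ov t" "Y = ov u" unfolding tensor_A_def by blast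
  show "s (add_A D X Y) = add_A D (s X) (s Y)"
    by (simp add: X s clinear_add[OF SG_linear])
next
  fix a X assume "X \<in> tensor_A D (OM P) (Omega1 D)"
  then obtain t where X: "X = ov t" unfolding tensor_A_def by blast
  show "s (lmult_A D a X) = lmult_A D a (s X)"
    by (simp add: X s SG_def sgm_lm clinear_sum[of "tensor_map _ _"])
next
  fix a X assume "X \<in> tensor_A D (OM P) (Omega1 D)"
  then obtain t where X: "X = ov t" unfolding tensor_A_def by blast
  have "ov (SG P (rm a t)) = ov (\<Sum>\<epsilon>\<in>P. rm a (sgm \<epsilon> t))"
    unfolding SG_def by (rule ov_sum) (rule sgm_rm)
  then show "s (rmult_A D X a) = rmult_A D (s X) a"
    by (simp add: X s SG_def clinear_sum[of "tensor_map _ _"])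
next
  fix a x assume x: "x \<in> OM P"
  have "ov (NP P (rmult D x a)) = ov (\<Sum>\<epsilon>\<in>P. rm a (N \<epsilon> x) + sgm \<epsilon> (x \<otimes> ext_d D (form0 a)))"
    unfolding NP_def by (rule ov_sum) (rule N_right_Leibniz)
  then show "nabla P (rmult D x a) = add_A D (rmult_A D (nabla P x) a) (s (ov (x \<otimes> ext_d D (form0 a))))"
    using x by (simp add: nabla_ov OM_rmult s NP_def SG_def sum.distrib clinear_sum[of "tensor_map _ _"])
qed

lemma left_connection_eqI:
  assumes "left_connection D (OM P) n1" "left_connection D (OM P) n2"
    and "\<And>\<epsilon> v. \<epsilon> \<in> P \<Longrightarrow> n1 (ee \<epsilon> v) = n2 (ee \<epsilon> v)" "P \<noteq> {}"
  shows "n1 = n2"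
proof (rule PiE_ext)
  show "n1 \<in> OM P \<rightarrow>\<^sub>E tensor_A D (Omega1 D) (OM P)" "n2 \<in> OM P \<rightarrow>\<^sub>E tensor_A D (Omega1 D) (OM P)"
    using assms(1,2) unfolding left_connection_def by blast+
  have L: "n (lmult D a x) = add_A D (ov (ext_d D (form0 a) \<otimes> x)) (lmult_A D a (n x))" "x \<in> OM P \<Longrightarrow> y \<in> OM P \<Longrightarrow> n (x + y) = add_A D (n x) (n y)"
    if "left_connection D (OM P) n" "x \<in> OM P" for n a x y
    using that unfolding left_connection_def by blast+
  have p: "n1 (lmult D a (ee \<epsilon> v)) = n2 (lmult D a (ee \<epsilon> v))" if "\<epsilon> \<in> P" for a \<epsilon> v
    by (simp only: L(1)[OF assms(1) OM_inn[OF that]] L(1)[OF assms(2) OM_inn[OF that]] assms(3)[OF that])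
  fix x assume "x \<in> OM P"
  then show "n1 x = n2 x"
  proof (induct rule: OM_induct)
    case (pure \<epsilon> a v)
    then show ?case by (rule p)
  next
    \<comment> \<open>The form 0 is taken as the zero multiple of a generator, whose type comes from
      \<open>P\<close> being nonempty.\<close>
    case zero
    obtain \<epsilon> where "\<epsilon> \<in> P" using assms(4) by blast
    then show ?case using p[of \<epsilon> 0 0] clinear_0[of "\<lambda>a. lmult D a (ee \<epsilon> 0)"] by simp
  next
    case (add x y)
    show ?case using L(2)[OF assms(1) add(1,1,2)] L(2)[OF assms(2) add(1,1,2)] add(3,4) by simp
  qed
qed

lemma N_ee: "N \<epsilon> (ee \<delta> v) = 0"
  by (simp add: N_inn ext_d_one)

lemma nabla_the_only:
  "the_only (\<lambda>nab. left_connection D (OM {\<epsilon>}) nab \<and> (\<forall>v. nab (ee \<epsilon> v) = ov 0)) (nabla {\<epsilon>})"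
  unfolding the_only_def
proof (intro conjI allI impI)
  show "left_connection D (OM {\<epsilon>}) (nabla {\<epsilon>})" by (rule left_connection_nabla)
  show z: "nabla {\<epsilon>} (ee \<epsilon> v) = ov 0" for v by (simp add: nabla_ov OM_inn N_ee)
  fix n assume "left_connection D (OM {\<epsilon>}) n \<and> (\<forall>v. n (ee \<epsilon> v) = ov 0)"
  then show "n = nabla {\<epsilon>}"
    by (intro left_connection_eqI[of "{\<epsilon>}"] left_connection_nabla) (simp_all add: z)
qed

lemma sigma_gen:
  "sigma {\<epsilon>} (ov (ee \<epsilon> v \<otimes> d_gen D u)) = ov (tensor_map (d_gen D) (ee \<epsilon>) (sg \<epsilon> (v \<otimes> u)))"
proof -
  have d: "d_gen D = (\<lambda>u. ee True u + ee False u)" by (auto simp: gen_ee)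
  have "lam True \<epsilon> (1 \<otimes> z) + lam False \<epsilon> (1 \<otimes> z) = tensor_map (d_gen D) (ee \<epsilon>) z" for z
    unfolding d by (rule clinear_eqI[where t = z]) (simp_all add: lam_pure)
  then show ?thesis
    by (simp add: sigma_ov gen_ee clinear_add[OF sgm_linear(1)] sgm_gen)
qed

section \<open>Wedge products of generators and torsion\<close>

lemma W_one_one: "W w 1 1 w' b z = (w * w') \<otimes> b \<otimes> z"
proof -
  have *: "tensor_lift (\<lambda>b0 b1. (c * counit D b1 * d) *\<^sub>C ((w * w0) \<otimes> b0 \<otimes> z)) (\<rho>B b) = (d * c) *\<^sub>C ((w * w0) \<otimes> b \<otimes> z)" for c d and w0 :: 'l
    unfolding mult.assoc mult.commute[of _ d] scaleC_scaleC[symmetric] scaleC_tensor_lift[symmetric]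
    using counit_comodule[OF B.comodule_q, of "\<lambda>b. (w * w0) \<otimes> b \<otimes> z" b] by (simp add: mult.commute)
  have **: "tensor_lift (\<lambda>h1 h2. (counit D h1 * counit D h2) *\<^sub>C y) (comult D h) = counit D h *\<^sub>C y" for h and y :: "('b, 'l) forms"
    unfolding scaleC_scaleC[symmetric] using counit_right[of "\<lambda>h. counit D h *\<^sub>C y"] by (simp add: mult.commute)
  show ?thesis
    using counit_comodule[OF L.comodule_q, of "\<lambda>w0. (w * w0) \<otimes> b \<otimes> z" w'] by (simp add: W_def act_one_left * **)
qed

lemma ee_pure: "ee True v = 1 \<otimes> 1 \<otimes> L.gen v" "ee False v = L.gen v \<otimes> 1 \<otimes> 1"
  by (simp_all add: inn_def braid_BV)

lemma wedge_gen:
  "wedge D (w \<otimes> b \<otimes> z) (ee True v) = w \<otimes> b \<otimes> (z * L.gen v)"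
  "wedge D (ee False v) (1 \<otimes> b \<otimes> z) = L.gen v \<otimes> b \<otimes> z"
  "wedge D (ee False v) (L.gen u \<otimes> b \<otimes> z) = (L.gen v * L.gen u) \<otimes> b \<otimes> z"
  by (simp_all add: ee_pure wedge_one wedge_pure W_one_one W_one_right B.coact_q_one act_one act_one_left clinear_0[of "\<lambda>x. W _ _ _ x _ _"]
    counit_comodule[OF B.comodule_q, of "\<lambda>b. L.gen v \<otimes> b \<otimes> z"])

definition wee :: "bool \<Rightarrow> bool \<Rightarrow> ('v, 'v) tensor \<Rightarrow> ('b, 'l) forms"
  where "wee \<epsilon> \<delta> = tensor_lift (\<lambda>v w. wedge D (ee \<epsilon> v) (ee \<delta> w))"

lemma wee_linear [simp]: "clinear (wee \<epsilon> \<delta>)" "clinear f \<Longrightarrow> clinear (\<lambda>x. wee \<epsilon> \<delta> (f x))"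
  and wee_pure: "wee \<epsilon> \<delta> (v \<otimes> w) = wedge D (ee \<epsilon> v) (ee \<delta> w)"
  by (simp_all add: wee_def)

lemma wee_mixed: "wee False True z = tensor_lift (\<lambda>v w. L.gen v \<otimes> 1 \<otimes> L.gen w) z"
  "wee True False z = - wee False True (\<psi> z)"
proof -
  show 1: "wee False True z = tensor_lift (\<lambda>v w. L.gen v \<otimes> 1 \<otimes> L.gen w) z" for z
    by (rule clinear_eqI[where t = z]) (simp_all add: wee_pure ee_pure(1) wedge_gen)
  show "wee True False z = - wee False True (\<psi> z)"
  proof (rule clinear_eqI[where t = z])
    fix v w
    have "tensor_lift (\<lambda>h1 h2. counit D h1 *\<^sub>C (w0 \<otimes> 1 \<otimes> L.gen (act \<rho>V v h2))) (comult D h) = w0 \<otimes> 1 \<otimes> L.gen (act \<rho>V v h)" for w0 :: 'l and h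
      by (rule counit_left) simp
    note * = this
    have "W 1 1 (L.gen v) (L.gen w) 1 1 = tensor_lift (\<lambda>v w. L.gen v \<otimes> 1 \<otimes> L.gen w) (\<psi> (v \<otimes> w))"
      by (simp add: W_def B.coact_q_one act_one act_one_left L.act_gen L.coact_gen tensor_lift_tensor_map Psi_def
          braid_pure_linear * clinear_tensor_lift_swap[of "tensor_lift (\<lambda>v w. L.gen v \<otimes> 1 \<otimes> L.gen w)"])
    then show "wee True False (v \<otimes> w) = - wee False True (\<psi> (v \<otimes> w))"
      unfolding 1 wee_pure by (simp add: ee_pure wedge_pure clinear_0[of "\<lambda>x. W _ _ _ x _ _"] clinear_minus[of "\<lambda>x. W _ _ x _ _ _"])
  qed simp_all
qed

text \<open>In mixed degree the minus sign is the Koszul sign of exchanging the two one-forms; in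
  degree (2,0) it is the defining relation of \<Lambda>, read at the image of z under the inverse
  braiding.\<close>

lemma wee_sg: "wee \<delta> False (sg False z) = - wee False \<delta> z"
proof (cases \<delta>)
  case True
  then show ?thesis by (simp add: wee_mixed(2) sg_def)
next
  case False
  have "wee False False z = - wee False False (\<psi> z)" for z
  proof (rule clinear_eqI[where t = z])
    fix v w
    have 1: "wee False False z = (\<pi>L (quad z)) \<otimes> 1 \<otimes> 1" for z
      by (rule clinear_eqI[where t = z]) (simp_all add: wee_pure wedge_gen(3)[of _ _ 1 1, folded ee_pure(2)] L.p_mult)
    show "wee False False (v \<otimes> w) = - wee False False (\<psi> (v \<otimes> w))"
      unfolding 1 using clinear_minus[of "\<lambda>x. x \<otimes> 1 \<otimes> 1" "\<pi>L (quad (\<psi> (v \<otimes> w)))"] L_gen_relation[of v w] by (simp add: L.p_mult)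
  qed simp_all
  from this[of "inv \<psi> z"] show ?thesis using False by (simp add: sg_def)
qed

lemma wedge_lam: "tensor_lift (wedge D) (lam \<epsilon> \<delta> (a \<otimes> z)) = lmult D a (wee \<epsilon> \<delta> z)"
  by (rule clinear_eqI[where t = z]) (simp_all add: lam_pure inn_pure[of _ a] wedge_lmult wee_pure)

lemma wedge_kill: "ov s = ov t \<Longrightarrow> tensor_lift (wedge D) s = tensor_lift (wedge D) t"
  by (erule clinear_kill[rotated -1]) (simp_all add: wedge_balanced)

lemma wedge_sgm_False:
  assumes "t \<in> SP {False} UNIV"
  shows "tensor_lift (wedge D) (sgm False t) = - tensor_lift (wedge D) t"
proof -
  have 1: "tensor_lift (wedge D) (lam \<delta> False (sg3 False s)) = - tensor_lift (wedge D) (lam False \<delta> s)" for \<delta> s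
    by (rule clinear_eqI[where t = s]) (simp_all add: wedge_lam wee_sg clinear_minus[of "lmult D _"])
  show ?thesis
    unfolding wedge_kill[OF SP_normal[OF assms]] sgm_def
    by (simp add: clinear_sum[OF wedge_lift_linear] 1 sum_negf)
qed

text \<open>The generator of a (0,1)-form stands at the right end, so that d of the form is da
  wedged with the generator, without a sign.\<close>

lemma torsion_free_F: "torsion_free D (OM {True}) (nabla {True})"
  unfolding torsion_free_def
proof
  fix x assume x: "x \<in> OM {True}"
  have l: "tensor_lift (\<lambda>v c. L.gen v \<otimes> c \<otimes> L.gen u) s = wedge D (iota10 s) (ee True u)" for s u
    by (rule clinear_eqI[where t = s]) (simp_all add: wedge_gen)
  have l': "tensor_lift (\<lambda>c v. 1 \<otimes> c \<otimes> (L.gen v * L.gen u)) s = wedge D (iota01 s) (ee True u)" for s u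
    by (rule clinear_eqI[where t = s]) (simp_all add: wedge_gen)
  from x have "tensor_lift (wedge D) (N True x) = ext_d D x"
  proof (induct rule: OM_induct)
    case (pure \<epsilon> a v)
    then have e: "\<epsilon>" by simp
    have "ext_d D (1 \<otimes> a \<otimes> L.gen v) = wedge D (ext_d D (form0 a)) (ee True v)"
      by (simp add: ext_d_def del_pure delbar_pure l l' del_form0 delbar_form0 clinear_add[of "\<lambda>x. wedge D x _"])
    then show ?case using e by (simp add: inn_pure[symmetric] N_inn) (simp add: inn_def)
  qed (simp_all add: clinear_0[OF N_linear(1)] clinear_0[OF ext_d_linear(1)] clinear_0[OF wedge_lift_linear]
      clinear_add[OF N_linear(1)] clinear_add[OF ext_d_linear(1)] clinear_add[OF wedge_lift_linear])
  then show "wedge_A D (nabla {True} x) - ext_d D x = 0" using x by (simp add: nabla_ov)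
qed

text \<open>The generator of a (1,0)-form stands on the left, so d of \<partial>v . b is minus
  \<partial>v wedged with db. By the right Leibniz rule \<nabla> of this form is
  \<sigma>(\<partial>v \<otimes> db), and wedge after \<sigma> is minus wedge.\<close>

lemma torsion_free_E: "torsion_free D (OM {False}) (nabla {False})"
  unfolding torsion_free_def
proof
  fix x assume x: "x \<in> OM {False}"
  have l: "del D (L.gen u \<otimes> b \<otimes> 1) = - wedge D (ee False u) (iota10 (dB b))" for b u
    unfolding del_pure by (rule clinear_eqI[where t = "dB b"]) (simp_all add: wedge_gen)
  have l': "delbar D (L.gen u \<otimes> b \<otimes> 1) = - wedge D (ee False u) (iota01 (dbarB b))" for b u
    unfolding delbar_pure by (rule clinear_eqI[where t = "dbarB b"]) (simp_all add: wedge_gen)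
  have "tensor_lift (wedge D) (N False (iota10 t)) = ext_d D (iota10 t)" for t
  proof (induct t rule: tensor_induct)
    case (pure v b)
    have v: "iota10 (v \<otimes> b) = rmult D (ee False v) b"
      by (simp only: inn_def if_False braid_BV lact_one rmult_iota10) simp
    have "tensor_lift (wedge D) (N False (iota10 (v \<otimes> b))) = tensor_lift (wedge D) (sgm False (ee False v \<otimes> ext_d D (form0 b)))"
      unfolding v using wedge_kill[OF N_right_Leibniz[of False "ee False v" b]] by (simp add: N_ee clinear_0[of "tensor_map _ _"])
    also have "\<dots> = - wedge D (ee False v) (ext_d D (form0 b))"
      by (subst wedge_sgm_False) (simp_all add: SP_pure OM_inn ext_d_OM)
    also have "\<dots> = ext_d D (iota10 (v \<otimes> b))"
      by (simp add: ext_d_def l l' del_form0 delbar_form0 clinear_add[of "\<lambda>x. wedge D _ x"])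
    finally show ?case .
  next
    case (add s t)
    then show ?case
      by (simp add: clinear_add[OF iota_linear(1)] clinear_add[OF N_linear(1)] clinear_add[OF ext_d_linear(1)] clinear_add[OF wedge_lift_linear])
  qed
  moreover obtain t where "x = iota10 t" using x Omega10 MM_OM[of False] by (auto simp: MM_def)
  ultimately show "wedge_A D (nabla {False} x) - ext_d D x = 0" using x by (simp add: nabla_ov)
qed

section \<open>Compatibility with the involution\<close>

lemma dg_lm: "dg (lm a t) = rm (star_B D a) (dg t)"
  by (induct t rule: tensor_induct) (simp_all add: dg_pure form_star_lmult dg_add clinear_add[of "tensor_map _ _"])

lemma sg_dagger: "sg (\<not> \<epsilon>) (dagger (vstar D) (sg \<epsilon> z)) = dagger (vstar D) z"
proof (cases \<epsilon>)
  case True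
  then show ?thesis by (simp add: sg_def flip: Psi_dagger)
next
  case False
  then show ?thesis by (simp add: sg_def Psi_dagger)
qed

lemma dg_ee: "dg (tensor_map (ee \<delta>) (ee \<epsilon>) z) = tensor_map (ee (\<not> \<epsilon>)) (ee (\<not> \<delta>)) (dagger (vstar D) z)"
proof (induct z rule: tensor_induct)
  case (pure v w)
  show ?case by (simp add: dg_pure dagger_pure form_star_ee)
next
  case (add s t)
  then show ?case by (simp add: dg_add clinear_add[of "tensor_map _ _"]) (simp add: dagger_def tensor_lift_cnj_add clinear_add[of "tensor_map _ _"])
qed

lemma lam_one: "lam \<epsilon> \<delta> (1 \<otimes> z) = tensor_map (ee \<epsilon>) (ee \<delta>) z"
  by (rule clinear_eqI[where t = z]) (simp_all add: lam_pure)

lemma sgm_ee: "sgm \<epsilon> (tensor_map (ee \<epsilon>') (ee \<delta>) z) = (if \<epsilon> = \<epsilon>' then tensor_map (ee \<delta>) (ee \<epsilon>) (sg \<epsilon> z) else 0)"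
  by (simp add: sgm_lam flip: lam_one)

text \<open>Dagger turns the left coefficient into a right one, and \<sigma> is right linear on
  cosets; this reduces the claim to pairs of generators, where \<Psi> and its inverse cancel by
  \<open>sg_dagger\<close>.\<close>

lemma star_core: "ov (sgm (\<not> \<epsilon>) (dg (sgm \<epsilon> (lam \<epsilon> \<delta> s)))) = ov (dg (lam \<epsilon> \<delta> s))"
proof (induct s rule: tensor_induct)
  case (pure a z)
  have l: "lam \<epsilon> \<delta> (a \<otimes> z) = lm a (tensor_map (ee \<epsilon>) (ee \<delta>) z)"
    using lam_lm3[of \<epsilon> \<delta> a "1 \<otimes> z"] by (simp add: lam_one)
  have "ov (sgm (\<not> \<epsilon>) (rm (star_B D a) (dg (sgm \<epsilon> (tensor_map (ee \<epsilon>) (ee \<delta>) z)))))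
      = ov (rm (star_B D a) (dg (tensor_map (ee \<epsilon>) (ee \<delta>) z)))"
    unfolding sgm_rm by (simp add: sgm_ee dg_ee sg_dagger)
  then show ?case by (simp add: l sgm_lm dg_lm)
next
  case (add s t)
  from ov_add[OF add] show ?case
    by (simp add: clinear_add[OF lam_linear(1)] clinear_add[OF sgm_linear(1)] dg_add)
qed

text \<open>Dagger exchanges the factors and their types, so the first factor acquires the type
  opposite to \<epsilon>, which \<open>sgm \<epsilon>\<close> annihilates. These are the cross terms
  of \<sigma> on the direct sum.\<close>

lemma dg_lam_kill: "sgm \<epsilon> (dg (lam \<delta> \<epsilon> s)) = 0"
proof -
  have "sgm \<epsilon> (dg (x \<otimes> ee \<epsilon> w)) = 0" for x w
    by (simp add: dg_pure form_star_ee sgm_def kap_pure cc_inn clinear_0[of "\<lambda>s. mr _ s _"] clinear_0[of "tensor_map _ _"]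
      clinear_0[OF lam_linear(1)])
  note x = this
  have "sgm \<epsilon> (dg (lam \<delta> \<epsilon> (a \<otimes> u))) = 0" for a u
    by (induct u rule: tensor_induct)
      (simp_all add: lam_pure x clinear_add[OF lam_linear(1)] dg_add clinear_add[OF sgm_linear(1)])
  then show ?thesis
    by (induct s rule: tensor_induct)
      (simp_all add: clinear_add[OF lam_linear(1)] dg_add clinear_add[OF sgm_linear(1)])
qed

lemma dg_sum: "dg (sum f I) = (\<Sum>i\<in>I. dg (f i))"
proof (induct I rule: infinite_finite_induct)
  case (insert i I)
  then show ?case by (simp add: dg_add)
qed (use dg_scale[of 0 0] in simp_all)

lemma sgm_dg_sgm: "sgm \<epsilon> (dg (sgm \<epsilon> t)) = 0"
  by (simp add: sgm_def[of \<epsilon> t] dg_sum clinear_sum[OF sgm_linear(1)] dg_lam_kill)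

lemma sgm_dg_N: "sgm \<epsilon> (dg (N \<epsilon> x)) = 0"
proof -
  have "sgm \<epsilon> (dg (y \<otimes> ee \<epsilon> w)) = 0" for y w
    by (simp add: dg_pure form_star_ee sgm_def kap_pure cc_inn clinear_0[of "\<lambda>s. mr _ s _"] clinear_0[of "tensor_map _ _"]
      clinear_0[OF lam_linear(1)])
  note x = this
  have "sgm \<epsilon> (dg (tensor_lift (\<lambda>a v. ext_d D (form0 a) \<otimes> ee \<epsilon> v) s)) = 0" for s
    by (induct s rule: tensor_induct)
      (simp_all add: x tensor_lift_add dg_add clinear_add[OF sgm_linear(1)])
  then show ?thesis by (simp add: N_def)
qed

lemma star_sum: "t \<in> SP P UNIV \<Longrightarrow> ov (\<Sum>\<epsilon>\<in>P. sgm (\<not> \<epsilon>) (dg (sgm \<epsilon> t))) = ov (dg t)"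
proof -
  assume t: "t \<in> SP P UNIV"
  let ?t = "\<Sum>\<epsilon>\<in>P. \<Sum>\<delta>\<in>UNIV. lam \<epsilon> \<delta> (kap \<epsilon> \<delta> t)"
  have n: "ov t = ov ?t" by (rule SP_normal[OF t])
  have s: "sgm \<epsilon> ?t = (\<Sum>\<delta>\<in>UNIV. sgm \<epsilon> (lam \<epsilon> \<delta> (kap \<epsilon> \<delta> t)))" if "\<epsilon> \<in> P" for \<epsilon>
  proof -
    have "sgm \<epsilon> ?t = (\<Sum>\<epsilon>'\<in>P. if \<epsilon>' = \<epsilon> then \<Sum>\<delta>\<in>UNIV. sgm \<epsilon> (lam \<epsilon> \<delta> (kap \<epsilon> \<delta> t)) else 0)"
      unfolding clinear_sum[OF sgm_linear(1)] by (rule sum.cong) (auto simp: sgm_lam)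
    then show ?thesis using that by (simp add: sum.delta)
  qed
  have "ov (\<Sum>\<epsilon>\<in>P. sgm (\<not> \<epsilon>) (dg (sgm \<epsilon> ?t))) = ov (\<Sum>\<epsilon>\<in>P. \<Sum>\<delta>\<in>UNIV. sgm (\<not> \<epsilon>) (dg (sgm \<epsilon> (lam \<epsilon> \<delta> (kap \<epsilon> \<delta> t)))))"
    by (rule arg_cong[where f = ov], rule sum.cong[OF refl], simp only: s) (simp only: dg_sum clinear_sum[OF sgm_linear(1)])
  also have "\<dots> = ov (\<Sum>\<epsilon>\<in>P. \<Sum>\<delta>\<in>UNIV. dg (lam \<epsilon> \<delta> (kap \<epsilon> \<delta> t)))"
    by (intro ov_sum star_core)
  also have "\<dots> = ov (dg ?t)" by (simp only: dg_sum)
  also have "\<dots> = ov (dg t)" by (rule dg_preserve[OF n[symmetric]])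
  finally show ?thesis by (simp only: sgm_kill[OF n])
qed

text \<open>The star of a . \<delta>v is a generator followed by the star of a, and there \<nabla>
  is \<sigma> of that generator tensored with the differential of the star of a. The identity
  \<sigma> \<dagger> \<sigma> = \<dagger> then undoes the braiding.\<close>

lemma N_star:
  assumes "x \<in> OM UNIV"
  shows "ov (N \<epsilon> x) = ov (sgm \<epsilon> (dg (N (\<not> \<epsilon>) (form_star D x))))"
  using assms
proof (induct rule: OM_induct)
  case (pure \<delta> a v)
  show ?case
  proof (cases "\<epsilon> = \<delta>")
    case True
    let ?y = "ee (\<not> \<epsilon>) (vstar D v)"
    have y: "?y \<otimes> ext_d D (form0 (star_B D a)) \<in> SP {\<not> \<epsilon>} UNIV"
      by (rule SP_pure[OF OM_inn ext_d_OM]) simp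
    have "ov (N (\<not> \<epsilon>) (rmult D ?y (star_B D a))) = ov (sgm (\<not> \<epsilon>) (?y \<otimes> ext_d D (form0 (star_B D a))))"
      using N_right_Leibniz[of "\<not> \<epsilon>" ?y "star_B D a"] by (simp add: N_ee clinear_0[of "tensor_map _ _"])
    from sgm_kill[OF dg_preserve[OF this]]
    have "ov (sgm \<epsilon> (dg (N (\<not> \<epsilon>) (rmult D ?y (star_B D a))))) = ov (dg (?y \<otimes> ext_d D (form0 (star_B D a))))"
      using star_sum[OF y] by simp
    also have "dg (?y \<otimes> ext_d D (form0 (star_B D a))) = ext_d D (form0 a) \<otimes> ee \<epsilon> v"
      by (simp add: dg_pure form_star_ee form_star_ext_d flip: form_star_ext_d)
    finally show ?thesis
      using True by (simp add: form_star_lmult form_star_ee) (simp add: N_inn flip: inn_pure)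
  next
    case False
    then show ?thesis
      unfolding form_star_lmult form_star_ee rmult_inn
      unfolding inn_pure[symmetric] N_def cc_inn
      using dg_scale[of 0 0] clinear_0[OF sgm_linear(1)] by (simp add: clinear_0[of "tensor_lift _"])
  qed
next
  case zero
  show ?case using form_star_scale[of 0 0] dg_scale[of 0 0]
    by (simp add: clinear_0[OF N_linear(1)] clinear_0[OF sgm_linear(1)])
next
  case (add x y)
  from ov_add[OF add(3,4)] show ?case
    by (simp add: clinear_add[OF N_linear(1)] form_star_add dg_add clinear_add[OF sgm_linear(1)])
qed

lemma form_star_OM: "x \<in> OM P \<Longrightarrow> form_star D x \<in> OM (Not ` P)"
proof (induct rule: OM_induct)
  case (pure \<epsilon> a v)
  then show ?case by (simp add: form_star_lmult form_star_ee OM_rmult OM_inn)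
next
  case zero
  show ?case using form_star_scale[of 0 0] by (simp add: OM_0)
next
  case (add x y)
  then show ?case by (simp add: form_star_add OM_add)
qed

lemma OM_UNIV: "x \<in> OM P \<Longrightarrow> x \<in> OM UNIV"
  by (induct rule: OM_induct) (simp_all add: OM_lmult OM_inn OM_0 OM_add)

lemma sigma_dagger_sigma:
  "X \<in> tensor_A D (OM {True}) (Omega1 D) \<Longrightarrow> sigma {False} (dagger_A D (sigma {True} X)) = dagger_A D X"
proof -
  assume "X \<in> tensor_A D (OM {True}) (Omega1 D)"
  then obtain t where "t \<in> SP {True} UNIV" "X = ov t" unfolding Omega1_OM tensor_A_SP by blast
  then show ?thesis using star_sum[of t "{True}"] by (simp add: sigma_ov)
qed

lemma nabla_dagger:
  assumes "x \<in> OM {False}"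
  shows "nabla {False} x = sigma {False} (dagger_A D (nabla {True} (form_star D x)))"
  using N_star[OF OM_UNIV[OF assms], of False] form_star_OM[OF assms] assms by (simp add: nabla_ov sigma_ov)

lemma sum_nabla: "sum_connection D (nabla {False}) (nabla {True}) = nabla UNIV"
proof -
  have N: "N \<epsilon> (pr \<epsilon> x) = N \<epsilon> x" for \<epsilon> x by (simp add: N_def cc_pr)
  have O: "pr \<epsilon> x \<in> OM {\<epsilon>}" for \<epsilon> x by (simp add: pr_def OM_inn)
  show ?thesis
    unfolding sum_connection_def nabla_def[of UNIV] Omega1_OM
    by (rule restrict_ext) (simp add: part_pr nabla_ov O N NP_def UNIV_bool add.commute)
qed

lemma sum_sigma: "sum_braiding D (sigma {False}) (sigma {True}) (ov t) = ov (SG UNIV t)"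
proof -
  have p: "pr \<epsilon> (rmult D x a) = rmult D (pr \<epsilon> x) a" for \<epsilon> x a
    by (simp add: pr_def cc_rmult rmult_inn)
  have m: "map_A D (tensor_map (pr \<epsilon>) (\<lambda>y. y)) (ov t) = ov (tensor_map (pr \<epsilon>) (\<lambda>y. y) t)" for \<epsilon>
    by (rule map_A_ov) (erule clinear_preserve[rotated -1], simp_all add: p ov_gen)
  have s: "sgm \<epsilon> (tensor_map (pr \<epsilon>) (\<lambda>y. y) t) = sgm \<epsilon> t" for \<epsilon>
    by (rule clinear_eqI[where t = t]) (simp_all add: sgm_def kap_pure cc_pr)
  show ?thesis
    unfolding sum_braiding_def id_def part_pr m sigma_ov add_A_ov SG_single s
    by (simp add: SG_def UNIV_bool add.commute)
qed

lemma star_preserving_nabla: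
  assumes s: "\<And>t. s (ov t) = ov (SG UNIV t)"
  shows "star_preserving D (nabla UNIV) s"
  unfolding star_preserving_def
proof (intro conjI ballI)
  have u: "(\<Sum>\<epsilon>\<in>UNIV. f \<epsilon>) = f True + f False" for f :: "bool \<Rightarrow> (('b, 'l) forms, ('b, 'l) forms) tensor"
    by (simp add: UNIV_bool)
  {
    fix X assume "X \<in> tensor_A D (Omega1 D) (Omega1 D)"
    then obtain t where t: "t \<in> SP UNIV UNIV" "X = ov t" unfolding Omega1_OM tensor_A_SP by blast
    have "SG UNIV (dg (SG UNIV t)) = (\<Sum>\<epsilon>\<in>UNIV. sgm (\<not> \<epsilon>) (dg (sgm \<epsilon> t)))"
      by (simp add: SG_def u dg_add clinear_add[OF sgm_linear(1)] sgm_dg_sgm)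
    then show "s (dagger_A D (s X)) = dagger_A D X" using star_sum[OF t(1)] by (simp add: t(2) s)
  next
    fix x assume "x \<in> Omega1 D"
    then have x: "x \<in> OM UNIV" by (simp add: Omega1_OM)
    then have x': "form_star D x \<in> OM UNIV" using form_star_OM OM_UNIV by blast
    have "ov (NP UNIV x) = ov (\<Sum>\<epsilon>\<in>UNIV. sgm \<epsilon> (dg (N (\<not> \<epsilon>) (form_star D x))))"
      unfolding NP_def by (rule ov_sum) (rule N_star[OF x])
    also have "(\<Sum>\<epsilon>\<in>UNIV. sgm \<epsilon> (dg (N (\<not> \<epsilon>) (form_star D x)))) = SG UNIV (dg (NP UNIV (form_star D x)))"
      by (simp add: SG_def NP_def u dg_add clinear_add[OF sgm_linear(1)] sgm_dg_N)
    finally show "nabla UNIV x = s (dagger_A D (nabla UNIV (form_star D x)))"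
      using x x' by (simp add: nabla_ov s)
  }
qed

end

section \<open>Chern connections\<close>

context calculus
begin

text \<open>Reads off the component of bidegree (1,1) in V \<otimes> B \<otimes> V. Up to an
  invertible map it is a left inverse of the wedge product on the mixed summands.\<close>

definition C11 :: "('b, 'l) forms \<Rightarrow> ('v, ('b, 'v) tensor) tensor"
  where "C11 = tensor_lift (\<lambda>w. tensor_lift (\<lambda>b z. deg1 \<pi>L w \<otimes> b \<otimes> deg1 \<pi>L z))"

lemma C11_linear [simp]: "clinear C11" "clinear f \<Longrightarrow> clinear (\<lambda>x. C11 (f x))"
  and C11_pure: "C11 (w \<otimes> b \<otimes> z) = deg1 \<pi>L w \<otimes> b \<otimes> deg1 \<pi>L z"
  by (simp_all add: C11_def)

lemma beta_linear [simp]: "clinear \<beta>" "clinear \<beta>'"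
  by (simp_all add: B.comodule_q coact_comodule)

lemma apl_beta_inv: "apl \<beta>' (apl \<beta> s) = s"
  by (rule tensor_map_inverse(2)) simp_all

lemma wee_C11: "C11 (lmult D a (wee False True z)) = apl \<beta> (a \<otimes> z)"
proof (rule clinear_eqI[where t = z])
  fix v w
  show "C11 (lmult D a (wee False True (v \<otimes> w))) = apl \<beta> (a \<otimes> v \<otimes> w)"
    by (simp add: wee_mixed(1) lmult_pure L.coact_gen tensor_lift_tensor_map apl_pure braid_BV lact_pure
        clinear_tensor_lift_swap[of C11] C11_pure clinear_tensor_lift_swap[of "tensor_lift (\<lambda>c d. c \<otimes> d \<otimes> w)"])
qed (simp_all add: clinear_compose[OF clinear_apl])

text \<open>After \<open>C11\<close> the wedge product becomes \<beta> on the first two factors,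
  preceded by minus \<Psi> when the types stand in the order (0,1), (1,0); all of these are
  invertible.\<close>

lemma wedge_lam_inj:
  assumes "tensor_lift (wedge D) (lam (\<not> \<epsilon>) \<epsilon> s) = tensor_lift (wedge D) (lam (\<not> \<epsilon>) \<epsilon> t)"
  shows "s = t"
proof (cases \<epsilon>)
  case True
  have "C11 (tensor_lift (wedge D) (lam False True s)) = apl \<beta> s" for s
    by (rule clinear_eqI[where t = s]) (simp_all add: wedge_lam wee_C11)
  then have "apl \<beta> s = apl \<beta> t" using assms True by (metis (full_types))
  then show ?thesis using apl_beta_inv by metis
next
  case False
  let ?P = "tensor_map (\<lambda>b. b) \<psi>"
  have "C11 (tensor_lift (wedge D) (lam True False s)) = - apl \<beta> (?P s)" for s
    by (rule clinear_eqI[where t = s])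
      (simp_all add: wedge_lam wee_mixed(2) clinear_minus[of "lmult D _"] clinear_minus[OF C11_linear(1)] wee_C11 clinear_compose[OF clinear_apl])
  then have "- apl \<beta> (?P s) = - apl \<beta> (?P t)" using assms False by (metis (full_types))
  then have "?P s = ?P t" using apl_beta_inv by (metis neg_equal_iff_equal)
  moreover have "tensor_map (\<lambda>b. b) (sg False) (?P s) = s" for s :: "('b, ('v, 'v) tensor) tensor"
    by (rule tensor_map_inverse(1)) (simp_all add: sg_def sg_linear(1)[of False, unfolded sg_def if_False])
  ultimately show ?thesis by metis
qed

lemma wedge_A_inj: "inj_on (wedge_A D) (tensor_A D (OM {\<not> \<epsilon>}) (OM {\<epsilon>}))"
proof (rule inj_onI)
  fix X Y assume "X \<in> tensor_A D (OM {\<not> \<epsilon>}) (OM {\<epsilon>})" "Y \<in> tensor_A D (OM {\<not> \<epsilon>}) (OM {\<epsilon>})"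
    and e: "wedge_A D X = wedge_A D Y"
  then obtain s t where s: "s \<in> SP {\<not> \<epsilon>} {\<epsilon>}" "X = ov s" and t: "t \<in> SP {\<not> \<epsilon>} {\<epsilon>}" "Y = ov t"
    unfolding tensor_A_SP by blast
  have n: "X = ov (lam (\<not> \<epsilon>) \<epsilon> (kap (\<not> \<epsilon>) \<epsilon> s))" "Y = ov (lam (\<not> \<epsilon>) \<epsilon> (kap (\<not> \<epsilon>) \<epsilon> t))"
    using SP_normal[OF s(1)] SP_normal[OF t(1)] s(2) t(2) by simp_all
  from e have "kap (\<not> \<epsilon>) \<epsilon> s = kap (\<not> \<epsilon>) \<epsilon> t"
    unfolding n wedge_A_ov by (rule wedge_lam_inj)
  then show "X = Y" unfolding n by simp
qed

section \<open>The mixed component of the connection\<close>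

abbreviation prl :: "bool \<Rightarrow> (('b, 'l) forms, ('b, 'l) forms) tensor \<Rightarrow> (('b, 'l) forms, ('b, 'l) forms) tensor"
  where "prl \<delta> \<equiv> tensor_map (pr \<delta>) (\<lambda>y. y)"

definition pd :: "bool \<Rightarrow> ('b, 'l) forms \<Rightarrow> ('b, 'l) forms" where "pd \<epsilon> = (if \<epsilon> then del D else delbar D)"

lemma prl_preserve: "ov s = ov t \<Longrightarrow> ov (prl \<delta> s) = ov (prl \<delta> t)"
  by (erule clinear_preserve[rotated -1]) (simp_all add: pr_def cc_rmult rmult_inn[symmetric] ov_gen)

lemma prl_lam: "prl \<delta> (lam \<epsilon> \<epsilon>' s) = (if \<delta> = \<epsilon> then lam \<epsilon> \<epsilon>' s else 0)"
proof (cases "\<delta> = \<epsilon>")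
  case True
  have "prl \<epsilon> (lam \<epsilon> \<epsilon>' s) = lam \<epsilon> \<epsilon>' s"
    by (rule tensor3_eqI[where t = s]) (simp_all add: lam_pure pr_inn)
  then show ?thesis using True by simp
next
  case False
  have "prl (\<not> \<epsilon>) (lam \<epsilon> \<epsilon>' s) = 0"
    by (rule tensor3_eqI[where t = s and g = "\<lambda>_. 0"]) (simp_all add: lam_pure pr_inn)
  then show ?thesis using False by simp
qed

text \<open>The part of torsion freeness in bidegree (1,1): the projection keeps only first factors
  of the type opposite to \<epsilon>. For E the argument again passes through the right Leibniz rule
  and the sign of wedge after \<sigma>.\<close>

lemma wedge_prl_N: "x \<in> OM {\<epsilon>} \<Longrightarrow> tensor_lift (wedge D) (prl (\<not> \<epsilon>) (N \<epsilon> x)) = pd \<epsilon> x"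
proof (cases \<epsilon>)
  case True
  assume "x \<in> OM {\<epsilon>}"
  then show ?thesis
  proof (induct rule: OM_induct)
    case (pure \<delta> a v)
    have l: "tensor_lift (\<lambda>v c. L.gen v \<otimes> c \<otimes> L.gen u) s = wedge D (iota10 s) (ee True u)" for s u
      by (rule clinear_eqI[where t = s]) (simp_all add: wedge_gen)
    have p: "pr False (ext_d D (form0 a)) = iota10 (dB a)"
      unfolding ext_d_inn clinear_add[OF pr_linear(1)] by (simp add: pr_inn) (simp add: inn_def dd_def)
    have "lmult D a (ee True v) = 1 \<otimes> a \<otimes> L.gen v"
      unfolding inn_pure[symmetric] by (simp add: inn_def)
    then have "del D (lmult D a (ee True v)) = wedge D (iota10 (dB a)) (ee True v)"
      by (simp add: del_pure l)
    then show ?case using pure True by (simp add: pd_def inn_pure[symmetric] N_inn p)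
  next
    case zero
    show ?case using clinear_0[OF del_linear(1)]
      by (simp add: True pd_def clinear_0[OF N_linear(1)] clinear_0[of "tensor_map _ _"] clinear_0[OF wedge_lift_linear])
  next
    case (add x y)
    then show ?case using True
      by (simp add: pd_def clinear_add[OF N_linear(1)] clinear_add[OF del_linear(1)] clinear_add[of "tensor_map _ _"]
          clinear_add[OF wedge_lift_linear])
  qed
next
  case False
  assume "x \<in> OM {\<epsilon>}"
  then obtain t where x: "x = iota10 t" using Omega10 MM_OM[of False] False by (auto simp: MM_def)
  have l: "delbar D (L.gen u \<otimes> b \<otimes> 1) = - wedge D (ee False u) (iota01 (dbarB b))" for b u
    unfolding delbar_pure by (rule clinear_eqI[where t = "dbarB b"]) (simp_all add: wedge_gen)
  have "tensor_lift (wedge D) (prl True (N False (iota10 t))) = delbar D (iota10 t)"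
  proof (induct t rule: tensor_induct)
    case (pure v b)
    let ?m = "ee False v \<otimes> ext_d D (form0 b)"
    have v: "iota10 (v \<otimes> b) = rmult D (ee False v) b"
      by (simp only: inn_def if_False braid_BV lact_one rmult_iota10) simp
    have "tensor_lift (wedge D) (prl True (N False (iota10 (v \<otimes> b)))) = tensor_lift (wedge D) (prl True (sgm False ?m))"
      unfolding v using wedge_kill[OF prl_preserve[OF N_right_Leibniz[of False "ee False v" b]]] by (simp add: N_ee clinear_0[of "tensor_map _ _"])
    \<comment> \<open>As \<sigma> swaps the generators, only the part of db of type True ends up
      with a first factor of type True.\<close>
    also have "prl True (sgm False ?m) = sgm False (ee False v \<otimes> inn True (dbarB b))"
    proof -
      have 1: "kap False True ?m = kap False True (ee False v \<otimes> inn True (dbarB b))"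
        unfolding kap_pure ext_d_inn clinear_add[OF cc_linear(1)] by (simp add: cc_inn dd_def)
      have 2: "kap False False (ee False v \<otimes> inn True (dbarB b)) = 0"
        by (simp add: kap_pure cc_inn clinear_0[of "mr _ _"])
      show ?thesis
        by (simp add: sgm_def UNIV_bool clinear_add[of "tensor_map _ _"] prl_lam 1 2 clinear_0[of "tensor_map _ _"] clinear_0[OF lam_linear(1)])
    qed
    also have "tensor_lift (wedge D) \<dots> = - wedge D (ee False v) (inn True (dbarB b))"
      by (subst wedge_sgm_False) (simp_all add: SP_pure OM_inn)
    also have "\<dots> = delbar D (iota10 (v \<otimes> b))" by (simp add: l) (simp add: inn_def)
    finally show ?case .
  next
    case (add s t)
    then show ?case
      by (simp add: clinear_add[OF iota_linear(1)] clinear_add[OF N_linear(1)] clinear_add[OF del_linear(2)] clinear_add[of "tensor_map _ _"]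
          clinear_add[OF wedge_lift_linear])
  qed
  then show ?thesis using False by (simp add: pd_def x)
qed

lemma pd_ee: "pd \<epsilon> (ee \<epsilon> v) = 0"
  by (cases \<epsilon>) (simp_all add: pd_def ee_pure del_pure delbar_pure clinear_0[of "tensor_lift _"])

text \<open>The inverse of the wedge product is evaluated, by injectivity, at the mixed component of
  \<nabla>, whose wedge is \<open>pd \<epsilon> x\<close>. The remaining component of \<nabla> is
  the witness.\<close>

lemma nabla_split:
  assumes x: "x \<in> OM {\<epsilon>}"
  shows "\<exists>Y\<in>tensor_A D (OM {\<epsilon>}) (OM {\<epsilon>}). nabla {\<epsilon>} x =
    add_A D (inv_into (tensor_A D (OM {\<not> \<epsilon>}) (OM {\<epsilon>})) (wedge_A D) (pd \<epsilon> x)) Y"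
proof -
  have S: "prl \<delta> t \<in> SP {\<delta>} Q" if "t \<in> SP P Q" for \<delta> t P Q
    using that[unfolded SP_def]
  proof (induct rule: cvec.span_induct_alt)
    case base
    show ?case by (simp add: clinear_0[of "tensor_map _ _"] SP_0)
  next
    case (step c z t)
    then obtain a b where z: "z = a \<otimes> b" "b \<in> OM Q" by blast
    have "prl \<delta> z \<in> SP {\<delta>} Q" unfolding z using z(2) by (simp add: SP_pure pr_def OM_inn)
    then show ?case using step(2)
      by (simp add: clinear_add[of "tensor_map _ _"] clinear_scale[of "tensor_map _ _"] SP_def cvec.span_add cvec.span_scale)
  qed
  have u: "t = prl (\<not> \<epsilon>) t + prl \<epsilon> t" if "t \<in> SP UNIV Q" for t Q
    using that[unfolded SP_def]
  proof (induct rule: cvec.span_induct_alt)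
    case base
    show ?case by (simp add: clinear_0[of "tensor_map _ _"])
  next
    case (step c z t)
    then obtain a b where z: "z = a \<otimes> b" "a \<in> OM UNIV" by blast
    have "(\<Sum>\<delta>\<in>UNIV. pr \<delta> a) = pr (\<not> \<epsilon>) a + pr \<epsilon> a"
      by (cases \<epsilon>) (simp_all add: UNIV_bool)
    then have "a = pr (\<not> \<epsilon>) a + pr \<epsilon> a" using OM_sum[OF z(2)] by simp
    then have "prl (\<not> \<epsilon>) z + prl \<epsilon> z = z"
      unfolding z by (simp flip: tensor_pure_add)
    then show ?case using step(2)
      by (simp add: clinear_add[of "tensor_map _ _"] clinear_scale[of "tensor_map _ _"])
        (metis (no_types, lifting) add.assoc add.left_commute scaleC_add_right)
  qed
  have N: "N \<epsilon> x \<in> SP UNIV {\<epsilon>}" by (rule N_SP) simp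
  have "inv_into (tensor_A D (OM {\<not> \<epsilon>}) (OM {\<epsilon>})) (wedge_A D) (wedge_A D (ov (prl (\<not> \<epsilon>) (N \<epsilon> x)))) = ov (prl (\<not> \<epsilon>) (N \<epsilon> x))"
    by (rule inv_into_f_f[OF wedge_A_inj]) (unfold tensor_A_SP, rule imageI, rule S[OF N])
  then have i: "inv_into (tensor_A D (OM {\<not> \<epsilon>}) (OM {\<epsilon>})) (wedge_A D) (pd \<epsilon> x) = ov (prl (\<not> \<epsilon>) (N \<epsilon> x))"
    by (simp add: wedge_prl_N[OF x])
  show ?thesis
  proof
    show "ov (prl \<epsilon> (N \<epsilon> x)) \<in> tensor_A D (OM {\<epsilon>}) (OM {\<epsilon>})"
      unfolding tensor_A_SP by (rule imageI) (rule S[OF N])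
    show "nabla {\<epsilon>} x = add_A D (inv_into (tensor_A D (OM {\<not> \<epsilon>}) (OM {\<epsilon>})) (wedge_A D) (pd \<epsilon> x)) (ov (prl \<epsilon> (N \<epsilon> x)))"
      unfolding i add_A_ov u[OF N, symmetric] using x by (simp add: nabla_ov)
  qed
qed

definition chern :: "bool \<Rightarrow> (('b, 'l) forms \<Rightarrow> ('b, 'l) forms \<Rightarrow> 'b) \<Rightarrow> (('b, 'l) forms \<Rightarrow> ('b, 'l) forms_A) \<Rightarrow> bool" where
  "chern \<epsilon> g nab \<longleftrightarrow>
     left_connection D (OM {\<epsilon>}) nab \<and> hermitian_compatible D g (OM {\<epsilon>}) nab \<and>
     (\<forall>m \<in> OM {\<epsilon>}. \<exists>Y \<in> tensor_A D (OM {\<epsilon>}) (OM {\<epsilon>}).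
        nab m = add_A D (inv_into (tensor_A D (OM {\<not> \<epsilon>}) (OM {\<epsilon>})) (wedge_A D) (pd \<epsilon> m)) Y)"

lemma is_chern: "is_chern_F D \<eta> = chern True (metric_F D \<eta>)" "is_chern_E D \<eta> = chern False (metric_E D \<eta>)"
proof -
  have "Omega D 0 1 = OM {True}" "Omega D 1 0 = OM {False}"
    using MM_OM[of True] MM_OM[of False] by (simp_all add: MM_def)
  then show "is_chern_F D \<eta> = chern True (metric_F D \<eta>)" "is_chern_E D \<eta> = chern False (metric_E D \<eta>)"
    by (auto simp: fun_eq_iff is_chern_F_def is_chern_E_def chern_def pd_def)
qed

end

text \<open>The common properties of the two hermitian metrics: sesquilinearity over B and scalar
  values on the generators, the scalar being named by \<open>deg0\<close>.\<close>

locale scalar_metric = calculus D for D :: "('h::complex_alg_1, 'v::complex_vec, 'b::complex_alg_1, 'l::complex_alg_1) braided_data" +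
  fixes \<epsilon> :: bool and g :: "('b, 'l) forms \<Rightarrow> ('b, 'l) forms \<Rightarrow> 'b"
  assumes g_linear: "clinear (\<lambda>x. g x z)" and g_lmult: "g (lmult D a x) z = a * g x z"
    and g_antilinear: "antilinear (g x)" and g_star: "g x (lmult D a z) = g x z * star_B D a"
    and g_scalar: "g (inn \<epsilon> (1 \<otimes> v)) (inn \<epsilon> (1 \<otimes> w)) = deg0 (proj_B D) (g (inn \<epsilon> (1 \<otimes> v)) (inn \<epsilon> (1 \<otimes> w))) *\<^sub>C 1"
begin

abbreviation gv :: "'v \<Rightarrow> 'v \<Rightarrow> complex" where "gv v w \<equiv> deg0 \<pi>B (g (ee \<epsilon> v) (ee \<epsilon> w))"

abbreviation Lg :: "('b, 'l) forms \<Rightarrow> (('b, 'l) forms, ('b, 'l) forms) tensor \<Rightarrow> ('b, 'l) forms"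
  where "Lg z \<equiv> tensor_lift (\<lambda>m1 m2. rmult D m1 (g m2 z))"

abbreviation Rg :: "('b, 'l) forms \<Rightarrow> (('b, 'l) forms, ('b, 'l) forms) tensor \<Rightarrow> ('b, 'l) forms"
  where "Rg x \<equiv> tensor_lift_cnj (\<lambda>n1 n2. lmult D (g x n2) (form_star D n1))"

lemma g_comp [simp]: "clinear f \<Longrightarrow> clinear (\<lambda>x. g (f x) z)"
  using clinear_compose[OF g_linear] .

lemma Lg_linear [simp]: "clinear (Lg z)" and Lg_pure: "Lg z (m1 \<otimes> m2) = rmult D m1 (g m2 z)"
  using g_linear by simp_all

lemma Rg_bi: "\<forall>n1. antilinear (\<lambda>n2. lmult D (g x n2) (form_star D n1))" "\<forall>n2. antilinear (\<lambda>n1. lmult D (g x n2) (form_star D n1))"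
  using linear_comp_antilinear[OF lmult_linear(1)[OF clinear_ident(1)] g_antilinear]
    linear_comp_antilinear[OF lmult_linear(3) form_star_antilinear] by blast+

lemma Rg_pure: "Rg x (n1 \<otimes> n2) = lmult D (g x n2) (form_star D n1)"
  and Rg_add: "Rg x (s + t) = Rg x s + Rg x t" and Rg_scale: "Rg x (c *\<^sub>C s) = cnj c *\<^sub>C Rg x s"
  using Rg_bi by (simp_all add: tensor_lift_cnj_add tensor_lift_cnj_scale)

lemma Lg_kill: "ov s = ov t \<Longrightarrow> Lg z s = Lg z t"
  by (erule clinear_kill[rotated -1]) (simp_all add: Lg_pure rmult_rmult g_lmult)

lemma Rg_kill: "ov s = ov t \<Longrightarrow> Rg x s = Rg x t"
  by (erule bal_kill[rotated -1]) (simp_all add: Rg_pure Rg_add Rg_scale form_star_rmult lmult_lmult g_star)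

lemma compatible_iff:
  assumes "\<And>x. x \<in> OM {\<epsilon>} \<Longrightarrow> nab x = ov (T x)"
  shows "hermitian_compatible D g (OM {\<epsilon>}) nab \<longleftrightarrow>
    (\<forall>m\<in>OM {\<epsilon>}. \<forall>n\<in>OM {\<epsilon>}. ext_d D (form0 (g m n)) = Lg n (T m) + Rg m (T n))"
proof -
  have "the_elem (Lg n ` nab m) + the_elem (Rg m ` nab n) = Lg n (T m) + Rg m (T n)"
    if "m \<in> OM {\<epsilon>}" "n \<in> OM {\<epsilon>}" for m n
    by (simp only: assms that the_elem_ov[of "Lg n", OF Lg_kill] the_elem_ov[of "Rg m", OF Rg_kill])
  then show ?thesis unfolding hermitian_compatible_def by simp
qed

lemma ext_d_scalar: "ext_d D (form0 (c *\<^sub>C 1)) = 0"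
  using clinear_scale[of "\<lambda>a. ext_d D (form0 a)" c 1] by (simp add: ext_d_one)

text \<open>The metric of a . \<delta>v and b . \<delta>w is a constant times a times the star of b,
  and the two terms of the Leibniz rule for d are the two terms of compatibility.\<close>

lemma compatible_nabla: "hermitian_compatible D g (OM {\<epsilon>}) (nabla {\<epsilon>})"
proof -
  have dl: "clinear (\<lambda>a. ext_d D (form0 a))" by simp
  have gp: "g (lmult D a (ee \<epsilon> v)) (lmult D b (ee \<epsilon> w)) = gv v w *\<^sub>C (a * star_B D b)" for a b v w
    unfolding g_lmult g_star by (subst g_scalar) (simp add: mult_scaleC_left mult_scaleC_right)
  have Radd: "Rg (x + y) t = Rg x t + Rg y t" for x y t
  proof (induct t rule: tensor_induct)
    case (pure a b)
    show ?case unfolding Rg_pure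
      by (simp only: clinear_add[OF g_linear] clinear_add[OF lmult_linear(1)[OF clinear_ident(1)]])
  next
    case (add s t)
    then show ?case by (simp only: Rg_add ac_simps)
  qed
  have "ext_d D (form0 (g m n)) = Lg n (N \<epsilon> m) + Rg m (N \<epsilon> n)" if "m \<in> OM {\<epsilon>}" "n \<in> OM {\<epsilon>}" for m n
    using that(1)
  proof (induct rule: OM_induct)
    case (pure \<delta> a v)
    then have \<delta>: "\<delta> = \<epsilon>" by simp
    from that(2) show ?case unfolding \<delta>
    proof (induct rule: OM_induct)
      case (pure \<delta>' b w)
      then have \<delta>': "\<delta>' = \<epsilon>" by simp
      have L: "Lg (lmult D b (ee \<epsilon> w)) (N \<epsilon> (lmult D a (ee \<epsilon> v))) = gv v w *\<^sub>C rmult D (ext_d D (form0 a)) (star_B D b)"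
        using gp[of 1 v b w] unfolding inn_pure[symmetric] N_inn
        by (simp add: Lg_pure clinear_scale[of "rmult D _"])
      have R: "Rg (lmult D a (ee \<epsilon> v)) (N \<epsilon> (lmult D b (ee \<epsilon> w))) = gv v w *\<^sub>C lmult D a (ext_d D (form0 (star_B D b)))"
        using gp[of a v 1 w] unfolding inn_pure[symmetric] N_inn
        by (simp add: Rg_pure form_star_ext_d clinear_scale[of "\<lambda>a. lmult D a _"])
      show ?case unfolding \<delta>' gp L R by (simp add: clinear_scale[OF dl] ext_d_mult scaleC_add_right)
    next
      case zero
      show ?case using antilinear_0[OF g_antilinear] Rg_scale[of _ 0 0]
        by (simp add: clinear_0[OF dl] clinear_0[OF N_linear(1)] clinear_0[of "rmult D _"] clinear_0[of "tensor_lift _"])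
    next
      case (add x y)
      have "Lg (x + y) t = Lg x t + Lg y t" for t
        by (rule clinear_eqI[where t = t]) (simp_all add: Lg_pure antilinear_add[OF g_antilinear] clinear_add[of "rmult D _"])
      then show ?case using add
        by (simp add: antilinear_add[OF g_antilinear] clinear_add[OF dl] clinear_add[OF N_linear(1)] Rg_add)
    qed
  next
    case zero
    have "Rg 0 t = 0" for t
      using Radd[of 0 0 t] by (metis add_0 add_cancel_right_right)
    then show ?case by (simp add: clinear_0[OF g_linear] clinear_0[OF dl] clinear_0[OF N_linear(1)] clinear_0[OF Lg_linear])
  next
    case (add x y)
    then show ?case unfolding Radd
      by (simp add: clinear_add[OF g_linear] clinear_add[OF dl] clinear_add[OF N_linear(1)] clinear_add[OF Lg_linear])
  qed
  then show ?thesis by (subst compatible_iff[of _ "N \<epsilon>"]) (simp_all add: nabla_ov)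
qed

text \<open>The Gram matrix has scalar entries while its inverse is given over B. Applying
  \<open>deg0\<close> to the inverse yields a scalar right inverse, with which s is rebuilt from its
  contractions.\<close>

lemma contraction_zero:
  assumes "invertible_gram (\<lambda>v w. g (ee \<epsilon> v) (ee \<epsilon> w))"
    and "\<And>w. Lg (ee \<epsilon> w) (lam \<epsilon> \<epsilon> s) = 0"
  shows "s = 0"
proof -
  define con where "con w = tensor_lift (\<lambda>(a::'b). tensor_lift (\<lambda>(p::'v) q. gv q w *\<^sub>C a \<otimes> p))" for w
  define emb where "emb k = tensor_lift (\<lambda>(a::'b) (p::'v). a \<otimes> p \<otimes> (k::'v))" for k
  have con_pure: "con w ((a::'b) \<otimes> p \<otimes> q) = gv q w *\<^sub>C a \<otimes> p" and con_linear [simp]: "clinear (con w)" for w a p q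
    by (simp_all add: con_def)
  have emb_pure: "emb k (a \<otimes> p) = a \<otimes> p \<otimes> k" and emb_linear [simp]: "clinear (emb k)" for k a p
    by (simp_all add: emb_def)
  have "Lg (ee \<epsilon> w) (lam \<epsilon> \<epsilon> s) = inn \<epsilon> (con w s)" for w
  proof (rule tensor3_eqI[where t = s])
    fix a p q
    show "Lg (ee \<epsilon> w) (lam \<epsilon> \<epsilon> (a \<otimes> p \<otimes> q)) = inn \<epsilon> (con w (a \<otimes> p \<otimes> q))"
      unfolding lam_pure Lg_pure con_pure by (subst g_scalar)
        (simp add: rmult_inn clinear_scale[of "\<lambda>x. rgt \<epsilon> (a \<otimes> p) x"] clinear_scale[OF inn_linear(1)])
  qed (simp_all add: clinear_compose[OF con_linear])
  then have c0: "con w s = 0" for w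
    using assms(2)[of w] cc_inn[of \<epsilon> \<epsilon> "con w s"] by (simp add: clinear_0[OF cc_linear(1)])
  obtain S h where S: "finite S" "cvec.span S = UNIV"
    and h: "\<And>i k. i \<in> S \<Longrightarrow> k \<in> S \<Longrightarrow> (\<Sum>j\<in>S. g (ee \<epsilon> i) (ee \<epsilon> j) * h j k) = (if i = k then 1 else 0)"
    using assms(1) unfolding invertible_gram_def by blast
  have H: "(\<Sum>j\<in>S. gv i j * deg0 \<pi>B (h j k)) = (if i = k then 1 else 0)" if "i \<in> S" "k \<in> S" for i k
  proof -
    have "g (ee \<epsilon> i) (ee \<epsilon> j) * h j k = gv i j *\<^sub>C h j k" for j
      by (subst g_scalar) (simp add: mult_scaleC_left)
    then have "deg0 \<pi>B (\<Sum>j\<in>S. gv i j *\<^sub>C h j k) = deg0 \<pi>B (if i = k then 1 else 0)"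
      using h[OF that] by simp
    then show ?thesis
      by (simp add: clinear_sum[OF B.deg0_linear(1)] clinear_scale[OF B.deg0_linear(1)] scaleC_complex_def clinear_0[OF B.deg0_linear(1)] split: if_splits)
  qed
  \<comment> \<open>For q in \<open>S\<close> this is the matrix identity \<open>H\<close>; it
    extends to all q because both sides are linear and \<open>S\<close> spans V.\<close>
  have q: "(\<Sum>k\<in>S. \<Sum>j\<in>S. (gv q j * deg0 \<pi>B (h j k)) *\<^sub>C k) = q" for q
  proof -
    have "q \<in> cvec.span S" using S(2) by simp
    then show ?thesis
    proof (induct rule: cvec.span_induct_alt)
      case base
      show ?case by (simp add: clinear_0[OF inn_linear(1)] clinear_0[OF g_linear] clinear_0[OF B.deg0_linear(1)])
    next
      case (step c x y)
      have "(\<Sum>k\<in>S. \<Sum>j\<in>S. (gv x j * deg0 \<pi>B (h j k)) *\<^sub>C k) = (\<Sum>k\<in>S. if k = x then k else 0)"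
        unfolding cvec.scale_sum_left[symmetric] by (rule sum.cong) (auto simp: H step(1))
      also have "\<dots> = x" using step(1) S(1) by simp
      finally have x: "(\<Sum>k\<in>S. \<Sum>j\<in>S. (gv x j * deg0 \<pi>B (h j k)) *\<^sub>C k) = x" .
      have "gv (c *\<^sub>C x + y) j = c * gv x j + gv y j" for j
        using clinear_add[of "\<lambda>q. gv q j" "c *\<^sub>C x" y] clinear_scale[of "\<lambda>q. gv q j" c x] by (simp add: scaleC_complex_def)
      then have "(\<Sum>k\<in>S. \<Sum>j\<in>S. (gv (c *\<^sub>C x + y) j * deg0 \<pi>B (h j k)) *\<^sub>C k) =
        c *\<^sub>C (\<Sum>k\<in>S. \<Sum>j\<in>S. (gv x j * deg0 \<pi>B (h j k)) *\<^sub>C k) + (\<Sum>k\<in>S. \<Sum>j\<in>S. (gv y j * deg0 \<pi>B (h j k)) *\<^sub>C k)"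
        by (simp add: distrib_right scaleC_add_left sum.distrib scaleC_sum scaleC_scaleC mult.assoc)
      then show ?case using x step(2) by simp
    qed
  qed
  have "s = (\<Sum>k\<in>S. \<Sum>j\<in>S. deg0 \<pi>B (h j k) *\<^sub>C emb k (con j s))"
  proof (rule tensor3_eqI[where t = s])
    fix a :: 'b and p q :: 'v
    have "a \<otimes> p \<otimes> q = (\<Sum>k\<in>S. \<Sum>j\<in>S. a \<otimes> p \<otimes> ((gv q j * deg0 \<pi>B (h j k)) *\<^sub>C k))"
      by (subst q[of q, symmetric]) (simp add: clinear_sum[of "\<lambda>z. a \<otimes> p \<otimes> z"])
    also have "\<dots> = (\<Sum>k\<in>S. \<Sum>j\<in>S. deg0 \<pi>B (h j k) *\<^sub>C emb k (con j (a \<otimes> p \<otimes> q)))"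
      by (simp add: con_pure clinear_scale[OF emb_linear] emb_pure scaleC_scaleC mult.commute)
    finally show "a \<otimes> p \<otimes> q = (\<Sum>k\<in>S. \<Sum>j\<in>S. deg0 \<pi>B (h j k) *\<^sub>C emb k (con j (a \<otimes> p \<otimes> q)))" .
  qed (simp_all add: clinear_compose[OF emb_linear])
  then show ?thesis by (simp add: c0 clinear_0[OF emb_linear])
qed

text \<open>For uniqueness, the prescribed mixed part vanishes on generators, so only the summand
  with both factors of type \<epsilon> remains. There compatibility reads 0 = left term + right term
  with the two terms of opposite types; hence each is 0, and \<open>contraction_zero\<close> applies
  to the left one.\<close>

lemma chern_nabla:
  assumes "invertible_gram (\<lambda>v w. g (ee \<epsilon> v) (ee \<epsilon> w))"
  shows "the_only (chern \<epsilon> g) (nabla {\<epsilon>})"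
  unfolding the_only_def
proof (intro conjI allI impI)
  show "chern \<epsilon> g (nabla {\<epsilon>})"
    unfolding chern_def using left_connection_nabla compatible_nabla nabla_split by blast
next
  fix n assume n: "chern \<epsilon> g n"
  have lc: "left_connection D (OM {\<epsilon>}) n" and hc: "hermitian_compatible D g (OM {\<epsilon>}) n"
    and sp: "\<And>m. m \<in> OM {\<epsilon>} \<Longrightarrow> \<exists>Y \<in> tensor_A D (OM {\<epsilon>}) (OM {\<epsilon>}).
        n m = add_A D (inv_into (tensor_A D (OM {\<not> \<epsilon>}) (OM {\<epsilon>})) (wedge_A D) (pd \<epsilon> m)) Y"
    using n unfolding chern_def by blast+
  have "\<exists>t. n x = ov t" if "x \<in> OM {\<epsilon>}" for x
    using lc that unfolding left_connection_def tensor_A_def by blast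
  then obtain T where T: "\<And>x. x \<in> OM {\<epsilon>} \<Longrightarrow> n x = ov (T x)" by metis
  have O: "ee \<epsilon> v \<in> OM {\<epsilon>}" for v by (simp add: OM_inn)
  have "\<exists>s. n (ee \<epsilon> v) = ov (lam \<epsilon> \<epsilon> s)" for v
  proof -
    have i: "inv_into (tensor_A D (OM {\<not> \<epsilon>}) (OM {\<epsilon>})) (wedge_A D) (pd \<epsilon> (ee \<epsilon> v)) = ov 0"
    proof -
      have "wedge_A D (ov 0) = 0" by (simp add: clinear_0[OF wedge_lift_linear])
      moreover have "ov 0 \<in> tensor_A D (OM {\<not> \<epsilon>}) (OM {\<epsilon>})" unfolding tensor_A_SP by (rule imageI) (rule SP_0)
      ultimately show ?thesis using inv_into_f_f[OF wedge_A_inj, of "ov 0" \<epsilon>] by (simp add: pd_ee)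
    qed
    obtain t where t: "t \<in> SP {\<epsilon>} {\<epsilon>}" "n (ee \<epsilon> v) = ov t"
      using sp[OF O[of v], unfolded i] unfolding tensor_A_SP by auto
    then show ?thesis using SP_normal[OF t(1)] by auto
  qed
  then obtain s where s: "\<And>v. n (ee \<epsilon> v) = ov (lam \<epsilon> \<epsilon> (s v))" by metis
  have L: "\<exists>y. Lg z (lam \<epsilon> \<epsilon> u) = inn \<epsilon> y" for z u
  proof (induct u rule: tensor_induct)
    case (pure a u)
    show ?case
    proof (induct u rule: tensor_induct)
      case (pure v w)
      show ?case by (auto simp: lam_pure Lg_pure rmult_inn)
    next
      case (add s t)
      then obtain y y' where "Lg z (lam \<epsilon> \<epsilon> (a \<otimes> s)) = inn \<epsilon> y" "Lg z (lam \<epsilon> \<epsilon> (a \<otimes> t)) = inn \<epsilon> y'" by blast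
      then have "Lg z (lam \<epsilon> \<epsilon> (a \<otimes> (s + t))) = inn \<epsilon> (y + y')"
        by (simp add: clinear_add[OF lam_linear(1)] clinear_add[OF Lg_linear] clinear_add[OF inn_linear(1)])
      then show ?case by blast
    qed
  next
    case (add s t)
    then obtain y y' where "Lg z (lam \<epsilon> \<epsilon> s) = inn \<epsilon> y" "Lg z (lam \<epsilon> \<epsilon> t) = inn \<epsilon> y'" by blast
    then have "Lg z (lam \<epsilon> \<epsilon> (s + t)) = inn \<epsilon> (y + y')"
      by (simp add: clinear_add[OF lam_linear(1)] clinear_add[OF Lg_linear] clinear_add[OF inn_linear(1)])
    then show ?case by blast
  qed
  \<comment> \<open>The involution exchanges the types, so the right term has no component of type
    \<epsilon>.\<close>
  have R: "cc \<epsilon> (Rg x (lam \<epsilon> \<epsilon> u)) = 0" for x u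
  proof (induct u rule: tensor_induct)
    case (pure a u)
    show ?case
    proof (induct u rule: tensor_induct)
      case (pure v w)
      have "form_star D (inn \<epsilon> (a \<otimes> v)) = inn (\<not> \<epsilon>) (rgt (\<not> \<epsilon>) (1 \<otimes> vstar D v) (star_B D a))"
        unfolding inn_pure[of _ a] form_star_lmult form_star_ee rmult_inn ..
      then show ?case by (simp add: lam_pure Rg_pure lmult_inn cc_inn)
    next
      case (add s t)
      then show ?case by (simp add: clinear_add[OF lam_linear(1)] Rg_add clinear_add[OF cc_linear(1)])
    qed
  next
    case (add s t)
    then show ?case by (simp add: clinear_add[OF lam_linear(1)] Rg_add clinear_add[OF cc_linear(1)])
  qed
  have "s v = 0" for v
  proof (rule contraction_zero[OF assms])
    fix w
    have "ext_d D (form0 (g (ee \<epsilon> v) (ee \<epsilon> w))) = Lg (ee \<epsilon> w) (T (ee \<epsilon> v)) + Rg (ee \<epsilon> v) (T (ee \<epsilon> w))"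
      using iffD1[OF compatible_iff[OF T] hc] O by blast
    moreover have "ext_d D (form0 (g (ee \<epsilon> v) (ee \<epsilon> w))) = 0"
      by (subst g_scalar) (rule ext_d_scalar)
    moreover have "Lg (ee \<epsilon> w) (T (ee \<epsilon> v)) = Lg (ee \<epsilon> w) (lam \<epsilon> \<epsilon> (s v))"
      by (rule Lg_kill) (simp only: s T[OF O, symmetric])
    moreover have "Rg (ee \<epsilon> v) (T (ee \<epsilon> w)) = Rg (ee \<epsilon> v) (lam \<epsilon> \<epsilon> (s w))"
      by (rule Rg_kill) (simp only: s T[OF O, symmetric])
    ultimately have "0 = Lg (ee \<epsilon> w) (lam \<epsilon> \<epsilon> (s v)) + Rg (ee \<epsilon> v) (lam \<epsilon> \<epsilon> (s w))" by simp
    then have "cc \<epsilon> (Lg (ee \<epsilon> w) (lam \<epsilon> \<epsilon> (s v))) + cc \<epsilon> (Rg (ee \<epsilon> v) (lam \<epsilon> \<epsilon> (s w))) = 0"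
      using clinear_add[OF cc_linear(1)] clinear_0[OF cc_linear(1)] by metis
    then have c: "cc \<epsilon> (Lg (ee \<epsilon> w) (lam \<epsilon> \<epsilon> (s v))) = 0" by (simp add: R)
    obtain y where "Lg (ee \<epsilon> w) (lam \<epsilon> \<epsilon> (s v)) = inn \<epsilon> y" using L by blast
    then show "Lg (ee \<epsilon> w) (lam \<epsilon> \<epsilon> (s v)) = 0" using c by (simp add: cc_inn clinear_0[OF inn_linear(1)])
  qed
  then have "n (ee \<epsilon> v) = ov 0" for v by (simp add: s clinear_0[OF lam_linear(1)])
  then show "n = nabla {\<epsilon>}"
    by (intro left_connection_eqI[of "{\<epsilon>}"] lc left_connection_nabla) (simp_all add: nabla_ov OM_inn N_ee)
qed

end

section \<open>The hermitian metrics\<close>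

context calculus
begin

abbreviation "\<gamma> \<equiv> braid D \<rho>V \<rho>B"
abbreviation "\<gamma>' \<equiv> braid_inv \<rho>V \<rho>B"

lemma gamma_linear [simp]: "clinear \<gamma>" "clinear \<gamma>'" "clinear f \<Longrightarrow> clinear (\<lambda>x. \<gamma> (f x))" "clinear g \<Longrightarrow> clinear (\<lambda>x. \<gamma>' (g x))"
  by (simp_all add: B.comodule_q coact_comodule)

lemma gamma_inv [simp]: "\<gamma> (\<gamma>' t) = t" "\<gamma>' (\<gamma> s) = s"
  by (rule braid_braid_inv[OF coact_comodule B.comodule_q])+

lemma gamma_inv_ract: "\<gamma>' (ract t a) = rmul (\<gamma>' t) a"
proof -
  have "\<gamma> (rmul s a) = ract (\<gamma> s) a" for s
    by (rule clinear_eqI[where t = s]) (simp_all add: braid_VB ract_mult)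
  from this[of "\<gamma>' t"] show ?thesis by (metis gamma_inv)
qed

definition mid :: "(('v, 'v) tensor \<Rightarrow> ('v, 'v) tensor) \<Rightarrow> (('b, 'v) tensor, ('v, 'b) tensor) tensor \<Rightarrow> (('b, 'v) tensor, ('v, 'b) tensor) tensor"
  where "mid f = tensor_lift (\<lambda>s u. tensor_lift (\<lambda>a v. tensor_lift (\<lambda>w b.
          tensor_lift (\<lambda>w' v'. (a \<otimes> w') \<otimes> (v' \<otimes> b)) (f (v \<otimes> w))) u) s)"

lemma mid:
  assumes f: "clinear f"
  shows "clinear (mid f)" "mid f ((a \<otimes> v) \<otimes> (w \<otimes> b)) = tensor_lift (\<lambda>w' v'. (a \<otimes> w') \<otimes> (v' \<otimes> b)) (f (v \<otimes> w))"
proof -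
  note [simp] = clinear_compose[OF f]
  show "clinear (mid f)" "mid f ((a \<otimes> v) \<otimes> (w \<otimes> b)) = tensor_lift (\<lambda>w' v'. (a \<otimes> w') \<otimes> (v' \<otimes> b)) (f (v \<otimes> w))"
    by (simp_all add: mid_def)
qed

lemma pair_eqI:
  assumes "clinear f" "clinear g" "\<And>a v w b. f ((a \<otimes> v) \<otimes> (w \<otimes> b)) = g ((a \<otimes> v) \<otimes> (w \<otimes> b))"
  shows "f t = g t"
proof (rule clinear_eqI[OF assms(1,2)])
  fix x y
  have "f ((a \<otimes> v) \<otimes> y) = g ((a \<otimes> v) \<otimes> y)" for a v
    by (rule clinear_eqI[where t = y]) (simp_all add: assms clinear_compose[OF assms(1)] clinear_compose[OF assms(2)])
  then show "f (x \<otimes> y) = g (x \<otimes> y)"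
    by (intro clinear_eqI[where t = x and f = "\<lambda>x. f (x \<otimes> y)" and g = "\<lambda>x. g (x \<otimes> y)"])
      (simp_all add: clinear_compose[OF assms(1)] clinear_compose[OF assms(2)])
qed

lemma mid_inverse:
  assumes "clinear f" "clinear g" "\<And>s. f (g s) = s"
  shows "mid f (mid g t) = t"
proof (rule pair_eqI[where t = t and g = "\<lambda>t. t"])
  fix a v w b
  have "mid f (tensor_lift (\<lambda>w' v'. (a \<otimes> w') \<otimes> (v' \<otimes> b)) z) = tensor_lift (\<lambda>w' v'. (a \<otimes> w') \<otimes> (v' \<otimes> b)) (f z)" for z
    by (rule clinear_eqI[where t = z]) (simp_all add: mid[OF assms(1)] assms(1) clinear_compose[OF mid(1)[OF assms(1)]] clinear_compose[OF assms(1)])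
  then show "mid f (mid g ((a \<otimes> v) \<otimes> (w \<otimes> b))) = (a \<otimes> v) \<otimes> (w \<otimes> b)"
    by (simp add: mid[OF assms(2)] assms(3))
qed (simp_all add: clinear_compose[OF mid(1)[OF assms(1)]] mid(1)[OF assms(2)])

lemma inv_psi_linear [simp]: "clinear (inv \<psi>)" "clinear f \<Longrightarrow> clinear (\<lambda>x. inv \<psi> (f x))"
  using sg_linear(1)[of False] clinear_compose[of "inv \<psi>" f] by (simp_all add: sg_def)

lemma Theta_mid: "Theta D t = tensor_map \<beta> \<gamma> (mid \<psi> t)"
  by (simp add: Theta_def mid_def B_alg_def)

text \<open>On arguments presented as images under \<beta> and \<gamma> the outer braidings of
  \<open>Theta\<close> cancel and only the inverse of \<Psi> in the middle is left. As \<beta> and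
  \<gamma> are invertible, every pair of arguments can be so presented.\<close>

lemma inv_Theta: "inv (Theta D) (\<beta> s \<otimes> \<gamma> t) = mid (inv \<psi>) (s \<otimes> t)"
proof -
  have p: "clinear \<psi>" by simp
  have 1: "mid (inv \<psi>) (mid \<psi> t) = t" "mid \<psi> (mid (inv \<psi>) t) = t" for t
    by (rule mid_inverse; simp)+
  have 2: "tensor_map \<beta>' \<gamma>' (tensor_map \<beta> \<gamma> t) = t" for t
    by (simp add: tensor_map_comp)
  have "inj (Theta D)"
    by (rule inj_on_inverseI[where g = "\<lambda>t. mid (inv \<psi>) (tensor_map \<beta>' \<gamma>' t)"]) (simp add: Theta_mid 1 2)
  moreover have "Theta D (mid (inv \<psi>) (s \<otimes> t)) = \<beta> s \<otimes> \<gamma> t"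
    by (simp add: Theta_mid 1)
  ultimately show ?thesis by (metis inv_f_f)
qed

text \<open>The coordinates of a form of the type opposite to \<epsilon> with its coefficient on the
  right, as the second argument of the metric has after the involution.\<close>

definition qq :: "bool \<Rightarrow> ('b, 'l) forms \<Rightarrow> ('v, 'b) tensor"
  where "qq \<epsilon> x = (if \<epsilon> then coord10 D x else \<gamma>' (coord01 D x))"

lemma qq_linear [simp]: "clinear (qq \<epsilon>)" and qq_rmult: "qq \<epsilon> (rmult D x a) = rmul (qq \<epsilon> x) a"
  by (cases \<epsilon>; simp add: qq_def[abs_def] coord10_rmult coord01_rmult gamma_inv_ract)+

lemma qq_ee: "qq \<epsilon> (ee (\<not> \<epsilon>) w) = w \<otimes> 1"
proof (cases \<epsilon>)
  case True
  then show ?thesis by (simp add: qq_def inn_def braid_BV coord_pure)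
next
  case False
  have "\<gamma>' (1 \<otimes> w) = w \<otimes> 1"
    using gamma_inv(2)[of "w \<otimes> 1"] by (simp add: braid_VB)
  then show ?thesis using False by (simp add: qq_def inn_def coord_pure)
qed

definition met :: "bool \<Rightarrow> (('v, 'v) tensor \<Rightarrow> 'b) \<Rightarrow> ('b, 'l) forms \<Rightarrow> ('b, 'l) forms \<Rightarrow> 'b"
  where "met \<epsilon> \<eta> x z = phi_minus \<eta> (cc \<epsilon> x \<otimes> qq \<epsilon> (form_star D z))"

lemma phi_minus:
  assumes e: "clinear \<eta>"
  shows "clinear (phi_minus \<eta>)" "phi_minus \<eta> ((a \<otimes> v) \<otimes> (w \<otimes> b)) = a * \<eta> (v \<otimes> w) * b"
    "phi_minus \<eta> (lmul c s \<otimes> t) = c * phi_minus \<eta> (s \<otimes> t)" "phi_minus \<eta> (s \<otimes> rmul t c) = phi_minus \<eta> (s \<otimes> t) * c"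
proof -
  note [simp] = clinear_compose[OF e]
  show l: "clinear (phi_minus \<eta>)" and p: "phi_minus \<eta> ((a \<otimes> v) \<otimes> (w \<otimes> b)) = a * \<eta> (v \<otimes> w) * b" for a v w b
    by (simp_all add: phi_minus_def)
  note [simp] = clinear_compose[OF l]
  have "phi_minus \<eta> (tensor_map (lmul c) (\<lambda>t. t) z) = c * phi_minus \<eta> z" for z
    by (rule pair_eqI[where t = z]) (simp_all add: p mult.assoc l)
  from this[of "s \<otimes> t"] show "phi_minus \<eta> (lmul c s \<otimes> t) = c * phi_minus \<eta> (s \<otimes> t)" by simp
  have "phi_minus \<eta> (tensor_map (\<lambda>s. s) (\<lambda>t. rmul t c) z) = phi_minus \<eta> z * c" for z
    by (rule pair_eqI[where t = z]) (simp_all add: p mult.assoc l)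
  from this[of "s \<otimes> t"] show "phi_minus \<eta> (s \<otimes> rmul t c) = phi_minus \<eta> (s \<otimes> t) * c" by simp
qed

text \<open>For E, the outer braidings of the inverse of \<open>Theta\<close> are absorbed by the
  coordinates \<open>cc\<close> and \<open>qq\<close>, and the inner factor replaces \<eta> by
  \<eta> after the inverse of \<Psi>. It is for this composite that \<open>nondegenerate_E\<close>
  asks an invertible Gram matrix.\<close>

lemma metric_met:
  assumes "clinear \<eta>"
  shows "metric_F D \<eta> = met True \<eta>" "metric_E D \<eta> = met False (\<lambda>t. \<eta> (inv \<psi> t))"
proof -
  note [simp] = clinear_compose[OF assms]
  show "metric_F D \<eta> = met True \<eta>"
    by (auto simp: fun_eq_iff metric_F_def met_def cc_def qq_def)
  have "phi_minus \<eta> (mid (inv \<psi>) z) = phi_minus (\<lambda>t. \<eta> (inv \<psi> t)) z" for z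
  proof (rule pair_eqI[where t = z])
    fix a v w b
    have "phi_minus \<eta> (tensor_lift (\<lambda>w' v'. (a \<otimes> w') \<otimes> (v' \<otimes> b)) z) = a * \<eta> z * b" for z
      by (rule clinear_eqI[where t = z]) (simp_all add: phi_minus[OF assms] clinear_compose[OF phi_minus(1)[OF assms]])
    then show "phi_minus \<eta> (mid (inv \<psi>) ((a \<otimes> v) \<otimes> (w \<otimes> b))) = phi_minus (\<lambda>t. \<eta> (inv \<psi> t)) ((a \<otimes> v) \<otimes> (w \<otimes> b))"
      by (simp add: mid phi_minus)
  qed (simp_all add: clinear_compose[OF phi_minus(1)[OF assms]] mid phi_minus)
  then have "phi_plus D \<eta> (\<beta> s \<otimes> \<gamma> t) = phi_minus (\<lambda>t. \<eta> (inv \<psi> t)) (s \<otimes> t)" for s t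
    by (simp add: phi_plus_def inv_Theta)
  from this[of "\<beta>' (coord10 D _)" "\<gamma>' (coord01 D _)"] show "metric_E D \<eta> = met False (\<lambda>t. \<eta> (inv \<psi> t))"
    by (auto simp: fun_eq_iff metric_E_def met_def cc_def qq_def)
qed

lemma met_ee: "clinear \<eta> \<Longrightarrow> met \<epsilon> \<eta> (ee \<epsilon> v) (ee \<epsilon> w) = \<eta> (v \<otimes> vstar D w)"
  by (simp add: met_def cc_inn form_star_ee qq_ee phi_minus)

lemma scalar_metric_met:
  assumes e: "clinear \<eta>" and c: "complex_valued \<eta>"
  shows "scalar_metric D \<epsilon> (met \<epsilon> \<eta>)"
proof (rule scalar_metric.intro[OF calculus_axioms], rule scalar_metric_axioms.intro)
  note [simp] = clinear_compose[OF phi_minus(1)[OF e]]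
  show "clinear (\<lambda>x. met \<epsilon> \<eta> x z)" for z by (simp add: met_def)
  show "met \<epsilon> \<eta> (lmult D a x) z = a * met \<epsilon> \<eta> x z" for a x z
    by (simp add: met_def cc_lmult phi_minus(3)[OF e])
  show "antilinear (met \<epsilon> \<eta> x)" for x
    unfolding met_def[abs_def] by (rule linear_comp_antilinear[OF _ form_star_antilinear]) (simp add: clinear_compose[OF qq_linear])
  show "met \<epsilon> \<eta> x (lmult D a z) = met \<epsilon> \<eta> x z * star_B D a" for a x z
    by (simp add: met_def form_star_lmult qq_rmult phi_minus(4)[OF e])
  show "met \<epsilon> \<eta> (ee \<epsilon> v) (ee \<epsilon> w) = deg0 \<pi>B (met \<epsilon> \<eta> (ee \<epsilon> v) (ee \<epsilon> w)) *\<^sub>C 1" for v w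
  proof -
    obtain k where "\<eta> (v \<otimes> vstar D w) = k *\<^sub>C 1" using c unfolding complex_valued_def by blast
    then show ?thesis by (simp add: met_ee[OF e] clinear_scale[OF B.deg0_linear(1)] scaleC_complex_def)
  qed
qed

lemma chern_met:
  assumes "clinear \<eta>" "complex_valued \<eta>" "invertible_gram (\<lambda>v w. \<eta> (v \<otimes> vstar D w))"
  shows "the_only (chern \<epsilon> (met \<epsilon> \<eta>)) (nabla {\<epsilon>})"
proof -
  interpret m: scalar_metric D \<epsilon> "met \<epsilon> \<eta>" by (rule scalar_metric_met[OF assms(1,2)])
  show ?thesis by (rule m.chern_nabla) (simp add: met_ee assms)
qed

lemma chern_F:
  assumes "hermitian_form D \<eta>" "complex_valued \<eta>" "nondegenerate_F D \<eta>"
  shows "the_only (is_chern_F D \<eta>) (nabla {True})"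
proof -
  have e: "clinear \<eta>" using assms(1) by (simp add: hermitian_form_def)
  show ?thesis unfolding is_chern metric_met[OF e]
    using chern_met[OF e assms(2)] assms(3) unfolding nondegenerate_F_def by blast
qed

lemma chern_E:
  assumes "hermitian_form D \<eta>" "complex_valued \<eta>" "nondegenerate_E D \<eta>"
  shows "the_only (is_chern_E D \<eta>) (nabla {False})"
proof -
  have e: "clinear \<eta>" using assms(1) by (simp add: hermitian_form_def)
  have "clinear (\<lambda>t. \<eta> (inv \<psi> t))" by (simp add: clinear_compose[OF e])
  moreover have "complex_valued (\<lambda>t. \<eta> (inv \<psi> t))" using assms(2) unfolding complex_valued_def by blast
  ultimately show ?thesis unfolding is_chern metric_met[OF e]
    using chern_met assms(3) unfolding nondegenerate_E_def by blast
qed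

end

theorem proposition4p11:
  fixes D :: "('h::complex_alg_1, 'v::complex_vec, 'b::complex_alg_1, 'l::complex_alg_1) braided_data"
  assumes "hopf_star_algebra D" and "coquasitriangular D" and "real_type D"
    and "unitary_comodule D" and "finite_dim TYPE('v)"
    and "quotient_by (proj_B D) (nichols_ideal D)"
    and "quotient_by (proj_\<Lambda> D) (exterior_ideal D)"
  defines "E \<equiv> Omega D 1 0" and "F \<equiv> Omega D 0 1"
  shows "\<exists>nab\<^sub>F \<sigma>\<^sub>F nab\<^sub>E \<sigma>\<^sub>E.
    (the_only (\<lambda>nab. left_connection D F nab \<and> (\<forall>v. nab (delbar_gen D v) = over_A D 0)) nab\<^sub>F
      \<and> torsion_free D F nab\<^sub>F
      \<and> bimodule_connection D F nab\<^sub>F \<sigma>\<^sub>F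
      \<and> (\<forall>v u. \<sigma>\<^sub>F (over_A D (delbar_gen D v \<otimes> d_gen D u))
            = over_A D (tensor_map (d_gen D) (delbar_gen D) (Psi D (v \<otimes> u))))
      \<and> (\<forall>\<eta>. hermitian_form D \<eta> \<and> complex_valued \<eta> \<and> nondegenerate_F D \<eta>
            \<longrightarrow> the_only (is_chern_F D \<eta>) nab\<^sub>F))
    \<and> (the_only (\<lambda>nab. left_connection D E nab \<and> (\<forall>v. nab (del_gen D v) = over_A D 0)) nab\<^sub>E
      \<and> torsion_free D E nab\<^sub>E
      \<and> bimodule_connection D E nab\<^sub>E \<sigma>\<^sub>E
      \<and> (\<forall>v u. \<sigma>\<^sub>E (over_A D (del_gen D v \<otimes> d_gen D u))
            = over_A D (tensor_map (d_gen D) (del_gen D) (inv (Psi D) (v \<otimes> u))))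
      \<and> (\<forall>\<eta>. hermitian_form D \<eta> \<and> complex_valued \<eta> \<and> nondegenerate_E D \<eta>
            \<longrightarrow> the_only (is_chern_E D \<eta>) nab\<^sub>E))
    \<and> ((\<forall>X \<in> tensor_A D F (Omega1 D). \<sigma>\<^sub>E (dagger_A D (\<sigma>\<^sub>F X)) = dagger_A D X)
      \<and> (\<forall>e \<in> E. nab\<^sub>E e = \<sigma>\<^sub>E (dagger_A D (nab\<^sub>F (form_star D e))))
      \<and> bimodule_connection D (Omega1 D) (sum_connection D nab\<^sub>E nab\<^sub>F) (sum_braiding D \<sigma>\<^sub>E \<sigma>\<^sub>F)
      \<and> star_preserving D (sum_connection D nab\<^sub>E nab\<^sub>F) (sum_braiding D \<sigma>\<^sub>E \<sigma>\<^sub>F))"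
proof -
  interpret calculus D
    by unfold_locales (use assms in blast)+
  have EF: "E = OM {False}" "F = OM {True}"
    using MM_OM[of False] MM_OM[of True] by (simp_all add: MM_def E_def F_def)
  have g: "delbar_gen D = ee True" "del_gen D = ee False" by (auto simp: gen_ee)
  have s: "sigma {\<epsilon>} (ov t) = ov (SG {\<epsilon>} t)" for \<epsilon> t by (rule sigma_ov)
  show ?thesis
    unfolding EF g
  proof (rule exI[of _ "nabla {True}"], rule exI[of _ "sigma {True}"],
      rule exI[of _ "nabla {False}"], rule exI[of _ "sigma {False}"], intro conjI allI impI)
    show "bimodule_connection D (OM {True}) (nabla {True}) (sigma {True})"
      "bimodule_connection D (OM {False}) (nabla {False}) (sigma {False})"
      by (rule bimodule_connection_nabla, rule s)+
    show "sigma {True} (ov (ee True v \<otimes> d_gen D u)) = ov (tensor_map (d_gen D) (ee True) (\<psi> (v \<otimes> u)))"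
      "sigma {False} (ov (ee False v \<otimes> d_gen D u)) = ov (tensor_map (d_gen D) (ee False) (inv \<psi> (v \<otimes> u)))" for v u
      by (simp_all only: sigma_gen sg_def if_True if_False)
    show "bimodule_connection D (Omega1 D) (sum_connection D (nabla {False}) (nabla {True}))
        (sum_braiding D (sigma {False}) (sigma {True}))"
      unfolding sum_nabla Omega1_OM by (rule bimodule_connection_nabla) (rule sum_sigma)
    show "star_preserving D (sum_connection D (nabla {False}) (nabla {True})) (sum_braiding D (sigma {False}) (sigma {True}))"
      unfolding sum_nabla by (rule star_preserving_nabla) (rule sum_sigma)
  qed (use nabla_the_only torsion_free_F torsion_free_E chern_F chern_E sigma_dagger_sigma nabla_dagger in blast)+
qed

end
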